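(* Let $N\ge 1$ and let $G:[0,\infty)\times[0,\infty)\to\mathbb{R}$, $G(s)=G(s_1,s_2)$, with partial derivatives $g_j=\partial G/\partial s_j$ ($j=1,2$), satisfy: (G1) $G\in C^1([0,\infty)\times[0,\infty),\mathbb{R})$ and $G(0,0)=0$; (G2) $\lim_{|s|\to0}g_j(s)=0$ for $j=1,2$; (G3) $\lim_{|s|\to\infty}g_j(s)/|s|^{2/N}=0$ for $j=1,2$; (G4) $g_j(s,t)\le g_j(s+h,t+k)$ for all $s,t,h,k\ge0$ and $j=1,2$; (G5) there exists $\sigma>0$ such that $G(s_1,0)+G(0,s_2)<G(s_1,s_2)$ for all $0<s_1,s_2\le\sigma$. Suppose moreover: (E2) $E_{\alpha,0}<0$ and $E_{0,\beta}<0$ for all $\alpha,\beta>0$. Then for all $\alpha,\beta\ge0$, every minimizing sequence $\{(u_n,v_n)\}_{n\in\mathbb{N}}$ with respect to $E_{\alpha,\beta}$ is precompact in the following sense: after passing to a subsequence, there exist $(u,v)\in M_{\alpha,\beta}$ and $\{y_n\}_{n\in\mathbb{N}}\subset\mathbb{R}^N$ such that $$u_n(\cdot-y_n)\to u,\qquad v_n(\cdot-y_n)\to v\qquad\text{in }H^1(\mathbb{R}^N)\text{ as }n\to\infty .$$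
   Context: For $\alpha,\beta\ge0$ set $$M_{\alpha,\beta}=\{(u,v)\in H^1(\mathbb{R}^N)\times H^1(\mathbb{R}^N):\ \|u\|_{L^2(\mathbb{R}^N)}^2=\alpha,\ \|v\|_{L^2(\mathbb{R}^N)}^2=\beta\},$$ $$J[u,v]=\frac12\int_{\mathbb{R}^N}\left(|\nabla u|^2+|\nabla v|^2\right)dx-\int_{\mathbb{R}^N}G(|u|^2,|v|^2)\,dx,\qquad E_{\alpha,\beta}=\inf_{(u,v)\in M_{\alpha,\beta}}J[u,v].$$ Elements of $H^1(\mathbb{R}^N)$ are taken complex-valued. A minimizing sequence with respect to $E_{\alpha,\beta}$ is a sequence $\{(u_n,v_n)\}\subset M_{\alpha,\beta}$ with $J[u_n,v_n]\to E_{\alpha,\beta}$. *)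

theory Defs
  imports "HOL-Analysis.Analysis"
begin

definition partial_deriv :: "'n \<Rightarrow> (real^'n \<Rightarrow> real) \<Rightarrow> real^'n::finite \<Rightarrow> real" where
  "partial_deriv i f x = frechet_derivative f (at x) (axis i 1)"

(* If all iterated partial derivatives (in any order) are Frechet differentiable, they are in
   particular all continuous; so this is exactly C^infinity. *)
definition smooth :: "(real^'n::finite \<Rightarrow> real) \<Rightarrow> bool" where
  "smooth f \<longleftrightarrow> (\<forall>is. foldr partial_deriv is f differentiable_on UNIV)"

definition test_function :: "(real^'n::finite \<Rightarrow> real) \<Rightarrow> bool" where
  "test_function \<phi> \<longleftrightarrow> smooth \<phi> \<and> compact (closure {x. \<phi> x \<noteq> 0})"

definition locally_integrable :: "(real^'n::finite \<Rightarrow> 'b::euclidean_space) \<Rightarrow> bool" where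
  "locally_integrable f \<longleftrightarrow> (\<forall>K. compact K \<longrightarrow> set_integrable lborel K f)"

(* Real-valued test functions suffice for complex-valued u, by linearity. *)
definition has_weak_gradient :: "(real^'n::finite \<Rightarrow> complex) \<Rightarrow> (real^'n \<Rightarrow> complex^'n) \<Rightarrow> bool" where
  "has_weak_gradient u U \<longleftrightarrow>
     locally_integrable u \<and> locally_integrable U \<and>
     (\<forall>\<phi> i. test_function \<phi> \<longrightarrow>
        (LINT x|lborel. partial_deriv i \<phi> x *\<^sub>R u x) = - (LINT x|lborel. \<phi> x *\<^sub>R (U x $ i)))"

(* Weak gradients are unique up to null sets, so the choice does not affect integrals. *)
definition weak_gradient :: "(real^'n::finite \<Rightarrow> complex) \<Rightarrow> real^'n \<Rightarrow> complex^'n" where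
  "weak_gradient u = (SOME U. has_weak_gradient u U)"

(* Elements of L^2 and H^1 are represented by Borel functions, not identified modulo null sets;
   every class of Lebesgue measurable functions has a Borel representative. *)
definition L2 :: "(real^'n::finite \<Rightarrow> 'b::euclidean_space) set" where
  "L2 = {f \<in> borel_measurable lborel. integrable lborel (\<lambda>x. (norm (f x))\<^sup>2)}"

definition H1 :: "(real^'n::finite \<Rightarrow> complex) set" where
  "H1 = {u \<in> L2. \<exists>U\<in>L2. has_weak_gradient u U}"

definition H1_norm :: "(real^'n::finite \<Rightarrow> complex) \<Rightarrow> real" where
  "H1_norm u = sqrt ((LINT x|lborel. (norm (u x))\<^sup>2) + (LINT x|lborel. (norm (weak_gradient u x))\<^sup>2))"

definition M :: "real \<Rightarrow> real \<Rightarrow> ((real^'n::finite \<Rightarrow> complex) \<times> (real^'n \<Rightarrow> complex)) set" where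
  "M \<alpha> \<beta> = {(u, v). u \<in> H1 \<and> v \<in> H1 \<and>
     (LINT x|lborel. (norm (u x))\<^sup>2) = \<alpha> \<and> (LINT x|lborel. (norm (v x))\<^sup>2) = \<beta>}"

definition J :: "(real \<times> real \<Rightarrow> real) \<Rightarrow> (real^'n::finite \<Rightarrow> complex) \<times> (real^'n \<Rightarrow> complex) \<Rightarrow> real" where
  "J G = (\<lambda>(u, v).
     1/2 * (LINT x|lborel. (norm (weak_gradient u x))\<^sup>2 + (norm (weak_gradient v x))\<^sup>2)
     - (LINT x|lborel. G ((norm (u x))\<^sup>2, (norm (v x))\<^sup>2)))"

(* The type argument supplies the dimension N = CARD('n). For \<alpha>, \<beta> \<ge> 0 the set M \<alpha> \<beta> is nonempty,
   and J is bounded below on it (by the Gagliardo-Nirenberg inequality) when G has mass-subcritical growth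
   at infinity and its partial derivatives vanish at the origin; then Inf is the true infimum. *)
definition E :: "'n::finite itself \<Rightarrow> (real \<times> real \<Rightarrow> real) \<Rightarrow> real \<Rightarrow> real \<Rightarrow> real" where
  "E _ G \<alpha> \<beta> = (INF p \<in> (M \<alpha> \<beta> :: ((real^'n \<Rightarrow> complex) \<times> (real^'n \<Rightarrow> complex)) set). J G p)"

definition minimizing_sequence ::
  "(real \<times> real \<Rightarrow> real) \<Rightarrow> real \<Rightarrow> real \<Rightarrow> (nat \<Rightarrow> real^'n::finite \<Rightarrow> complex) \<Rightarrow> (nat \<Rightarrow> real^'n \<Rightarrow> complex) \<Rightarrow> bool" where
  "minimizing_sequence G \<alpha> \<beta> u v \<longleftrightarrow>
     (\<forall>n. (u n, v n) \<in> M \<alpha> \<beta>) \<and> (\<lambda>n. J G (u n, v n)) \<longlonglongrightarrow> E TYPE('n) G \<alpha> \<beta>"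

definition quadrant :: "(real \<times> real) set" where
  "quadrant = {0..} \<times> {0..}"

(* C^1 up to the boundary, with partial derivatives g1, g2 (one-sided where a coordinate is 0).
   Values of G, g1, g2 off the quadrant are irrelevant. *)
definition C1_on_quadrant ::
  "(real \<times> real \<Rightarrow> real) \<Rightarrow> (real \<times> real \<Rightarrow> real) \<Rightarrow> (real \<times> real \<Rightarrow> real) \<Rightarrow> bool" where
  "C1_on_quadrant G g1 g2 \<longleftrightarrow>
     (\<forall>s\<ge>0. \<forall>t\<ge>0.
        ((\<lambda>x. G (x, t)) has_real_derivative g1 (s, t)) (at s within {0..}) \<and>
        ((\<lambda>y. G (s, y)) has_real_derivative g2 (s, t)) (at t within {0..})) \<and>
     continuous_on quadrant G \<and> continuous_on quadrant g1 \<and> continuous_on quadrant g2"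

end

theory Submission
  imports Defs "HOL-Library.Diagonal_Subsequence"
begin

text \<open>
  Write \<open>|u|\<close> for the \<open>L2\<close> norm and \<open>e(\<alpha>, \<beta>)\<close> for the infimum of the energy \<open>J\<close> over pairs of
  masses \<open>\<alpha>\<close> and \<open>\<beta>\<close>. The proof follows the concentration-compactness scheme.

  A minimizing sequence does not vanish: (G2) and (G3) bound the potential energy by
  \<open>\<epsilon>\<close> times the mass plus a multiple of the integral of \<open>|u(x)|^(2 + 4/N)\<close>, and the latter is
  controlled by the largest mass found in a unit cube (\<open>Gagliardo_Nirenberg\<close>). As \<open>e < 0\<close> by (E2),
  some unit cube keeps a fixed amount of mass (\<open>nonvanishing\<close>). Translating these cubes to the origin
  and passing to a subsequence gives a nonzero local limit \<open>(u', v')\<close> (\<open>Rellich\<close>). Cutting the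
  sequence at a large radius separates this limit from the rest, whence
  \<open>J(u', v') + e(\<alpha> - |u'|^2, \<beta> - |v'|^2) \<le> e(\<alpha>, \<beta>)\<close> (\<open>energy_of_limit\<close>). If \<open>e\<close> is strictly
  subadditive, no mass can be lost. The parallelogram identity then turns convergence of the masses and
  of the kinetic energies into convergence in \<open>H1\<close>.

  Strict subadditivity (\<open>strict_subadditivity\<close>) is obtained without rearrangements, from convexity.
  The pair \<open>sqrt(|u1|^2 + |u2|^2)\<close>, \<open>sqrt(|v1|^2 + |v2|^2)\<close>, formed pointwise, has the sums of the
  masses and at most the sum of the kinetic energies, and (G4) makes \<open>G\<close> superadditive: so \<open>e\<close> is
  subadditive. By (G4) again, \<open>G\<close> is convex along directions of the quadrant, so rescaling the two
  amplitudes of a fixed pair shows that \<open>e\<close> is concave along such directions. Suppose now that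
  \<open>e(a1 + b1, a2 + b2) = e(a1, a2) + e(b1, b2)\<close>. The concave function
  \<open>x \<mapsto> e(x, a2) + e(a1 + b1 - x, b2)\<close> is bounded below by this value by subadditivity, and attains it
  at the interior point \<open>a1\<close>; hence it is constant, and the whole first mass may be moved to either
  side. The same holds for the second mass. Two kinds of equality survive. The first,
  \<open>e(a + b, 0) = e(a, 0) + e(b, 0)\<close>, forces \<open>e(x, 0) \<le> c x\<close> for small \<open>x\<close> with a constant \<open>c < 0\<close>,
  whereas \<open>e(x, 0) \<ge> - \<epsilon> x\<close> for small \<open>x\<close> (\<open>strict_one\<close>). So the inequality is strict for a single
  component, and the scheme above already yields minimizers of the two problems with one component.
  The second, \<open>e(a, b) = e(a, 0) + e(0, b)\<close>, is then impossible: translate one of the two minimizers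
  until they overlap, and (G5) lowers the energy of the pair strictly below the sum
  (\<open>mixing_lowers_energy\<close>).

  Sobolev functions enter through difference quotients with dyadic steps: a function in \<open>L2\<close> lies in
  \<open>H1\<close> iff these are bounded in \<open>L2\<close>, and their squared norms increase to the kinetic energy
  (\<open>H1_I\<close>, \<open>H1_dq_tendsto\<close>). Bounds for superpositions, cutoffs and truncations thereby reduce to pointwise
  inequalities for increments, and lower semicontinuity reduces to Fatou's lemma.
\<close>

section \<open>Square-integrable functions and their mass\<close>

definition mass :: "(real^'n::finite \<Rightarrow> 'b::euclidean_space) \<Rightarrow> real" where
  "mass f = (LINT x|lborel. (norm (f x))\<^sup>2)"

lemma mass_nonneg [simp]: "0 \<le> mass f"
  by (simp add: mass_def)

lemma L2_measurable [measurable_dest]: "f \<in> L2 \<Longrightarrow> f \<in> borel_measurable borel"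
  by (simp add: L2_def)

lemma L2_integrable: "f \<in> L2 \<Longrightarrow> integrable lborel (\<lambda>x. (norm (f x))\<^sup>2)"
  by (simp add: L2_def)

lemma L2_I: "f \<in> borel_measurable borel \<Longrightarrow> integrable lborel (\<lambda>x. (norm (f x))\<^sup>2) \<Longrightarrow> f \<in> L2"
  by (simp add: L2_def)

lemma norm_add_sq_le: "(norm (a + b :: 'a::real_normed_vector))\<^sup>2 \<le> 2 * (norm a)\<^sup>2 + 2 * (norm b)\<^sup>2"
proof -
  have "(norm (a + b))\<^sup>2 \<le> (norm a + norm b)\<^sup>2"
    by (intro power_mono norm_triangle_ineq) auto
  also have "\<dots> \<le> 2 * (norm a)\<^sup>2 + 2 * (norm b)\<^sup>2"
    using sum_squares_bound[of "norm a" "norm b"] by (simp add: power2_sum)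
  finally show ?thesis .
qed

lemma L2_bound:
  assumes "f \<in> borel_measurable borel" "integrable lborel g" "\<And>x. (norm (f x))\<^sup>2 \<le> g x"
  shows "f \<in> L2" and "mass f \<le> (LINT x|lborel. g x)"
proof -
  have "integrable lborel (\<lambda>x. (norm (f x))\<^sup>2)"
    by (rule Bochner_Integration.integrable_bound[OF assms(2)])
       (use assms in \<open>auto intro!: AE_I2 order_trans[OF assms(3)]\<close>)
  then show "f \<in> L2" using assms by (auto intro: L2_I)
  show "mass f \<le> (LINT x|lborel. g x)"
    unfolding mass_def by (rule integral_mono) (use assms \<open>integrable lborel (\<lambda>x. (norm (f x))\<^sup>2)\<close> in auto)
qed

lemma L2_mono:
  fixes f :: "real^'n::finite \<Rightarrow> 'b::euclidean_space" and g :: "real^'n::finite \<Rightarrow> 'c::euclidean_space"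
  assumes "f \<in> borel_measurable borel" "g \<in> L2" "\<And>x. norm (f x) \<le> norm (g x)"
  shows "f \<in> L2" and "mass f \<le> mass g"
  using L2_bound[of f "\<lambda>x. (norm (g x))\<^sup>2"] assms L2_integrable[OF assms(2)]
  by (auto simp: mass_def power_mono)

lemma L2_zero [simp]: "(\<lambda>x. 0) \<in> L2"
  by (auto simp: L2_def)

lemma mass_zero [simp]: "mass (\<lambda>x. 0) = 0"
  by (simp add: mass_def)

lemma L2_add:
  assumes "f \<in> L2" "g \<in> L2"
  shows "(\<lambda>x. f x + g x) \<in> L2" and "mass (\<lambda>x. f x + g x) \<le> 2 * mass f + 2 * mass g"
proof -
  have [measurable]: "f \<in> borel_measurable borel" "g \<in> borel_measurable borel" using assms by auto
  have i: "integrable lborel (\<lambda>x. 2 * (norm (f x))\<^sup>2 + 2 * (norm (g x))\<^sup>2)"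
    using assms[THEN L2_integrable] by auto
  show "(\<lambda>x. f x + g x) \<in> L2" "mass (\<lambda>x. f x + g x) \<le> 2 * mass f + 2 * mass g"
    using L2_bound[OF _ i, of "\<lambda>x. f x + g x"] assms[THEN L2_integrable]
    by (auto simp: norm_add_sq_le mass_def)
qed

lemma L2_scaleR:
  assumes "f \<in> L2"
  shows "(\<lambda>x. c *\<^sub>R f x) \<in> L2" and "mass (\<lambda>x. c *\<^sub>R f x) = c\<^sup>2 * mass f"
  using assms by (auto simp: L2_def mass_def power_mult_distrib)

lemma L2_uminus:
  assumes "f \<in> L2" shows "(\<lambda>x. - f x) \<in> L2" and "mass (\<lambda>x. - f x) = mass f"
  using assms by (auto simp: L2_def mass_def)

lemma L2_diff:
  assumes "f \<in> L2" "g \<in> L2"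
  shows "(\<lambda>x. f x - g x) \<in> L2" and "mass (\<lambda>x. f x - g x) \<le> 2 * mass f + 2 * mass g"
  using L2_add[OF assms(1) L2_uminus(1)[OF assms(2)]] L2_uminus[OF assms(2)] by auto

lemma mass_diff_commute: "mass (\<lambda>x. f x - g x) = mass (\<lambda>x. g x - f x)"
  by (simp add: mass_def norm_minus_commute)

lemma mass_parallelogram:
  assumes "f \<in> L2" "g \<in> L2"
  shows "mass (\<lambda>x. f x + g x) + mass (\<lambda>x. f x - g x) = 2 * mass f + 2 * mass g"
proof -
  note i = L2_integrable[OF L2_add(1)[OF assms]] L2_integrable[OF L2_diff(1)[OF assms]]
    L2_integrable[OF assms(1)] L2_integrable[OF assms(2)]
  have "mass (\<lambda>x. f x + g x) + mass (\<lambda>x. f x - g x) = (LINT x|lborel. (norm (f x + g x))\<^sup>2 + (norm (f x - g x))\<^sup>2)"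
    unfolding mass_def using i by simp
  also have "\<dots> = (LINT x|lborel. 2 * (norm (f x))\<^sup>2 + 2 * (norm (g x))\<^sup>2)"
    by (rule Bochner_Integration.integral_cong)
       (auto simp: power2_norm_eq_inner inner_add_left inner_add_right inner_diff_left inner_diff_right inner_commute)
  also have "\<dots> = 2 * mass f + 2 * mass g"
    unfolding mass_def using i by simp
  finally show ?thesis .
qed

lemma nn_mass: "f \<in> L2 \<Longrightarrow> (\<integral>\<^sup>+x. ennreal ((norm (f x))\<^sup>2) \<partial>lborel) = ennreal (mass f)"
  unfolding mass_def by (rule nn_integral_eq_integral) (auto simp: L2_integrable)

lemma L2_I_nn:
  assumes "f \<in> borel_measurable borel" "(\<integral>\<^sup>+x. ennreal ((norm (f x))\<^sup>2) \<partial>lborel) \<le> ennreal C"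
  shows "f \<in> L2" and "0 \<le> C \<Longrightarrow> mass f \<le> C"
proof -
  have "integrable lborel (\<lambda>x. (norm (f x))\<^sup>2)"
    by (rule integrableI_bounded) (use assms in \<open>auto intro: le_less_trans\<close>)
  then show *: "f \<in> L2" using assms by (auto intro: L2_I)
  show "mass f \<le> C" if "0 \<le> C"
    using assms(2) unfolding nn_mass[OF *] using that by simp
qed

lemma mass_cong_AE:
  assumes "f \<in> borel_measurable borel" "g \<in> borel_measurable borel" "AE x in lborel. f x = g x"
  shows "mass f = mass g"
  unfolding mass_def by (rule integral_cong_AE) (use assms in auto)

lemma mass_eq_0_iff:
  assumes "f \<in> L2" shows "mass f = 0 \<longleftrightarrow> (AE x in lborel. f x = 0)"
  unfolding mass_def by (subst integral_nonneg_eq_0_iff_AE) (use L2_integrable[OF assms] in auto)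

lemma nn_integral_translate:
  fixes c :: "'a::euclidean_space"
  assumes [measurable]: "f \<in> borel_measurable borel"
  shows "(\<integral>\<^sup>+x. f (x + c) \<partial>lborel) = (\<integral>\<^sup>+x. f x \<partial>lborel)"
proof -
  have "(\<integral>\<^sup>+x. f x \<partial>lborel) = (\<integral>\<^sup>+x. f x \<partial>(distr lborel borel ((+) c)))"
    by (simp add: lborel_distr_plus)
  also have "\<dots> = (\<integral>\<^sup>+x. f (c + x) \<partial>lborel)" by (subst nn_integral_distr) auto
  finally show ?thesis by (simp add: add.commute)
qed

lemma integrable_translate:
  fixes c :: "'a::euclidean_space" and f :: "'a \<Rightarrow> 'b::{banach, second_countable_topology}"
  assumes "integrable lborel f"
  shows "integrable lborel (\<lambda>x. f (x + c))"
proof -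
  have "integrable (distr lborel borel ((+) c)) f" using assms by (simp add: lborel_distr_plus)
  then have "integrable lborel (\<lambda>x. f (c + x))"
    by (subst (asm) integrable_distr_eq) (use assms in auto)
  then show ?thesis by (simp add: add.commute)
qed

lemma integral_translate:
  fixes c :: "'a::euclidean_space" and f :: "'a \<Rightarrow> 'b::{banach, second_countable_topology}"
  assumes "f \<in> borel_measurable borel"
  shows "(LINT x|lborel. f (x + c)) = (LINT x|lborel. f x)"
proof -
  have "(LINT x|lborel. f x) = (LINT x|(distr lborel borel ((+) c)). f x)"
    by (simp add: lborel_distr_plus)
  also have "\<dots> = (LINT x|lborel. f (c + x))" by (subst integral_distr) (use assms in auto)
  finally show ?thesis by (simp add: add.commute)
qed

lemma AE_translate:
  fixes c :: "'a::euclidean_space"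
  assumes "AE x in lborel. P x"
  shows "AE x in lborel. P (x + c)"
proof -
  obtain N where N: "{x. \<not> P x} \<subseteq> N" "N \<in> sets borel" "emeasure lborel N = 0"
    using AE_E[OF assms] by auto
  have "emeasure lborel ((\<lambda>x. x + c) -` N) = emeasure (distr lborel borel ((+) c)) N"
    using N(2) by (subst emeasure_distr) (auto simp: add.commute vimage_def)
  then have "emeasure lborel ((\<lambda>x. x + c) -` N) = 0" using N by (simp add: lborel_distr_plus)
  moreover have "(\<lambda>x. x + c) -` N \<in> sets borel"
    using measurable_sets[of "\<lambda>x. x + c" borel borel N] N(2) by simp
  ultimately show ?thesis using N(1) by (intro AE_I[where N="(\<lambda>x. x + c) -` N"]) auto
qed

lemma L2_translate:
  assumes "f \<in> L2"
  shows "(\<lambda>x. f (x + c)) \<in> L2" and "mass (\<lambda>x. f (x + c)) = mass f"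
proof -
  have [measurable]: "f \<in> borel_measurable borel" using assms by auto
  show "(\<lambda>x. f (x + c)) \<in> L2"
    using integrable_translate[OF L2_integrable[OF assms], of c] by (auto intro!: L2_I)
  show "mass (\<lambda>x. f (x + c)) = mass f"
    unfolding mass_def by (rule integral_translate[where f="\<lambda>x. (norm (f x))\<^sup>2"]) simp
qed

lemma mass_Fatou:
  assumes L2: "\<And>n. f n \<in> L2" and [measurable]: "g \<in> borel_measurable borel"
    and lim: "AE x in lborel. (\<lambda>n. f n x) \<longlonglongrightarrow> g x" and C: "\<And>n. mass (f n) \<le> C"
  shows "g \<in> L2" and "mass g \<le> C"
proof -
  have [measurable]: "f n \<in> borel_measurable borel" for n using L2 by auto
  have C0: "0 \<le> C" using C[of 0] mass_nonneg[of "f 0"] by linarith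
  have "(\<integral>\<^sup>+x. ennreal ((norm (g x))\<^sup>2) \<partial>lborel) = (\<integral>\<^sup>+x. liminf (\<lambda>n. ennreal ((norm (f n x))\<^sup>2)) \<partial>lborel)"
  proof (rule nn_integral_cong_AE, use lim in eventually_elim)
    fix x assume "(\<lambda>n. f n x) \<longlonglongrightarrow> g x"
    then have "(\<lambda>n. ennreal ((norm (f n x))\<^sup>2)) \<longlonglongrightarrow> ennreal ((norm (g x))\<^sup>2)"
      by (intro tendsto_ennrealI tendsto_intros)
    from lim_imp_Liminf[OF trivial_limit_sequentially this]
    show "ennreal ((norm (g x))\<^sup>2) = liminf (\<lambda>n. ennreal ((norm (f n x))\<^sup>2))" by (rule sym)
  qed
  also have "\<dots> \<le> liminf (\<lambda>n. \<integral>\<^sup>+x. ennreal ((norm (f n x))\<^sup>2) \<partial>lborel)"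
    by (rule nn_integral_liminf) simp
  also have "\<dots> \<le> ennreal C"
    using C by (intro Liminf_le) (auto simp: nn_mass[OF L2] intro!: always_eventually ennreal_leI)
  finally show "g \<in> L2" "mass g \<le> C" using L2_I_nn[of g C] C0 by auto
qed

text \<open>
  A subsequence along which the mass stayed below would contradict Fatou's lemma.
\<close>

lemma mass_lsc:
  assumes L2: "\<And>n. f n \<in> L2" "g \<in> L2"
    and lim: "AE x in lborel. (\<lambda>n. f n x) \<longlonglongrightarrow> g x" and e: "0 < e"
  shows "eventually (\<lambda>n. mass g - e < mass (f n)) sequentially"
proof (rule ccontr)
  assume "\<not> ?thesis"
  then have "frequently (\<lambda>n. mass (f n) \<le> mass g - e) sequentially"
    by (simp add: frequently_def not_le)
  then obtain r :: "nat \<Rightarrow> nat" where r: "strict_mono r" "\<And>n. mass (f (r n)) \<le> mass g - e"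
    using infinite_enumerate[of "{n. mass (f n) \<le> mass g - e}"]
    by (auto simp: frequently_cofinite[symmetric] cofinite_eq_sequentially)
  have "AE x in lborel. (\<lambda>n. f (r n) x) \<longlonglongrightarrow> g x"
    using lim by eventually_elim (use r(1) LIMSEQ_subseq_LIMSEQ in \<open>auto simp: o_def\<close>)
  from mass_Fatou(2)[OF L2(1) _ this r(2)] e L2(2) show False by auto
qed

text \<open>
  A subsequence whose consecutive differences have masses at most \<open>(1/8)^k\<close> converges almost
  everywhere, because \<open>\<Sum>k. 2^k |d_k(x)|^2\<close> has a finite integral; Fatou's lemma transfers this to
  convergence in \<open>L2\<close>. The almost everywhere convergent subsequence is exported for later use.
\<close>

lemma L2_complete:
  fixes f :: "nat \<Rightarrow> real^'n::finite \<Rightarrow> 'b::euclidean_space"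
  assumes L2: "\<And>n. f n \<in> L2"
    and Cauchy: "\<And>e. 0 < e \<Longrightarrow> \<exists>N. \<forall>m\<ge>N. \<forall>n\<ge>N. mass (\<lambda>x. f m x - f n x) < e"
  obtains g r where "g \<in> L2" "strict_mono (r :: nat \<Rightarrow> nat)" "AE x in lborel. (\<lambda>k. f (r k) x) \<longlonglongrightarrow> g x"
    "(\<lambda>n. mass (\<lambda>x. f n x - g x)) \<longlonglongrightarrow> 0"
proof -
  have [measurable]: "f n \<in> borel_measurable borel" for n using L2 by auto
  obtain N where N: "\<And>k m n. m \<ge> N k \<Longrightarrow> n \<ge> N k \<Longrightarrow> mass (\<lambda>x. f m x - f n x) < (1/8::real)^k"
    using Cauchy[of "(1/8)^k" for k] by (metis zero_less_divide_1_iff zero_less_numeral zero_less_power)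
  define r where "r = rec_nat (N 0) (\<lambda>k m. max (Suc m) (N (Suc k)))"
  have r_Suc: "r (Suc k) = max (Suc (r k)) (N (Suc k))" for k by (simp add: r_def)
  have r: "strict_mono r" unfolding strict_mono_Suc_iff r_Suc by auto
  have rN: "N k \<le> r k" for k by (cases k) (auto simp: r_def)
  define d where "d k x = f (r (Suc k)) x - f (r k) x" for k x
  have d_L2: "d k \<in> L2" for k unfolding d_def using L2_diff L2 by blast
  have d_meas [measurable]: "d k \<in> borel_measurable borel" for k using d_L2 by auto
  have md: "mass (d k) \<le> (1/8)^k" for k
    unfolding d_def using N[of k "r (Suc k)" "r k"] rN[of k] strict_monoD[OF r, of k "Suc k"] by force
  have "(\<integral>\<^sup>+x. (\<Sum>k. ennreal (2^k * (norm (d k x))\<^sup>2)) \<partial>lborel) = (\<Sum>k. \<integral>\<^sup>+x. ennreal (2^k * (norm (d k x))\<^sup>2) \<partial>lborel)"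
    by (rule nn_integral_suminf) simp
  also have "\<dots> = (\<Sum>k. ennreal (2^k * mass (d k)))"
    by (simp add: ennreal_mult nn_integral_cmult nn_mass[OF d_L2])
  also have "\<dots> \<le> (\<Sum>k. ennreal ((1/4)^k))"
  proof (rule suminf_le)
    fix k show "ennreal (2^k * mass (d k)) \<le> ennreal ((1/4)^k)"
      using mult_left_mono[OF md[of k], of "2^k"]
      by (intro ennreal_leI) (simp add: power_mult_distrib[symmetric])
  qed auto
  also have "\<dots> < \<infinity>"
    by (subst suminf_ennreal2) (auto simp: summable_geometric)
  finally have "AE x in lborel. (\<Sum>k. ennreal (2^k * (norm (d k x))\<^sup>2)) \<noteq> \<infinity>"
    by (intro nn_integral_PInf_AE) auto
  then have conv: "AE x in lborel. convergent (\<lambda>k. f (r k) x)"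
  proof eventually_elim
    fix x assume "(\<Sum>k. ennreal (2^k * (norm (d k x))\<^sup>2)) \<noteq> \<infinity>"
    then have "summable (\<lambda>k. 2^k * (norm (d k x))\<^sup>2)"
      by (intro summable_suminf_not_top) (auto simp: top_ennreal_def)
    then have "(\<lambda>k. 2^k * (norm (d k x))\<^sup>2) \<longlonglongrightarrow> 0" by (rule summable_LIMSEQ_zero)
    then have "Bseq (\<lambda>k. 2^k * (norm (d k x))\<^sup>2)" by (metis Bseq_conv_Bfun convergentI convergent_imp_Bseq)
    then obtain B where B: "0 < B" "\<And>k. 2^k * (norm (d k x))\<^sup>2 \<le> B"
      unfolding Bseq_def by (auto simp: abs_le_iff)
    have nd: "norm (d k x) \<le> sqrt B * (sqrt (1/2))^k" for k
    proof -
      have "(norm (d k x))\<^sup>2 \<le> B * (1/2)^k" using B(2)[of k] by (simp add: field_simps)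
      then have "norm (d k x) \<le> sqrt (B * (1/2)^k)" using real_le_rsqrt by blast
      then show ?thesis by (simp add: real_sqrt_mult real_sqrt_power)
    qed
    have "summable (\<lambda>k. sqrt B * (sqrt (1/2))^k)"
      by (intro summable_mult summable_geometric) (simp add: real_sqrt_divide)
    then have "summable (\<lambda>k. d k x)"
      by (rule summable_comparison_test'[where N=0]) (use nd in auto)
    then have "convergent (\<lambda>n. \<Sum>k<n. d k x)" by (simp add: summable_iff_convergent)
    moreover have "(\<Sum>k<n. d k x) = f (r n) x - f (r 0) x" for n
      unfolding d_def by (rule sum_lessThan_telescope)
    ultimately have "convergent (\<lambda>n. f (r n) x - f (r 0) x)" by simp
    then show "convergent (\<lambda>k. f (r k) x)" by (simp add: convergent_diff_const_right_iff)
  qed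
  define g where "g x = lim (\<lambda>k. f (r k) x)" for x
  have [measurable]: "g \<in> borel_measurable borel" unfolding g_def by measurable
  have lim: "AE x in lborel. (\<lambda>k. f (r k) x) \<longlonglongrightarrow> g x"
    using conv by eventually_elim (simp add: g_def convergent_LIMSEQ_iff)
  have lim0: "(\<lambda>x. f n x - g x) \<in> L2 \<and> mass (\<lambda>x. f n x - g x) \<le> e"
    if e: "\<And>m. m \<ge> M \<Longrightarrow> mass (\<lambda>x. f n x - f m x) \<le> e" for n M e
  proof -
    have l: "AE x in lborel. (\<lambda>k. f n x - f (r (k + M)) x) \<longlonglongrightarrow> f n x - g x"
      using lim by eventually_elim (intro tendsto_intros LIMSEQ_ignore_initial_segment)
    have "r (k + M) \<ge> M" for k using seq_suble[OF r, of "k + M"] by linarith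
    with mass_Fatou[OF L2_diff(1)[OF L2 L2] _ l e] show ?thesis by auto
  qed
  obtain M where "\<forall>m\<ge>M. \<forall>n\<ge>M. mass (\<lambda>x. f m x - f n x) < 1" using Cauchy[of 1] by auto
  then have *: "(\<lambda>x. f M x - g x) \<in> L2" using lim0[of M M 1] by (auto intro: less_imp_le)
  have "g \<in> L2" using L2_diff(1)[OF L2[of M] *] by simp
  moreover have "(\<lambda>n. mass (\<lambda>x. f n x - g x)) \<longlonglongrightarrow> 0"
  proof (rule LIMSEQ_I)
    fix e :: real assume "0 < e"
    then obtain M where M: "\<forall>m\<ge>M. \<forall>n\<ge>M. mass (\<lambda>x. f m x - f n x) < e/2" using Cauchy[of "e/2"] by auto
    have "mass (\<lambda>x. f n x - g x) \<le> e/2" if "n \<ge> M" for n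
      using lim0[of M n "e/2"] M that by (auto intro: less_imp_le)
    then show "\<exists>no. \<forall>n\<ge>no. norm (mass (\<lambda>x. f n x - g x) - 0) < e"
      using \<open>0 < e\<close> by (intro exI[of _ M]) (force)
  qed
  ultimately show thesis using that r lim by blast
qed

section \<open>Test functions and the fundamental lemma of the calculus of variations\<close>

text \<open>
  Products over the coordinates of \<open>exp(-1/w)\<close>, with \<open>w\<close> a quadratic polynomial that is positive
  exactly on an interval, are smooth functions supported in a box. The factor \<open>w^(-k)\<close> makes the family
  closed under differentiation.
\<close>

definition flat_exp :: "nat \<Rightarrow> real \<Rightarrow> real" where
  "flat_exp k w = (if w > 0 then exp (- 1 / w) / w ^ k else 0)"

lemma flat_exp_shift: "flat_exp k w = w * flat_exp (Suc k) w"
  by (simp add: flat_exp_def)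

lemma flat_exp_tendsto_0: "(flat_exp k \<longlongrightarrow> 0) (at 0)"
proof -
  have "((\<lambda>y. y ^ k / exp y) \<longlongrightarrow> (0::real)) at_top" by (rule tendsto_power_div_exp_0)
  then have "((\<lambda>w. inverse w ^ k / exp (inverse w)) \<longlongrightarrow> (0::real)) (at_right 0)"
    by (rule filterlim_compose[OF _ filterlim_inverse_at_top_right])
  moreover have "eventually (\<lambda>w. inverse w ^ k / exp (inverse w) = flat_exp k w) (at_right 0)"
    by (rule eventually_at_right_less[THEN eventually_mono])
       (simp add: flat_exp_def exp_minus inverse_eq_divide field_simps)
  ultimately have R: "(flat_exp k \<longlongrightarrow> 0) (at_right 0)" by (rule Lim_transform_eventually)
  have "eventually (\<lambda>w. 0 = flat_exp k w) (at_left 0)"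
    by (auto simp: eventually_at_filter flat_exp_def)
  then have L: "(flat_exp k \<longlongrightarrow> 0) (at_left 0)" by (rule Lim_transform_eventually[OF tendsto_const])
  show ?thesis using L R by (simp add: filterlim_at_split)
qed

lemma flat_exp_deriv:
  "(flat_exp k has_real_derivative (flat_exp (k + 2) w - real k * flat_exp (k + 1) w)) (at w)"
proof (cases "w = 0")
  case True
  have "((\<lambda>h. (flat_exp k (0 + h) - flat_exp k 0) / h) \<longlongrightarrow> 0) (at 0)"
  proof (rule Lim_transform_eventually[OF flat_exp_tendsto_0[of "Suc k"]])
    show "\<forall>\<^sub>F h in at 0. flat_exp (Suc k) h = (flat_exp k (0 + h) - flat_exp k 0) / h"
      by (auto simp: eventually_at_filter flat_exp_def)
  qed
  then show ?thesis using True by (simp add: DERIV_def flat_exp_def)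
next
  case False
  show ?thesis
  proof (cases "w > 0")
    case True
    have "((\<lambda>w. exp (- 1 / w) / w ^ k) has_real_derivative (flat_exp (k + 2) w - real k * flat_exp (k + 1) w)) (at w)"
      by (rule derivative_eq_intros refl | use True in \<open>simp; fail\<close>)+
         (use True in \<open>cases k; simp add: flat_exp_def field_simps power2_eq_square\<close>)
    then show ?thesis
      by (rule DERIV_cong_ev[THEN iffD1, OF refl _ refl, rotated])
         (use eventually_nhds_in_open[of "{0<..}" w] True in \<open>auto elim!: eventually_mono simp: flat_exp_def\<close>)
  next
    case neg: False
    have "((\<lambda>w. 0) has_real_derivative (flat_exp (k + 2) w - real k * flat_exp (k + 1) w)) (at w)"
      using neg by (simp add: flat_exp_def)
    then show ?thesis
      by (rule DERIV_cong_ev[THEN iffD1, OF refl _ refl, rotated])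
         (use eventually_nhds_in_open[of "{..<0}" w] neg False in \<open>auto elim!: eventually_mono simp: flat_exp_def\<close>)
  qed
qed

text \<open>
  The \<open>n\<close>-th derivative of \<open>exp(-1/W(x))\<close> is \<open>P_n(x) W(x)^(-2n) exp(-1/W(x))\<close>, and these are the
  polynomials \<open>P_n\<close>.
\<close>

fun bump_coeff :: "real poly \<Rightarrow> nat \<Rightarrow> real poly" where
  "bump_coeff W 0 = 1"
| "bump_coeff W (Suc n) = pderiv (bump_coeff W n) * W ^ 2
     + bump_coeff W n * pderiv W * (1 - smult (real (2 * n)) W)"

definition bump :: "real poly \<Rightarrow> nat \<Rightarrow> real \<Rightarrow> real" where
  "bump W n x = poly (bump_coeff W n) x * flat_exp (2 * n) (poly W x)"

lemma bump_deriv: "(bump W n has_real_derivative bump W (Suc n) x) (at x)"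
proof -
  let ?w = "poly W x" and ?p = "poly (bump_coeff W n) x"
  have e1: "flat_exp (2 * n) ?w = ?w\<^sup>2 * flat_exp (2 * n + 2) ?w"
    using flat_exp_shift[of "2 * n" ?w] flat_exp_shift[of "Suc (2 * n)" ?w] by (simp add: power2_eq_square)
  have e2: "flat_exp (2 * n + 1) ?w = ?w * flat_exp (2 * n + 2) ?w"
    using flat_exp_shift[of "Suc (2 * n)" ?w] by simp
  have "(bump W n has_real_derivative
      (poly (pderiv (bump_coeff W n)) x * flat_exp (2 * n) ?w
       + ((flat_exp (2 * n + 2) ?w - real (2 * n) * flat_exp (2 * n + 1) ?w) * poly (pderiv W) x) * ?p)) (at x)"
    unfolding bump_def[abs_def]
    by (intro DERIV_mult poly_DERIV DERIV_chain2[OF flat_exp_deriv])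
  also have "poly (pderiv (bump_coeff W n)) x * flat_exp (2 * n) ?w
       + ((flat_exp (2 * n + 2) ?w - real (2 * n) * flat_exp (2 * n + 1) ?w) * poly (pderiv W) x) * ?p
       = bump W (Suc n) x"
    unfolding e1 e2 bump_def by (simp add: algebra_simps)
  finally show ?thesis .
qed

text \<open>
  If \<open>H i n\<close> are the successive derivatives of functions \<open>H i 0\<close> of one variable, this is the mixed partial
  derivative of order \<open>m\<close> of the product of the \<open>H i 0\<close> over the coordinates.
  Keeping the orders \<open>m\<close> as an argument makes the set of such products closed under all partial
  derivatives, which is smoothness in the sense of iterated partial derivatives.
\<close>

definition tensor :: "('n \<Rightarrow> nat \<Rightarrow> real \<Rightarrow> real) \<Rightarrow> ('n \<Rightarrow> nat) \<Rightarrow> real^'n::finite \<Rightarrow> real" where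
  "tensor H m x = (\<Prod>i\<in>UNIV. H i (m i) (x $ i))"

lemma tensor_has_derivative:
  assumes "\<And>i n x. (H i n has_real_derivative H i (Suc n) x) (at x)"
  shows "(tensor H m has_derivative
    (\<lambda>y. \<Sum>i\<in>UNIV. (H i (Suc (m i)) (x $ i) * y $ i) * (\<Prod>j\<in>UNIV - {i}. H j (m j) (x $ j)))) (at x)"
  unfolding tensor_def[abs_def]
proof (rule has_derivative_prod)
  fix i
  have "(H i (m i) has_derivative (*) (H i (Suc (m i)) (x $ i))) (at (x $ i))"
    using assms[of i "m i" "x $ i"] by (simp add: has_field_derivative_def)
  from has_derivative_compose[OF bounded_linear_imp_has_derivative[OF bounded_linear_vec_nth[of i]] this]
  show "((\<lambda>x. H i (m i) (x $ i)) has_derivative (\<lambda>y. H i (Suc (m i)) (x $ i) * y $ i)) (at x)"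
    by simp
qed

lemma partial_deriv_tensor:
  assumes "\<And>i n x. (H i n has_real_derivative H i (Suc n) x) (at x)"
  shows "partial_deriv k (tensor H m) = tensor H (m(k := Suc (m k)))"
proof
  fix x
  have "partial_deriv k (tensor H m) x =
      (\<Sum>i\<in>UNIV. (H i (Suc (m i)) (x $ i) * axis k 1 $ i) * (\<Prod>j\<in>UNIV - {i}. H j (m j) (x $ j)))"
    unfolding partial_deriv_def frechet_derivative_at[OF tensor_has_derivative[of H, OF assms], symmetric] ..
  also have "\<dots> = (\<Sum>i\<in>UNIV. if i = k then H k (Suc (m k)) (x $ k) * (\<Prod>j\<in>UNIV - {k}. H j (m j) (x $ j)) else 0)"
    by (rule sum.cong) (auto simp: axis_def)
  also have "\<dots> = H k (Suc (m k)) (x $ k) * (\<Prod>j\<in>UNIV - {k}. H j (m j) (x $ j))" by simp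
  also have "\<dots> = tensor H (m(k := Suc (m k))) x"
    unfolding tensor_def by (subst prod.remove[of UNIV k]) auto
  finally show "partial_deriv k (tensor H m) x = tensor H (m(k := Suc (m k))) x" .
qed

lemma smooth_tensor:
  assumes "\<And>i n x. (H i n has_real_derivative H i (Suc n) x) (at x)"
  shows "smooth (tensor H m)"
  unfolding smooth_def
proof
  fix l
  have "\<exists>m'. foldr partial_deriv l (tensor H m) = tensor H m'"
    by (induction l) (auto simp: partial_deriv_tensor[of H, OF assms])
  then obtain m' where m': "foldr partial_deriv l (tensor H m) = tensor H m'" by blast
  show "foldr partial_deriv l (tensor H m) differentiable_on UNIV"
    unfolding m' differentiable_on_def differentiable_def using tensor_has_derivative[of H m', OF assms] by blast
qed

text \<open>
  The parameter \<open>c\<close> sharpens the bump: for \<open>c \<rightarrow> \<infinity>\<close> it increases to the indicator of the open box.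
\<close>

definition box_bump :: "real \<Rightarrow> real^'n \<Rightarrow> real^'n \<Rightarrow> real^'n::finite \<Rightarrow> real" where
  "box_bump c a b = tensor (\<lambda>i. bump (smult c ([:- (a $ i), 1:] * [:b $ i, - 1:]))) (\<lambda>i. 0)"

lemma box_bump_eq:
  "box_bump c a b x = (\<Prod>i\<in>UNIV. flat_exp 0 (c * ((x $ i - a $ i) * (b $ i - x $ i))))"
  by (simp add: box_bump_def tensor_def bump_def algebra_simps)

lemma flat_exp_0_bounds: "0 \<le> flat_exp 0 w" "flat_exp 0 w \<le> 1"
  by (auto simp: flat_exp_def)

lemma box_bump_bounds: "0 \<le> box_bump c a b x" "box_bump c a b x \<le> 1"
  unfolding box_bump_eq by (auto intro!: prod_nonneg prod_le_1 simp: flat_exp_0_bounds)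

lemma box_bump_outside:
  assumes "0 \<le> c" "\<And>i. a $ i \<le> b $ i" "x \<notin> box a b"
  shows "box_bump c a b x = 0"
proof -
  obtain i where i: "x $ i \<le> a $ i \<or> b $ i \<le> x $ i"
    using assms(3) by (auto simp: mem_box_cart not_less)
  then have "(x $ i - a $ i) * (b $ i - x $ i) \<le> 0"
    using assms(2)[of i] by (auto simp: mult_nonpos_nonneg mult_nonneg_nonpos)
  then have "c * ((x $ i - a $ i) * (b $ i - x $ i)) \<le> 0" using assms(1) by (simp add: mult_nonneg_nonpos)
  then have "flat_exp 0 (c * ((x $ i - a $ i) * (b $ i - x $ i))) = 0" by (simp add: flat_exp_def)
  then show ?thesis unfolding box_bump_eq by (auto intro!: prod_zero)
qed

lemma test_function_box_bump:
  assumes "0 \<le> c" "\<And>i. a $ i \<le> b $ i"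
  shows "test_function (box_bump c a b)"
  unfolding test_function_def
proof
  show "smooth (box_bump c a b)" unfolding box_bump_def by (rule smooth_tensor) (rule bump_deriv)
  have "{x. box_bump c a b x \<noteq> 0} \<subseteq> cbox a b"
    using box_bump_outside[OF assms] box_subset_cbox[of a b] by blast
  then have "closure {x. box_bump c a b x \<noteq> 0} \<subseteq> cbox a b" by (rule closure_minimal[OF _ closed_cbox])
  then show "compact (closure {x. box_bump c a b x \<noteq> 0})"
    using compact_Int_closed[OF compact_cbox[of a b] closed_closure] by (metis inf.absorb_iff2)
qed

lemma box_bump_tendsto:
  fixes a b x :: "real^'n::finite"
  assumes ab: "\<And>i. a $ i \<le> b $ i"
  shows "(\<lambda>n. box_bump (real n) a b x) \<longlonglongrightarrow> indicator (box a b) x"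
proof (cases "x \<in> box a b")
  case True
  have "(\<lambda>n. flat_exp 0 (real n * ((x $ i - a $ i) * (b $ i - x $ i)))) \<longlonglongrightarrow> 1" for i
  proof -
    define q where "q = (x $ i - a $ i) * (b $ i - x $ i)"
    have q: "q > 0" using True by (auto simp: q_def mem_box_cart)
    have "(\<lambda>n. - (1 / q) * (1 / real n)) \<longlonglongrightarrow> - (1 / q) * 0"
      by (intro tendsto_intros lim_1_over_n)
    then have "(\<lambda>n. exp (- (1 / q) * (1 / real n))) \<longlonglongrightarrow> exp 0" by (intro tendsto_exp) simp
    moreover have "eventually (\<lambda>n. exp (- (1 / q) * (1 / real n)) = flat_exp 0 (real n * q)) sequentially"
      using eventually_gt_at_top[of 0] by eventually_elim (use q in \<open>auto simp: flat_exp_def field_simps\<close>)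
    ultimately show ?thesis unfolding q_def[symmetric] by (simp add: Lim_transform_eventually)
  qed
  then have "(\<lambda>n. box_bump (real n) a b x) \<longlonglongrightarrow> (\<Prod>i\<in>(UNIV :: 'n set). 1)"
    unfolding box_bump_eq by (intro tendsto_prod)
  then show ?thesis using True by simp
next
  case False
  then show ?thesis using box_bump_outside[OF _ ab] by simp
qed

lemma test_function_continuous:
  assumes "test_function \<phi>" shows "continuous_on UNIV \<phi>"
proof -
  have "foldr partial_deriv [] \<phi> differentiable_on UNIV" using assms by (simp only: test_function_def smooth_def)
  then show ?thesis by (simp add: differentiable_imp_continuous_on)
qed

lemma test_function_differentiable:
  assumes "test_function \<phi>" shows "\<phi> differentiable (at x)"
proof -
  have "foldr partial_deriv [] \<phi> differentiable_on UNIV" using assms by (simp only: test_function_def smooth_def)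
  then show ?thesis by (simp add: differentiable_on_def)
qed

lemma test_function_partial_continuous:
  assumes "test_function \<phi>" shows "continuous_on UNIV (partial_deriv i \<phi>)"
proof -
  have "foldr partial_deriv [i] \<phi> differentiable_on UNIV" using assms by (simp only: test_function_def smooth_def)
  then show ?thesis by (simp add: differentiable_imp_continuous_on)
qed

lemma test_function_bounded_support:
  assumes "test_function \<phi>"
  obtains R where "0 < R" "\<And>x. norm x > R \<Longrightarrow> \<phi> x = 0"
proof -
  have "bounded {x. \<phi> x \<noteq> 0}"
    using assms compact_imp_bounded bounded_subset closure_subset unfolding test_function_def by blast
  then obtain B where "0 < B" "\<And>x. \<phi> x \<noteq> 0 \<Longrightarrow> norm x \<le> B" by (auto simp: bounded_pos)
  then show thesis using that[of B] by force
qed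

lemma partial_deriv_outside:
  fixes \<phi> :: "real^'n::finite \<Rightarrow> real"
  assumes "\<And>x. norm x > R \<Longrightarrow> \<phi> x = 0" "norm x > R"
  shows "partial_deriv i \<phi> x = 0"
proof -
  have "(\<phi> has_derivative (\<lambda>_. 0)) (at x)"
  proof (rule has_derivative_transform_within_open[of "\<lambda>_. 0" _ _ UNIV "{x. norm x > R}"])
    show "open {x::real^'n. norm x > R}" by (intro open_Collect_less continuous_intros)
  qed (use assms in auto)
  then have "frechet_derivative \<phi> (at x) = (\<lambda>_. 0)" by (metis frechet_derivative_at)
  then show ?thesis by (simp add: partial_deriv_def)
qed

lemma continuous_bounded_support_bounded:
  fixes h :: "real^'n::finite \<Rightarrow> real"
  assumes "continuous_on UNIV h" "\<And>x. norm x > R \<Longrightarrow> h x = 0"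
  obtains B where "0 < B" "\<And>x. \<bar>h x\<bar> \<le> B * indicator (cball 0 R) x"
proof -
  have "compact (h ` cball 0 R)" by (intro compact_continuous_image continuous_on_subset[OF assms(1)]) auto
  then obtain B where "0 < B" "\<And>x. x \<in> cball 0 R \<Longrightarrow> \<bar>h x\<bar> \<le> B"
    using compact_imp_bounded bounded_pos by (metis (no_types, lifting) image_eqI real_norm_def)
  then show thesis using assms(2) by (intro that[of B]) (auto simp: indicator_def)
qed

lemma locally_integrable_measurable:
  fixes f :: "real^'n::finite \<Rightarrow> 'b::euclidean_space"
  assumes "locally_integrable f" shows "f \<in> borel_measurable borel"
proof (rule borel_measurable_LIMSEQ_metric[where f="\<lambda>k x. indicator (cball 0 (real k)) x *\<^sub>R f x"])
  show "(\<lambda>x. indicator (cball 0 (real k)) x *\<^sub>R f x) \<in> borel_measurable borel" for k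
  proof -
    have "integrable lborel (\<lambda>x. indicator (cball 0 (real k)) x *\<^sub>R f x)"
      using assms compact_cball[of 0 "real k"] unfolding locally_integrable_def set_integrable_def by blast
    then show ?thesis using borel_measurable_integrable by force
  qed
  fix x :: "real^'n"
  have "eventually (\<lambda>k. indicator (cball 0 (real k)) x *\<^sub>R f x = f x) sequentially"
    using eventually_ge_at_top[of "nat \<lceil>norm x\<rceil>"]
  proof eventually_elim
    fix k assume "k \<ge> nat \<lceil>norm x\<rceil>"
    then have "norm x \<le> real k" using real_nat_ceiling_ge[of "norm x"] by linarith
    then show "indicator (cball 0 (real k)) x *\<^sub>R f x = f x" by simp
  qed
  then show "(\<lambda>k. indicator (cball 0 (real k)) x *\<^sub>R f x) \<longlonglongrightarrow> f x" by (rule tendsto_eventually)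
qed

lemma L2_locally_integrable:
  assumes "f \<in> L2" shows "locally_integrable f"
  unfolding locally_integrable_def
proof (intro allI impI)
  fix K :: "(real^'a) set" assume "compact K"
  then have K: "K \<in> sets lborel" "emeasure lborel K < \<infinity>"
    using borel_closed[OF compact_imp_closed[of K]] emeasure_compact_finite by auto
  have "integrable lborel (\<lambda>x. indicator K x + (norm (f x))\<^sup>2)"
    using K L2_integrable[OF assms] by (intro Bochner_Integration.integrable_add integrable_real_indicator) auto
  then show "set_integrable lborel K f"
    unfolding set_integrable_def
  proof (rule Bochner_Integration.integrable_bound)
    have [measurable]: "f \<in> borel_measurable borel" "K \<in> sets borel" using assms K by auto
    show "(\<lambda>x. indicator K x *\<^sub>R f x) \<in> borel_measurable lborel" by simp
    have "norm (f x) \<le> 1 + (norm (f x))\<^sup>2" for x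
      using sum_squares_bound[of "1::real" "norm (f x)"] norm_ge_zero[of "f x"] unfolding one_power2 by linarith
    then show "AE x in lborel. norm (indicator K x *\<^sub>R f x) \<le> norm (indicator K x + (norm (f x))\<^sup>2)"
      by (auto simp: indicator_def)
  qed
qed

lemma locally_integrable_mult:
  fixes f :: "real^'n::finite \<Rightarrow> 'b::euclidean_space" and h :: "real^'n \<Rightarrow> real"
  assumes "locally_integrable f" "h \<in> borel_measurable borel" "\<And>x. \<bar>h x\<bar> \<le> B * indicator (cball 0 R) x"
  shows "integrable lborel (\<lambda>x. h x *\<^sub>R f x)"
proof -
  have [measurable]: "f \<in> borel_measurable borel" "h \<in> borel_measurable borel"
    using assms locally_integrable_measurable by auto
  have "integrable lborel (\<lambda>x. B *\<^sub>R (indicator (cball 0 R) x *\<^sub>R f x))"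
    using assms(1) by (intro integrable_scaleR_right) (auto simp: locally_integrable_def set_integrable_def)
  then show ?thesis
  proof (rule Bochner_Integration.integrable_bound)
    show "AE x in lborel. norm (h x *\<^sub>R f x) \<le> norm (B *\<^sub>R indicator (cball 0 R) x *\<^sub>R f x)"
    proof (rule AE_I2)
      fix x
      have "\<bar>h x\<bar> * norm (f x) \<le> \<bar>B * indicator (cball 0 R) x\<bar> * norm (f x)"
        using assms(3)[of x] by (intro mult_right_mono) auto
      then show "norm (h x *\<^sub>R f x) \<le> norm (B *\<^sub>R indicator (cball 0 R) x *\<^sub>R f x)" by (simp add: abs_mult)
    qed
  qed simp
qed

text \<open>
  Dominated convergence along the sharpening bumps.
\<close>

lemma box_integral_zero:
  fixes f :: "real^'n::finite \<Rightarrow> 'b::euclidean_space"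
  assumes li: "locally_integrable f"
    and zero: "\<And>\<phi>. test_function \<phi> \<Longrightarrow> (LINT x|lborel. \<phi> x *\<^sub>R f x) = 0"
  shows "(LINT x|lborel. indicator (box a b) x *\<^sub>R f x) = 0"
proof (cases "\<forall>i. a $ i \<le> b $ i")
  case True
  then have ab: "\<And>i. a $ i \<le> b $ i" by blast
  have [measurable]: "f \<in> borel_measurable borel" using locally_integrable_measurable[OF li] .
  have tf: "test_function (box_bump (real n) a b)" for n by (rule test_function_box_bump) (use ab in auto)
  have [measurable]: "box_bump (real n) a b \<in> borel_measurable borel" for n
    using test_function_continuous[OF tf] by (rule borel_measurable_continuous_onI)
  have "(\<lambda>n. LINT x|lborel. box_bump (real n) a b x *\<^sub>R f x) \<longlonglongrightarrow> (LINT x|lborel. indicator (box a b) x *\<^sub>R f x)"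
  proof (rule integral_dominated_convergence[where w="\<lambda>x. norm (indicator (cbox a b) x *\<^sub>R f x)"])
    show "integrable lborel (\<lambda>x. norm (indicator (cbox a b) x *\<^sub>R f x))"
      using li compact_cbox[of a b] unfolding locally_integrable_def set_integrable_def by (intro integrable_norm) blast
    show "AE x in lborel. (\<lambda>n. box_bump (real n) a b x *\<^sub>R f x) \<longlonglongrightarrow> indicator (box a b) x *\<^sub>R f x"
      by (intro AE_I2 tendsto_scaleR box_bump_tendsto ab tendsto_const)
    show "AE x in lborel. norm (box_bump (real n) a b x *\<^sub>R f x) \<le> norm (indicator (cbox a b) x *\<^sub>R f x)" for n
    proof (rule AE_I2)
      fix x
      have "\<bar>box_bump (real n) a b x\<bar> \<le> indicator (cbox a b) x"
        using box_bump_bounds[of "real n" a b x] box_bump_outside[of "real n" a b x] ab box_subset_cbox[of a b]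
        by (auto simp: indicator_def)
      then show "norm (box_bump (real n) a b x *\<^sub>R f x) \<le> norm (indicator (cbox a b) x *\<^sub>R f x)"
        by (simp add: mult_right_mono)
    qed
  qed auto
  then show ?thesis unfolding zero[OF tf] by (simp add: LIMSEQ_const_iff)
next
  case False
  then obtain i where "b $ i < a $ i" by (auto simp: not_le)
  then have "x \<notin> box a b" for x by (auto simp: mem_box_cart intro!: exI[of _ i])
  then have "box a b = {}" by blast
  then show ?thesis by simp
qed

text \<open>
  Open boxes form an intersection-stable generator of the Borel sets, so the vanishing of the integral
  extends from boxes to all Borel sets.
\<close>

lemma integrable_zero_on_boxes:
  fixes f :: "real^'n::finite \<Rightarrow> 'b::euclidean_space"
  assumes int: "integrable lborel f" and tot: "(LINT x|lborel. f x) = 0"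
    and zero: "\<And>a b. (LINT x|lborel. indicator (box a b) x *\<^sub>R f x) = 0"
  shows "AE x in lborel. f x = 0"
proof (rule sigma_finite_measure.density_zero[OF sigma_finite_lborel int])
  fix A :: "(real^'n) set" assume "A \<in> sets lborel"
  then have A: "A \<in> sigma_sets UNIV (range (\<lambda>(a, b). box a b))"
    by (simp add: borel_eq_box)
  have st: "Int_stable (range (\<lambda>(a, b). box a b :: (real^'n) set))"
    by (auto simp: Int_stable_def box_Int_box)
  have cl: "range (\<lambda>(a, b). box a b :: (real^'n) set) \<subseteq> Pow UNIV" by simp
  have "(LINT x|lborel. indicator A x *\<^sub>R f x) = 0"
    using st cl A
  proof (induction rule: sigma_sets_induct_disjoint)
    case (basic A) then show ?case using zero by auto
  next
    case empty show ?case by simp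
  next
    case (compl A)
    then have [measurable]: "A \<in> sets borel" by (simp add: borel_eq_box)
    have "(LINT x|lborel. indicator (UNIV - A) x *\<^sub>R f x) = (LINT x|lborel. f x - indicator A x *\<^sub>R f x)"
      by (rule Bochner_Integration.integral_cong) (auto simp: indicator_def)
    also have "\<dots> = 0"
      using int tot compl.IH by (subst Bochner_Integration.integral_diff) (auto intro: integrable_mult_indicator)
    finally show ?case .
  next
    case (union A)
    then have m: "A i \<in> sets lborel" for i by (auto simp: borel_eq_box)
    have "(LINT x:(\<Union>i. A i)|lborel. f x) = (\<Sum>i. LINT x:A i|lborel. f x)"
      by (rule lebesgue_integral_countable_add)
         (use m union.hyps int in \<open>auto simp: disjoint_family_on_def set_integrable_def intro!: integrable_mult_indicator\<close>)
    then show ?case using union.IH by (simp add: set_lebesgue_integral_def)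
  qed
  then show "set_lebesgue_integral lborel A f = 0" by (simp add: set_lebesgue_integral_def)
qed

text \<open>
  Restriction to a bounded box makes \<open>f\<close> integrable; boxes are stable under intersection, so the
  restriction still has vanishing integrals over boxes.
\<close>

theorem fundamental_lemma:
  fixes f :: "real^'n::finite \<Rightarrow> 'b::euclidean_space"
  assumes li: "locally_integrable f"
    and zero: "\<And>\<phi>. test_function \<phi> \<Longrightarrow> (LINT x|lborel. \<phi> x *\<^sub>R f x) = 0"
  shows "AE x in lborel. f x = 0"
proof -
  define B :: "nat \<Rightarrow> (real^'n) set" where "B k = box (\<chi> i. - real k) (\<chi> i. real k)" for k
  have "AE x in lborel. indicator (B k) x *\<^sub>R f x = 0" for k
  proof (rule integrable_zero_on_boxes)
    have *: "integrable lborel (\<lambda>x. indicator (cbox (\<chi> i. - real k) (\<chi> i. real k)) x *\<^sub>R f x)"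
      using li by (auto simp: locally_integrable_def set_integrable_def)
    have "integrable lborel (\<lambda>x. indicator (B k) x *\<^sub>R (indicator (cbox (\<chi> i. - real k) (\<chi> i. real k)) x *\<^sub>R f x))"
      by (intro integrable_mult_indicator *) (simp add: B_def)
    also have "(\<lambda>x. indicator (B k) x *\<^sub>R (indicator (cbox (\<chi> i. - real k) (\<chi> i. real k)) x *\<^sub>R f x)) = (\<lambda>x. indicator (B k) x *\<^sub>R f x)"
      using box_subset_cbox[of "\<chi> i. - real k" "\<chi> i. real k"] by (auto simp: B_def indicator_def fun_eq_iff)
    finally show "integrable lborel (\<lambda>x. indicator (B k) x *\<^sub>R f x)" .
    show "(LINT x|lborel. indicator (B k) x *\<^sub>R f x) = 0"
      unfolding B_def by (rule box_integral_zero[OF li zero])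
    fix a b :: "real^'n"
    have "(\<lambda>x. indicator (box a b) x *\<^sub>R (indicator (B k) x *\<^sub>R f x)) = (\<lambda>x. indicator (box a b \<inter> B k) x *\<^sub>R f x)"
      by (auto simp: indicator_def fun_eq_iff)
    then show "(LINT x|lborel. indicator (box a b) x *\<^sub>R (indicator (B k) x *\<^sub>R f x)) = 0"
      unfolding B_def box_Int_box using box_integral_zero[OF li zero] by simp
  qed
  then have "AE x in lborel. \<forall>k. indicator (B k) x *\<^sub>R f x = 0" unfolding AE_all_countable by blast
  then show ?thesis
  proof eventually_elim
    fix x assume x: "\<forall>k. indicator (B k) x *\<^sub>R f x = 0"
    have "x \<in> B (nat \<lceil>norm x\<rceil> + 1)"
    proof -
      have "\<bar>x $ i\<bar> < real (nat \<lceil>norm x\<rceil> + 1)" for i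
        using component_le_norm_cart[of x i] real_nat_ceiling_ge[of "norm x"] by linarith
      then have "- real (nat \<lceil>norm x\<rceil> + 1) < x $ i \<and> x $ i < real (nat \<lceil>norm x\<rceil> + 1)" for i
        by (metis abs_less_iff minus_less_iff)
      then show ?thesis unfolding B_def mem_box_cart vec_lambda_beta by blast
    qed
    then show "f x = 0" using x[THEN spec, of "nat \<lceil>norm x\<rceil> + 1"] by simp
  qed
qed

section \<open>Weak limits and pairings with test functions\<close>

lemma Cauchy_Schwarz_integral:
  assumes [measurable]: "f \<in> borel_measurable N" "g \<in> borel_measurable N"
    and f: "integrable N (\<lambda>x. (f x)\<^sup>2)" and g: "integrable N (\<lambda>x. (g x)\<^sup>2)"
    and nn: "\<And>x. 0 \<le> f x" "\<And>x. 0 \<le> (g x :: real)"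
  shows "integrable N (\<lambda>x. f x * g x)"
    and "(LINT x|N. f x * g x)\<^sup>2 \<le> (LINT x|N. (f x)\<^sup>2) * (LINT x|N. (g x)\<^sup>2)"
proof -
  have "integrable N (\<lambda>x. (f x)\<^sup>2 + (g x)\<^sup>2)" using f g by simp
  then show int: "integrable N (\<lambda>x. f x * g x)"
  proof (rule Bochner_Integration.integrable_bound)
    have "f x * g x \<le> (f x)\<^sup>2 + (g x)\<^sup>2" for x
      using sum_squares_bound[of "f x" "g x"] mult_nonneg_nonneg[OF nn(1) nn(2), of x x] by linarith
    then show "AE x in N. norm (f x * g x) \<le> norm ((f x)\<^sup>2 + (g x)\<^sup>2)"
      using nn by (auto simp: abs_mult)
  qed simp
  have "(\<integral>\<^sup>+x. ennreal (f x) * ennreal (g x) \<partial>N)\<^sup>2 \<le> (\<integral>\<^sup>+x. (ennreal (f x))\<^sup>2 \<partial>N) * (\<integral>\<^sup>+x. (ennreal (g x))\<^sup>2 \<partial>N)"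
    by (rule Cauchy_Schwarz_nn_integral) auto
  moreover have "(\<integral>\<^sup>+x. ennreal (f x) * ennreal (g x) \<partial>N) = ennreal (LINT x|N. f x * g x)"
    using nn int by (simp add: ennreal_mult[symmetric] nn_integral_eq_integral)
  moreover have "(\<integral>\<^sup>+x. (ennreal (f x))\<^sup>2 \<partial>N) = ennreal (LINT x|N. (f x)\<^sup>2)"
    using nn f by (simp add: ennreal_power nn_integral_eq_integral)
  moreover have "(\<integral>\<^sup>+x. (ennreal (g x))\<^sup>2 \<partial>N) = ennreal (LINT x|N. (g x)\<^sup>2)"
    using nn g by (simp add: ennreal_power nn_integral_eq_integral)
  ultimately have "ennreal ((LINT x|N. f x * g x)\<^sup>2) \<le> ennreal ((LINT x|N. (f x)\<^sup>2) * (LINT x|N. (g x)\<^sup>2))"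
    using nn by (simp add: ennreal_power ennreal_mult integral_nonneg_AE)
  then show "(LINT x|N. f x * g x)\<^sup>2 \<le> (LINT x|N. (f x)\<^sup>2) * (LINT x|N. (g x)\<^sup>2)"
    by (subst (asm) ennreal_le_iff) (auto intro!: mult_nonneg_nonneg)
qed

lemma L2_pairing:
  fixes h :: "real^'n::finite \<Rightarrow> real" and f :: "real^'n \<Rightarrow> 'b::euclidean_space"
  assumes "h \<in> L2" "f \<in> L2"
  shows "integrable lborel (\<lambda>x. h x *\<^sub>R f x)"
    and "(norm (LINT x|lborel. h x *\<^sub>R f x))\<^sup>2 \<le> mass h * mass f"
proof -
  have [measurable]: "h \<in> borel_measurable borel" "f \<in> borel_measurable borel" using assms by auto
  note CS = Cauchy_Schwarz_integral[of "\<lambda>x. norm (h x)" lborel "\<lambda>x. norm (f x)"]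
  have i: "integrable lborel (\<lambda>x. norm (h x *\<^sub>R f x))"
    using CS(1) assms[THEN L2_integrable] by simp
  then show int: "integrable lborel (\<lambda>x. h x *\<^sub>R f x)" by (subst (asm) integrable_norm_iff) auto
  have "(norm (LINT x|lborel. h x *\<^sub>R f x))\<^sup>2 \<le> (LINT x|lborel. norm (h x *\<^sub>R f x))\<^sup>2"
    by (intro power_mono integral_norm_bound) auto
  also have "\<dots> \<le> mass h * mass f"
    using CS(2) assms[THEN L2_integrable] by (simp add: mass_def)
  finally show "(norm (LINT x|lborel. h x *\<^sub>R f x))\<^sup>2 \<le> mass h * mass f" .
qed

text \<open>
  A bounded sequence whose pairings with the functions in \<open>T\<close> converge has a weak limit that represents
  these limits. Instead of weak compactness, the proof takes elements of almost minimal norm in a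
  decreasing sequence of convex sets \<open>S j\<close> that contain the tails of the sequence; by the
  parallelogram identity they form a Cauchy sequence.
\<close>

lemma L2_weak_limit:
  fixes w :: "nat \<Rightarrow> real^'n::finite \<Rightarrow> 'b::euclidean_space" and T :: "(real^'n \<Rightarrow> real) set"
  assumes w: "\<And>j. w j \<in> L2" and wC: "\<And>j. mass (w j) \<le> C"
    and T: "\<And>\<phi>. \<phi> \<in> T \<Longrightarrow> \<phi> \<in> L2"
    and lim: "\<And>\<phi>. \<phi> \<in> T \<Longrightarrow> (\<lambda>j. LINT x|lborel. \<phi> x *\<^sub>R w j x) \<longlonglongrightarrow> L \<phi>"
  obtains z where "z \<in> L2" "mass z \<le> C" "\<And>\<phi>. \<phi> \<in> T \<Longrightarrow> (LINT x|lborel. \<phi> x *\<^sub>R z x) = L \<phi>"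
proof -
  define I where "I \<phi> f = (LINT x|lborel. \<phi> x *\<^sub>R f x)" for \<phi> :: "real^'n \<Rightarrow> real" and f :: "real^'n \<Rightarrow> 'b"
  \<comment> \<open>\<open>S j\<close> collects the functions whose pairings satisfy every error bound that holds for all \<open>w i\<close> with \<open>i \<ge> j\<close>\<close>
  define S where "S j = {z \<in> L2. \<forall>\<phi>\<in>T. \<forall>c. (\<forall>i\<ge>j. norm (I \<phi> (w i) - L \<phi>) \<le> c) \<longrightarrow> norm (I \<phi> z - L \<phi>) \<le> c}" for j
  \<comment> \<open>the squared distance from the origin to \<open>S j\<close> increases with \<open>j\<close> and is at most \<open>C\<close>\<close>
  define r where "r j = Inf (mass ` S j)" for j
  have wS: "w j \<in> S j" for j using w by (auto simp: S_def)
  have bdd: "bdd_below (mass ` S j)" for j by (intro bdd_belowI[of _ 0]) auto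
  have S_anti: "S k \<subseteq> S j" if "j \<le> k" for j k
    using that unfolding S_def by (auto intro: order_trans)
  have r_le: "r j \<le> mass z" if "z \<in> S j" for z j
    unfolding r_def by (rule cInf_lower[OF _ bdd]) (use that in auto)
  have r_mono: "r j \<le> r k" if "j \<le> k" for j k
    unfolding r_def using wS[of k] S_anti[OF that] bdd by (intro cInf_superset_mono) auto
  have rC: "r j \<le> C" for j using r_le[OF wS] wC order_trans by blast
  have mid: "(\<lambda>x. (1/2) *\<^sub>R (z x + z' x)) \<in> S j" if z: "z \<in> S j" "z' \<in> S j" for z z' j
  proof -
    have L2: "z \<in> L2" "z' \<in> L2" using z by (auto simp: S_def)
    have eq: "I \<phi> (\<lambda>x. (1/2) *\<^sub>R (z x + z' x)) - L \<phi> = (1/2) *\<^sub>R ((I \<phi> z - L \<phi>) + (I \<phi> z' - L \<phi>))" if "\<phi> \<in> T" for \<phi>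
    proof -
      have "I \<phi> (\<lambda>x. (1/2) *\<^sub>R (z x + z' x)) = (LINT x|lborel. (1/2) *\<^sub>R (\<phi> x *\<^sub>R z x + \<phi> x *\<^sub>R z' x))"
        unfolding I_def by (simp add: scaleR_add_right scaleR_left_commute)
      also have "\<dots> = (1/2) *\<^sub>R (I \<phi> z + I \<phi> z')"
        unfolding I_def using L2_pairing(1)[OF T[OF that] L2(1)] L2_pairing(1)[OF T[OF that] L2(2)] by simp
      finally have *: "I \<phi> (\<lambda>x. (1/2) *\<^sub>R (z x + z' x)) = (1/2) *\<^sub>R (I \<phi> z + I \<phi> z')" .
      have "L \<phi> = (1/2) *\<^sub>R (L \<phi> + L \<phi>)" by (simp add: scaleR_2[symmetric])
      then have "I \<phi> (\<lambda>x. (1/2) *\<^sub>R (z x + z' x)) - L \<phi> = (1/2) *\<^sub>R (I \<phi> z + I \<phi> z') - (1/2) *\<^sub>R (L \<phi> + L \<phi>)"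
        using * by simp
      then show ?thesis by (simp add: scaleR_diff_right[symmetric] algebra_simps)
    qed
    have "norm (I \<phi> (\<lambda>x. (1/2) *\<^sub>R (z x + z' x)) - L \<phi>) \<le> c"
      if phi: "\<phi> \<in> T" and c: "\<forall>i\<ge>j. norm (I \<phi> (w i) - L \<phi>) \<le> c" for \<phi> c
    proof -
      have "norm (I \<phi> z - L \<phi>) \<le> c" "norm (I \<phi> z' - L \<phi>) \<le> c" using z phi c by (auto simp: S_def)
      then have "norm ((I \<phi> z - L \<phi>) + (I \<phi> z' - L \<phi>)) \<le> 2 * c"
        using norm_triangle_ineq[of "I \<phi> z - L \<phi>" "I \<phi> z' - L \<phi>"] by linarith
      then show ?thesis unfolding eq[OF phi] by simp
    qed
    then show ?thesis using L2_scaleR(1)[OF L2_add(1)[OF L2], of "1/2"] by (auto simp: S_def)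
  qed
  have "\<exists>z. z \<in> S j \<and> mass z < r j + 1 / real (Suc j)" for j
    using cInf_lessD[of "mass ` S j" "r j + 1 / real (Suc j)"] wS[of j] by (auto simp: r_def)
  then obtain z where z: "\<And>j. z j \<in> S j" "\<And>j. mass (z j) < r j + 1 / real (Suc j)" by metis
  have zL2: "z j \<in> L2" for j using z(1)[of j] by (auto simp: S_def)
  have diff: "mass (\<lambda>x. z j x - z k x) \<le> 2 * (r k - r j) + 4 / real (Suc j)" if "j \<le> k" for j k
  proof -
    have "r j \<le> mass (\<lambda>x. (1/2) *\<^sub>R (z j x + z k x))"
      by (rule r_le[OF mid]) (use z(1) S_anti[OF that] in auto)
    also have "\<dots> = (1/4) * mass (\<lambda>x. z j x + z k x)"
      by (subst L2_scaleR(2)[OF L2_add(1)[OF zL2 zL2]]) (simp add: power2_eq_square)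
    finally have "4 * r j \<le> mass (\<lambda>x. z j x + z k x)" by simp
    moreover have "1 / real (Suc k) \<le> 1 / real (Suc j)" using that by (simp add: frac_le)
    ultimately show ?thesis
      using mass_parallelogram[OF zL2[of j] zL2[of k]] z(2)[of j] z(2)[of k] by simp
  qed
  have "convergent r"
    by (rule incseq_convergent[of r C]) (auto simp: incseq_def r_mono rC convergent_def)
  then have Cr: "Cauchy r" by (rule convergent_Cauchy)
  have "\<exists>N. \<forall>m\<ge>N. \<forall>n\<ge>N. mass (\<lambda>x. z m x - z n x) < e" if e: "0 < e" for e
  proof -
    obtain N1 where N1: "\<And>m n. m \<ge> N1 \<Longrightarrow> n \<ge> N1 \<Longrightarrow> norm (r m - r n) < e / 4"
      using Cr e unfolding Cauchy_iff by (metis divide_pos_pos zero_less_numeral)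
    obtain N2 where N2: "4 / e * 2 < real (Suc N2)" using reals_Archimedean2[of "4 / e * 2"] by (metis less_Suc_eq of_nat_less_iff less_trans)
    have "mass (\<lambda>x. z m x - z n x) < e" if "m \<ge> max N1 N2" "m \<le> n" for m n
    proof -
      have "4 / e * 2 < real (Suc m)" using N2 that by simp
      then have "4 / real (Suc m) < e / 2" using e by (simp add: field_simps)
      moreover have "norm (r n - r m) < e / 4" using N1 that by auto
      then have "r n - r m < e / 4" by (simp only: real_norm_def abs_less_iff)
      then have "2 * (r n - r m) < e / 2" by simp
      ultimately have "2 * (r n - r m) + 4 / real (Suc m) < e / 2 + e / 2" by (intro add_strict_mono)
      then have "2 * (r n - r m) + 4 / real (Suc m) < e" by (simp only: field_sum_of_halves)
      then show ?thesis by (rule le_less_trans[OF diff[OF that(2)]])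
    qed
    then show ?thesis by (metis mass_diff_commute nle_le)
  qed
  from L2_complete[OF zL2 this] obtain g q where g: "g \<in> L2" "strict_mono (q :: nat \<Rightarrow> nat)"
    "AE x in lborel. (\<lambda>k. z (q k) x) \<longlonglongrightarrow> g x" "(\<lambda>n. mass (\<lambda>x. z n x - g x)) \<longlonglongrightarrow> 0" by blast
  have "mass g \<le> C + e" if e: "0 < e" for e
  proof -
    have "eventually (\<lambda>n. mass g - e/2 < mass (z (q n))) sequentially"
      by (rule mass_lsc[OF zL2 g(1) g(3)]) (use e in simp)
    moreover have "eventually (\<lambda>n. 1 / real (Suc (q n)) < e/2) sequentially"
    proof -
      have "(\<lambda>n. 1 / real (Suc (q n))) \<longlonglongrightarrow> 0"
        using LIMSEQ_subseq_LIMSEQ[OF LIMSEQ_Suc[OF lim_1_over_n] g(2)] by (simp add: o_def)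
      from order_tendstoD(2)[OF this, of "e/2"] e show ?thesis by simp
    qed
    ultimately have "eventually (\<lambda>n. mass g < C + e) sequentially"
    proof eventually_elim
      case (elim n) then show ?case using z(2)[of "q n"] rC[of "q n"] by linarith
    qed
    then have "mass g < C + e" by (simp add: eventually_const)
    then show ?thesis by simp
  qed
  then have "mass g \<le> C" by (rule field_le_epsilon)
  moreover have "I \<phi> g = L \<phi>" if phi: "\<phi> \<in> T" for \<phi>
  proof -
    have "(\<lambda>j. I \<phi> (z j)) \<longlonglongrightarrow> L \<phi>"
    proof (rule LIMSEQ_I)
      fix e :: real assume e: "0 < e"
      then obtain N where N: "\<And>i. i \<ge> N \<Longrightarrow> norm (I \<phi> (w i) - L \<phi>) < e/2"
        using LIMSEQ_D[OF lim[OF phi], of "e/2"] by (auto simp: I_def)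
      have "norm (I \<phi> (z j) - L \<phi>) \<le> e/2" if "j \<ge> N" for j
      proof -
        have "\<forall>i\<ge>j. norm (I \<phi> (w i) - L \<phi>) \<le> e/2" using N that by (meson less_imp_le order_trans)
        then show ?thesis using z(1)[of j] phi unfolding S_def by blast
      qed
      then show "\<exists>no. \<forall>n\<ge>no. norm (I \<phi> (z n) - L \<phi>) < e" using e by (intro exI[of _ N]) force
    qed
    moreover have "(\<lambda>j. I \<phi> (z j)) \<longlonglongrightarrow> I \<phi> g"
    proof -
      have eq: "I \<phi> (z j) - I \<phi> g = I \<phi> (\<lambda>x. z j x - g x)" for j
        unfolding I_def scaleR_diff_right
        by (rule Bochner_Integration.integral_diff[symmetric]) (rule L2_pairing(1) T[OF phi] zL2 g(1))+
      have le: "norm (I \<phi> (z j) - I \<phi> g) \<le> sqrt (mass \<phi> * mass (\<lambda>x. z j x - g x))" for j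
        unfolding eq unfolding I_def by (rule real_le_rsqrt L2_pairing(2) T[OF phi] L2_diff zL2 g)+
      have "(\<lambda>j. sqrt (mass \<phi> * mass (\<lambda>x. z j x - g x))) \<longlonglongrightarrow> sqrt (mass \<phi> * 0)"
        by (intro tendsto_real_sqrt tendsto_mult tendsto_const g(4))
      then have to0: "(\<lambda>j. sqrt (mass \<phi> * mass (\<lambda>x. z j x - g x))) \<longlonglongrightarrow> 0" by simp
      have "(\<lambda>j. I \<phi> (z j) - I \<phi> g) \<longlonglongrightarrow> 0"
        by (rule Lim_null_comparison[OF _ to0]) (intro always_eventually allI le)
      then show ?thesis by (rule LIM_zero_cancel)
    qed
    ultimately show ?thesis using LIMSEQ_unique by blast
  qed
  ultimately show thesis using that[of g] g(1) unfolding I_def by blast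
qed

lemma norm_vec_sq: "(norm (v :: 'a::euclidean_space^'n::finite))\<^sup>2 = (\<Sum>i\<in>UNIV. (norm (v $ i))\<^sup>2)"
  by (simp add: norm_vec_def L2_set_def sum_nonneg)

lemma borel_measurable_vec_lambda:
  fixes f :: "'n::finite \<Rightarrow> 'c \<Rightarrow> 'a::euclidean_space"
  assumes "\<And>i. f i \<in> borel_measurable N"
  shows "(\<lambda>x. \<chi> i. f i x) \<in> borel_measurable N"
proof (rule borel_measurable_euclidean_space[THEN iffD2], intro ballI)
  fix b :: "'a^'n" assume "b \<in> Basis"
  then obtain i c where b: "b = axis i c" by (auto simp: Basis_vec_def)
  have [measurable]: "f i \<in> borel_measurable N" for i by (rule assms)
  have "(\<lambda>x. (\<chi> i. f i x) \<bullet> b) = (\<lambda>x. f i x \<bullet> c)" by (simp add: b inner_axis)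
  then show "(\<lambda>x. (\<chi> i. f i x) \<bullet> b) \<in> borel_measurable N" by simp
qed

lemma borel_measurable_vec_nth_comp:
  fixes f :: "'c \<Rightarrow> 'a::euclidean_space^'n::finite"
  assumes [measurable]: "f \<in> borel_measurable N" shows "(\<lambda>x. f x $ i) \<in> borel_measurable N"
proof -
  have "(\<lambda>v :: 'a^'n. v $ i) \<in> borel_measurable borel"
    by (intro borel_measurable_continuous_onI continuous_intros)
  from measurable_compose[OF assms this] show ?thesis .
qed

lemma L2_vec_iff: "(\<lambda>x. \<chi> i. f i x) \<in> L2 \<longleftrightarrow> (\<forall>i::'n::finite. (f i :: real^'m::finite \<Rightarrow> 'a::euclidean_space) \<in> L2)"
proof
  assume L: "(\<lambda>x. \<chi> i. f i x) \<in> L2"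
  show "\<forall>i. f i \<in> L2"
  proof
    fix i
    have "f i \<in> borel_measurable borel"
      using borel_measurable_vec_nth_comp[OF L2_measurable[OF L], of i] by simp
    then show "f i \<in> L2" 
    proof (rule L2_mono(1)[OF _ L])
      show "norm (f i x) \<le> norm (\<chi> i. f i x)" for x
        using Finite_Cartesian_Product.norm_nth_le[of "\<chi> i. f i x" i] by simp
    qed
  qed
next
  assume "\<forall>i. f i \<in> L2"
  then have f: "\<And>i. f i \<in> L2" by blast
  show "(\<lambda>x. \<chi> i. f i x) \<in> L2"
    by (rule L2_I) (use f in \<open>auto intro!: borel_measurable_vec_lambda Bochner_Integration.integrable_sum L2_integrable simp: norm_vec_sq\<close>)
qed

lemma mass_vec: "(\<And>i. f i \<in> L2) \<Longrightarrow> mass (\<lambda>x. \<chi> i. f i x) = (\<Sum>i\<in>UNIV. mass (f i))"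
  unfolding mass_def norm_vec_sq by (subst Bochner_Integration.integral_sum[symmetric]) (auto intro: L2_integrable)

lemma L2_nth: "F \<in> L2 \<Longrightarrow> (\<lambda>x. F x $ i) \<in> L2" for F :: "real^'m::finite \<Rightarrow> 'a::euclidean_space^'n::finite"
  using L2_vec_iff[of "\<lambda>i x. F x $ i"] by simp

lemma mass_nth: "F \<in> L2 \<Longrightarrow> mass F = (\<Sum>i\<in>UNIV. mass (\<lambda>x. F x $ i))" for F :: "real^'m::finite \<Rightarrow> 'a::euclidean_space^'n::finite"
  using mass_vec[of "\<lambda>i x. F x $ i"] L2_nth[of F] by simp

lemma integral_nth:
  fixes F :: "'c \<Rightarrow> 'a::euclidean_space^'n::finite"
  assumes "integrable N F" shows "(LINT x|N. F x) $ i = (LINT x|N. F x $ i)"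
  using integral_bounded_linear[OF bounded_linear_vec_nth assms] by simp

lemma test_function_bound:
  fixes \<phi> :: "real^'n::finite \<Rightarrow> real"
  assumes "test_function \<phi>"
  obtains B R where "0 < B" "0 < R" "\<And>x. \<bar>\<phi> x\<bar> \<le> B * indicator (cball 0 R) x"
    "\<And>i x. \<bar>partial_deriv i \<phi> x\<bar> \<le> B * indicator (cball 0 R) x"
proof -
  obtain R where R: "0 < R" "\<And>x. norm x > R \<Longrightarrow> \<phi> x = 0" using test_function_bounded_support[OF assms] by blast
  obtain B0 where B0: "0 < B0" "\<And>x. \<bar>\<phi> x\<bar> \<le> B0 * indicator (cball 0 R) x"
    using continuous_bounded_support_bounded[OF test_function_continuous[OF assms] R(2)] by blast
  have "\<exists>B>0. \<forall>x. \<bar>partial_deriv i \<phi> x\<bar> \<le> B * indicator (cball 0 R) x" for i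
    by (rule continuous_bounded_support_bounded[OF test_function_partial_continuous[OF assms, of i], of R])
       (use partial_deriv_outside[of R \<phi>] R in auto)
  then obtain B1 where B1: "\<And>i. B1 i > 0" "\<And>i x. \<bar>partial_deriv i \<phi> x\<bar> \<le> B1 i * indicator (cball 0 R) x" by metis
  define B where "B = B0 + (\<Sum>i\<in>UNIV. B1 i)"
  have s: "0 \<le> (\<Sum>i\<in>UNIV. B1 i)" "B1 i \<le> (\<Sum>i\<in>UNIV. B1 i)" for i
    using B1(1) by (auto intro!: sum_nonneg member_le_sum intro: less_imp_le)
  have "0 < B" "B0 \<le> B" "B1 i \<le> B" for i using B0(1) s(1) s(2)[of i] by (auto simp: B_def)
  then have "B0 * indicator (cball 0 R) x \<le> B * indicator (cball 0 R) x"
    "B1 i * indicator (cball 0 R) x \<le> B * indicator (cball 0 R) x" for x :: "real^'n" and i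
    by (simp_all add: mult_right_mono)
  then show thesis
    using that[OF \<open>0 < B\<close> R(1)] B0(2) B1(2) order_trans by blast
qed

lemma test_function_L2:
  fixes \<phi> :: "real^'n::finite \<Rightarrow> real"
  assumes "test_function \<phi>" shows "\<phi> \<in> L2"
proof -
  obtain B R where B: "\<And>x. \<bar>\<phi> x\<bar> \<le> B * indicator (cball 0 R) x" using test_function_bound[OF assms] by metis
  show ?thesis
  proof (rule L2_bound(1))
    show "\<phi> \<in> borel_measurable borel" using test_function_continuous[OF assms] by (rule borel_measurable_continuous_onI)
    show "integrable lborel (\<lambda>x::real^'n. B\<^sup>2 * indicator (cball 0 R) x)"
      by (intro integrable_mult_right integrable_real_indicator) (use emeasure_bounded_finite[of "cball 0 R :: (real^'n) set"] in auto)
    show "(norm (\<phi> x))\<^sup>2 \<le> B\<^sup>2 * indicator (cball 0 R) x" for x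
      using power_mono[OF B[of x], of 2] by (auto simp: indicator_def split: if_splits)
  qed
qed

lemma frechet_derivative_partial:
  assumes "\<phi> differentiable (at x)"
  shows "frechet_derivative \<phi> (at x) z = (\<Sum>i\<in>UNIV. z $ i * partial_deriv i \<phi> x)"
proof -
  have lin: "linear (frechet_derivative \<phi> (at x))" using assms by (rule linear_frechet_derivative)
  have "z = (\<Sum>i\<in>UNIV. z $ i *\<^sub>R axis i 1)"
    using basis_expansion[of z] by (simp add: scalar_mult_eq_scaleR)
  then have "frechet_derivative \<phi> (at x) z = (\<Sum>i\<in>UNIV. frechet_derivative \<phi> (at x) (z $ i *\<^sub>R axis i 1))"
    using linear_sum[OF lin, of "\<lambda>i. z $ i *\<^sub>R axis i 1" UNIV] by simp
  then show ?thesis by (simp add: linear_cmul[OF lin] partial_deriv_def)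
qed

lemma test_function_line_deriv:
  fixes \<phi> :: "real^'n::finite \<Rightarrow> real"
  assumes "test_function \<phi>"
  shows "((\<lambda>s. \<phi> (x + s *\<^sub>R z)) has_real_derivative (\<Sum>i\<in>UNIV. z $ i * partial_deriv i \<phi> (x + s *\<^sub>R z))) (at s)"
proof -
  note d = test_function_differentiable[OF assms]
  have "((\<lambda>s. x + s *\<^sub>R z) has_derivative (\<lambda>h. h *\<^sub>R z)) (at s)" by (auto intro!: derivative_eq_intros)
  from has_derivative_compose[OF this frechet_derivative_works[THEN iffD1, OF d]]
  have "((\<lambda>s. \<phi> (x + s *\<^sub>R z)) has_derivative (\<lambda>h. frechet_derivative \<phi> (at (x + s *\<^sub>R z)) (h *\<^sub>R z))) (at s)" .
  moreover have "(\<lambda>h. frechet_derivative \<phi> (at (x + s *\<^sub>R z)) (h *\<^sub>R z)) = (*) (\<Sum>i\<in>UNIV. z $ i * partial_deriv i \<phi> (x + s *\<^sub>R z))"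
    by (auto simp: fun_eq_iff frechet_derivative_partial[OF d] sum_distrib_left mult_ac)
  ultimately show ?thesis by (simp add: has_field_derivative_def)
qed

lemma partial_deriv_translate:
  "partial_deriv i (\<lambda>x. f (x + c)) = (\<lambda>x. partial_deriv i f (x + c))" if "f differentiable_on UNIV"
proof
  fix x
  have d: "f differentiable at (x + c)" using that by (simp add: differentiable_on_def)
  have "((\<lambda>x. x + c) has_derivative (\<lambda>h. h)) (at x)" by (auto intro!: derivative_eq_intros)
  from has_derivative_compose[OF this frechet_derivative_works[THEN iffD1, OF d]]
  have hd: "((\<lambda>x. f (x + c)) has_derivative frechet_derivative f (at (x + c))) (at x)" .
  show "partial_deriv i (\<lambda>x. f (x + c)) x = partial_deriv i f (x + c)"
    unfolding partial_deriv_def frechet_derivative_at[OF hd, symmetric] ..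
qed

lemma test_function_translate:
  fixes \<phi> :: "real^'n::finite \<Rightarrow> real"
  assumes "test_function \<phi>" shows "test_function (\<lambda>x. \<phi> (x + c))"
proof -
  have sm: "foldr partial_deriv l \<phi> differentiable_on UNIV" for l
    using assms by (simp add: test_function_def smooth_def)
  have "foldr partial_deriv l (\<lambda>x. \<phi> (x + c)) = (\<lambda>x. foldr partial_deriv l \<phi> (x + c))" for l
    by (induction l) (simp_all add: partial_deriv_translate[OF sm])
  moreover have "(\<lambda>x. foldr partial_deriv l \<phi> (x + c)) differentiable_on UNIV" for l
  proof -
    have "(\<lambda>x. foldr partial_deriv l \<phi> (x + c)) differentiable at x" for x
    proof -
      have "foldr partial_deriv l \<phi> differentiable at (x + c)" using sm by (simp add: differentiable_on_def)
      then obtain D where D: "(foldr partial_deriv l \<phi> has_derivative D) (at (x + c))" by (auto simp: differentiable_def)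
      have "((\<lambda>x. x + c) has_derivative (\<lambda>h. h)) (at x)" by (auto intro!: derivative_eq_intros)
      from has_derivative_compose[OF this D] show ?thesis by (auto simp: differentiable_def)
    qed
    then show ?thesis by (simp add: differentiable_on_def)
  qed
  ultimately have "smooth (\<lambda>x. \<phi> (x + c))" by (simp add: smooth_def)
  moreover have "compact (closure {x. \<phi> (x + c) \<noteq> 0})"
  proof -
    obtain R where R: "\<And>x. norm x > R \<Longrightarrow> \<phi> x = 0" using test_function_bounded_support[OF assms] by blast
    have "norm x \<le> R + norm c" if "\<phi> (x + c) \<noteq> 0" for x
      using R[of "x + c"] that norm_triangle_ineq4[of "x + c" c] by force
    then have "bounded {x. \<phi> (x + c) \<noteq> 0}" by (auto simp: bounded_iff)
    then show ?thesis by (simp add: compact_closure)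
  qed
  ultimately show ?thesis by (simp add: test_function_def)
qed

section \<open>Weak gradients as limits of difference quotients\<close>

definition kin :: "(real^'n::finite \<Rightarrow> complex) \<Rightarrow> real" where
  "kin u = mass (weak_gradient u)"

text \<open>
  Forward difference quotients in all coordinate directions with step \<open>2^(-j)\<close>. Dyadic steps make
  their masses monotone in \<open>j\<close>.
\<close>

definition dq :: "nat \<Rightarrow> (real^'n::finite \<Rightarrow> complex) \<Rightarrow> real^'n \<Rightarrow> complex^'n" where
  "dq j u x = (\<chi> i. 2^j *\<^sub>R (u (x + axis i (1/2^j)) - u x))"

lemma dq_L2:
  assumes "u \<in> L2" shows "dq j u \<in> L2"
    and "mass (dq j u) = 4^j * (\<Sum>i\<in>UNIV. mass (\<lambda>x. u (x + axis i (1/2^j)) - u x))"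
proof -
  have L: "(\<lambda>x. u (x + axis i (1/2^j)) - u x) \<in> L2" for i
    by (intro L2_diff L2_translate assms)
  have "(2::real)^j * 2^j = 4^j" by (simp add: power_mult_distrib[symmetric])
  then show "dq j u \<in> L2" "mass (dq j u) = 4^j * (\<Sum>i\<in>UNIV. mass (\<lambda>x. u (x + axis i (1/2^j)) - u x))"
    unfolding dq_def[abs_def] using L2_scaleR[OF L]
    by (auto simp: L2_vec_iff mass_vec sum_distrib_left power2_eq_square)
qed

text \<open>
  A step is the sum of two half steps, and translation preserves the mass.
\<close>

lemma dq_mono_Suc:
  assumes "u \<in> L2" shows "mass (dq j u) \<le> mass (dq (Suc j) u)"
proof -
  have "mass (\<lambda>x. u (x + axis i (1/2^j)) - u x) \<le> 4 * mass (\<lambda>x. u (x + axis i (1/2^Suc j)) - u x)" for i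
  proof -
    define h :: "real^'a" where "h = axis i (1/2^Suc j)"
    have hh: "axis i (1/2^j) = h + h" by (simp add: h_def axis_def vec_eq_iff)
    have L: "(\<lambda>x. u (x + h) - u x) \<in> L2" by (intro L2_diff L2_translate assms)
    have "(\<lambda>x. u (x + axis i (1/2^j)) - u x) = (\<lambda>x. (u (x + h + h) - u (x + h)) + (u (x + h) - u x))"
      by (simp add: hh add.assoc)
    then have "mass (\<lambda>x. u (x + axis i (1/2^j)) - u x) \<le> 2 * mass (\<lambda>x. u (x + h + h) - u (x + h)) + 2 * mass (\<lambda>x. u (x + h) - u x)"
      using L2_add(2)[OF L2_translate(1)[OF L, of h] L] by simp
    then show ?thesis using L2_translate(2)[OF L, of h] by (simp add: h_def)
  qed
  then have "(\<Sum>i\<in>UNIV. mass (\<lambda>x. u (x + axis i (1/2^j)) - u x)) \<le> 4 * (\<Sum>i\<in>UNIV. mass (\<lambda>x. u (x + axis i (1/2^Suc j)) - u x))"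
    unfolding sum_distrib_left by (intro sum_mono)
  then show ?thesis unfolding dq_L2(2)[OF assms] by simp
qed

lemma dq_mono: "u \<in> L2 \<Longrightarrow> j \<le> k \<Longrightarrow> mass (dq j u) \<le> mass (dq k u)"
  by (rule lift_Suc_mono_le[of "\<lambda>j. mass (dq j u)"]) (auto intro: dq_mono_Suc)

text \<open>
  The discrete analogue of integration by parts: a translation is moved onto the test function.
\<close>

lemma integral_translate_swap:
  fixes u :: "real^'n::finite \<Rightarrow> 'b::euclidean_space"
  assumes "\<phi> \<in> borel_measurable borel" "u \<in> borel_measurable borel"
  shows "(LINT x|lborel. \<phi> x *\<^sub>R u (x + c)) = (LINT x|lborel. \<phi> (x - c) *\<^sub>R u x)"
proof -
  have [measurable]: "\<phi> \<in> borel_measurable borel" "u \<in> borel_measurable borel" by fact+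
  show ?thesis using integral_translate[of "\<lambda>x. \<phi> (x - c) *\<^sub>R u x" c] by simp
qed

text \<open>
  Difference quotients of a test function converge to its partial derivative, dominated by a constant on
  a fixed ball by the mean value theorem.
\<close>

lemma test_function_quotient:
  fixes u :: "real^'n::finite \<Rightarrow> complex"
  assumes u: "u \<in> L2" and tf: "test_function \<phi>"
  shows "(\<lambda>j. LINT x|lborel. (2^j * (\<phi> (x - axis i (1/2^j)) - \<phi> x)) *\<^sub>R u x)
    \<longlonglongrightarrow> - (LINT x|lborel. partial_deriv i \<phi> x *\<^sub>R u x)"
proof -
  have [measurable]: "u \<in> borel_measurable borel" using u by auto
  have [measurable]: "\<phi> \<in> borel_measurable borel" "partial_deriv i \<phi> \<in> borel_measurable borel"
    using test_function_continuous[OF tf] test_function_partial_continuous[OF tf] by (auto intro: borel_measurable_continuous_onI)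
  obtain B R where B: "0 < B" "0 < R" "\<And>x. \<bar>\<phi> x\<bar> \<le> B * indicator (cball 0 R) x"
    "\<And>i x. \<bar>partial_deriv i \<phi> x\<bar> \<le> B * indicator (cball 0 R) x" using test_function_bound[OF tf] by metis
  have ax: "axis i t = t *\<^sub>R axis i (1::real)" for t by (simp add: axis_def vec_eq_iff)
  have sm: "(\<Sum>k\<in>UNIV. axis i (1::real) $ k * g k) = g i" for g
    by (simp add: axis_def if_distrib[of "\<lambda>x. x * _"] cong: if_cong)
  have line: "((\<lambda>s. \<phi> (x + s *\<^sub>R axis i 1)) has_real_derivative partial_deriv i \<phi> (x + s *\<^sub>R axis i 1)) (at s)" for x s
    using test_function_line_deriv[OF tf, of x "axis i 1" s] unfolding sm .
  have bd: "\<bar>2^j * (\<phi> (x - axis i (1/2^j)) - \<phi> x)\<bar> \<le> B * indicator (cball 0 (R + 1)) x" for j x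
  proof -
    define t :: real where "t = 1/2^j"
    have t: "0 < t" "t \<le> 1" by (simp_all add: t_def)
    obtain s where s: "- t < s" "s < 0" "\<phi> (x + 0 *\<^sub>R axis i 1) - \<phi> (x + (- t) *\<^sub>R axis i 1) = (0 - (- t)) * partial_deriv i \<phi> (x + s *\<^sub>R axis i 1)"
      using MVT2[of "-t" 0 "\<lambda>s. \<phi> (x + s *\<^sub>R axis i 1)" "\<lambda>s. partial_deriv i \<phi> (x + s *\<^sub>R axis i 1)"] line t by auto
    have "\<phi> (x - axis i t) - \<phi> x = - t * partial_deriv i \<phi> (x + s *\<^sub>R axis i 1)"
      using s(3) by (simp add: ax[of t])
    then have "2^j * (\<phi> (x - axis i (1/2^j)) - \<phi> x) = - partial_deriv i \<phi> (x + s *\<^sub>R axis i 1)"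
      by (simp add: t_def)
    then have "\<bar>2^j * (\<phi> (x - axis i (1/2^j)) - \<phi> x)\<bar> \<le> B * indicator (cball 0 R) (x + s *\<^sub>R axis i 1)"
      using B(4)[of i "x + s *\<^sub>R axis i 1"] by simp
    also have "\<dots> \<le> B * indicator (cball 0 (R + 1)) x"
    proof -
      have "norm x \<le> norm (x + s *\<^sub>R axis i 1) + norm (s *\<^sub>R axis i (1::real) :: real^'n)"
        using norm_triangle_ineq4[of "x + s *\<^sub>R axis i 1" "s *\<^sub>R axis i 1"] by simp
      moreover have "norm (s *\<^sub>R axis i (1::real) :: real^'n) \<le> 1" using s t by simp
      ultimately show ?thesis using B(1) by (auto simp: indicator_def)
    qed
    finally show ?thesis .
  qed
  have "(\<lambda>j. LINT x|lborel. (2^j * (\<phi> (x - axis i (1/2^j)) - \<phi> x)) *\<^sub>R u x)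
    \<longlonglongrightarrow> (LINT x|lborel. (- partial_deriv i \<phi> x) *\<^sub>R u x)"
  proof (rule integral_dominated_convergence[where w="\<lambda>x. norm ((B * indicator (cball 0 (R + 1)) x) *\<^sub>R u x)"])
    show "integrable lborel (\<lambda>x. norm ((B * indicator (cball 0 (R + 1)) x) *\<^sub>R u x))"
    proof -
      have mB: "(\<lambda>x::real^'n. B * indicator (cball 0 (R + 1)) x) \<in> borel_measurable borel"
        by (intro borel_measurable_times borel_measurable_const borel_measurable_indicator) auto
      have "\<bar>B * indicator (cball 0 (R + 1)) x\<bar> \<le> B * indicator (cball 0 (R + 1)) x" for x :: "real^'n"
        using B(1) by (simp add: indicator_def)
      from integrable_norm[OF locally_integrable_mult[OF L2_locally_integrable[OF u] mB this]] show ?thesis .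
    qed
    show "AE x in lborel. (\<lambda>j. (2^j * (\<phi> (x - axis i (1/2^j)) - \<phi> x)) *\<^sub>R u x) \<longlonglongrightarrow> (- partial_deriv i \<phi> x) *\<^sub>R u x"
    proof (intro AE_I2 tendsto_scaleR tendsto_const)
      fix x
      have "((\<lambda>h. (\<phi> (x + h *\<^sub>R axis i 1) - \<phi> x) / h) \<longlongrightarrow> partial_deriv i \<phi> x) (at 0)"
        using line[of x 0] by (simp add: DERIV_def)
      moreover have "filterlim (\<lambda>j. - (1/2^j) :: real) (at 0) sequentially"
      proof (rule filterlim_atI)
        have "(\<lambda>j. - ((1/2)^j) :: real) \<longlonglongrightarrow> - 0" by (intro tendsto_minus LIMSEQ_power_zero) simp
        then show "(\<lambda>j. - (1/2^j) :: real) \<longlonglongrightarrow> 0" by (simp add: power_one_over)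
      qed auto
      ultimately have "(\<lambda>j. (\<phi> (x + (- (1/2^j)) *\<^sub>R axis i 1) - \<phi> x) / (- (1/2^j))) \<longlonglongrightarrow> partial_deriv i \<phi> x"
        by (rule filterlim_compose)
      then have "(\<lambda>j. - ((\<phi> (x + (- (1/2^j)) *\<^sub>R axis i 1) - \<phi> x) / (- (1/2^j)))) \<longlonglongrightarrow> - partial_deriv i \<phi> x"
        by (rule tendsto_minus)
      then show "(\<lambda>j. 2^j * (\<phi> (x - axis i (1/2^j)) - \<phi> x)) \<longlonglongrightarrow> - partial_deriv i \<phi> x"
        by (simp add: ax[of "1/2^_"] mult.commute)
    qed
    show "AE x in lborel. norm ((2^j * (\<phi> (x - axis i (1/2^j)) - \<phi> x)) *\<^sub>R u x) \<le> norm ((B * indicator (cball 0 (R + 1)) x) *\<^sub>R u x)" for j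
    proof (rule AE_I2)
      fix x
      have "\<bar>2^j * (\<phi> (x - axis i (1/2^j)) - \<phi> x)\<bar> \<le> \<bar>B * indicator (cball 0 (R + 1)) x\<bar>"
        using bd[of j x] by linarith
      then show "norm ((2^j * (\<phi> (x - axis i (1/2^j)) - \<phi> x)) *\<^sub>R u x) \<le> norm ((B * indicator (cball 0 (R + 1)) x) *\<^sub>R u x)"
        unfolding norm_scaleR real_norm_def by (rule mult_right_mono) simp
    qed
  qed measurable
  then show ?thesis by simp
qed

text \<open>
  The difference quotients, bounded in \<open>L2\<close>, have a weak limit; by \<open>test_function_quotient\<close> it is a weak gradient.
\<close>

lemma weak_gradient_exists:
  fixes u :: "real^'n::finite \<Rightarrow> complex"
  assumes u: "u \<in> L2" and C: "\<And>j. mass (dq j u) \<le> C"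
  obtains U where "U \<in> L2" "has_weak_gradient u U" "mass U \<le> C"
proof -
  define L :: "(real^'n \<Rightarrow> real) \<Rightarrow> complex^'n" where "L \<phi> = (\<chi> i. - (LINT x|lborel. partial_deriv i \<phi> x *\<^sub>R u x))" for \<phi>
  have [measurable]: "u \<in> borel_measurable borel" using u by auto
  have lim: "(\<lambda>j. LINT x|lborel. \<phi> x *\<^sub>R dq j u x) \<longlonglongrightarrow> L \<phi>" if "\<phi> \<in> Collect test_function" for \<phi>
  proof (rule vec_tendstoI)
    fix i
    have tf: "test_function \<phi>" using that by simp
    have [measurable]: "\<phi> \<in> borel_measurable borel"
      using test_function_continuous[OF tf] by (auto intro: borel_measurable_continuous_onI)
    have "(LINT x|lborel. \<phi> x *\<^sub>R dq j u x) $ i = (LINT x|lborel. (2^j * (\<phi> (x - axis i (1/2^j)) - \<phi> x)) *\<^sub>R u x)" for j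
    proof -
      have i1: "integrable lborel (\<lambda>x. \<phi> x *\<^sub>R u (x + axis i (1/2^j)))" and i2: "integrable lborel (\<lambda>x. \<phi> x *\<^sub>R u x)"
        by (intro L2_pairing test_function_L2 tf L2_translate u)+
      have i3: "integrable lborel (\<lambda>x. \<phi> (x - axis i (1/2^j)) *\<^sub>R u x)"
        using L2_pairing(1)[OF L2_translate(1)[OF test_function_L2[OF tf], of "- axis i (1/2^j)"] u] by simp
      have "(LINT x|lborel. \<phi> x *\<^sub>R dq j u x) $ i = (LINT x|lborel. (\<phi> x *\<^sub>R dq j u x) $ i)"
        by (intro integral_nth L2_pairing test_function_L2 tf dq_L2 u)
      also have "\<dots> = (LINT x|lborel. 2^j *\<^sub>R (\<phi> x *\<^sub>R u (x + axis i (1/2^j)) - \<phi> x *\<^sub>R u x))"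
        by (simp add: dq_def scaleR_diff_right mult.commute)
      also have "\<dots> = 2^j *\<^sub>R ((LINT x|lborel. \<phi> x *\<^sub>R u (x + axis i (1/2^j))) - (LINT x|lborel. \<phi> x *\<^sub>R u x))"
        using i1 i2 by simp
      also have "(LINT x|lborel. \<phi> x *\<^sub>R u (x + axis i (1/2^j))) = (LINT x|lborel. \<phi> (x - axis i (1/2^j)) *\<^sub>R u x)"
        by (rule integral_translate_swap) simp_all
      also have "2^j *\<^sub>R (\<dots> - (LINT x|lborel. \<phi> x *\<^sub>R u x)) = (LINT x|lborel. 2^j *\<^sub>R (\<phi> (x - axis i (1/2^j)) *\<^sub>R u x - \<phi> x *\<^sub>R u x))"
        using i2 i3 by simp
      also have "(\<lambda>x. 2^j *\<^sub>R (\<phi> (x - axis i (1/2^j)) *\<^sub>R u x - \<phi> x *\<^sub>R u x))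
          = (\<lambda>x. (2^j * (\<phi> (x - axis i (1/2^j)) - \<phi> x)) *\<^sub>R u x)"
        by (simp only: scaleR_diff_left[symmetric] scaleR_scaleR)
      finally show ?thesis .
    qed
    then show "(\<lambda>j. (LINT x|lborel. \<phi> x *\<^sub>R dq j u x) $ i) \<longlonglongrightarrow> L \<phi> $ i"
      using test_function_quotient[OF u tf, of i] by (simp add: L_def)
  qed
  obtain U where U: "U \<in> L2" "mass U \<le> C" "\<And>\<phi>. \<phi> \<in> Collect test_function \<Longrightarrow> (LINT x|lborel. \<phi> x *\<^sub>R U x) = L \<phi>"
  proof (rule L2_weak_limit[where w="\<lambda>j. dq j u" and C=C and T="Collect test_function" and L=L])
    show "\<phi> \<in> L2" if "\<phi> \<in> Collect test_function" for \<phi> :: "real^'n \<Rightarrow> real"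
      using that test_function_L2 by simp
  qed (rule dq_L2(1)[OF u] C lim | assumption | blast)+
  have "has_weak_gradient u U"
    unfolding has_weak_gradient_def
  proof (intro conjI allI impI L2_locally_integrable u U)
    fix \<phi> :: "real^'n \<Rightarrow> real" and i assume tf: "test_function \<phi>"
    have "(LINT x|lborel. \<phi> x *\<^sub>R (U x $ i)) = (LINT x|lborel. (\<phi> x *\<^sub>R U x) $ i)" by simp
    also have "\<dots> = (LINT x|lborel. \<phi> x *\<^sub>R U x) $ i"
      by (rule integral_nth[symmetric]) (intro L2_pairing test_function_L2 tf U)
    also have "\<dots> = - (LINT x|lborel. partial_deriv i \<phi> x *\<^sub>R u x)" using U(3) tf by (simp add: L_def)
    finally show "(LINT x|lborel. partial_deriv i \<phi> x *\<^sub>R u x) = - (LINT x|lborel. \<phi> x *\<^sub>R (U x $ i))" by simp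
  qed
  then show thesis using that U by blast
qed

lemma weak_gradient_unique:
  fixes u :: "real^'n::finite \<Rightarrow> complex"
  assumes "has_weak_gradient u U" "has_weak_gradient u V"
  shows "AE x in lborel. U x = V x"
proof -
  have li: "locally_integrable U" "locally_integrable V" using assms by (auto simp: has_weak_gradient_def)
  have "AE x in lborel. U x - V x = 0"
  proof (rule fundamental_lemma)
    show "locally_integrable (\<lambda>x. U x - V x)"
      using li by (auto simp: locally_integrable_def intro!: set_integral_diff)
    fix \<phi> :: "real^'n \<Rightarrow> real" assume tf: "test_function \<phi>"
    obtain B R where B: "\<And>x. \<bar>\<phi> x\<bar> \<le> B * indicator (cball 0 R) x" using test_function_bound[OF tf] by metis
    have m: "\<phi> \<in> borel_measurable borel"
      using test_function_continuous[OF tf] by (auto intro: borel_measurable_continuous_onI)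
    note i = locally_integrable_mult[OF li(1) m B] locally_integrable_mult[OF li(2) m B]
    have "(LINT x|lborel. \<phi> x *\<^sub>R U x) $ i = (LINT x|lborel. \<phi> x *\<^sub>R V x) $ i" for i
      using integral_nth[OF i(1), of i] integral_nth[OF i(2), of i] assms tf
      unfolding has_weak_gradient_def by (simp add: minus_equation_iff[of "integral\<^sup>L _ _"])
    then have "(LINT x|lborel. \<phi> x *\<^sub>R U x) = (LINT x|lborel. \<phi> x *\<^sub>R V x)" by (simp add: vec_eq_iff)
    then show "(LINT x|lborel. \<phi> x *\<^sub>R (U x - V x)) = 0"
      unfolding scaleR_diff_right using i by (subst Bochner_Integration.integral_diff) auto
  qed
  then show ?thesis by simp
qed

text \<open>
  Cauchy-Schwarz against the indicator of \<open>A\<close>. Stated with extended nonnegative integrals, so that it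
  can be integrated over parameters without checking integrability first; if the left integrand is not
  integrable, the left-hand side is zero.
\<close>

lemma Jensen_square:
  fixes f :: "'c \<Rightarrow> 'b::euclidean_space"
  assumes [measurable]: "f \<in> borel_measurable N" "A \<in> sets N"
  shows "ennreal ((norm (LINT x|N. indicator A x *\<^sub>R f x))\<^sup>2)
    \<le> emeasure N A * (\<integral>\<^sup>+x. indicator A x * ennreal ((norm (f x))\<^sup>2) \<partial>N)"
proof (cases "integrable N (\<lambda>x. indicator A x *\<^sub>R f x)")
  case True
  have "ennreal (norm (LINT x|N. indicator A x *\<^sub>R f x)) \<le> (\<integral>\<^sup>+x. ennreal (norm (indicator A x *\<^sub>R f x)) \<partial>N)"
    using True by (rule integral_norm_bound_ennreal)
  also have "\<dots> = (\<integral>\<^sup>+x. indicator A x * (indicator A x * ennreal (norm (f x))) \<partial>N)"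
    by (intro nn_integral_cong) (auto simp: indicator_def)
  finally have "(ennreal (norm (LINT x|N. indicator A x *\<^sub>R f x)))\<^sup>2 \<le> (\<integral>\<^sup>+x. indicator A x * (indicator A x * ennreal (norm (f x))) \<partial>N)\<^sup>2"
    by (intro power_mono) auto
  also have "\<dots> \<le> (\<integral>\<^sup>+x. (indicator A x)\<^sup>2 \<partial>N) * (\<integral>\<^sup>+x. (indicator A x * ennreal (norm (f x)))\<^sup>2 \<partial>N)"
    by (rule Cauchy_Schwarz_nn_integral) auto
  also have "(\<integral>\<^sup>+x. (indicator A x)\<^sup>2 \<partial>N) = (\<integral>\<^sup>+x. indicator A x \<partial>N)"
    by (intro nn_integral_cong) (auto simp: indicator_def)
  also have "(\<integral>\<^sup>+x. (indicator A x * ennreal (norm (f x)))\<^sup>2 \<partial>N) = (\<integral>\<^sup>+x. indicator A x * ennreal ((norm (f x))\<^sup>2) \<partial>N)"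
    by (intro nn_integral_cong) (auto simp: indicator_def ennreal_power)
  finally show ?thesis by (simp add: ennreal_power)
qed (simp add: not_integrable_integral_eq)


lemma directional_bound: "norm (\<Sum>i\<in>UNIV. z $ i *\<^sub>R v $ i) \<le> norm z * norm v"
  for z :: "real^'n::finite" and v :: "'a::euclidean_space^'n"
proof -
  have "norm (\<Sum>i\<in>UNIV. z $ i *\<^sub>R v $ i) \<le> (\<Sum>i\<in>UNIV. \<bar>norm (z $ i)\<bar> * \<bar>norm (v $ i)\<bar>)"
    by (rule order_trans[OF norm_sum]) simp
  also have "\<dots> \<le> L2_set (\<lambda>i. norm (z $ i)) UNIV * L2_set (\<lambda>i. norm (v $ i)) UNIV"
    by (rule L2_set_mult_ineq)
  finally show ?thesis by (simp add: norm_vec_def)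
qed

lemma segment_average:
  fixes V :: "real^'n::finite \<Rightarrow> 'b::euclidean_space"
  assumes V: "V \<in> L2"
  shows "(\<lambda>x. LINT s|lborel. indicator {0..1::real} s *\<^sub>R V (x + s *\<^sub>R z)) \<in> L2"
    and "mass (\<lambda>x. LINT s|lborel. indicator {0..1::real} s *\<^sub>R V (x + s *\<^sub>R z)) \<le> mass V"
proof -
  have [measurable]: "V \<in> borel_measurable borel" using V by auto
  let ?W = "\<lambda>x. LINT s|lborel. indicator {0..1::real} s *\<^sub>R V (x + s *\<^sub>R z)"
  have [measurable]: "?W \<in> borel_measurable borel" by measurable
  have "(\<integral>\<^sup>+x. ennreal ((norm (?W x))\<^sup>2) \<partial>lborel)
      \<le> (\<integral>\<^sup>+x. emeasure lborel {0..1::real} * (\<integral>\<^sup>+s. indicator {0..1::real} s * ennreal ((norm (V (x + s *\<^sub>R z)))\<^sup>2) \<partial>lborel) \<partial>lborel)"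
    by (intro nn_integral_mono Jensen_square) measurable
  also have "\<dots> = (\<integral>\<^sup>+x. (\<integral>\<^sup>+s. indicator {0..1::real} s * ennreal ((norm (V (x + s *\<^sub>R z)))\<^sup>2) \<partial>lborel) \<partial>lborel)"
    by simp
  also have "\<dots> = (\<integral>\<^sup>+s. (\<integral>\<^sup>+x. indicator {0..1::real} s * ennreal ((norm (V (x + s *\<^sub>R z)))\<^sup>2) \<partial>lborel) \<partial>lborel)"
    by (rule lborel_pair.Fubini'[symmetric]) measurable
  also have "\<dots> = (\<integral>\<^sup>+s. indicator {0..1::real} s * ennreal (mass V) \<partial>lborel)"
    by (intro nn_integral_cong) (simp add: nn_integral_cmult
        nn_integral_translate[where f="\<lambda>x. ennreal ((norm (V x))\<^sup>2)"] nn_mass[OF V])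
  also have "\<dots> = ennreal (mass V)" by (simp add: nn_integral_multc)
  finally show "?W \<in> L2" "mass ?W \<le> mass V" using L2_I_nn[of ?W "mass V"] by auto
qed

lemma mult_le_sum_squares: "a * b \<le> a\<^sup>2 + (b::real)\<^sup>2"
  using sum_squares_bound[of a b] zero_le_power2[of a] zero_le_power2[of b] by linarith

lemma pair_integrable_translate:
  fixes V :: "real^'n::finite \<Rightarrow> 'b::euclidean_space" and h :: "real^'n \<Rightarrow> real"
  assumes h: "h \<in> L2" and V: "V \<in> L2"
  shows "integrable (lborel \<Otimes>\<^sub>M lborel) (\<lambda>(x, s). (indicator {0..1::real} s * h x) *\<^sub>R V (x + s *\<^sub>R z))"
proof (rule integrableI_bounded)
  have [measurable]: "V \<in> borel_measurable borel" "h \<in> borel_measurable borel" using assms by auto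
  show [measurable]: "(\<lambda>(x, s). (indicator {0..1::real} s * h x) *\<^sub>R V (x + s *\<^sub>R z)) \<in> borel_measurable (lborel \<Otimes>\<^sub>M lborel)"
    by measurable
  have "(\<integral>\<^sup>+p. ennreal (norm (case p of (x, s) \<Rightarrow> (indicator {0..1::real} s * h x) *\<^sub>R V (x + s *\<^sub>R z))) \<partial>(lborel \<Otimes>\<^sub>M lborel))
      = (\<integral>\<^sup>+s. \<integral>\<^sup>+x. ennreal (norm ((indicator {0..1::real} s * h x) *\<^sub>R V (x + s *\<^sub>R z))) \<partial>lborel \<partial>lborel)"
    by (subst lborel_pair.nn_integral_snd[symmetric]) simp_all
  also have "\<dots> \<le> (\<integral>\<^sup>+s. indicator {0..1::real} s * ennreal (mass h + mass V) \<partial>lborel)"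
  proof (rule nn_integral_mono)
    fix s :: real
    have "(\<integral>\<^sup>+x. ennreal (norm ((indicator {0..1::real} s * h x) *\<^sub>R V (x + s *\<^sub>R z))) \<partial>lborel)
       \<le> (\<integral>\<^sup>+x. indicator {0..1::real} s * (ennreal ((norm (h x))\<^sup>2) + ennreal ((norm (V (x + s *\<^sub>R z)))\<^sup>2)) \<partial>lborel)"
    proof (rule nn_integral_mono)
      fix x
      have "\<bar>h x\<bar> * norm (V (x + s *\<^sub>R z)) \<le> (norm (h x))\<^sup>2 + (norm (V (x + s *\<^sub>R z)))\<^sup>2"
        using mult_le_sum_squares[of "\<bar>h x\<bar>" "norm (V (x + s *\<^sub>R z))"] by simp
      then show "ennreal (norm ((indicator {0..1::real} s * h x) *\<^sub>R V (x + s *\<^sub>R z)))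
          \<le> indicator {0..1::real} s * (ennreal ((norm (h x))\<^sup>2) + ennreal ((norm (V (x + s *\<^sub>R z)))\<^sup>2))"
        by (auto simp: indicator_def ennreal_plus[symmetric] simp del: ennreal_plus intro!: ennreal_leI)
    qed
    also have "\<dots> = indicator {0..1::real} s * (ennreal (mass h) + ennreal (mass V))"
      using nn_mass[OF h] by (simp add: nn_integral_cmult nn_integral_add
          nn_integral_translate[where f="\<lambda>x. ennreal ((norm (V x))\<^sup>2)"] nn_mass[OF V])
    finally show "(\<integral>\<^sup>+x. ennreal (norm ((indicator {0..1::real} s * h x) *\<^sub>R V (x + s *\<^sub>R z))) \<partial>lborel)
       \<le> indicator {0..1::real} s * ennreal (mass h + mass V)" by simp
  qed
  also have "\<dots> = ennreal (mass h + mass V)" by (simp add: nn_integral_multc)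
  also have "\<dots> < \<infinity>" by simp
  finally show "(\<integral>\<^sup>+p. ennreal (norm (case p of (x, s) \<Rightarrow> (indicator {0..1::real} s * h x) *\<^sub>R V (x + s *\<^sub>R z))) \<partial>(lborel \<Otimes>\<^sub>M lborel)) < \<infinity>" .
qed

text \<open>
  An increment of \<open>u\<close> is almost everywhere the average over the segment from \<open>x\<close> to \<open>x + z\<close> of the
  derivative \<open>V\<close> in direction \<open>z\<close>, and averaging does not increase the mass. The identity is verified
  against test functions, where Fubini's theorem and the fundamental theorem of calculus apply, and
  follows from \<open>fundamental_lemma\<close>.
\<close>

lemma weak_gradient_difference:
  fixes u :: "real^'n::finite \<Rightarrow> complex" and z :: "real^'n"
  assumes u: "u \<in> L2" and U: "U \<in> L2" and g: "has_weak_gradient u U"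
  defines "V \<equiv> \<lambda>x. \<Sum>i\<in>UNIV. z $ i *\<^sub>R U x $ i"
  shows "V \<in> L2" and "mass (\<lambda>x. u (x + z) - u x) \<le> mass V"
proof -
  have [measurable]: "u \<in> borel_measurable borel" "U \<in> borel_measurable borel" using u U by auto
  have [measurable]: "(\<lambda>x. U x $ i) \<in> borel_measurable borel" for i by (rule borel_measurable_vec_nth_comp) simp
  have [measurable]: "V \<in> borel_measurable borel" unfolding V_def by measurable
  show V: "V \<in> L2"
  proof (rule L2_mono(1))
    show "(\<lambda>x. norm z *\<^sub>R U x) \<in> L2" by (rule L2_scaleR(1)[OF U])
    show "norm (V x) \<le> norm (norm z *\<^sub>R U x)" for x using directional_bound[of z "U x"] by (simp add: V_def)
  qed simp
  define W where "W x = (LINT s|lborel. indicator {0..1::real} s *\<^sub>R V (x + s *\<^sub>R z))" for x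
  have W: "W \<in> L2" "mass W \<le> mass V" unfolding W_def using segment_average[OF V, of z] by auto
  have d: "(\<lambda>x. u (x + z) - u x) \<in> L2" by (intro L2_diff L2_translate u)
  have "AE x in lborel. (u (x + z) - u x) - W x = 0"
  proof (rule fundamental_lemma[OF L2_locally_integrable[OF L2_diff(1)[OF d W(1)]]])
    fix \<phi> :: "real^'n \<Rightarrow> real" assume tf: "test_function \<phi>"
    define D where "D x = (\<Sum>i\<in>UNIV. z $ i * partial_deriv i \<phi> x)" for x
    have \<phi>: "\<phi> \<in> L2" by (rule test_function_L2[OF tf])
    have [measurable]: "\<phi> \<in> borel_measurable borel" using \<phi> by auto
    have Dc: "continuous_on UNIV D"
      unfolding D_def by (intro continuous_intros test_function_partial_continuous[OF tf])
    then have [measurable]: "D \<in> borel_measurable borel" by (rule borel_measurable_continuous_onI)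
    obtain R where R: "0 < R" "\<And>x. norm x > R \<Longrightarrow> \<phi> x = 0" using test_function_bounded_support[OF tf] by blast
    have D0: "D x = 0" if "norm x > R" for x
      unfolding D_def using partial_deriv_outside[OF R(2) that] by simp
    have DL2: "D \<in> L2"
    proof -
      obtain B where B: "0 < B" "\<And>x. \<bar>D x\<bar> \<le> B * indicator (cball 0 R) x"
        using continuous_bounded_support_bounded[OF Dc D0] by blast
      show ?thesis
      proof (rule L2_bound(1))
        show "integrable lborel (\<lambda>x::real^'n. B\<^sup>2 * indicator (cball 0 R) x)"
          by (intro integrable_mult_right integrable_real_indicator) (use emeasure_bounded_finite[of "cball 0 R :: (real^'n) set"] in auto)
        show "(norm (D x))\<^sup>2 \<le> B\<^sup>2 * indicator (cball 0 R) x" for x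
          using power_mono[OF B(2)[of x], of 2] by (auto simp: indicator_def split: if_splits)
      qed simp
    qed
    have by_parts: "(LINT x|lborel. \<phi> x *\<^sub>R V (x + s *\<^sub>R z)) = - (LINT x|lborel. D x *\<^sub>R u (x + s *\<^sub>R z))" for s
    proof -
      define \<psi> where "\<psi> x = \<phi> (x + (- s *\<^sub>R z))" for x
      have \<psi>: "test_function \<psi>" unfolding \<psi>_def by (rule test_function_translate[OF tf])
      have \<psi>L: "\<psi> \<in> L2" by (rule test_function_L2[OF \<psi>])
      have pd: "partial_deriv i \<psi> x = partial_deriv i \<phi> (x + (- s *\<^sub>R z))" for i x
        unfolding \<psi>_def using partial_deriv_translate[of \<phi> i "- s *\<^sub>R z"] test_function_differentiable[OF tf]
        by (simp add: differentiable_on_def)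
      have pdL: "partial_deriv i \<psi> \<in> L2" for i
      proof -
        obtain B R where B: "0 < B" "\<And>x. \<bar>partial_deriv i \<psi> x\<bar> \<le> B * indicator (cball 0 R) x"
          using test_function_bound[OF \<psi>] by metis
        show ?thesis
        proof (rule L2_bound(1))
          show "partial_deriv i \<psi> \<in> borel_measurable borel"
            using test_function_partial_continuous[OF \<psi>] by (rule borel_measurable_continuous_onI)
          show "integrable lborel (\<lambda>x::real^'n. B\<^sup>2 * indicator (cball 0 R) x)"
            by (intro integrable_mult_right integrable_real_indicator) (use emeasure_bounded_finite[of "cball 0 R :: (real^'n) set"] in auto)
          show "(norm (partial_deriv i \<psi> x))\<^sup>2 \<le> B\<^sup>2 * indicator (cball 0 R) x" for x
            using power_mono[OF B(2)[of x], of 2] by (auto simp: indicator_def split: if_splits)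
        qed
      qed
      have "(LINT x|lborel. \<phi> x *\<^sub>R V (x + s *\<^sub>R z)) = (LINT x|lborel. \<psi> x *\<^sub>R V x)"
        using integral_translate_swap[of \<phi> V "s *\<^sub>R z"] by (simp add: \<psi>_def)
      also have "\<dots> = (\<Sum>i\<in>UNIV. z $ i *\<^sub>R (LINT x|lborel. \<psi> x *\<^sub>R U x $ i))"
      proof -
        have "(\<lambda>x. \<psi> x *\<^sub>R V x) = (\<lambda>x. \<Sum>i\<in>UNIV. z $ i *\<^sub>R (\<psi> x *\<^sub>R U x $ i))"
          by (simp add: V_def scaleR_sum_right mult.commute)
        moreover have "integrable lborel (\<lambda>x. \<psi> x *\<^sub>R U x $ i)" for i
          by (rule L2_pairing(1)[OF \<psi>L L2_nth[OF U]])
        ultimately show ?thesis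
          by (simp only: Bochner_Integration.integral_sum integrable_scaleR_right integral_scaleR_right)
      qed
      also have "\<dots> = (\<Sum>i\<in>UNIV. z $ i *\<^sub>R (- (LINT x|lborel. partial_deriv i \<psi> x *\<^sub>R u x)))"
        using g \<psi> by (simp add: has_weak_gradient_def)
      also have "\<dots> = - (LINT x|lborel. (\<Sum>i\<in>UNIV. z $ i * partial_deriv i \<psi> x) *\<^sub>R u x)"
      proof -
        have "(\<lambda>x. (\<Sum>i\<in>UNIV. z $ i * partial_deriv i \<psi> x) *\<^sub>R u x)
            = (\<lambda>x. \<Sum>i\<in>UNIV. z $ i *\<^sub>R (partial_deriv i \<psi> x *\<^sub>R u x))"
          by (simp add: scaleR_sum_left)
        moreover have "integrable lborel (\<lambda>x. partial_deriv i \<psi> x *\<^sub>R u x)" for i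
          by (rule L2_pairing(1)[OF pdL u])
        ultimately have "(LINT x|lborel. (\<Sum>i\<in>UNIV. z $ i * partial_deriv i \<psi> x) *\<^sub>R u x)
            = (\<Sum>i\<in>UNIV. z $ i *\<^sub>R (LINT x|lborel. partial_deriv i \<psi> x *\<^sub>R u x))"
          by (simp only: Bochner_Integration.integral_sum integrable_scaleR_right integral_scaleR_right)
        then show ?thesis by (simp only: scaleR_minus_right sum_negf)
      qed
      also have "\<dots> = - (LINT x|lborel. D (x - s *\<^sub>R z) *\<^sub>R u x)" by (simp add: D_def pd)
      also have "\<dots> = - (LINT x|lborel. D x *\<^sub>R u (x + s *\<^sub>R z))"
        using integral_translate_swap[of D u "s *\<^sub>R z"] by simp
      finally show ?thesis .
    qed
    have FTC: "(LINT s|lborel. indicator {0..1::real} s * D (x - s *\<^sub>R z)) = \<phi> x - \<phi> (x - z)" for x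
    proof -
      have "((\<lambda>s. - \<phi> (x + s *\<^sub>R (- z))) has_real_derivative D (x - s *\<^sub>R z)) (at s)" for s
        using DERIV_minus[OF test_function_line_deriv[OF tf, of x "- z" s]] by (simp add: D_def sum_negf)
      moreover have "isCont (\<lambda>s. D (x - s *\<^sub>R z)) s" for s
      proof (rule isCont_o2[where g=D])
        show "isCont D (x - s *\<^sub>R z)" using Dc by (simp add: continuous_on_eq_continuous_at)
      qed (intro continuous_intros)
      ultimately have "(LINT s|lborel. D (x - s *\<^sub>R z) * indicator {0..1::real} s) = - \<phi> (x + 1 *\<^sub>R (- z)) - - \<phi> (x + 0 *\<^sub>R (- z))"
        by (intro integral_FTC_Icc_real) auto
      then show ?thesis by (simp add: mult.commute)
    qed
    have "(LINT x|lborel. \<phi> x *\<^sub>R W x) = (LINT x|lborel. LINT s|lborel. (indicator {0..1::real} s * \<phi> x) *\<^sub>R V (x + s *\<^sub>R z))"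
    proof -
      have "(\<lambda>s. (indicator {0..1::real} s * \<phi> x) *\<^sub>R V (x + s *\<^sub>R z)) = (\<lambda>s. \<phi> x *\<^sub>R (indicator {0..1::real} s *\<^sub>R V (x + s *\<^sub>R z)))" for x
        by (simp add: mult.commute)
      then show ?thesis unfolding W_def by (simp only: integral_scaleR_right)
    qed
    also have "\<dots> = (LINT s|lborel. LINT x|lborel. (indicator {0..1::real} s * \<phi> x) *\<^sub>R V (x + s *\<^sub>R z))"
      by (rule lborel_pair.Fubini_integral[symmetric, OF pair_integrable_translate[OF \<phi> V]])
    also have "\<dots> = (LINT s|lborel. - (LINT x|lborel. (indicator {0..1::real} s * D x) *\<^sub>R u (x + s *\<^sub>R z)))"
      by (simp only: scaleR_scaleR[symmetric] integral_scaleR_right by_parts scaleR_minus_right)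
    also have "\<dots> = - (LINT s|lborel. LINT x|lborel. (indicator {0..1::real} s * D x) *\<^sub>R u (x + s *\<^sub>R z))"
      by simp
    also have "(LINT s|lborel. LINT x|lborel. (indicator {0..1::real} s * D x) *\<^sub>R u (x + s *\<^sub>R z))
       = (LINT s|lborel. LINT x|lborel. (indicator {0..1::real} s * D (x - s *\<^sub>R z)) *\<^sub>R u x)"
    proof (rule Bochner_Integration.integral_cong)
      fix s
      show "(LINT x|lborel. (indicator {0..1::real} s * D x) *\<^sub>R u (x + s *\<^sub>R z))
         = (LINT x|lborel. (indicator {0..1::real} s * D (x - s *\<^sub>R z)) *\<^sub>R u x)"
        using integral_translate_swap[of "\<lambda>x. indicator {0..1::real} s * D x" u "s *\<^sub>R z"] by simp
    qed simp
    also have "\<dots> = (LINT x|lborel. LINT s|lborel. (indicator {0..1::real} s * D (x - s *\<^sub>R z)) *\<^sub>R u x)"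
    proof (rule lborel_pair.Fubini_integral)
      have "integrable (lborel \<Otimes>\<^sub>M lborel) (\<lambda>(x, s). (indicator {0..1::real} s * (norm (u x))) *\<^sub>R D (x + s *\<^sub>R (- z)))"
        by (rule pair_integrable_translate[OF _ DL2]) (rule L2_mono(1)[OF _ u], simp_all)
      then show "integrable (lborel \<Otimes>\<^sub>M lborel) (\<lambda>(x, s). (indicator {0..1::real} s * D (x - s *\<^sub>R z)) *\<^sub>R u x)"
        by (rule Bochner_Integration.integrable_bound) (measurable, auto simp: abs_mult mult_ac)
    qed
    also have "\<dots> = (LINT x|lborel. (\<phi> x - \<phi> (x - z)) *\<^sub>R u x)"
    proof (rule Bochner_Integration.integral_cong)
      fix x
      have "integrable lborel (\<lambda>s. indicator {0..1::real} s * D (x - s *\<^sub>R z))"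
      proof -
        have "continuous_on {0..1} (\<lambda>s. D (x - s *\<^sub>R z))"
          by (intro continuous_on_compose2[OF Dc] continuous_intros) auto
        from borel_integrable_atLeastAtMost'[OF this] show ?thesis by (simp add: set_integrable_def)
      qed
      then show "(LINT s|lborel. (indicator {0..1::real} s * D (x - s *\<^sub>R z)) *\<^sub>R u x) = (\<phi> x - \<phi> (x - z)) *\<^sub>R u x"
        by (simp add: integral_scaleR_left FTC)
    qed simp
    finally have 1: "(LINT x|lborel. \<phi> x *\<^sub>R W x) = - (LINT x|lborel. (\<phi> x - \<phi> (x - z)) *\<^sub>R u x)" .
    have i1: "integrable lborel (\<lambda>x. \<phi> x *\<^sub>R u x)" "integrable lborel (\<lambda>x. \<phi> x *\<^sub>R u (x + z))"
      by (intro L2_pairing \<phi> u L2_translate)+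
    have i2: "integrable lborel (\<lambda>x. \<phi> (x - z) *\<^sub>R u x)"
      using L2_pairing(1)[OF L2_translate(1)[OF \<phi>, of "- z"] u] by simp
    have "(LINT x|lborel. \<phi> x *\<^sub>R (u (x + z) - u x)) = (LINT x|lborel. \<phi> (x - z) *\<^sub>R u x) - (LINT x|lborel. \<phi> x *\<^sub>R u x)"
      using i1 integral_translate_swap[of \<phi> u z] by (simp add: scaleR_diff_right)
    also have "\<dots> = - (LINT x|lborel. (\<phi> x - \<phi> (x - z)) *\<^sub>R u x)"
      using i1 i2 by (simp add: scaleR_diff_left)
    finally have 2: "(LINT x|lborel. \<phi> x *\<^sub>R (u (x + z) - u x)) = (LINT x|lborel. \<phi> x *\<^sub>R W x)" using 1 by simp
    have "(LINT x|lborel. \<phi> x *\<^sub>R (u (x + z) - u x - W x)) = (LINT x|lborel. \<phi> x *\<^sub>R (u (x + z) - u x)) - (LINT x|lborel. \<phi> x *\<^sub>R W x)"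
      unfolding scaleR_diff_right[of _ _ "W _"]
      by (rule Bochner_Integration.integral_diff) (intro L2_pairing \<phi> d W)+
    then show "(LINT x|lborel. \<phi> x *\<^sub>R (u (x + z) - u x - W x)) = 0" using 2 by simp
  qed
  then have "AE x in lborel. u (x + z) - u x = W x" by simp
  then have "mass (\<lambda>x. u (x + z) - u x) = mass W"
    using d W(1) by (intro mass_cong_AE) auto
  then show "mass (\<lambda>x. u (x + z) - u x) \<le> mass V" using W(2) by simp
qed

lemma H1_L2: "u \<in> H1 \<Longrightarrow> u \<in> L2"
  by (simp add: H1_def)

lemma H1_weak_gradient:
  assumes "u \<in> H1" shows "weak_gradient u \<in> L2" "has_weak_gradient u (weak_gradient u)"
proof -
  obtain U where U: "U \<in> L2" "has_weak_gradient u U" using assms by (auto simp: H1_def)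
  show h: "has_weak_gradient u (weak_gradient u)" unfolding weak_gradient_def by (rule someI[of _ U]) fact
  have m: "weak_gradient u \<in> borel_measurable borel"
    using h locally_integrable_measurable by (auto simp: has_weak_gradient_def)
  have ae: "AE x in lborel. U x = weak_gradient u x" by (rule weak_gradient_unique[OF U(2) h])
  have "integrable lborel (\<lambda>x. (norm (weak_gradient u x))\<^sup>2)"
    using L2_integrable[OF U(1)]
    by (rule integrable_cong_AE_imp) (use m ae in auto)
  then show "weak_gradient u \<in> L2" using m by (auto intro: L2_I)
qed

text \<open>
  Together with \<open>H1_dq_le\<close> and \<open>H1_dq_tendsto\<close>, this describes \<open>H1\<close> and the kinetic energy by difference
  quotients alone; the stability of \<open>H1\<close>
  under the operations below rests on this description.
\<close>

lemma H1_I: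
  assumes u: "u \<in> L2" and C: "\<And>j. mass (dq j u) \<le> C"
  shows "u \<in> H1" and "kin u \<le> C"
proof -
  obtain U where U: "U \<in> L2" "has_weak_gradient u U" "mass U \<le> C" using weak_gradient_exists[OF u C] by blast
  show H: "u \<in> H1" using u U by (auto simp: H1_def)
  have "mass (weak_gradient u) = mass U"
    using H1_weak_gradient[OF H] U weak_gradient_unique[OF H1_weak_gradient(2)[OF H] U(2)]
    by (intro mass_cong_AE) auto
  then show "kin u \<le> C" using U by (simp add: kin_def)
qed

lemma H1_dq_le:
  assumes "u \<in> H1" shows "mass (dq j u) \<le> kin u"
proof -
  note g = H1_weak_gradient[OF assms] and u = H1_L2[OF assms]
  have "mass (\<lambda>x. u (x + axis i (1/2^j)) - u x) \<le> (1/2^j)\<^sup>2 * mass (\<lambda>x. weak_gradient u x $ i)" for i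
  proof -
    have "(\<Sum>k\<in>UNIV. axis i (1/2^j) $ k *\<^sub>R weak_gradient u x $ k) = (1/2^j) *\<^sub>R weak_gradient u x $ i" for x
      by (simp add: axis_def if_distrib[of "\<lambda>c. c *\<^sub>R _"] cong: if_cong)
    then show ?thesis
      using weak_gradient_difference(2)[OF u g, of "axis i (1/2^j)"] L2_scaleR(2)[OF L2_nth[OF g(1), of i], of "1/2^j"]
      by simp
  qed
  then have "mass (dq j u) \<le> 4^j * (\<Sum>i\<in>UNIV. (1/2^j)\<^sup>2 * mass (\<lambda>x. weak_gradient u x $ i))"
    unfolding dq_L2(2)[OF u] by (intro mult_left_mono sum_mono) auto
  also have "\<dots> = kin u"
    unfolding kin_def mass_nth[OF g(1)] by (simp add: sum_distrib_left power_divide power2_eq_square power_mult_distrib[symmetric])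
  finally show ?thesis .
qed

lemma H1_translate_diff:
  assumes "u \<in> H1" shows "mass (\<lambda>x. u (x + z) - u x) \<le> (norm z)\<^sup>2 * kin u"
proof -
  note g = H1_weak_gradient[OF assms] and u = H1_L2[OF assms]
  note V = weak_gradient_difference[OF u g, of z]
  have "mass (\<lambda>x. \<Sum>i\<in>UNIV. z $ i *\<^sub>R weak_gradient u x $ i) \<le> mass (\<lambda>x. norm z *\<^sub>R weak_gradient u x)"
  proof (rule L2_mono(2))
    show "norm (\<Sum>i\<in>UNIV. z $ i *\<^sub>R weak_gradient u x $ i) \<le> norm (norm z *\<^sub>R weak_gradient u x)" for x
      using directional_bound[of z "weak_gradient u x"] by simp
  qed (use V(1) L2_scaleR(1)[OF g(1)] in auto)
  then show ?thesis using V(2) L2_scaleR(2)[OF g(1), of "norm z"] by (simp add: kin_def)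
qed

lemma H1_dq_tendsto:
  assumes "u \<in> H1" shows "(\<lambda>j. mass (dq j u)) \<longlonglongrightarrow> kin u"
proof -
  note u = H1_L2[OF assms]
  have inc: "incseq (\<lambda>j. mass (dq j u))" using dq_mono[OF u] by (auto simp: incseq_def)
  then obtain K where K: "(\<lambda>j. mass (dq j u)) \<longlonglongrightarrow> K" "\<And>j. mass (dq j u) \<le> K"
    using incseq_convergent[of "\<lambda>j. mass (dq j u)" "kin u"] H1_dq_le[OF assms] by blast
  have "kin u \<le> K" by (rule H1_I(2)[OF u K(2)])
  moreover have "K \<le> kin u" by (rule LIMSEQ_le_const2[OF K(1)]) (use H1_dq_le[OF assms] in blast)
  ultimately show ?thesis using K by simp
qed

lemma kin_nonneg [simp]: "0 \<le> kin u"
  by (simp add: kin_def)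

section \<open>Operations that control the kinetic energy\<close>

lemma norm_axis_real [simp]: "norm (axis i t :: real^'n::finite) = \<bar>t\<bar>"
proof -
  have "axis i t = t *\<^sub>R (axis i 1 :: real^'n)" by (simp add: axis_def vec_eq_iff)
  then show ?thesis by simp
qed

lemma dq_norm_sq: "(norm (dq j u x))\<^sup>2 = 4^j * (\<Sum>i\<in>UNIV. (norm (u (x + axis i (1/2^j)) - u x))\<^sup>2)"
proof -
  have "((2::real)^j)\<^sup>2 = 4^j" by (simp add: power2_eq_square power_mult_distrib[symmetric])
  then show ?thesis by (simp add: norm_vec_sq dq_def power_mult_distrib sum_distrib_left)
qed

text \<open>
  An inequality between increments, valid for all pairs of points, passes to the difference quotients,
  and from there to \<open>H1\<close> and to the kinetic energies.
\<close>

lemma dq_le_add: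
  assumes L2: "w \<in> L2" "u \<in> L2" "v \<in> L2"
    and le: "\<And>x y. (norm (w x - w y))\<^sup>2 \<le> (norm (u x - u y))\<^sup>2 + (norm (v x - v y))\<^sup>2"
  shows "mass (dq j w) \<le> mass (dq j u) + mass (dq j v)"
proof -
  note i = L2_integrable[OF dq_L2(1)[OF L2(1), of j]] L2_integrable[OF dq_L2(1)[OF L2(2), of j]]
    L2_integrable[OF dq_L2(1)[OF L2(3), of j]]
  have "mass (dq j w) \<le> (LINT x|lborel. (norm (dq j u x))\<^sup>2 + (norm (dq j v x))\<^sup>2)"
    unfolding mass_def
  proof (rule integral_mono)
    fix x show "(norm (dq j w x))\<^sup>2 \<le> (norm (dq j u x))\<^sup>2 + (norm (dq j v x))\<^sup>2"
      unfolding dq_norm_sq distrib_left[symmetric] sum.distrib[symmetric] by (intro mult_left_mono sum_mono le) simp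
  qed (use i in auto)
  also have "\<dots> = mass (dq j u) + mass (dq j v)" unfolding mass_def using i by simp
  finally show ?thesis .
qed

lemma H1_of_add_bound:
  assumes w: "w \<in> L2" and u: "u \<in> H1" and v: "v \<in> H1"
    and le: "\<And>x y. (norm (w x - w y))\<^sup>2 \<le> (norm (u x - u y))\<^sup>2 + (norm (v x - v y))\<^sup>2"
  shows "w \<in> H1" and "kin w \<le> kin u + kin v"
proof -
  have "mass (dq j w) \<le> kin u + kin v" for j
    using dq_le_add[OF w u[THEN H1_L2] v[THEN H1_L2] le, of j] H1_dq_le[OF u, of j] H1_dq_le[OF v, of j] by linarith
  then show "w \<in> H1" "kin w \<le> kin u + kin v" using H1_I[OF w] by auto
qed

lemma H1_of_eq:
  assumes w: "w \<in> L2" and u: "u \<in> H1" and eq: "\<And>j. mass (dq j w) = c * mass (dq j u)" and c: "0 \<le> c"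
  shows "w \<in> H1" and "kin w = c * kin u"
proof -
  have "mass (dq j w) \<le> c * kin u" for j unfolding eq using H1_dq_le[OF u] c by (rule mult_left_mono)
  then show w: "w \<in> H1" using H1_I[OF w] by blast
  have "(\<lambda>j. c * mass (dq j u)) \<longlonglongrightarrow> c * kin u" by (intro tendsto_intros H1_dq_tendsto u)
  then show "kin w = c * kin u" using H1_dq_tendsto[OF w] LIMSEQ_unique unfolding eq by blast
qed

lemma H1_translate:
  assumes "u \<in> H1"
  shows "(\<lambda>x. u (x + y)) \<in> H1" and "kin (\<lambda>x. u (x + y)) = kin u"
proof -
  have "dq j (\<lambda>x. u (x + y)) = (\<lambda>x. dq j u (x + y))" for j
    by (simp add: dq_def fun_eq_iff add_ac)
  then have "mass (dq j (\<lambda>x. u (x + y))) = 1 * mass (dq j u)" for j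
    using L2_translate(2)[OF dq_L2(1)[OF H1_L2[OF assms]]] by simp
  from H1_of_eq[OF L2_translate(1)[OF H1_L2[OF assms]] assms this]
  show "(\<lambda>x. u (x + y)) \<in> H1" "kin (\<lambda>x. u (x + y)) = kin u" by simp_all
qed

lemma H1_scaleR:
  assumes "u \<in> H1"
  shows "(\<lambda>x. c *\<^sub>R u x) \<in> H1" and "kin (\<lambda>x. c *\<^sub>R u x) = c\<^sup>2 * kin u"
proof -
  have "dq j (\<lambda>x. c *\<^sub>R u x) = (\<lambda>x. c *\<^sub>R dq j u x)" for j
    by (simp add: dq_def fun_eq_iff vec_eq_iff algebra_simps)
  then have "mass (dq j (\<lambda>x. c *\<^sub>R u x)) = c\<^sup>2 * mass (dq j u)" for j
    using L2_scaleR(2)[OF dq_L2(1)[OF H1_L2[OF assms]]] by simp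
  from H1_of_eq[OF L2_scaleR(1)[OF H1_L2[OF assms]] assms this]
  show "(\<lambda>x. c *\<^sub>R u x) \<in> H1" "kin (\<lambda>x. c *\<^sub>R u x) = c\<^sup>2 * kin u" by simp_all
qed

lemma dq_add: "dq j (\<lambda>x. u x + v x) = (\<lambda>x. dq j u x + dq j v x)"
  by (simp add: dq_def fun_eq_iff vec_eq_iff algebra_simps)

lemma dq_diff: "dq j (\<lambda>x. u x - v x) = (\<lambda>x. dq j u x - dq j v x)"
  by (simp add: dq_def fun_eq_iff vec_eq_iff algebra_simps)

lemma H1_add_diff:
  assumes u: "u \<in> H1" and v: "v \<in> H1"
  shows "(\<lambda>x. u x + v x) \<in> H1" and "(\<lambda>x. u x - v x) \<in> H1"
    and "kin (\<lambda>x. u x + v x) + kin (\<lambda>x. u x - v x) = 2 * kin u + 2 * kin v"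
proof -
  note L = u[THEN H1_L2] v[THEN H1_L2]
  have b: "mass (dq j u) \<le> kin u" "mass (dq j v) \<le> kin v" for j using H1_dq_le u v by auto
  have p: "mass (dq j (\<lambda>x. u x + v x)) + mass (dq j (\<lambda>x. u x - v x)) = 2 * mass (dq j u) + 2 * mass (dq j v)" for j
    unfolding dq_add dq_diff by (intro mass_parallelogram dq_L2 L)
  have b1: "mass (dq j (\<lambda>x. u x + v x)) \<le> 2 * kin u + 2 * kin v" for j
    using p[of j] b[of j] mass_nonneg[of "dq j (\<lambda>x. u x - v x)"] by linarith
  have b2: "mass (dq j (\<lambda>x. u x - v x)) \<le> 2 * kin u + 2 * kin v" for j
    using p[of j] b[of j] mass_nonneg[of "dq j (\<lambda>x. u x + v x)"] by linarith
  show a: "(\<lambda>x. u x + v x) \<in> H1" by (rule H1_I(1)[OF L2_add(1)[OF L] b1])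
  show d: "(\<lambda>x. u x - v x) \<in> H1" by (rule H1_I(1)[OF L2_diff(1)[OF L] b2])
  have "(\<lambda>j. mass (dq j (\<lambda>x. u x + v x)) + mass (dq j (\<lambda>x. u x - v x))) \<longlonglongrightarrow> kin (\<lambda>x. u x + v x) + kin (\<lambda>x. u x - v x)"
    by (intro tendsto_add H1_dq_tendsto a d)
  moreover have "(\<lambda>j. 2 * mass (dq j u) + 2 * mass (dq j v)) \<longlonglongrightarrow> 2 * kin u + 2 * kin v"
    by (intro tendsto_intros H1_dq_tendsto u v)
  ultimately show "kin (\<lambda>x. u x + v x) + kin (\<lambda>x. u x - v x) = 2 * kin u + 2 * kin v"
    unfolding p using LIMSEQ_unique by blast
qed

lemma null_H1:
  assumes "u \<in> L2" "mass u = 0" shows "u \<in> H1" and "kin u = 0"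
proof -
  have "mass (dq j u) \<le> 0" for j
  proof -
    have "mass (\<lambda>x. u (x + axis i (1/2^j)) - u x) \<le> 0" for i
      using L2_diff(2)[OF L2_translate(1)[OF assms(1), of "axis i (1/2^j)"] assms(1)]
        L2_translate(2)[OF assms(1), of "axis i (1/2^j)"] assms(2) by simp
    then have "mass (\<lambda>x. u (x + axis i (1/2^j)) - u x) = 0" for i using mass_nonneg order_antisym by blast
    then show ?thesis unfolding dq_L2(2)[OF assms(1)] by simp
  qed
  from H1_I[OF assms(1) this] show "u \<in> H1" "kin u = 0" using kin_nonneg[of u] by (auto intro: antisym)
qed

text \<open>
  The pointwise Euclidean norm of the pair: densities, hence masses, add up, while its oscillation is at
  most that of the pair.
\<close>

definition superpose :: "(real^'n::finite \<Rightarrow> complex) \<Rightarrow> (real^'n \<Rightarrow> complex) \<Rightarrow> real^'n \<Rightarrow> complex" where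
  "superpose u v x = complex_of_real (sqrt ((norm (u x))\<^sup>2 + (norm (v x))\<^sup>2))"

lemma superpose_norm [simp]: "(norm (superpose u v x))\<^sup>2 = (norm (u x))\<^sup>2 + (norm (v x))\<^sup>2"
  by (simp add: superpose_def)

lemma superpose_L2:
  assumes "u \<in> L2" "v \<in> L2"
  shows "superpose u v \<in> L2" and "mass (superpose u v) = mass u + mass v"
proof -
  have [measurable]: "u \<in> borel_measurable borel" "v \<in> borel_measurable borel" using assms by auto
  have m: "superpose u v \<in> borel_measurable borel" unfolding superpose_def[abs_def] by measurable
  show "superpose u v \<in> L2" by (rule L2_I[OF m]) (use assms[THEN L2_integrable] in simp)
  show "mass (superpose u v) = mass u + mass v" unfolding mass_def using assms[THEN L2_integrable] by simp
qed

text \<open>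
  The increment of a Euclidean norm is at most the norm of the increment, here in the product of two copies of the complex plane.
\<close>

lemma superpose_H1:
  assumes "u \<in> H1" "v \<in> H1"
  shows "superpose u v \<in> H1" and "kin (superpose u v) \<le> kin u + kin v"
proof -
  have "(norm (superpose u v x - superpose u v y))\<^sup>2 \<le> (norm (u x - u y))\<^sup>2 + (norm (v x - v y))\<^sup>2" for x y
  proof -
    have "norm (superpose u v x - superpose u v y) = \<bar>norm (u x, v x) - norm (u y, v y)\<bar>"
      unfolding superpose_def of_real_diff[symmetric] norm_of_real by (simp add: norm_prod_def)
    also have "\<dots> \<le> norm ((u x, v x) - (u y, v y))" by (rule norm_triangle_ineq3)
    finally have "(norm (superpose u v x - superpose u v y))\<^sup>2 \<le> (norm ((u x, v x) - (u y, v y)))\<^sup>2"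
      by (intro power_mono) auto
    then show ?thesis by (simp add: norm_prod_def)
  qed
  from H1_of_add_bound[OF superpose_L2(1)[OF assms[THEN H1_L2]] assms this]
  show "superpose u v \<in> H1" "kin (superpose u v) \<le> kin u + kin v" by auto
qed

text \<open>
  The squared error of the discrete product rule. For \<open>cos\<close> and \<open>sin\<close> of the same angle the mixed
  terms combine to \<open>2 (1 - cos (s - t)) (a \<bullet> b)\<close>, which is quadratic in \<open>s - t\<close>: there is no first
  order term pairing \<open>u\<close> with its gradient, and the two parts of a cutoff have together almost the kinetic
  energy of the whole.
\<close>

lemma rotation_increment:
  fixes a b :: complex and s t :: real
  shows "(norm (cos s *\<^sub>R a - cos t *\<^sub>R b))\<^sup>2 + (norm (sin s *\<^sub>R a - sin t *\<^sub>R b))\<^sup>2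
    \<le> (norm (a - b))\<^sup>2 + (s - t)\<^sup>2 * ((norm a)\<^sup>2 + (norm b)\<^sup>2) / 2"
proof -
  have cs: "cos s * cos s + sin s * sin s = 1" "cos t * cos t + sin t * sin t = 1"
    using sin_cos_squared_add3[of s] sin_cos_squared_add3[of t] by auto
  have "(norm (cos s *\<^sub>R a - cos t *\<^sub>R b))\<^sup>2 + (norm (sin s *\<^sub>R a - sin t *\<^sub>R b))\<^sup>2
      = (cos s * cos s + sin s * sin s) * (a \<bullet> a) + (cos t * cos t + sin t * sin t) * (b \<bullet> b) - 2 * (cos s * cos t + sin s * sin t) * (a \<bullet> b)"
    by (simp only: power2_norm_eq_inner inner_diff_left inner_diff_right inner_scaleR_left inner_scaleR_right inner_commute[of b a])
       (simp add: algebra_simps del: sin_cos_squared_add3)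
  also have "\<dots> = a \<bullet> a + b \<bullet> b - 2 * cos (s - t) * (a \<bullet> b)" by (simp only: cs cos_diff mult_1)
  also have "\<dots> = (norm (a - b))\<^sup>2 + 2 * (1 - cos (s - t)) * (a \<bullet> b)"
    by (simp only: power2_norm_eq_inner inner_diff_left inner_diff_right inner_commute[of b a]) (simp add: algebra_simps)
  also have "2 * (1 - cos (s - t)) * (a \<bullet> b) \<le> (s - t)\<^sup>2 * ((norm a)\<^sup>2 + (norm b)\<^sup>2) / 2"
  proof -
    have c: "2 * (1 - cos (s - t)) = 4 * (sin ((s - t) / 2))\<^sup>2"
    proof -
      have e: "2 * ((s - t) / 2) = s - t" by simp
      show ?thesis using cos_double_sin[of "(s - t)/2", unfolded e] by (simp add: right_diff_distrib)
    qed
    have "\<bar>sin ((s - t) / 2)\<bar> \<le> \<bar>(s - t) / 2\<bar>" by (rule abs_sin_x_le_abs_x)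
    then have "(sin ((s - t) / 2))\<^sup>2 \<le> ((s - t) / 2)\<^sup>2" by (rule abs_le_square_iff[THEN iffD1])
    then have d: "2 * (1 - cos (s - t)) \<le> (s - t)\<^sup>2" "0 \<le> 2 * (1 - cos (s - t))"
      unfolding c by (simp_all add: power_divide)
    have "a \<bullet> b \<le> ((norm a)\<^sup>2 + (norm b)\<^sup>2) / 2"
      using norm_cauchy_schwarz[of a b] sum_squares_bound[of "norm a" "norm b"] unfolding mult.assoc by argo
    then have "2 * (1 - cos (s - t)) * (a \<bullet> b) \<le> 2 * (1 - cos (s - t)) * (((norm a)\<^sup>2 + (norm b)\<^sup>2) / 2)"
      using d(2) by (rule mult_left_mono)
    also have "\<dots> \<le> (s - t)\<^sup>2 * (((norm a)\<^sup>2 + (norm b)\<^sup>2) / 2)"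
      using d(1) by (rule mult_right_mono) simp
    finally show ?thesis by simp
  qed
  finally show ?thesis by simp
qed

lemma cutoff_L2:
  fixes u :: "real^'n::finite \<Rightarrow> complex"
  assumes u: "u \<in> L2" and [measurable]: "\<theta> \<in> borel_measurable borel"
  shows "(\<lambda>x. cos (\<theta> x) *\<^sub>R u x) \<in> L2" and "(\<lambda>x. sin (\<theta> x) *\<^sub>R u x) \<in> L2"
    and "mass (\<lambda>x. cos (\<theta> x) *\<^sub>R u x) + mass (\<lambda>x. sin (\<theta> x) *\<^sub>R u x) = mass u"
proof -
  have [measurable]: "u \<in> borel_measurable borel" using u by auto
  have c: "norm (cos (\<theta> x) *\<^sub>R u x) \<le> norm (u x)" for x
    using mult_right_mono[OF abs_cos_le_one[of "\<theta> x"] norm_ge_zero[of "u x"]] by simp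
  have s: "norm (sin (\<theta> x) *\<^sub>R u x) \<le> norm (u x)" for x
    using mult_right_mono[OF abs_sin_le_one[of "\<theta> x"] norm_ge_zero[of "u x"]] by simp
  show 1: "(\<lambda>x. cos (\<theta> x) *\<^sub>R u x) \<in> L2" by (rule L2_mono(1)[OF _ u c]) measurable
  show 2: "(\<lambda>x. sin (\<theta> x) *\<^sub>R u x) \<in> L2" by (rule L2_mono(1)[OF _ u s]) measurable
  have "mass (\<lambda>x. cos (\<theta> x) *\<^sub>R u x) + mass (\<lambda>x. sin (\<theta> x) *\<^sub>R u x)
      = (LINT x|lborel. (norm (cos (\<theta> x) *\<^sub>R u x))\<^sup>2 + (norm (sin (\<theta> x) *\<^sub>R u x))\<^sup>2)"
    unfolding mass_def using 1 2 by (simp add: L2_integrable del: norm_scaleR)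
  also have "\<dots> = mass u"
    unfolding mass_def by (rule Bochner_Integration.integral_cong) (auto simp: power_mult_distrib distrib_right[symmetric])
  finally show "mass (\<lambda>x. cos (\<theta> x) *\<^sub>R u x) + mass (\<lambda>x. sin (\<theta> x) *\<^sub>R u x) = mass u" .
qed

lemma cutoff_H1:
  fixes u :: "real^'n::finite \<Rightarrow> complex" and L :: real
  assumes u: "u \<in> H1" and lip: "\<And>x y. \<bar>\<theta> x - \<theta> y\<bar> \<le> L * norm (x - y)" and m: "\<theta> \<in> borel_measurable borel"
  shows "(\<lambda>x. cos (\<theta> x) *\<^sub>R u x) \<in> H1" and "(\<lambda>x. sin (\<theta> x) *\<^sub>R u x) \<in> H1"
    and "kin (\<lambda>x. cos (\<theta> x) *\<^sub>R u x) + kin (\<lambda>x. sin (\<theta> x) *\<^sub>R u x) \<le> kin u + CARD('n) * L\<^sup>2 * mass u"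
proof -
  let ?c = "\<lambda>x. cos (\<theta> x) *\<^sub>R u x" and ?s = "\<lambda>x. sin (\<theta> x) *\<^sub>R u x"
  note uL = H1_L2[OF u]
  note L = cutoff_L2[OF uL m]
  have le: "mass (dq j ?c) + mass (dq j ?s) \<le> kin u + CARD('n) * L\<^sup>2 * mass u" for j
  proof -
    define h :: "'n \<Rightarrow> real^'n" where "h i = axis i (1/2^j)" for i
    have nh: "norm (h i) = 1/2^j" for i by (simp add: h_def)
    have uh: "(\<lambda>x. u (x + h i)) \<in> L2" "mass (\<lambda>x. u (x + h i)) = mass u" for i
      using L2_translate[OF uL, of "h i"] by auto
    have pt: "(norm (dq j ?c x))\<^sup>2 + (norm (dq j ?s x))\<^sup>2
       \<le> (norm (dq j u x))\<^sup>2 + (\<Sum>i\<in>UNIV. L\<^sup>2 / 2 * ((norm (u (x + h i)))\<^sup>2 + (norm (u x))\<^sup>2))" for x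
    proof -
      have "(norm (?c (x + h i) - ?c x))\<^sup>2 + (norm (?s (x + h i) - ?s x))\<^sup>2
          \<le> (norm (u (x + h i) - u x))\<^sup>2 + (1/4^j) * (L\<^sup>2 / 2 * ((norm (u (x + h i)))\<^sup>2 + (norm (u x))\<^sup>2))" for i
      proof -
        have "\<bar>\<theta> (x + h i) - \<theta> x\<bar> \<le> L * (1/2^j)" using lip[of "x + h i" x] nh by simp
        from power_mono[OF this abs_ge_zero, of 2]
        have "(\<theta> (x + h i) - \<theta> x)\<^sup>2 \<le> (L * (1/2^j))\<^sup>2" by simp
        also have "\<dots> = L\<^sup>2 * (1/4^j)"
          by (simp add: power_mult_distrib power_divide power2_eq_square[of "2^j"] power_mult_distrib[symmetric])
        finally have "(\<theta> (x + h i) - \<theta> x)\<^sup>2 * ((norm (u (x + h i)))\<^sup>2 + (norm (u x))\<^sup>2) / 2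
            \<le> L\<^sup>2 * (1/4^j) * ((norm (u (x + h i)))\<^sup>2 + (norm (u x))\<^sup>2) / 2"
          by (intro divide_right_mono mult_right_mono) auto
        then show ?thesis using rotation_increment[of "\<theta> (x + h i)" "u (x + h i)" "\<theta> x" "u x"] by (simp add: mult_ac)
      qed
      then have "4^j * (\<Sum>i\<in>UNIV. (norm (?c (x + h i) - ?c x))\<^sup>2 + (norm (?s (x + h i) - ?s x))\<^sup>2)
          \<le> 4^j * (\<Sum>i\<in>UNIV. (norm (u (x + h i) - u x))\<^sup>2 + (1/4^j) * (L\<^sup>2 / 2 * ((norm (u (x + h i)))\<^sup>2 + (norm (u x))\<^sup>2)))"
        by (intro mult_left_mono sum_mono) auto
      then show ?thesis
        unfolding dq_norm_sq h_def[symmetric] sum.distrib sum_distrib_left[symmetric] by (simp add: distrib_left)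
    qed
    have "mass (dq j ?c) + mass (dq j ?s) = (LINT x|lborel. (norm (dq j ?c x))\<^sup>2 + (norm (dq j ?s x))\<^sup>2)"
      unfolding mass_def using L2_integrable[OF dq_L2(1)[OF L(1), of j]] L2_integrable[OF dq_L2(1)[OF L(2), of j]] by simp
    also have "\<dots> \<le> (LINT x|lborel. (norm (dq j u x))\<^sup>2 + (\<Sum>i\<in>UNIV. L\<^sup>2 / 2 * ((norm (u (x + h i)))\<^sup>2 + (norm (u x))\<^sup>2)))"
      by (intro integral_mono pt Bochner_Integration.integrable_add Bochner_Integration.integrable_sum integrable_mult_right
          L2_integrable[OF dq_L2(1)[OF L(1), of j]] L2_integrable[OF dq_L2(1)[OF L(2), of j]]
          L2_integrable[OF dq_L2(1)[OF uL, of j]] L2_integrable[OF uh(1)] L2_integrable[OF uL])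
    also have "\<dots> = mass (dq j u) + (\<Sum>i\<in>UNIV. L\<^sup>2 / 2 * (mass (\<lambda>x. u (x + h i)) + mass u))"
      unfolding mass_def
      using L2_integrable[OF dq_L2(1)[OF uL, of j]] L2_integrable[OF uh(1)] L2_integrable[OF uL] by simp
    also have "\<dots> = mass (dq j u) + CARD('n) * L\<^sup>2 * mass u" by (simp add: uh(2))
    finally show ?thesis using H1_dq_le[OF u, of j] by linarith
  qed
  have lec: "mass (dq j ?c) \<le> kin u + CARD('n) * L\<^sup>2 * mass u" for j using le[of j] mass_nonneg[of "dq j ?s"] by linarith
  have les: "mass (dq j ?s) \<le> kin u + CARD('n) * L\<^sup>2 * mass u" for j using le[of j] mass_nonneg[of "dq j ?c"] by linarith
  show c: "?c \<in> H1" by (rule H1_I(1)[OF L(1) lec])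
  show s: "?s \<in> H1" by (rule H1_I(1)[OF L(2) les])
  have "(\<lambda>j. mass (dq j ?c) + mass (dq j ?s)) \<longlonglongrightarrow> kin ?c + kin ?s" by (intro tendsto_add H1_dq_tendsto c s)
  then show "kin ?c + kin ?s \<le> kin u + CARD('n) * L\<^sup>2 * mass u"
    by (rule LIMSEQ_le_const2) (use le in blast)
qed

lemma AE_dq_tendsto:
  assumes lim: "AE x in lborel. (\<lambda>n. f n x) \<longlonglongrightarrow> g x"
  shows "AE x in lborel. (\<lambda>n. dq j (f n) x) \<longlonglongrightarrow> dq j g x"
proof -
  have "AE x in lborel. \<forall>i\<in>UNIV. (\<lambda>n. f n (x + axis i (1/2^j))) \<longlonglongrightarrow> g (x + axis i (1/2^j))"
    by (rule AE_finite_allI) (auto intro: AE_translate[OF lim])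
  with lim show ?thesis
  proof eventually_elim
    fix x assume "(\<lambda>n. f n x) \<longlonglongrightarrow> g x" "\<forall>i\<in>UNIV. (\<lambda>n. f n (x + axis i (1/2^j))) \<longlonglongrightarrow> g (x + axis i (1/2^j))"
    then show "(\<lambda>n. dq j (f n) x) \<longlonglongrightarrow> dq j g x"
      by (intro vec_tendstoI) (auto simp: dq_def intro!: tendsto_intros)
  qed
qed

lemma H1_Fatou:
  assumes f: "\<And>n. f n \<in> H1" and g: "g \<in> borel_measurable borel"
    and lim: "AE x in lborel. (\<lambda>n. f n x) \<longlonglongrightarrow> g x"
    and A: "\<And>n. mass (f n) \<le> A" and C: "\<And>n. kin (f n) \<le> C"
  shows "g \<in> H1" and "mass g \<le> A" and "kin g \<le> C"
proof -
  note L = mass_Fatou[OF H1_L2[OF f] g lim A]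
  have "mass (dq j g) \<le> C" for j
  proof (rule mass_Fatou(2)[OF dq_L2(1)[OF H1_L2[OF f]] _ AE_dq_tendsto[OF lim]])
    show "dq j g \<in> borel_measurable borel" using dq_L2(1)[OF L(1)] by auto
    show "mass (dq j (f n)) \<le> C" for n using H1_dq_le[OF f, of j n] C[of n] by linarith
  qed
  from H1_I[OF L(1) this] show "g \<in> H1" "kin g \<le> C" by auto
  show "mass g \<le> A" by fact
qed

lemma kin_lsc:
  assumes f: "\<And>n. f n \<in> H1" and g: "g \<in> H1"
    and lim: "AE x in lborel. (\<lambda>n. f n x) \<longlonglongrightarrow> g x" and e: "0 < e"
  shows "eventually (\<lambda>n. kin g - e < kin (f n)) sequentially"
proof -
  have "eventually (\<lambda>j. kin g - e/2 < mass (dq j g)) sequentially"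
    using H1_dq_tendsto[OF g] by (rule order_tendstoD) (use e in simp)
  then obtain j where j: "kin g - e/2 < mass (dq j g)" by (auto simp: eventually_sequentially)
  have "eventually (\<lambda>n. mass (dq j g) - e/2 < mass (dq j (f n))) sequentially"
    by (rule mass_lsc[OF dq_L2(1)[OF H1_L2[OF f]] dq_L2(1)[OF H1_L2[OF g]] AE_dq_tendsto[OF lim]]) (use e in simp)
  then show ?thesis
  proof eventually_elim
    case (elim n) then show ?case using j H1_dq_le[OF f, of j n] by linarith
  qed
qed

text \<open>
  Some nonzero element of \<open>H1\<close> is needed so that every prescribed mass is realised; the energy infimum
  is then taken over a nonempty set.
\<close>

lemma tent_H1:
  defines "t \<equiv> (\<lambda>x::real^'n::finite. complex_of_real (max 0 (1 - norm x)))"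
  shows "t \<in> H1" and "mass t > 0"
proof -
  have m: "t \<in> borel_measurable borel" unfolding t_def by measurable
  have fin: "integrable lborel (\<lambda>x::real^'n. indicator (cball 0 r) x :: real)" for r
    using emeasure_bounded_finite[of "cball 0 r :: (real^'n) set"] by (intro integrable_real_indicator) auto
  have nt: "norm (t x) = max 0 (1 - norm x)" for x by (simp add: t_def)
  have tL: "t \<in> L2"
    by (rule L2_bound(1)[OF m fin[of 1]]) (auto simp: nt indicator_def power_le_one max_def)
  have "mass (dq j t) \<le> (LINT x|lborel. real CARD('n) * indicator (cball 0 2 :: (real^'n) set) x)" for j
  proof (rule L2_bound(2))
    show "dq j t \<in> borel_measurable borel" using dq_L2(1)[OF tL] by auto
    show "integrable lborel (\<lambda>x::real^'n. real CARD('n) * indicator (cball 0 2) x)" using fin[of 2] by simp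
    fix x
    have "(norm (t (x + axis i (1/2^j)) - t x))\<^sup>2 \<le> (1/4^j) * indicator (cball 0 2) x" for i
    proof (cases "x \<in> cball 0 2")
      case True
      have "norm (t (x + axis i (1/2^j)) - t x) = \<bar>max 0 (1 - norm (x + axis i (1/2^j))) - max 0 (1 - norm x)\<bar>"
        unfolding t_def of_real_diff[symmetric] norm_of_real ..
      also have "\<dots> \<le> \<bar>norm (x + axis i (1/2^j)) - norm x\<bar>" by (simp add: max_def abs_minus_commute)
      also have "\<dots> \<le> norm ((x + axis i (1/2^j)) - x)" by (rule norm_triangle_ineq3)
      also have "\<dots> = 1/2^j" by simp
      finally have "(norm (t (x + axis i (1/2^j)) - t x))\<^sup>2 \<le> (1/2^j)\<^sup>2" by (intro power_mono) auto
      also have "((1::real)/2^j)\<^sup>2 = 1/4^j" by (simp add: power_divide power2_eq_square power_mult_distrib[symmetric])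
      finally show ?thesis using True by simp
    next
      case False
      have "norm x \<le> norm (x + axis i (1/2^j)) + norm (axis i ((1::real)/2^j) :: real^'n)"
        using norm_triangle_ineq4[of "x + axis i (1/2^j)" "axis i (1/2^j)"] by simp
      moreover have "norm (axis i ((1::real)/2^j) :: real^'n) \<le> 1" by simp
      ultimately have "norm x \<ge> 1 \<and> norm (x + axis i (1/2^j)) \<ge> 1" using False unfolding mem_cball_0 by linarith
      then have "t (x + axis i (1/2^j)) = 0" "t x = 0" by (auto simp: t_def)
      then show ?thesis by simp
    qed
    then have "(norm (dq j t x))\<^sup>2 \<le> 4^j * (\<Sum>i\<in>(UNIV::'n set). (1/4^j) * indicator (cball 0 2) x)"
      unfolding dq_norm_sq by (intro mult_left_mono sum_mono) auto
    then show "(norm (dq j t x))\<^sup>2 \<le> real CARD('n) * indicator (cball 0 2) x" by simp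
  qed
  then show "t \<in> H1" by (rule H1_I(1)[OF tL])
  show "mass t > 0"
  proof (rule ccontr)
    assume "\<not> mass t > 0"
    then have "mass t = 0" using mass_nonneg[of t] by linarith
    then have "AE x in lborel. t x = 0" using mass_eq_0_iff[OF tL] by simp
    then have "AE x in lborel. x \<notin> (ball 0 1 :: (real^'n) set)" by eventually_elim (auto simp: t_def)
    then have "emeasure lborel (ball 0 1 :: (real^'n) set) = 0"
      using AE_iff_null_sets[of "ball 0 1 :: (real^'n) set" lborel] by (auto simp: null_sets_def)
    then have "measure lborel (ball 0 1 :: (real^'n) set) = 0" by (simp add: measure_def)
    then show False using content_ball_pos[of 1 "0::real^'n"] by simp
  qed
qed

lemma H1_mass_exists:
  assumes "0 \<le> \<alpha>" obtains u :: "real^'n::finite \<Rightarrow> complex" where "u \<in> H1" "mass u = \<alpha>"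
proof -
  obtain t :: "real^'n \<Rightarrow> complex" where t: "t \<in> H1" "mass t > 0" using tent_H1 by blast
  show thesis
    by (rule that[of "\<lambda>x. sqrt (\<alpha> / mass t) *\<^sub>R t x"])
       (use t assms in \<open>auto simp: H1_scaleR L2_scaleR(2)[OF H1_L2]\<close>)
qed

text \<open>
  Cutting the modulus of a function at an increasing sequence of levels \<open>l\<close> yields layers whose
  increments all have the sign of the increment of the modulus and add up to no more than it; so the sum
  of their squares is at most its square, and the kinetic energies add up to at most that of the function.
\<close>

definition clamp_to :: "real \<Rightarrow> real \<Rightarrow> real \<Rightarrow> real" where
  "clamp_to lo hi a = max lo (min hi a)"

lemma layers_sum_sq:
  assumes l: "\<And>k. l k \<le> l (Suc k)"
  shows "(\<Sum>k<n. (clamp_to (l k) (l (Suc k)) a - clamp_to (l k) (l (Suc k)) b)\<^sup>2) \<le> (a - b)\<^sup>2"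
proof -
  define d where "d k a = clamp_to (l k) (l (Suc k)) a" for k a
  have tele: "(\<Sum>k<n. d k a - l k) = max (l 0) (min (l n) a) - l 0" for n a
  proof (induction n)
    case (Suc n)
    have "l 0 \<le> l n" by (rule lift_Suc_mono_le[of l]) (use l in auto)
    then show ?case using Suc l[of n] by (auto simp: d_def clamp_to_def max_def min_def split: if_splits)
  qed simp
  have main: "(\<Sum>k<n. (d k a - d k b)\<^sup>2) \<le> (a - b)\<^sup>2" if ab: "b \<le> a" for a b
  proof -
    have nn: "0 \<le> d k a - d k b" for k using ab by (auto simp: d_def clamp_to_def)
    have "(\<Sum>k<n. d k a - d k b) = (\<Sum>k<n. d k a - l k) - (\<Sum>k<n. d k b - l k)" by (simp add: sum_subtractf)
    also have "\<dots> \<le> a - b" unfolding tele using ab by (auto simp: max_def min_def)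
    finally have s: "(\<Sum>k<n. d k a - d k b) \<le> a - b" .
    have "(\<Sum>k<n. (d k a - d k b)\<^sup>2) \<le> (\<Sum>k<n. d k a - d k b)\<^sup>2"
    proof (induction n)
      case (Suc n)
      have "0 \<le> (\<Sum>k<n. d k a - d k b) * (d n a - d n b)" by (intro mult_nonneg_nonneg sum_nonneg nn)
      then show ?case using Suc by (simp add: power2_sum)
    qed simp
    also have "\<dots> \<le> (a - b)\<^sup>2" by (intro power_mono s sum_nonneg nn)
    finally show ?thesis .
  qed
  show ?thesis
  proof (cases "b \<le> a")
    case True then show ?thesis using main unfolding d_def by simp
  next
    case False
    then show ?thesis using main[of a b] unfolding d_def by (simp add: power2_commute)
  qed
qed

definition layer :: "(nat \<Rightarrow> real) \<Rightarrow> nat \<Rightarrow> (real^'n::finite \<Rightarrow> complex) \<Rightarrow> real^'n \<Rightarrow> complex" where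
  "layer l k u x = complex_of_real (clamp_to (l k) (l (Suc k)) (norm (u x)) - l k)"

lemma layer_H1:
  assumes u: "u \<in> H1" and l: "\<And>k. l k \<le> l (Suc k)" "0 \<le> l 0"
  shows "layer l k u \<in> H1" and "(\<Sum>k<n. kin (layer l k u)) \<le> kin u"
proof -
  note uL = H1_L2[OF u]
  have [measurable]: "u \<in> borel_measurable borel" using uL by auto
  have l0: "0 \<le> l k" for k using l(2) lift_Suc_mono_le[of l 0 k] l(1) by auto
  have L: "layer l k u \<in> L2" for k
  proof (rule L2_mono(1)[OF _ uL])
    show "layer l k u \<in> borel_measurable borel" unfolding layer_def[abs_def] clamp_to_def by measurable
    show "norm (layer l k u x) \<le> norm (u x)" for x
      unfolding layer_def norm_of_real using l(1)[of k] l0[of k] by (auto simp: clamp_to_def max_def min_def)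
  qed
  have le: "(\<Sum>k<n. mass (dq j (layer l k u))) \<le> mass (dq j u)" for j n
  proof -
    have "(\<Sum>k<n. mass (dq j (layer l k u))) = (LINT x|lborel. (\<Sum>k<n. (norm (dq j (layer l k u) x))\<^sup>2))"
      unfolding mass_def using L2_integrable[OF dq_L2(1)[OF L]] by simp
    also have "\<dots> \<le> mass (dq j u)"
      unfolding mass_def
    proof (rule integral_mono)
      fix x
      have "(\<Sum>k<n. (norm (layer l k u (x + axis i (1/2^j)) - layer l k u x))\<^sup>2) \<le> (norm (u (x + axis i (1/2^j)) - u x))\<^sup>2" for i
      proof -
        have "(\<Sum>k<n. (norm (layer l k u (x + axis i (1/2^j)) - layer l k u x))\<^sup>2) \<le> (norm (u (x + axis i (1/2^j))) - norm (u x))\<^sup>2"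
          unfolding layer_def of_real_diff[symmetric] norm_of_real power2_abs using layers_sum_sq[where l=l and n=n, OF l(1)] by simp
        also have "\<dots> \<le> (norm (u (x + axis i (1/2^j)) - u x))\<^sup>2"
          using norm_triangle_ineq3 by (subst abs_le_square_iff[symmetric]) simp
        finally show ?thesis .
      qed
      then have "(\<Sum>i\<in>UNIV. \<Sum>k<n. (norm (layer l k u (x + axis i (1/2^j)) - layer l k u x))\<^sup>2) \<le> (\<Sum>i\<in>UNIV. (norm (u (x + axis i (1/2^j)) - u x))\<^sup>2)"
        by (rule sum_mono)
      then show "(\<Sum>k<n. (norm (dq j (layer l k u) x))\<^sup>2) \<le> (norm (dq j u x))\<^sup>2"
        unfolding dq_norm_sq sum_distrib_left[symmetric] sum.swap[of _ UNIV] by simp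
    qed (use L2_integrable[OF dq_L2(1)[OF L]] L2_integrable[OF dq_L2(1)[OF uL]] in auto)
    finally show ?thesis .
  qed
  have "mass (dq j (layer l k u)) \<le> kin u" for j k
  proof -
    have "mass (dq j (layer l k u)) \<le> (\<Sum>k<Suc k. mass (dq j (layer l k u)))" by (simp add: sum_nonneg)
    then show ?thesis using le[of j "Suc k"] H1_dq_le[OF u, of j] by linarith
  qed
  then show H: "layer l k u \<in> H1" for k by (rule H1_I(1)[OF L])
  have "(\<lambda>j. \<Sum>k<n. mass (dq j (layer l k u))) \<longlonglongrightarrow> (\<Sum>k<n. kin (layer l k u))"
    by (intro tendsto_sum H1_dq_tendsto H)
  then show "(\<Sum>k<n. kin (layer l k u)) \<le> kin u"
    by (rule LIMSEQ_le_const2) (use le H1_dq_le[OF u] order_trans in blast)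
qed

section \<open>Cube averages and the Gagliardo-Nirenberg inequality\<close>

definition cube :: "real \<Rightarrow> (real^'n::finite) set" where
  "cube t = cbox 0 (\<chi> i. t)"

definition local_mass :: "real \<Rightarrow> (real^'n::finite \<Rightarrow> complex) \<Rightarrow> real^'n \<Rightarrow> real" where
  "local_mass t f x = (LINT z|lborel. indicator (cube t) z * (norm (f (x + z)))\<^sup>2)"

definition cube_avg :: "real \<Rightarrow> (real^'n::finite \<Rightarrow> complex) \<Rightarrow> real^'n \<Rightarrow> complex" where
  "cube_avg t f x = (1 / t ^ CARD('n)) *\<^sub>R (LINT z|lborel. indicator (cube t) z *\<^sub>R f (x + z))"

lemma cube_measurable [measurable, simp]: "cube t \<in> sets borel"
  by (simp add: cube_def)

lemma cube_measure:
  assumes "0 < t"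
  shows "emeasure lborel (cube t :: (real^'n::finite) set) = ennreal (t ^ CARD('n))"
    and "measure lborel (cube t :: (real^'n::finite) set) = t ^ CARD('n)"
proof -
  have "cube t \<noteq> ({} :: (real^'n) set)" using assms by (auto simp: cube_def interval_ne_empty_cart less_imp_le)
  then show m: "measure lborel (cube t :: (real^'n) set) = t ^ CARD('n)"
    unfolding cube_def by (subst content_cbox_cart) auto
  have "emeasure lborel (cube t :: (real^'n) set) < \<infinity>"
    unfolding cube_def by (intro emeasure_compact_finite compact_cbox)
  then show "emeasure lborel (cube t :: (real^'n) set) = ennreal (t ^ CARD('n))"
    unfolding m[symmetric] by (intro emeasure_eq_ennreal_measure) auto
qed

lemma cube_norm:
  fixes t :: real
  assumes "z \<in> (cube t :: (real^'n::finite) set)" shows "(norm z)\<^sup>2 \<le> CARD('n) * t\<^sup>2"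
proof -
  have "(norm z)\<^sup>2 = (\<Sum>i\<in>UNIV. (z $ i)\<^sup>2)" by (simp add: norm_vec_sq)
  also have "\<dots> \<le> (\<Sum>i\<in>(UNIV::'n set). t\<^sup>2)"
    by (intro sum_mono power_mono) (use assms in \<open>auto simp: cube_def mem_box_cart\<close>)
  finally show ?thesis by simp
qed

lemma local_mass_integrable:
  assumes f: "f \<in> L2"
  shows "integrable lborel (\<lambda>z. indicator (cube t) z * (norm (f (x + z)))\<^sup>2)"
proof -
  have "(\<lambda>z. f (x + z)) \<in> L2" using L2_translate(1)[OF f, of x] by (simp add: add.commute)
  from integrable_mult_indicator[OF _ L2_integrable[OF this], of "cube t"] show ?thesis by simp
qed

lemma local_mass_le_mass:
  assumes f: "f \<in> L2" shows "local_mass t f x \<le> mass f"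
proof -
  have L: "(\<lambda>z. f (x + z)) \<in> L2" "mass (\<lambda>z. f (x + z)) = mass f"
    using L2_translate[OF f, of x] by (simp_all add: add.commute)
  have "local_mass t f x \<le> mass (\<lambda>z. f (x + z))"
    unfolding local_mass_def mass_def
    by (rule integral_mono) (use local_mass_integrable[OF f] L2_integrable[OF L(1)] in \<open>auto simp: indicator_def\<close>)
  then show ?thesis using L by simp
qed

lemma local_mass_mono:
  assumes "f \<in> L2" "g \<in> L2" "\<And>x. norm (f x) \<le> norm (g x)" "s \<le> t"
  shows "local_mass s f x \<le> local_mass t g x"
  unfolding local_mass_def
proof (rule integral_mono)
  have "cube s \<subseteq> (cube t :: (real^'a) set)" using assms(4) by (auto simp: cube_def mem_box_cart) (meson order_trans)
  then show "indicator (cube s) z * (norm (f (x + z)))\<^sup>2 \<le> indicator (cube t) z * (norm (g (x + z)))\<^sup>2" for z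
    using assms(3)[of "x + z"] by (auto simp: indicator_def power_mono)
qed (use assms local_mass_integrable in auto)

lemma cube_integrable:
  fixes f :: "real^'n::finite \<Rightarrow> complex"
  assumes f: "f \<in> L2"
  shows "integrable lborel (\<lambda>z. indicator (cube t) z *\<^sub>R f (x + z))"
proof -
  have "(\<lambda>z. f (x + z)) \<in> L2" using L2_translate(1)[OF f, of x] by (simp add: add.commute)
  from L2_locally_integrable[OF this] show ?thesis
    by (auto simp: locally_integrable_def set_integrable_def cube_def)
qed

lemma cube_avg_bound:
  fixes f :: "real^'n::finite \<Rightarrow> complex"
  assumes f: "f \<in> L2" and t: "0 < t"
  shows "(norm (cube_avg t f x))\<^sup>2 \<le> local_mass t f x / t ^ CARD('n)"
proof -
  have [measurable]: "f \<in> borel_measurable borel" using f by auto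
  let ?I = "LINT z|lborel. indicator (cube t) z *\<^sub>R f (x + z)"
  have lm0: "0 \<le> local_mass t f x" unfolding local_mass_def by (intro integral_nonneg_AE) auto
  have "ennreal ((norm ?I)\<^sup>2) \<le> emeasure lborel (cube t :: (real^'n) set) * (\<integral>\<^sup>+z. indicator (cube t) z * ennreal ((norm (f (x + z)))\<^sup>2) \<partial>lborel)"
    by (rule Jensen_square) auto
  also have "(\<integral>\<^sup>+z. indicator (cube t) z * ennreal ((norm (f (x + z)))\<^sup>2) \<partial>lborel) = (\<integral>\<^sup>+z. ennreal (indicator (cube t) z * (norm (f (x + z)))\<^sup>2) \<partial>lborel)"
    by (intro nn_integral_cong) (auto simp: indicator_def)
  also have "\<dots> = ennreal (local_mass t f x)"
    unfolding local_mass_def by (rule nn_integral_eq_integral) (use local_mass_integrable[OF f] in auto)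
  also have "emeasure lborel (cube t :: (real^'n) set) * ennreal (local_mass t f x) = ennreal (t ^ CARD('n) * local_mass t f x)"
    using t lm0 by (simp add: cube_measure ennreal_mult)
  finally have "(norm ?I)\<^sup>2 \<le> t ^ CARD('n) * local_mass t f x"
    using t lm0 by (subst (asm) ennreal_le_iff) auto
  then have "(norm ?I)\<^sup>2 / (t ^ CARD('n))\<^sup>2 \<le> (t ^ CARD('n) * local_mass t f x) / (t ^ CARD('n))\<^sup>2"
    by (rule divide_right_mono) simp
  also have "\<dots> = local_mass t f x / t ^ CARD('n)" using t by (simp add: power2_eq_square)
  also have "(norm ?I)\<^sup>2 / (t ^ CARD('n))\<^sup>2 = (norm (cube_avg t f x))\<^sup>2"
    using t by (simp add: cube_avg_def power_divide power_mult_distrib)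
  finally show ?thesis .
qed

lemma cube_avg_measurable:
  assumes [measurable]: "f \<in> borel_measurable borel" shows "cube_avg t f \<in> borel_measurable borel"
  unfolding cube_avg_def[abs_def] by measurable

lemma cube_avg_translate: "cube_avg t (\<lambda>w. f (w + c)) x = cube_avg t f (x + c)"
  by (simp add: cube_avg_def add_ac)

lemma cube_avg_diff:
  assumes "f \<in> L2" "g \<in> L2"
  shows "cube_avg t (\<lambda>x. f x - g x) x = cube_avg t f x - cube_avg t g x"
  unfolding cube_avg_def scaleR_diff_right
  by (subst Bochner_Integration.integral_diff) (auto intro!: cube_integrable assms simp: scaleR_diff_right)

lemma cube_avg_Lipschitz:
  fixes f :: "real^'n::finite \<Rightarrow> complex"
  assumes f: "f \<in> H1" and t: "0 < t"
  shows "(norm (cube_avg t f x - cube_avg t f y))\<^sup>2 \<le> (norm (x - y))\<^sup>2 * kin f / t ^ CARD('n)"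
proof -
  note fL = H1_L2[OF f]
  let ?g = "\<lambda>w. f (w + (x - y)) - f w"
  have gL: "?g \<in> L2" by (intro L2_diff L2_translate fL)
  have "cube_avg t ?g y = cube_avg t f x - cube_avg t f y"
    by (subst cube_avg_diff[OF L2_translate(1)[OF fL] fL]) (simp add: cube_avg_translate)
  then have "(norm (cube_avg t f x - cube_avg t f y))\<^sup>2 \<le> local_mass t ?g y / t ^ CARD('n)"
    using cube_avg_bound[OF gL t, of y] by simp
  also have "\<dots> \<le> ((norm (x - y))\<^sup>2 * kin f) / t ^ CARD('n)"
    using order_trans[OF local_mass_le_mass[OF gL] H1_translate_diff[OF f]] t by (intro divide_right_mono) auto
  finally show ?thesis .
qed

text \<open>
  A Poincare inequality on the whole space: the distance from \<open>f\<close> to its average is an average of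
  translation increments, each bounded by \<open>H1_translate_diff\<close>.
\<close>

lemma cube_avg_error:
  fixes f :: "real^'n::finite \<Rightarrow> complex" and t :: real
  assumes f: "f \<in> H1" and t: "0 < t"
  shows "(\<lambda>x. f x - cube_avg t f x) \<in> L2" and "mass (\<lambda>x. f x - cube_avg t f x) \<le> CARD('n) * t\<^sup>2 * kin f"
proof -
  note fL = H1_L2[OF f]
  have [measurable]: "f \<in> borel_measurable borel" using fL by auto
  have [measurable]: "cube_avg t f \<in> borel_measurable borel" by (rule cube_avg_measurable) simp
  let ?V = "t ^ CARD('n)"
  have V: "0 < ?V" using t by simp
  have pt: "ennreal ((norm (f x - cube_avg t f x))\<^sup>2)
      \<le> ennreal (1 / ?V) * (\<integral>\<^sup>+z. indicator (cube t) z * ennreal ((norm (f (x + z) - f x))\<^sup>2) \<partial>lborel)" for x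
  proof -
    have "(LINT z|lborel. indicator (cube t) z *\<^sub>R (f (x + z) - f x))
        = (LINT z|lborel. indicator (cube t) z *\<^sub>R f (x + z)) - (LINT z::real^'n|lborel. indicator (cube t) z *\<^sub>R f x)"
      unfolding scaleR_diff_right
    proof (rule Bochner_Integration.integral_diff)
      show "integrable lborel (\<lambda>z. indicator (cube t) z *\<^sub>R f (x + z))" by (rule cube_integrable[OF fL])
      have "integrable lborel (indicator (cube t) :: real^'n \<Rightarrow> real)"
        using cube_measure(1)[where ?'n='n, OF t] by (intro integrable_real_indicator) auto
      then show "integrable lborel (\<lambda>z::real^'n. indicator (cube t) z *\<^sub>R f x)" by (intro integrable_scaleR_left)
    qed
    also have "(LINT z::real^'n|lborel. indicator (cube t) z *\<^sub>R f x) = ?V *\<^sub>R f x"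
      using cube_measure[where ?'n='n, OF t] by simp
    finally have I: "(LINT z|lborel. indicator (cube t) z *\<^sub>R (f (x + z) - f x)) = ?V *\<^sub>R (cube_avg t f x - f x)"
      using t by (simp add: cube_avg_def scaleR_diff_right)
    have "ennreal ((norm (LINT z|lborel. indicator (cube t) z *\<^sub>R (f (x + z) - f x)))\<^sup>2)
       \<le> emeasure lborel (cube t :: (real^'n) set) * (\<integral>\<^sup>+z. indicator (cube t) z * ennreal ((norm (f (x + z) - f x))\<^sup>2) \<partial>lborel)"
      by (rule Jensen_square) auto
    then have "ennreal (1 / ?V\<^sup>2) * ennreal ((norm (?V *\<^sub>R (cube_avg t f x - f x)))\<^sup>2)
       \<le> ennreal (1 / ?V\<^sup>2) * (ennreal ?V * (\<integral>\<^sup>+z. indicator (cube t) z * ennreal ((norm (f (x + z) - f x))\<^sup>2) \<partial>lborel))"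
      unfolding I cube_measure(1)[OF t] by (rule mult_left_mono) simp
    also have "\<dots> = ennreal (1 / ?V) * (\<integral>\<^sup>+z. indicator (cube t) z * ennreal ((norm (f (x + z) - f x))\<^sup>2) \<partial>lborel)"
      unfolding mult.assoc[symmetric] using V by (subst ennreal_mult[symmetric]) (auto simp: power2_eq_square)
    also have "ennreal (1 / ?V\<^sup>2) * ennreal ((norm (?V *\<^sub>R (cube_avg t f x - f x)))\<^sup>2) = ennreal ((norm (f x - cube_avg t f x))\<^sup>2)"
      using V t by (subst ennreal_mult[symmetric]) (auto simp: power_mult_distrib norm_minus_commute)
    finally show ?thesis .
  qed
  have "(\<integral>\<^sup>+x. ennreal ((norm (f x - cube_avg t f x))\<^sup>2) \<partial>lborel)
      \<le> (\<integral>\<^sup>+x. ennreal (1 / ?V) * (\<integral>\<^sup>+z. indicator (cube t) z * ennreal ((norm (f (x + z) - f x))\<^sup>2) \<partial>lborel) \<partial>lborel)"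
    by (intro nn_integral_mono pt)
  also have "\<dots> = ennreal (1 / ?V) * (\<integral>\<^sup>+x. (\<integral>\<^sup>+z. indicator (cube t) z * ennreal ((norm (f (x + z) - f x))\<^sup>2) \<partial>lborel) \<partial>lborel)"
    by (rule nn_integral_cmult) measurable
  also have "(\<integral>\<^sup>+x. (\<integral>\<^sup>+z. indicator (cube t) z * ennreal ((norm (f (x + z) - f x))\<^sup>2) \<partial>lborel) \<partial>lborel)
     = (\<integral>\<^sup>+z. (\<integral>\<^sup>+x. indicator (cube t) z * ennreal ((norm (f (x + z) - f x))\<^sup>2) \<partial>lborel) \<partial>lborel)"
    by (rule lborel_pair.Fubini'[symmetric]) measurable
  also have "\<dots> \<le> (\<integral>\<^sup>+z. indicator (cube t :: (real^'n) set) z * ennreal (CARD('n) * t\<^sup>2 * kin f) \<partial>lborel)"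
  proof (rule nn_integral_mono)
    fix z :: "real^'n"
    have L: "(\<lambda>x. f (x + z) - f x) \<in> L2" by (intro L2_diff L2_translate fL)
    have "(\<integral>\<^sup>+x. indicator (cube t) z * ennreal ((norm (f (x + z) - f x))\<^sup>2) \<partial>lborel) = indicator (cube t) z * ennreal (mass (\<lambda>x. f (x + z) - f x))"
      by (subst nn_integral_cmult) (auto simp: nn_mass[OF L])
    also have "\<dots> \<le> indicator (cube t) z * ennreal (CARD('n) * t\<^sup>2 * kin f)"
    proof (cases "z \<in> cube t")
      case True
      have "mass (\<lambda>x. f (x + z) - f x) \<le> CARD('n) * t\<^sup>2 * kin f"
        using H1_translate_diff[OF f, of z] mult_right_mono[OF cube_norm[OF True] kin_nonneg[of f]] by linarith
      then show ?thesis using True by (simp add: ennreal_leI)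
    qed simp
    finally show "(\<integral>\<^sup>+x. indicator (cube t) z * ennreal ((norm (f (x + z) - f x))\<^sup>2) \<partial>lborel) \<le> indicator (cube t) z * ennreal (CARD('n) * t\<^sup>2 * kin f)" .
  qed
  also have "\<dots> = ennreal ?V * ennreal (CARD('n) * t\<^sup>2 * kin f)"
    using cube_measure(1)[where ?'n='n, OF t] by (simp add: nn_integral_multc)
  also have "ennreal (1 / ?V) * (ennreal ?V * ennreal (CARD('n) * t\<^sup>2 * kin f)) = ennreal (CARD('n) * t\<^sup>2 * kin f)"
    unfolding mult.assoc[symmetric] using V by (subst ennreal_mult[symmetric]) auto
  finally have le: "(\<integral>\<^sup>+x. ennreal ((norm (f x - cube_avg t f x))\<^sup>2) \<partial>lborel) \<le> ennreal (CARD('n) * t\<^sup>2 * kin f)"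
    by (simp add: mult_left_mono)
  show "(\<lambda>x. f x - cube_avg t f x) \<in> L2" "mass (\<lambda>x. f x - cube_avg t f x) \<le> CARD('n) * t\<^sup>2 * kin f"
    using L2_I_nn[OF _ le] by auto
qed

text \<open>
  The mass-critical integrand \<open>|u|^(2 + 4/N)\<close>.
\<close>

definition crit :: "(real^'n::finite \<Rightarrow> complex) \<Rightarrow> real^'n \<Rightarrow> real" where
  "crit u x = (norm (u x))\<^sup>2 * ((norm (u x))\<^sup>2) powr (2 / CARD('n))"

text \<open>
  This is the weak-type estimate at one level. The layer at height \<open>l k\<close> is compared with its average
  over a cube of volume \<open>4^(-k)\<close>. As the mass in a unit cube is at most \<open>m\<close>, the square of the average is
  at most \<open>4^k m = (l k / 2)^2\<close>; so where \<open>|u|\<close> is at least \<open>2 l k\<close>, the layer, of height \<open>l k\<close> there,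
  differs from its average by at least \<open>l k / 2\<close>. \<open>cube_avg_error\<close> bounds the measure of that set by
  the kinetic energy of the layer.
\<close>

lemma layer_superlevel:
  fixes u :: "real^'n::finite \<Rightarrow> complex"
  assumes u: "u \<in> H1" and m: "0 < m" and lm: "\<And>y. local_mass 1 u y \<le> m"
  defines "l \<equiv> \<lambda>k. 2 * sqrt m * 2^k"
  defines "B \<equiv> \<lambda>k. {x. l (Suc k) \<le> norm (u x)}"
  shows "integrable lborel (\<lambda>x. indicator (B k) x :: real)"
    and "(l k)\<^sup>2 * (LINT x|lborel. indicator (B k) x) \<le> 4 * CARD('n) * (1/4^k) powr (2 / CARD('n)) * kin (layer l k u)"
proof -
  note uL = H1_L2[OF u]
  have [measurable]: "u \<in> borel_measurable borel" using uL by auto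
  have [measurable]: "B k \<in> sets borel" unfolding B_def by measurable
  have l: "0 < l k" "l (Suc k) = 2 * l k" for k using m by (simp_all add: l_def)
  have lS: "l k \<le> l (Suc k)" for k using l[of k] by simp
  have l2: "(l k)\<^sup>2 = 4 * m * 4^k" for k
    using m by (simp add: l_def power_mult_distrib power2_eq_square[of "2^k"] power_mult_distrib[symmetric])
  note f = layer_H1(1)[of u l, OF u lS less_imp_le[OF l(1)], of k]
  note fL = H1_L2[OF f]
  define t where "t = (1/4^k) powr (1 / CARD('n))"
  have t0: "0 < t" by (simp add: t_def)
  have t1: "t \<le> 1" unfolding t_def by (rule powr_le1) auto
  have tN: "t ^ CARD('n) = 1/4^k"
    unfolding powr_realpow[OF t0, symmetric] by (simp add: t_def powr_powr)
  have t2: "t\<^sup>2 = (1/4^k) powr (2 / CARD('n))"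
    unfolding powr_realpow[OF t0, symmetric] by (simp add: t_def powr_powr)
  have fu: "norm (layer l k u x) \<le> norm (u x)" for x
    unfolding layer_def norm_of_real using lS[of k] l(1)[of k] by (auto simp: clamp_to_def max_def min_def)
  let ?d = "\<lambda>x. layer l k u x - cube_avg t (layer l k u) x"
  have avg: "norm (cube_avg t (layer l k u) x) \<le> l k / 2" for x
  proof -
    have "(norm (cube_avg t (layer l k u) x))\<^sup>2 \<le> local_mass t (layer l k u) x / t ^ CARD('n)"
      by (rule cube_avg_bound[OF fL t0])
    also have "\<dots> \<le> m / t ^ CARD('n)"
      using order_trans[OF local_mass_mono[OF fL uL fu t1] lm] t0 by (intro divide_right_mono) auto
    also have "\<dots> = (l k / 2)\<^sup>2" by (simp add: tN l2 power_divide)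
    finally show ?thesis by (rule power2_le_imp_le) (use l(1)[of k] in simp)
  qed
  have pt: "(l k)\<^sup>2 / 4 * indicator (B k) x \<le> (norm (?d x))\<^sup>2" for x
  proof (cases "x \<in> B k")
    case True
    then have "l k \<le> norm (layer l k u x)"
      unfolding layer_def norm_of_real using l(1)[of k] by (auto simp: B_def clamp_to_def max_def min_def l(2))
    then have "l k / 2 \<le> norm (?d x)"
      using norm_triangle_ineq2[of "layer l k u x" "cube_avg t (layer l k u) x"] avg[of x] by linarith
    then have "(l k / 2)\<^sup>2 \<le> (norm (?d x))\<^sup>2" using l(1)[of k] by (intro power_mono) auto
    then show ?thesis using True by (simp add: power_divide)
  qed simp
  note e = cube_avg_error[OF f t0]
  have i: "integrable lborel (\<lambda>x. (l k)\<^sup>2 / 4 * indicator (B k) x)"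
    by (rule Bochner_Integration.integrable_bound[OF L2_integrable[OF e(1)]]) (use pt in auto)
  from integrable_mult_right[OF i, of "4 / (l k)\<^sup>2"]
  show int: "integrable lborel (\<lambda>x. indicator (B k) x :: real)" using l(1)[of k] by simp
  have "(l k)\<^sup>2 / 4 * (LINT x|lborel. indicator (B k) x) = (LINT x|lborel. (l k)\<^sup>2 / 4 * indicator (B k) x)"
    by simp
  also have "\<dots> \<le> mass ?d"
    unfolding mass_def by (rule integral_mono) (use pt i L2_integrable[OF e(1)] in auto)
  also have "\<dots> \<le> CARD('n) * t\<^sup>2 * kin (layer l k u)" by (rule e(2))
  finally show "(l k)\<^sup>2 * (LINT x|lborel. indicator (B k) x) \<le> 4 * CARD('n) * (1/4^k) powr (2 / CARD('n)) * kin (layer l k u)"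
    unfolding t2 by simp
qed

text \<open>
  Summing \<open>layer_superlevel\<close> over the dyadic levels gives the strong inequality, because the kinetic
  energies of the layers add up to at most that of \<open>u\<close>. Below the first level the integrand is at most a constant times the
  density. The factor \<open>m powr (2/N)\<close> is what excludes vanishing.
\<close>

theorem Gagliardo_Nirenberg:
  fixes u :: "real^'n::finite \<Rightarrow> complex"
  assumes u: "u \<in> H1" and m: "0 < m" and lm: "\<And>y. local_mass 1 u y \<le> m"
  shows "integrable lborel (crit u)"
    and "(LINT x|lborel. crit u x) \<le> 64 * 64 powr (2 / CARD('n)) * CARD('n) * m powr (2 / CARD('n)) * (mass u + kin u)"
proof -
  note uL = H1_L2[OF u]
  have [measurable]: "u \<in> borel_measurable borel" using uL by auto
  define p where "p = 2 / real CARD('n)"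
  have p: "0 < p" by (simp add: p_def)
  define l where "l k = 2 * sqrt m * 2^k" for k :: nat
  define B where "B k = {x. l (Suc k) \<le> norm (u x)}" for k
  have [measurable]: "B k \<in> sets borel" for k unfolding B_def by measurable
  have l: "0 < l k" "l (Suc k) = 2 * l k" for k using m by (simp_all add: l_def)
  have lS: "l k \<le> l (Suc k)" for k using l[of k] by simp
  have l2: "(l k)\<^sup>2 = 4 * m * 4^k" for k
    using m by (simp add: l_def power_mult_distrib power2_eq_square[of "2^k"] power_mult_distrib[symmetric])
  note sl = layer_superlevel[OF u m lm, folded l_def B_def]
  define F where "F a = a\<^sup>2 * (a\<^sup>2) powr p" for a :: real
  have Fmono: "F a \<le> F b" if "0 \<le> a" "a \<le> b" for a b
    unfolding F_def using that p by (intro mult_mono power_mono powr_mono2) auto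
  have F0: "0 \<le> F a" for a by (simp add: F_def)
  define C where "C = 64 * 64 powr p * CARD('n) * m powr p"
  have C0: "0 \<le> C" by (simp add: C_def)
  \<comment> \<open>each point with \<open>|u x|\<close> between \<open>l (Suc k)\<close> and \<open>l (Suc (Suc k))\<close> is charged to the level \<open>k\<close>\<close>
  have pt: "(if norm (u x) < l (Suc n) then crit u x else 0) \<le> ((l 1)\<^sup>2) powr p * (norm (u x))\<^sup>2 + (\<Sum>k<n. F (l (Suc (Suc k))) * indicator (B k) x)" for n x
  proof (induction n)
    case 0
    show ?case
    proof (cases "norm (u x) < l (Suc 0)")
      case True
      then have "((norm (u x))\<^sup>2) powr p \<le> ((l 1)\<^sup>2) powr p" using p by (intro powr_mono2 power_mono) auto
      from mult_right_mono[OF this, of "(norm (u x))\<^sup>2"] show ?thesis using True by (simp add: crit_def p_def mult.commute)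
    qed simp
  next
    case (Suc n)
    show ?case
    proof (cases "norm (u x) < l (Suc n)")
      case True
      then show ?thesis using Suc F0[of "l (Suc (Suc n))"] lS[of "Suc n"] by (auto intro: order_trans simp: indicator_def)
    next
      case False
      have s: "0 \<le> (\<Sum>k<n. F (l (Suc (Suc k))) * indicator (B k) x)" by (intro sum_nonneg mult_nonneg_nonneg F0) auto
      show ?thesis
      proof (cases "norm (u x) < l (Suc (Suc n))")
        case True
        then have "crit u x \<le> F (l (Suc (Suc n)))"
          using Fmono[of "norm (u x)" "l (Suc (Suc n))"] by (simp add: F_def crit_def p_def)
        moreover have "0 \<le> ((l 1)\<^sup>2) powr p * (norm (u x))\<^sup>2" by simp
        moreover have ind: "indicator (B n) x = (1::real)" using False by (simp add: B_def)
        ultimately show ?thesis using s unfolding sum.lessThan_Suc if_P[OF True] ind mult_1_right by linarith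
      next
        case f: False
        then show ?thesis using s F0[of "l (Suc (Suc n))"] by (auto simp: indicator_def)
      qed
    qed
  qed
  have Fl: "F (l (Suc (Suc k))) * (LINT x|lborel. indicator (B k) x) \<le> C * kin (layer l k u)" for k
  proof -
    have q: "l (Suc (Suc k)) = 4 * l k" using l(2) by simp
    have "F (l (Suc (Suc k))) = 16 * (l k)\<^sup>2 * (16 * (l k)\<^sup>2) powr p" unfolding q F_def by (simp add: power_mult_distrib)
    then have "F (l (Suc (Suc k))) * (LINT x|lborel. indicator (B k) x)
       = 16 * (16 * (l k)\<^sup>2) powr p * ((l k)\<^sup>2 * (LINT x|lborel. indicator (B k) x))" by simp
    also have "\<dots> \<le> 16 * (16 * (l k)\<^sup>2) powr p * (4 * CARD('n) * (1/4^k) powr p * kin (layer l k u))"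
      unfolding p_def by (intro mult_left_mono sl(2)) auto
    also have "(16 * (l k)\<^sup>2) powr p = 64 powr p * m powr p * (4^k) powr p"
      unfolding l2 using m by (simp add: powr_mult[symmetric] mult.assoc)
    also have "16 * (64 powr p * m powr p * (4^k) powr p) * (4 * CARD('n) * (1/4^k) powr p * kin (layer l k u))
       = C * kin (layer l k u) * ((4^k) powr p * (1/4^k) powr p)" by (simp add: C_def)
    also have "(4^k) powr p * (1/4^k :: real) powr p = 1" by (simp add: powr_mult[symmetric])
    finally show ?thesis by simp
  qed
  have i1: "integrable lborel (\<lambda>x. ((l 1)\<^sup>2) powr p * (norm (u x))\<^sup>2 + (\<Sum>k<n. F (l (Suc (Suc k))) * indicator (B k) x))" for n
    using L2_integrable[OF uL] sl(1) by (intro Bochner_Integration.integrable_add Bochner_Integration.integrable_sum integrable_mult_right) auto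
  have bound: "(LINT x|lborel. ((l 1)\<^sup>2) powr p * (norm (u x))\<^sup>2 + (\<Sum>k<n. F (l (Suc (Suc k))) * indicator (B k) x)) \<le> C * (mass u + kin u)" for n
  proof -
    have "(LINT x|lborel. ((l 1)\<^sup>2) powr p * (norm (u x))\<^sup>2 + (\<Sum>k<n. F (l (Suc (Suc k))) * indicator (B k) x))
      = ((l 1)\<^sup>2) powr p * mass u + (\<Sum>k<n. F (l (Suc (Suc k))) * (LINT x|lborel. indicator (B k) x))"
    proof -
      have j: "integrable lborel (\<lambda>x. F (l (Suc (Suc k))) * indicator (B k) x)" for k using sl(1)[of k] by simp
      show ?thesis
        unfolding mass_def using L2_integrable[OF uL]
        by (simp only: Bochner_Integration.integral_add Bochner_Integration.integrable_sum
            Bochner_Integration.integral_sum integrable_mult_right j integral_mult_right_zero)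
    qed
    also have "\<dots> \<le> C * mass u + C * kin u"
    proof (rule add_mono)
      have "((l 1)\<^sup>2) powr p = 16 powr p * m powr p" unfolding l2 using m by (simp add: powr_mult[symmetric])
      also have "\<dots> \<le> 64 powr p * m powr p" using p by (intro mult_right_mono powr_mono2) auto
      also have "\<dots> \<le> C"
      proof -
        have "1 * (64 powr p * m powr p) \<le> (64 * real CARD('n)) * (64 powr p * m powr p)"
        proof (rule mult_right_mono)
          have "1 \<le> CARD('n)" by (simp add: Suc_le_eq)
          then show "1 \<le> 64 * real CARD('n)" by linarith
        qed simp
        then show ?thesis by (simp add: C_def mult_ac)
      qed
      finally show "((l 1)\<^sup>2) powr p * mass u \<le> C * mass u" by (rule mult_right_mono) simp
      have "(\<Sum>k<n. F (l (Suc (Suc k))) * (LINT x|lborel. indicator (B k) x)) \<le> (\<Sum>k<n. C * kin (layer l k u))"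
        by (intro sum_mono Fl)
      also have "\<dots> \<le> C * kin u"
        unfolding sum_distrib_left[symmetric] by (intro mult_left_mono layer_H1(2)[of u l, OF u lS] C0) (use l(1)[of 0] in simp)
      finally show "(\<Sum>k<n. F (l (Suc (Suc k))) * (LINT x|lborel. indicator (B k) x)) \<le> C * kin u" .
    qed
    finally show ?thesis by (simp add: distrib_left)
  qed
  have crit0: "0 \<le> crit u x" for x by (simp add: crit_def)
  have [measurable]: "crit u \<in> borel_measurable borel" unfolding crit_def[abs_def] by measurable
  have "(\<integral>\<^sup>+x. ennreal (crit u x) \<partial>lborel) = (\<integral>\<^sup>+x. liminf (\<lambda>n. ennreal (if norm (u x) < l (Suc n) then crit u x else 0)) \<partial>lborel)"
  proof (rule nn_integral_cong)
    fix x
    have "eventually (\<lambda>n. ennreal (crit u x) = ennreal (if norm (u x) < l (Suc n) then crit u x else 0)) sequentially"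
    proof -
      obtain n0 where n0: "norm (u x) / (2 * sqrt m) < 2^n0" using real_arch_pow[of 2] by auto
      have "norm (u x) < l (Suc n)" if "n \<ge> n0" for n
      proof -
        have "norm (u x) < l n0" using n0 m by (simp add: l_def field_simps)
        also have "\<dots> \<le> l (Suc n)" by (rule lift_Suc_mono_le[of l]) (use lS that in auto)
        finally show ?thesis .
      qed
      then show ?thesis unfolding eventually_sequentially by auto
    qed
    then have "(\<lambda>n. ennreal (if norm (u x) < l (Suc n) then crit u x else 0)) \<longlonglongrightarrow> ennreal (crit u x)"
      by (rule Lim_transform_eventually[OF tendsto_const])
    from lim_imp_Liminf[OF trivial_limit_sequentially this]
    show "ennreal (crit u x) = liminf (\<lambda>n. ennreal (if norm (u x) < l (Suc n) then crit u x else 0))" by (rule sym)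
  qed
  also have "\<dots> \<le> liminf (\<lambda>n. \<integral>\<^sup>+x. ennreal (if norm (u x) < l (Suc n) then crit u x else 0) \<partial>lborel)"
    by (rule nn_integral_liminf) measurable
  also have "\<dots> \<le> ennreal (C * (mass u + kin u))"
  proof -
    have "(\<integral>\<^sup>+x. ennreal (if norm (u x) < l (Suc n) then crit u x else 0) \<partial>lborel) \<le> ennreal (C * (mass u + kin u))" for n
    proof -
    have "(\<integral>\<^sup>+x. ennreal (if norm (u x) < l (Suc n) then crit u x else 0) \<partial>lborel)
       \<le> (\<integral>\<^sup>+x. ennreal (((l 1)\<^sup>2) powr p * (norm (u x))\<^sup>2 + (\<Sum>k<n. F (l (Suc (Suc k))) * indicator (B k) x)) \<partial>lborel)"
      by (intro nn_integral_mono ennreal_leI pt)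
    also have "\<dots> = ennreal (LINT x|lborel. ((l 1)\<^sup>2) powr p * (norm (u x))\<^sup>2 + (\<Sum>k<n. F (l (Suc (Suc k))) * indicator (B k) x))"
      by (rule nn_integral_eq_integral[OF i1]) (auto intro!: add_nonneg_nonneg sum_nonneg mult_nonneg_nonneg F0)
    also have "\<dots> \<le> ennreal (C * (mass u + kin u))" by (intro ennreal_leI bound)
    finally show "(\<integral>\<^sup>+x. ennreal (if norm (u x) < l (Suc n) then crit u x else 0) \<partial>lborel) \<le> ennreal (C * (mass u + kin u))" .
    qed
    then show ?thesis by (intro Liminf_le) (auto intro!: always_eventually)
  qed
  finally have le: "(\<integral>\<^sup>+x. ennreal (crit u x) \<partial>lborel) \<le> ennreal (C * (mass u + kin u))" .
  show int: "integrable lborel (crit u)"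
    by (rule integrableI_bounded) (use le crit0 in \<open>auto intro: le_less_trans\<close>)
  have "ennreal (LINT x|lborel. crit u x) \<le> ennreal (C * (mass u + kin u))"
    using le nn_integral_eq_integral[OF int] crit0 by simp
  then have "(LINT x|lborel. crit u x) \<le> C * (mass u + kin u)"
    by (subst (asm) ennreal_le_iff) (auto intro!: mult_nonneg_nonneg add_nonneg_nonneg C0)
  then show "(LINT x|lborel. crit u x) \<le> 64 * 64 powr (2 / CARD('n)) * CARD('n) * m powr (2 / CARD('n)) * (mass u + kin u)"
    by (simp add: C_def p_def)
qed

section \<open>Local compactness in H1\<close>

text \<open>
  A positive integrable weight, bounded and bounded away from zero on balls, replaces a diagonal argument
  over balls in the proof of local compactness.
\<close>

lemma exists_weight:
  obtains w :: "real^'n::finite \<Rightarrow> real" where "w \<in> borel_measurable borel" "integrable lborel w"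
    "\<And>x. 0 < w x" "\<And>x. w x \<le> 2" "\<And>R. \<exists>c>0. \<forall>x. norm x < R \<longrightarrow> c \<le> w x"
proof -
  define m where "m k = measure lborel (ball 0 (real k) :: (real^'n) set)" for k
  define a where "a k = (1/2)^k / (1 + m k)" for k
  define f where "f k x = a k * indicator (ball 0 (real k)) x" for k and x :: "real^'n"
  define w where "w x = (\<Sum>k. f k x)" for x
  have m: "0 \<le> m k" for k by (simp add: m_def)
  have a: "0 < a k" for k unfolding a_def using m[of k] by (intro divide_pos_pos) auto
  have a2: "a k \<le> (1/2)^k" for k unfolding a_def using m[of k] by (simp add: divide_le_eq mult_le_cancel_left1)
  have am: "a k * m k \<le> (1/2)^k" for k
  proof -
    have "a k * m k = (1/2)^k * (m k / (1 + m k))" by (simp add: a_def)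
    also have "\<dots> \<le> (1/2)^k * 1" using m[of k] by (intro mult_left_mono) auto
    finally show ?thesis by simp
  qed
  have f0: "0 \<le> f k x" for k x using a[of k] by (simp add: f_def less_imp_le)
  have fle: "f k x \<le> (1/2)^k" for k x using a2[of k] a[of k] by (auto simp: f_def indicator_def)
  have geo: "summable (\<lambda>k. (1/2::real)^k)" by (intro summable_geometric) simp
  have sm: "summable (\<lambda>k. f k x)" for x
    by (rule summable_comparison_test'[OF geo, of 0]) (use f0 fle in auto)
  have fin: "emeasure lborel (ball 0 (real k) :: (real^'n) set) < \<infinity>" for k
    by (intro emeasure_bounded_finite bounded_ball)
  have fi: "integrable lborel (f k)" for k
    unfolding f_def[abs_def] using fin[of k] by (intro integrable_mult_right integrable_real_indicator) auto
  have wi: "integrable lborel w"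
    unfolding w_def[abs_def]
  proof (rule integrable_suminf[OF fi])
    show "AE x in lborel. summable (\<lambda>k. norm (f k x))" using sm f0 by simp
    have "(LINT x|lborel. norm (f k x)) = a k * m k" for k
      using f0[of k] by (simp add: f_def m_def)
    then show "summable (\<lambda>k. LINT x|lborel. norm (f k x))"
      using am a m by (intro summable_comparison_test'[OF geo, of 0]) (simp add: less_imp_le)
  qed
  have wge: "f k x \<le> w x" for k x
    unfolding w_def using sum_le_suminf[OF sm[of x], of "{k}"] f0 by simp
  show thesis
  proof (rule that[OF _ wi])
    show "w \<in> borel_measurable borel" using borel_measurable_integrable[OF wi] by simp
    show "0 < w x" for x
    proof -
      have "norm x < real (nat \<lceil>norm x\<rceil> + 1)" using real_nat_ceiling_ge[of "norm x"] by linarith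
      then have "f (nat \<lceil>norm x\<rceil> + 1) x = a (nat \<lceil>norm x\<rceil> + 1)" by (simp add: f_def)
      then show ?thesis using wge[of "nat \<lceil>norm x\<rceil> + 1" x] a[of "nat \<lceil>norm x\<rceil> + 1"] by linarith
    qed
    show "w x \<le> 2" for x
    proof -
      have "w x \<le> (\<Sum>k. (1/2::real)^k)" unfolding w_def by (rule suminf_le[OF fle sm geo])
      also have "\<dots> = 2" using suminf_geometric[of "1/2::real"] by simp
      finally show ?thesis .
    qed
    show "\<exists>c>0. \<forall>x. norm x < R \<longrightarrow> c \<le> w x" for R
    proof (intro exI[of _ "a (nat \<lceil>R\<rceil>)"] conjI allI impI a)
      fix x :: "real^'n" assume "norm x < R"
      then have "norm x < real (nat \<lceil>R\<rceil>)" using real_nat_ceiling_ge[of R] by linarith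
      then have "f (nat \<lceil>R\<rceil>) x = a (nat \<lceil>R\<rceil>)" by (simp add: f_def)
      then show "a (nat \<lceil>R\<rceil>) \<le> w x" using wge[of "nat \<lceil>R\<rceil>" x] by simp
    qed
  qed
qed

lemma cube_avg_uniform_bound:
  fixes f :: "real^'n::finite \<Rightarrow> complex"
  assumes f: "f \<in> L2" "mass f \<le> A" and t: "0 < t"
  shows "norm (cube_avg t f x) \<le> sqrt (A / t ^ CARD('n))"
proof -
  have "(norm (cube_avg t f x))\<^sup>2 \<le> A / t ^ CARD('n)"
    using cube_avg_bound[OF f(1) t, of x] divide_right_mono[OF order_trans[OF local_mass_le_mass[OF f(1), of t x] f(2)], of "t ^ CARD('n)"] t
    by simp
  then show ?thesis by (rule real_le_rsqrt)
qed

text \<open>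
  At each scale the averages are bounded and uniformly Lipschitz. A diagonal subsequence converges on a countable dense
  set for all dyadic scales, hence everywhere.
\<close>

lemma cube_avg_subsequence:
  fixes f :: "nat \<Rightarrow> real^'n::finite \<Rightarrow> complex"
  assumes f: "\<And>n. f n \<in> H1" and A: "\<And>n. mass (f n) \<le> A" and C: "\<And>n. kin (f n) \<le> C"
  obtains d where "strict_mono (d :: nat \<Rightarrow> nat)" "\<And>j x. convergent (\<lambda>n. cube_avg ((1/2)^j) (f (d n)) x)"
proof -
  note fL = H1_L2[OF f]
  obtain D :: "(real^'n) set" where D: "countable D" "\<And>X. open X \<Longrightarrow> X \<noteq> {} \<Longrightarrow> \<exists>d\<in>D. d \<in> X"
    using countable_dense_exists by metis
  have Dne: "D \<noteq> {}" using D(2)[of UNIV] by auto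
  define e where "e = from_nat_into ((UNIV :: nat set) \<times> D)"
  have e: "range e = UNIV \<times> D" unfolding e_def using D(1) Dne by (intro range_from_nat_into) auto
  define P where "P k s = convergent (\<lambda>i::nat. cube_avg ((1/2)^(fst (e k))) (f (s i)) (snd (e k)))" for k and s :: "nat \<Rightarrow> nat"
  interpret subseqs P
  proof
    fix k and s :: "nat \<Rightarrow> nat"
    have "bounded (range (\<lambda>i. cube_avg ((1/2)^(fst (e k))) (f (s i)) (snd (e k))))"
      by (rule boundedI) (use cube_avg_uniform_bound[OF fL A, of "(1/2)^(fst (e k))"] in auto)
    then obtain l r where "strict_mono (r :: nat \<Rightarrow> nat)" "((\<lambda>i. cube_avg ((1/2)^(fst (e k))) (f (s i)) (snd (e k))) \<circ> r) \<longlonglongrightarrow> l"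
      using bounded_imp_convergent_subsequence by blast
    then show "\<exists>r'. strict_mono r' \<and> P k (s \<circ> r')" by (auto simp: P_def o_def convergent_def)
  qed
  have stable: "P k (s \<circ> r)" if "strict_mono r" "P k s" for r s k
    using convergent_subseq_convergent[OF that(2)[unfolded P_def] that(1)] by (simp add: P_def o_def)
  define d where "d = diagseq"
  have d: "strict_mono d" unfolding d_def by (rule subseq_diagseq)
  have Pd: "P k d" for k
  proof -
    have "P k (d \<circ> ((+) (Suc k)))" unfolding d_def by (rule diagseq_holds) (rule stable)
    then have "convergent (\<lambda>i. cube_avg ((1/2)^(fst (e k))) (f (d (i + Suc k))) (snd (e k)))"
      by (simp add: P_def o_def add.commute)
    then show ?thesis unfolding P_def by (subst (asm) convergent_ignore_initial_segment)
  qed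
  have conv: "convergent (\<lambda>n. cube_avg ((1/2)^j) (f (d n)) x)" for j x
  proof (rule Cauchy_convergent, rule metric_CauchyI)
    fix \<epsilon> :: real assume \<epsilon>: "0 < \<epsilon>"
    define t where "t = (1/2::real)^j"
    have t: "0 < t" by (simp add: t_def)
    have C0: "0 \<le> C" using order_trans[OF kin_nonneg C] .
    define K where "K = sqrt (C / t ^ CARD('n)) + 1"
    have K: "0 < K" using C0 t unfolding K_def by (intro add_nonneg_pos) auto
    have lip: "dist (cube_avg t (f n) x) (cube_avg t (f n) y) \<le> K * dist x y" for n x y
    proof -
      have "(norm (cube_avg t (f n) x - cube_avg t (f n) y))\<^sup>2 \<le> (norm (x - y))\<^sup>2 * C / t ^ CARD('n)"
        using cube_avg_Lipschitz[OF f t, of n x y]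
      proof (rule order_trans)
        show "(norm (x - y))\<^sup>2 * kin (f n) / t ^ CARD('n) \<le> (norm (x - y))\<^sup>2 * C / t ^ CARD('n)"
          using t by (intro divide_right_mono mult_left_mono C) auto
      qed
      then have "norm (cube_avg t (f n) x - cube_avg t (f n) y) \<le> sqrt ((norm (x - y))\<^sup>2 * C / t ^ CARD('n))"
        by (rule real_le_rsqrt)
      also have "\<dots> = norm (x - y) * sqrt (C / t ^ CARD('n))" by (simp add: real_sqrt_mult real_sqrt_divide)
      also have "\<dots> \<le> norm (x - y) * K" unfolding K_def by (intro mult_left_mono) auto
      finally show ?thesis by (simp add: dist_norm mult.commute)
    qed
    obtain q where q: "q \<in> D" "dist q x < \<epsilon> / (4 * K)"
    proof -
      have "0 < \<epsilon> / (4 * K)" using \<epsilon> K by simp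
      then have "ball x (\<epsilon> / (4 * K)) \<noteq> {}" by (simp only: ball_eq_empty not_le)
      from D(2)[OF open_ball this] obtain q where "q \<in> D" "dist x q < \<epsilon> / (4 * K)" by (auto simp only: mem_ball)
      then show thesis using that[of q] by (simp add: dist_commute)
    qed
    obtain k where k: "e k = (j, q)" using e q(1) by (metis (no_types, lifting) SigmaI UNIV_I imageE)
    have "Cauchy (\<lambda>n. cube_avg t (f (d n)) q)"
      using Pd[of k] convergent_Cauchy unfolding P_def k t_def by auto
    then obtain N where N: "\<And>m n. m \<ge> N \<Longrightarrow> n \<ge> N \<Longrightarrow> dist (cube_avg t (f (d m)) q) (cube_avg t (f (d n)) q) < \<epsilon> / 4"
      unfolding Cauchy_def using \<epsilon> by (metis divide_pos_pos zero_less_numeral)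
    have qx: "K * dist x q < \<epsilon> / 4" using q(2) K by (simp add: field_simps dist_commute)
    have "dist (cube_avg t (f (d m)) x) (cube_avg t (f (d n)) x) < \<epsilon>" if "m \<ge> N" "n \<ge> N" for m n
    proof -
      have "dist (cube_avg t (f (d m)) x) (cube_avg t (f (d n)) x)
         \<le> dist (cube_avg t (f (d m)) x) (cube_avg t (f (d m)) q)
          + (dist (cube_avg t (f (d m)) q) (cube_avg t (f (d n)) q) + dist (cube_avg t (f (d n)) q) (cube_avg t (f (d n)) x))"
        using dist_triangle dist_triangle_le by (meson add_left_mono order_trans)
      also have "\<dots> < \<epsilon> / 4 + (\<epsilon> / 4 + \<epsilon> / 4)"
        using lip[of "d m" x q] lip[of "d n" q x] N[OF that] qx by (simp add: dist_commute[of q x])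
      also have "\<dots> < \<epsilon>" using \<epsilon> by simp
      finally show ?thesis .
    qed
    then show "\<exists>N. \<forall>m\<ge>N. \<forall>n\<ge>N. dist (cube_avg ((1/2)^j) (f (d m)) x) (cube_avg ((1/2)^j) (f (d n)) x) < \<epsilon>"
      unfolding t_def by blast
  qed
  show thesis by (rule that[OF d conv])
qed

lemma weighted_L2:
  assumes "w \<in> borel_measurable borel" "\<And>x. 0 < w x" "\<And>x. w x \<le> (2::real)" "f \<in> L2"
  shows "(\<lambda>x. sqrt (w x) *\<^sub>R f x) \<in> L2" and "mass (\<lambda>x. sqrt (w x) *\<^sub>R f x) \<le> 2 * mass f"
proof -
  have [measurable]: "w \<in> borel_measurable borel" "f \<in> borel_measurable borel" using assms by auto
  have i: "integrable lborel (\<lambda>x. 2 * (norm (f x))\<^sup>2)" using L2_integrable[OF assms(4)] by simp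
  have le: "(norm (sqrt (w x) *\<^sub>R f x))\<^sup>2 \<le> 2 * (norm (f x))\<^sup>2" for x
    using mult_right_mono[OF assms(3)[of x], of "(norm (f x))\<^sup>2"] assms(2)[of x] by (simp add: power_mult_distrib less_imp_le)
  show "(\<lambda>x. sqrt (w x) *\<^sub>R f x) \<in> L2" by (rule L2_bound(1)[OF _ i le]) measurable
  have "mass (\<lambda>x. sqrt (w x) *\<^sub>R f x) \<le> (LINT x|lborel. 2 * (norm (f x))\<^sup>2)" by (rule L2_bound(2)[OF _ i le]) measurable
  then show "mass (\<lambda>x. sqrt (w x) *\<^sub>R f x) \<le> 2 * mass f" by (simp add: mass_def)
qed

lemma weighted_averages_converge:
  fixes f :: "nat \<Rightarrow> real^'n::finite \<Rightarrow> complex"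
  assumes f: "\<And>n. f n \<in> L2" and A: "\<And>n. mass (f n) \<le> A" and t: "0 < t"
    and w: "w \<in> borel_measurable borel" "integrable lborel w" "\<And>x. 0 < w x"
    and conv: "\<And>x. convergent (\<lambda>n. cube_avg t (f n) x)"
  obtains a where "\<And>n. (\<lambda>x. sqrt (w x) *\<^sub>R (cube_avg t (f n) x - a x)) \<in> L2"
    "(\<lambda>n. mass (\<lambda>x. sqrt (w x) *\<^sub>R (cube_avg t (f n) x - a x))) \<longlonglongrightarrow> 0"
proof -
  have [measurable]: "w \<in> borel_measurable borel" by (rule w)
  have [measurable]: "cube_avg t (f n) \<in> borel_measurable borel" for n using f[of n] by (intro cube_avg_measurable) auto
  define a where "a x = lim (\<lambda>n. cube_avg t (f n) x)" for x
  have lim: "(\<lambda>n. cube_avg t (f n) x) \<longlonglongrightarrow> a x" for x using conv[of x] by (simp add: a_def convergent_LIMSEQ_iff)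
  have [measurable]: "a \<in> borel_measurable borel" by (rule borel_measurable_LIMSEQ_metric[OF _ lim]) simp
  define B where "B = sqrt (A / t ^ CARD('n))"
  have b: "norm (cube_avg t (f n) x) \<le> B" for n x unfolding B_def by (rule cube_avg_uniform_bound[OF f A t])
  have ba: "norm (a x) \<le> B" for x
    by (rule LIMSEQ_le_const2[OF tendsto_norm[OF lim]]) (use b in blast)
  have i: "integrable lborel (\<lambda>x. w x * (4 * B\<^sup>2))" using w(2) by simp
  have le: "(norm (sqrt (w x) *\<^sub>R (cube_avg t (f n) x - a x)))\<^sup>2 \<le> w x * (4 * B\<^sup>2)" for n x
  proof -
    have "(norm (cube_avg t (f n) x - a x))\<^sup>2 \<le> (B + B)\<^sup>2"
      using norm_triangle_ineq4[of "cube_avg t (f n) x" "a x"] b[of n x] ba[of x] by (intro power_mono) auto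
    also have "\<dots> = 4 * B\<^sup>2" by (simp add: power2_eq_square)
    finally show ?thesis using w(3)[of x] by (simp add: power_mult_distrib less_imp_le mult_left_mono)
  qed
  show thesis
  proof (rule that)
    show "(\<lambda>x. sqrt (w x) *\<^sub>R (cube_avg t (f n) x - a x)) \<in> L2" for n
      by (rule L2_bound(1)[OF _ i le]) measurable
    have "(\<lambda>n. LINT x|lborel. (norm (sqrt (w x) *\<^sub>R (cube_avg t (f n) x - a x)))\<^sup>2) \<longlonglongrightarrow> (LINT x::real^'n|lborel. 0)"
    proof (rule integral_dominated_convergence[OF _ _ i])
      show "AE x in lborel. (\<lambda>n. (norm (sqrt (w x) *\<^sub>R (cube_avg t (f n) x - a x)))\<^sup>2) \<longlonglongrightarrow> 0"
      proof (rule AE_I2)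
        fix x
        have "(\<lambda>n. (norm (sqrt (w x) *\<^sub>R (cube_avg t (f n) x - a x)))\<^sup>2) \<longlonglongrightarrow> (norm (sqrt (w x) *\<^sub>R (a x - a x)))\<^sup>2"
          by (intro tendsto_intros lim)
        then show "(\<lambda>n. (norm (sqrt (w x) *\<^sub>R (cube_avg t (f n) x - a x)))\<^sup>2) \<longlonglongrightarrow> 0" by simp
      qed
      show "AE x in lborel. norm ((norm (sqrt (w x) *\<^sub>R (cube_avg t (f n) x - a x)))\<^sup>2) \<le> w x * (4 * B\<^sup>2)" for n
        using le[of _ n] by simp
    qed measurable
    then show "(\<lambda>n. mass (\<lambda>x. sqrt (w x) *\<^sub>R (cube_avg t (f n) x - a x))) \<longlonglongrightarrow> 0" by (simp add: mass_def)
  qed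
qed

text \<open>
  In the weighted norm, \<open>f (d n)\<close> is close to its averages at a small scale, uniformly in \<open>n\<close>, and the averages
  converge by dominated convergence; so the sequence is Cauchy.
\<close>

theorem Rellich:
  fixes f :: "nat \<Rightarrow> real^'n::finite \<Rightarrow> complex"
  assumes f: "\<And>n. f n \<in> H1" and A: "\<And>n. mass (f n) \<le> A" and C: "\<And>n. kin (f n) \<le> C"
  obtains r g where "strict_mono (r :: nat \<Rightarrow> nat)" "g \<in> H1" "AE x in lborel. (\<lambda>n. f (r n) x) \<longlonglongrightarrow> g x"
    "\<And>R. (\<lambda>n. mass (\<lambda>x. indicator (ball 0 R) x *\<^sub>R (f (r n) x - g x))) \<longlonglongrightarrow> 0"
proof -
  note fL = H1_L2[OF f]
  obtain d where d: "strict_mono (d :: nat \<Rightarrow> nat)" "\<And>j x. convergent (\<lambda>n. cube_avg ((1/2)^j) (f (d n)) x)"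
    by (rule cube_avg_subsequence[of f A C, OF f A C]) (rule that; assumption)
  obtain w :: "real^'n \<Rightarrow> real" where w: "w \<in> borel_measurable borel" "integrable lborel w"
    "\<And>x. 0 < w x" "\<And>x. w x \<le> 2" "\<And>R. \<exists>c>0. \<forall>x. norm x < R \<longrightarrow> c \<le> w x"
    using exists_weight by blast
  have [measurable]: "w \<in> borel_measurable borel" by (rule w)
  note wL = weighted_L2[OF w(1,3,4)]
  define h where "h n x = sqrt (w x) *\<^sub>R f (d n) x" for n x
  have hL: "h n \<in> L2" for n unfolding h_def[abs_def] by (rule wL(1)[OF fL])
  have C0: "0 \<le> C" using order_trans[OF kin_nonneg C] .
  have "\<exists>N. \<forall>m\<ge>N. \<forall>n\<ge>N. mass (\<lambda>x. h m x - h n x) < e" if e: "0 < e" for e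
  proof -
    define K where "K = real CARD('n) * C"
    have K: "0 \<le> K" using C0 by (simp add: K_def)
    obtain j where j: "(1/4::real)^j < e / (64 * (K + 1))"
      using real_arch_pow_inv[of "e / (64 * (K + 1))" "1/4"] e K by auto
    define t where "t = (1/2::real)^j"
    have t: "0 < t" by (simp add: t_def)
    have t2: "t\<^sup>2 = (1/4)^j" by (simp add: t_def power2_eq_square power_mult_distrib[symmetric])
    have Kt: "K * t\<^sup>2 \<le> e / 64"
    proof -
      have "K * t\<^sup>2 \<le> (K + 1) * (e / (64 * (K + 1)))"
        using j K e unfolding t2 by (intro mult_mono) auto
      also have "\<dots> = e / 64" using K by (simp add: field_simps)
      finally show ?thesis .
    qed
    obtain a where a: "\<And>n. (\<lambda>x. sqrt (w x) *\<^sub>R (cube_avg t (f (d n)) x - a x)) \<in> L2"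
      "(\<lambda>n. mass (\<lambda>x. sqrt (w x) *\<^sub>R (cube_avg t (f (d n)) x - a x))) \<longlonglongrightarrow> 0"
      by (rule weighted_averages_converge[of "\<lambda>n. f (d n)" A t w]) (use fL A t w d(2)[of j] in \<open>auto simp: t_def\<close>)
    obtain N where N: "\<And>n. n \<ge> N \<Longrightarrow> mass (\<lambda>x. sqrt (w x) *\<^sub>R (cube_avg t (f (d n)) x - a x)) < e / 16"
      using order_tendstoD(2)[OF a(2), of "e/16"] e by (auto simp: eventually_sequentially)
    define b where "b n x = sqrt (w x) *\<^sub>R (f (d n) x - cube_avg t (f (d n)) x)" for n x
    have b: "b n \<in> L2" "mass (b n) \<le> e / 32" for n
    proof -
      note ce = cube_avg_error[OF f t, of "d n"]
      show "b n \<in> L2" unfolding b_def[abs_def] by (rule wL(1)[OF ce(1)])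
      have "mass (b n) \<le> 2 * mass (\<lambda>x. f (d n) x - cube_avg t (f (d n)) x)" unfolding b_def[abs_def] by (rule wL(2)[OF ce(1)])
      also have "\<dots> \<le> 2 * (K * t\<^sup>2)"
        using order_trans[OF ce(2) mult_left_mono[OF C[of "d n"], of "CARD('n) * t\<^sup>2"]] by (simp add: K_def mult_ac)
      finally show "mass (b n) \<le> e / 32" using Kt by simp
    qed
    define c where "c n x = b n x + sqrt (w x) *\<^sub>R (cube_avg t (f (d n)) x - a x)" for n x
    have c: "c n \<in> L2" "mass (c n) \<le> 2 * mass (b n) + 2 * mass (\<lambda>x. sqrt (w x) *\<^sub>R (cube_avg t (f (d n)) x - a x))" for n
      unfolding c_def[abs_def] by (intro L2_add b a)+
    have "mass (\<lambda>x. h m x - h n x) < e" if "m \<ge> N" "n \<ge> N" for m n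
    proof -
      have "(\<lambda>x. h m x - h n x) = (\<lambda>x. c m x - c n x)" by (simp add: h_def c_def b_def fun_eq_iff algebra_simps)
      then have "mass (\<lambda>x. h m x - h n x) \<le> 2 * mass (c m) + 2 * mass (c n)" using L2_diff(2)[OF c(1) c(1)] by simp
      then show ?thesis using c(2)[of m] c(2)[of n] b(2)[of m] b(2)[of n] N[OF that(1)] N[OF that(2)] e by linarith
    qed
    then show ?thesis by blast
  qed
  from L2_complete[OF hL this] obtain gg q where g: "gg \<in> L2" "strict_mono (q :: nat \<Rightarrow> nat)"
    "AE x in lborel. (\<lambda>k. h (q k) x) \<longlonglongrightarrow> gg x" "(\<lambda>n. mass (\<lambda>x. h n x - gg x)) \<longlonglongrightarrow> 0" by blast
  have [measurable]: "gg \<in> borel_measurable borel" using g(1) by auto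
  define r where "r = d \<circ> q"
  define G where "G x = (1 / sqrt (w x)) *\<^sub>R gg x" for x
  have [measurable]: "G \<in> borel_measurable borel" unfolding G_def[abs_def] by measurable
  have sw: "0 < sqrt (w x)" for x using w(3)[of x] by simp
  have AE: "AE x in lborel. (\<lambda>n. f (r n) x) \<longlonglongrightarrow> G x"
    using g(3)
  proof eventually_elim
    fix x assume "(\<lambda>k. h (q k) x) \<longlonglongrightarrow> gg x"
    then have "(\<lambda>k. (1 / sqrt (w x)) *\<^sub>R h (q k) x) \<longlonglongrightarrow> G x" unfolding G_def by (intro tendsto_intros)
    then show "(\<lambda>n. f (r n) x) \<longlonglongrightarrow> G x" using sw[of x] by (simp add: h_def r_def)
  qed
  have GH: "G \<in> H1" by (rule H1_Fatou(1)[OF f _ AE A C]) measurable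
  show thesis
  proof (rule that[OF _ GH AE])
    show "strict_mono r" unfolding r_def by (intro strict_mono_o d g)
    fix R :: real
    obtain c where c: "c > 0" "\<And>x. norm x < R \<Longrightarrow> c \<le> w x" using w(5)[of R] by auto
    have le: "mass (\<lambda>x. indicator (ball 0 R) x *\<^sub>R (f (r n) x - G x)) \<le> (1/c) * mass (\<lambda>x. h (q n) x - gg x)" for n
    proof -
      have L: "(\<lambda>x. h (q n) x - gg x) \<in> L2" by (intro L2_diff hL g)
      have "mass (\<lambda>x. indicator (ball 0 R) x *\<^sub>R (f (r n) x - G x)) \<le> (LINT x|lborel. (1/c) * (norm (h (q n) x - gg x))\<^sup>2)"
      proof (rule L2_bound(2))
        show "(\<lambda>x. indicator (ball 0 R) x *\<^sub>R (f (r n) x - G x)) \<in> borel_measurable borel"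
          by (intro borel_measurable_scaleR borel_measurable_indicator borel_measurable_diff
              L2_measurable[OF fL] L2_measurable[OF H1_L2[OF GH]]) simp
        show "integrable lborel (\<lambda>x. (1/c) * (norm (h (q n) x - gg x))\<^sup>2)" using L2_integrable[OF L] by simp
        fix x :: "real^'n"
        have hg: "h (q n) x - gg x = sqrt (w x) *\<^sub>R (f (r n) x - G x)"
          using sw[of x] w(3)[of x] by (simp add: h_def r_def G_def scaleR_diff_right)
        have nn: "(norm (h (q n) x - gg x))\<^sup>2 = w x * (norm (f (r n) x - G x))\<^sup>2"
          unfolding hg using w(3)[of x] by (simp add: power_mult_distrib less_imp_le)
        show "(norm (indicator (ball 0 R) x *\<^sub>R (f (r n) x - G x)))\<^sup>2 \<le> (1/c) * (norm (h (q n) x - gg x))\<^sup>2"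
        proof (cases "norm x < R")
          case True
          have "c * (norm (f (r n) x - G x))\<^sup>2 \<le> w x * (norm (f (r n) x - G x))\<^sup>2"
            using c(2)[OF True] by (rule mult_right_mono) simp
          then show ?thesis unfolding nn using True c(1) by (simp add: field_simps)
        next
          case False
          then show ?thesis using c(1) by simp
        qed
      qed
      then show ?thesis by (simp add: mass_def)
    qed
    have "(\<lambda>n. (1/c) * mass (\<lambda>x. h (q n) x - gg x)) \<longlonglongrightarrow> (1/c) * 0"
      using LIMSEQ_subseq_LIMSEQ[OF g(4) g(2)] by (intro tendsto_mult tendsto_const) (simp add: o_def)
    then have lim0: "(\<lambda>n. (1/c) * mass (\<lambda>x. h (q n) x - gg x)) \<longlonglongrightarrow> 0" by simp
    show "(\<lambda>n. mass (\<lambda>x. indicator (ball 0 R) x *\<^sub>R (f (r n) x - G x))) \<longlonglongrightarrow> 0"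
      by (rule Lim_null_comparison[OF _ lim0]) (use le in auto)
  qed
qed

section \<open>Convex superadditive nonlinearities\<close>

text \<open>
  What the variational argument uses of \<open>G\<close>. Here \<open>\<gamma> \<rho>\<close> is a Lipschitz constant of \<open>G\<close> on the square of
  side \<open>\<rho>\<close>; \<open>\<gamma>_small\<close> and \<open>\<gamma>_large\<close> are the behaviour of the derivatives near zero and near infinity, in a form that
  allows integration.
\<close>

locale nonlinearity =
  fixes G :: "real \<times> real \<Rightarrow> real" and \<gamma> :: "real \<Rightarrow> real" and p :: real
  assumes p: "0 < p"
    and G_zero: "G (0, 0) = 0"
    and G_cont: "continuous_on quadrant G"
    and G_superadd: "\<And>s t h k. 0 \<le> s \<Longrightarrow> 0 \<le> t \<Longrightarrow> 0 \<le> h \<Longrightarrow> 0 \<le> k \<Longrightarrow> G (s, t) + G (h, k) \<le> G (s + h, t + k)"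
    and G_convex: "\<And>s t s' t' l. 0 \<le> s \<Longrightarrow> s \<le> s' \<Longrightarrow> 0 \<le> t \<Longrightarrow> t \<le> t' \<Longrightarrow> 0 \<le> l \<Longrightarrow> l \<le> 1 \<Longrightarrow>
      G ((1 - l) * s + l * s', (1 - l) * t + l * t') \<le> (1 - l) * G (s, t) + l * G (s', t')"
    and G_nonneg: "\<And>s t. 0 \<le> s \<Longrightarrow> 0 \<le> t \<Longrightarrow> 0 \<le> G (s, t)"
    and G_Lipschitz: "\<And>s t s' t' \<rho>. 0 \<le> s \<Longrightarrow> 0 \<le> t \<Longrightarrow> 0 \<le> s' \<Longrightarrow> 0 \<le> t' \<Longrightarrow> s \<le> \<rho> \<Longrightarrow> t \<le> \<rho> \<Longrightarrow> s' \<le> \<rho> \<Longrightarrow> t' \<le> \<rho> \<Longrightarrow>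
      \<bar>G (s, t) - G (s', t')\<bar> \<le> \<gamma> \<rho> * (\<bar>s - s'\<bar> + \<bar>t - t'\<bar>)"
    and \<gamma>_nonneg: "\<And>\<rho>. 0 \<le> \<rho> \<Longrightarrow> 0 \<le> \<gamma> \<rho>"
    and \<gamma>_small: "\<And>\<epsilon>. 0 < \<epsilon> \<Longrightarrow> \<exists>C\<ge>0. \<forall>\<rho>\<ge>0. \<gamma> \<rho> \<le> \<epsilon> + C * \<rho> powr p"
    and \<gamma>_large: "\<And>\<epsilon>. 0 < \<epsilon> \<Longrightarrow> \<exists>C\<ge>0. \<forall>\<rho>\<ge>0. \<gamma> \<rho> \<le> C + \<epsilon> * \<rho> powr p"
    and G_mix: "\<And>s t. 0 < s \<Longrightarrow> 0 < t \<Longrightarrow> G (s, 0) + G (0, t) < G (s, t)"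
begin

lemma G_le:
  assumes "0 \<le> s" "0 \<le> t" shows "G (s, t) \<le> \<gamma> (s + t) * (s + t)"
  using G_Lipschitz[of s t 0 0 "s + t"] G_zero assms by (simp add: abs_le_iff)

lemma G_measurable:
  assumes [measurable]: "f \<in> borel_measurable N" "g \<in> borel_measurable N"
    and nn: "\<And>x. 0 \<le> f x" "\<And>x. 0 \<le> g x"
  shows "(\<lambda>x. G (f x, g x)) \<in> borel_measurable N"
proof -
  have "continuous_on UNIV (\<lambda>z::real \<times> real. G (max 0 (fst z), max 0 (snd z)))"
    by (intro continuous_on_compose2[OF G_cont] continuous_intros) (auto simp: quadrant_def)
  then have "(\<lambda>z::real \<times> real. G (max 0 (fst z), max 0 (snd z))) \<in> borel_measurable borel"
    by (rule borel_measurable_continuous_onI)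
  from measurable_compose[OF borel_measurable_Pair[OF assms(1,2)] this] show ?thesis using nn by (simp add: max_def)
qed

text \<open>
  The pointwise bound behind continuity of the potential energy. Increments of the arguments that are small compared with
  the arguments are absorbed by \<open>\<eta>\<close>; otherwise the arguments are bounded by a multiple of the increments.
\<close>

lemma G_increment:
  assumes \<eta>: "0 < \<eta>" "\<eta> \<le> 1"
  obtains K where "0 \<le> K"
    "\<And>(a::complex) (b::complex) (c::complex) (d::complex) \<rho> \<delta>.
      \<rho> = (norm a)\<^sup>2 + (norm b)\<^sup>2 + ((norm c)\<^sup>2 + (norm d)\<^sup>2) \<Longrightarrow> \<delta> = (norm (a - c))\<^sup>2 + (norm (b - d))\<^sup>2 \<Longrightarrow>
      \<bar>G ((norm a)\<^sup>2, (norm b)\<^sup>2) - G ((norm c)\<^sup>2, (norm d)\<^sup>2)\<bar>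
        \<le> \<eta> * (\<rho> + \<rho> * \<rho> powr p) + K * (\<delta> + \<delta> * \<delta> powr p)"
proof -
  obtain C where C: "0 \<le> C" "\<And>\<rho>. 0 \<le> \<rho> \<Longrightarrow> \<gamma> \<rho> \<le> C + \<rho> powr p"
    using \<gamma>_large[of 1] by auto
  define B where "B = C + 1"
  have B: "0 < B" "C \<le> B" "1 \<le> B" using C(1) by (auto simp: B_def)
  have \<gamma>B: "\<gamma> \<rho> \<le> B * (1 + \<rho> powr p)" if "0 \<le> \<rho>" for \<rho>
  proof -
    have "B * (1 + \<rho> powr p) = C + \<rho> powr p + 1 + C * \<rho> powr p" by (simp add: B_def algebra_simps)
    moreover have "0 \<le> C * \<rho> powr p" using C(1) by simp
    ultimately show ?thesis using C(2)[OF that] by linarith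
  qed
  \<comment> \<open>\<open>\<theta>\<close> measures the relative size of the increment below which it is absorbed by \<open>\<eta>\<close>\<close>
  define \<theta> where "\<theta> = \<eta> / (4 * B)"
  have \<theta>: "0 < \<theta>" "\<theta> \<le> 1" using \<eta> B by (auto simp: \<theta>_def divide_le_eq)
  define K where "K = 4 * B * (1 / \<theta>\<^sup>2) * (1 + (1 / \<theta>\<^sup>2) powr p)"
  have K: "0 \<le> K" using B by (simp add: K_def)
  show thesis
  proof (rule that[OF K])
    fix a b c d :: complex and \<rho> \<delta> :: real
    assume \<rho>_def: "\<rho> = (norm a)\<^sup>2 + (norm b)\<^sup>2 + ((norm c)\<^sup>2 + (norm d)\<^sup>2)"
      and \<delta>_def: "\<delta> = (norm (a - c))\<^sup>2 + (norm (b - d))\<^sup>2"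
    have \<rho>: "0 \<le> \<rho>" and \<delta>: "0 \<le> \<delta>" by (simp_all add: \<rho>_def \<delta>_def)
    have sq: "\<bar>(norm x)\<^sup>2 - (norm y)\<^sup>2\<bar> \<le> norm (x - y) * (norm x + norm y)" for x y :: complex
    proof -
      have "\<bar>(norm x)\<^sup>2 - (norm y)\<^sup>2\<bar> = \<bar>norm x - norm y\<bar> * (norm x + norm y)"
        by (simp add: power2_eq_square square_diff_square_factored abs_mult mult.commute)
      also have "\<dots> \<le> norm (x - y) * (norm x + norm y)"
        by (intro mult_right_mono norm_triangle_ineq3) auto
      finally show ?thesis .
    qed
    have sq2: "\<bar>(norm x)\<^sup>2 - (norm y)\<^sup>2\<bar> \<le> 2 * sqrt \<delta> * sqrt \<rho>"
      if "(norm (x - y))\<^sup>2 \<le> \<delta>" "(norm x)\<^sup>2 \<le> \<rho>" "(norm y)\<^sup>2 \<le> \<rho>" for x y :: complex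
    proof -
      have "norm (x - y) * (norm x + norm y) \<le> sqrt \<delta> * (sqrt \<rho> + sqrt \<rho>)"
        using that \<rho> \<delta> by (intro mult_mono add_mono real_le_rsqrt) auto
      then show ?thesis using sq[of x y] by simp
    qed
    have "\<bar>(norm a)\<^sup>2 - (norm c)\<^sup>2\<bar> + \<bar>(norm b)\<^sup>2 - (norm d)\<^sup>2\<bar> \<le> 4 * (sqrt \<delta> * sqrt \<rho>)"
      using sq2[of a c] sq2[of b d] by (simp add: \<rho>_def \<delta>_def)
    then have main: "\<bar>G ((norm a)\<^sup>2, (norm b)\<^sup>2) - G ((norm c)\<^sup>2, (norm d)\<^sup>2)\<bar> \<le> \<gamma> \<rho> * (4 * (sqrt \<delta> * sqrt \<rho>))"
      using G_Lipschitz[of "(norm a)\<^sup>2" "(norm b)\<^sup>2" "(norm c)\<^sup>2" "(norm d)\<^sup>2" \<rho>]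
        mult_left_mono[OF _ \<gamma>_nonneg[OF \<rho>]] by (fastforce simp: \<rho>_def)
    have "\<gamma> \<rho> * (4 * (sqrt \<delta> * sqrt \<rho>)) \<le> \<eta> * (\<rho> + \<rho> * \<rho> powr p) + K * (\<delta> + \<delta> * \<delta> powr p)"
    proof (cases "sqrt \<delta> \<le> \<theta> * sqrt \<rho>")
      case True
      have "sqrt \<delta> * sqrt \<rho> \<le> \<theta> * sqrt \<rho> * sqrt \<rho>" using True \<rho> by (intro mult_right_mono) auto
      also have "\<dots> = \<theta> * \<rho>" using \<rho> by simp
      finally have s4: "4 * (sqrt \<delta> * sqrt \<rho>) \<le> 4 * (\<theta> * \<rho>)" by simp
      have "\<gamma> \<rho> * (4 * (sqrt \<delta> * sqrt \<rho>)) \<le> (B * (1 + \<rho> powr p)) * (4 * (\<theta> * \<rho>))"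
        by (rule mult_mono[OF \<gamma>B[OF \<rho>] s4]) (use B \<rho> \<delta> in auto)
      also have "\<dots> = \<eta> * (\<rho> + \<rho> * \<rho> powr p)" using B by (simp add: \<theta>_def field_simps)
      also have "\<dots> \<le> \<eta> * (\<rho> + \<rho> * \<rho> powr p) + K * (\<delta> + \<delta> * \<delta> powr p)"
        using K \<delta> by simp
      finally show ?thesis .
    next
      case False
      then have "sqrt \<rho> < sqrt \<delta> / \<theta>" using \<theta> by (simp add: field_simps)
      then have "(sqrt \<rho>)\<^sup>2 \<le> (sqrt \<delta> / \<theta>)\<^sup>2" using \<rho> by (intro power_mono) auto
      then have \<rho>\<delta>: "\<rho> \<le> \<delta> * (1 / \<theta>\<^sup>2)" using \<rho> \<delta> by (simp add: power_divide)
      have one: "1 \<le> 1 / \<theta>\<^sup>2" using \<theta> by (simp add: power_le_one)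
      have \<delta>\<delta>: "\<delta> \<le> \<delta> * (1 / \<theta>\<^sup>2)" using mult_left_mono[OF one \<delta>] by simp
      have "sqrt \<delta> * sqrt \<rho> \<le> sqrt (\<delta> * (1 / \<theta>\<^sup>2)) * sqrt (\<delta> * (1 / \<theta>\<^sup>2))"
        using \<rho>\<delta> \<delta>\<delta> \<rho> \<delta> by (intro mult_mono real_sqrt_le_mono) auto
      also have "\<dots> = \<delta> * (1 / \<theta>\<^sup>2)" using \<delta> by simp
      finally have s: "sqrt \<delta> * sqrt \<rho> \<le> \<delta> * (1 / \<theta>\<^sup>2)" .
      have "\<rho> powr p \<le> (\<delta> * (1 / \<theta>\<^sup>2)) powr p" using \<rho>\<delta> \<rho> p by (intro powr_mono2) auto
      also have "\<dots> = \<delta> powr p * (1 / \<theta>\<^sup>2) powr p" by (rule powr_mult)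
      finally have pw: "\<rho> powr p \<le> \<delta> powr p * (1 / \<theta>\<^sup>2) powr p" .
      have pw2: "1 + \<rho> powr p \<le> (1 + (1 / \<theta>\<^sup>2) powr p) * (1 + \<delta> powr p)"
        using pw by (simp add: algebra_simps add_increasing)
      have "\<gamma> \<rho> * (4 * (sqrt \<delta> * sqrt \<rho>)) \<le> (B * ((1 + (1 / \<theta>\<^sup>2) powr p) * (1 + \<delta> powr p))) * (4 * (\<delta> * (1 / \<theta>\<^sup>2)))"
      proof (rule mult_mono)
        show "\<gamma> \<rho> \<le> B * ((1 + (1 / \<theta>\<^sup>2) powr p) * (1 + \<delta> powr p))"
          using order_trans[OF \<gamma>B[OF \<rho>] mult_left_mono[OF pw2, of B]] B by simp
        show "4 * (sqrt \<delta> * sqrt \<rho>) \<le> 4 * (\<delta> * (1 / \<theta>\<^sup>2))" using s by simp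
        show "0 \<le> B * ((1 + (1 / \<theta>\<^sup>2) powr p) * (1 + \<delta> powr p))"
          using B by (intro mult_nonneg_nonneg add_nonneg_nonneg) auto
      qed (use \<rho> \<delta> in auto)
      also have "\<dots> = K * (\<delta> + \<delta> * \<delta> powr p)" by (simp add: K_def algebra_simps add_divide_distrib)
      also have "\<dots> \<le> \<eta> * (\<rho> + \<rho> * \<rho> powr p) + K * (\<delta> + \<delta> * \<delta> powr p)" using \<eta> \<rho> by simp
      finally show ?thesis .
    qed
    with main show "\<bar>G ((norm a)\<^sup>2, (norm b)\<^sup>2) - G ((norm c)\<^sup>2, (norm d)\<^sup>2)\<bar>
        \<le> \<eta> * (\<rho> + \<rho> * \<rho> powr p) + K * (\<delta> + \<delta> * \<delta> powr p)"
      by linarith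
  qed
qed

end


section \<open>Strict subadditivity from concavity\<close>

text \<open>
  The properties of the infimum \<open>e(\<alpha>, \<beta>)\<close> from which strict subadditivity follows, apart from the
  strict inequality for mixed masses, which is a premise of \<open>strict_subadditivity\<close> because its proof needs
  minimizers with one component.
\<close>

locale two_mass_energy =
  fixes e :: "real \<Rightarrow> real \<Rightarrow> real"
  assumes zero: "e 0 0 = 0"
    and sub: "\<And>a b c d. 0 \<le> a \<Longrightarrow> 0 \<le> b \<Longrightarrow> 0 \<le> c \<Longrightarrow> 0 \<le> d \<Longrightarrow> e (a + c) (b + d) \<le> e a b + e c d"
    and concave: "\<And>a b a' b' l. 0 \<le> a \<Longrightarrow> a \<le> a' \<Longrightarrow> 0 \<le> b \<Longrightarrow> b \<le> b' \<Longrightarrow> 0 \<le> l \<Longrightarrow> l \<le> 1 \<Longrightarrow>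
      (1 - l) * e a b + l * e a' b' \<le> e ((1 - l) * a + l * a') ((1 - l) * b + l * b')"
    and neg1: "\<And>a. 0 < a \<Longrightarrow> e a 0 < 0" and neg2: "\<And>b. 0 < b \<Longrightarrow> e 0 b < 0"
    and small: "\<And>\<epsilon>. 0 < \<epsilon> \<Longrightarrow> \<exists>d>0. \<forall>a b. 0 \<le> a \<longrightarrow> 0 \<le> b \<longrightarrow> a + b < d \<longrightarrow> - \<epsilon> * (a + b) \<le> e a b"
begin

lemma nonpos: "e a b \<le> 0" if "0 \<le> a" "0 \<le> b"
proof -
  have "e a 0 \<le> 0" "e 0 b \<le> 0" using neg1[of a] neg2[of b] zero that by (cases "a = 0"; cases "b = 0"; force)+
  then show ?thesis using sub[of a 0 0 b] that by simp
qed

lemma neg: "e a b < 0" if "0 \<le> a" "0 \<le> b" "0 < a + b"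
proof (cases "a = 0")
  case True then show ?thesis using neg2[of b] that by simp
next
  case False
  then show ?thesis using neg1[of a] nonpos[of 0 b] sub[of a 0 0 b] that by simp
qed

lemma mono: "e a' b' \<le> e a b" if "0 \<le> a" "a \<le> a'" "0 \<le> b" "b \<le> b'"
  using sub[of a b "a' - a" "b' - b"] nonpos[of "a' - a" "b' - b"] that by simp

text \<open>
  The value at \<open>(a + d, b + d)\<close> bounds the nearby values from below by monotonicity, and by concavity
  along the diagonal it is close to the value at \<open>(a, b)\<close>.
\<close>

lemma lsc:
  assumes "0 \<le> a" "0 \<le> b" "0 < \<epsilon>"
  shows "\<exists>d>0. \<forall>a' b'. 0 \<le> a' \<longrightarrow> 0 \<le> b' \<longrightarrow> a' < a + d \<longrightarrow> b' < b + d \<longrightarrow> e a b - \<epsilon> < e a' b'"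
proof -
  define D where "D = - e (a + 1) (b + 1) + 1"
  have D: "0 < D" using nonpos[of "a + 1" "b + 1"] assms by (simp add: D_def)
  define d where "d = min 1 (\<epsilon> / (2 * D))"
  have d: "0 < d" "d \<le> 1" "d * D < \<epsilon>"
  proof -
    show "0 < d" "d \<le> 1" using assms D by (auto simp: d_def)
    have "d * D \<le> \<epsilon> / (2 * D) * D" using D by (intro mult_right_mono) (auto simp: d_def)
    also have "\<dots> < \<epsilon>" using D assms by simp
    finally show "d * D < \<epsilon>" .
  qed
  have "e a b - \<epsilon> < e a' b'" if "0 \<le> a'" "0 \<le> b'" "a' < a + d" "b' < b + d" for a' b'
  proof -
    have "(1 - d) * e a b + d * e (a + 1) (b + 1) \<le> e ((1 - d) * a + d * (a + 1)) ((1 - d) * b + d * (b + 1))"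
      using assms d by (intro concave) auto
    also have "\<dots> = e (a + d) (b + d)" by (simp add: algebra_simps)
    also have "\<dots> \<le> e a' b'" using that by (intro mono) auto
    finally have 1: "(1 - d) * e a b + d * e (a + 1) (b + 1) \<le> e a' b'" .
    have "e a b \<le> (1 - d) * e a b"
      using mult_left_mono_neg[of "1 - d" 1 "e a b"] nonpos[OF assms(1,2)] d by (simp add: mult.commute)
    moreover have "- (d * D) \<le> d * e (a + 1) (b + 1)"
      unfolding D_def mult_minus_right[symmetric] using d by (intro mult_left_mono) auto
    ultimately show ?thesis using 1 d(3) by linarith
  qed
  then show ?thesis using d(1) by blast
qed

lemma swap: "two_mass_energy (\<lambda>a b. e b a)"
proof
  fix \<epsilon> :: real assume "0 < \<epsilon>"
  from small[OF this] show "\<exists>d>0. \<forall>a b. 0 \<le> a \<longrightarrow> 0 \<le> b \<longrightarrow> a + b < d \<longrightarrow> - \<epsilon> * (a + b) \<le> e b a"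
    by (metis add.commute)
qed (use zero sub concave neg1 neg2 in auto)

text \<open>
  Equality would make \<open>e(x, 0)\<close> agree at \<open>a\<close> with the chord from \<open>0\<close> to \<open>a + b\<close>, of negative slope
  \<open>c\<close>. Concavity then gives \<open>e(x, 0) \<le> c x\<close> below \<open>a\<close>, against the assumption \<open>small\<close> with \<open>\<epsilon> = - c / 2\<close>.
\<close>

lemma strict_one:
  assumes a: "0 < a" and b: "0 < b" shows "e (a + b) 0 < e a 0 + e b 0"
proof (rule ccontr)
  assume "\<not> ?thesis"
  then have ge: "e a 0 + e b 0 \<le> e (a + b) 0" by simp
  define c where "c = e (a + b) 0 / (a + b)"
  have c: "c < 0" using neg1[of "a + b"] a b by (simp add: c_def divide_neg_pos)
  have cab: "e (a + b) 0 = c * (a + b)" using a b by (simp add: c_def)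
  have chord: "c * x \<le> e x 0" if "0 \<le> x" "x \<le> a + b" for x
  proof -
    define l where "l = x / (a + b)"
    have "0 \<le> l" "l \<le> 1" using that a b by (auto simp: l_def)
    then have "(1 - l) * e 0 0 + l * e (a + b) 0 \<le> e ((1 - l) * 0 + l * (a + b)) ((1 - l) * 0 + l * 0)"
      using a b by (intro concave) auto
    then show ?thesis using a b by (simp add: zero cab l_def mult.commute)
  qed
  have "c * a + c * b = e (a + b) 0" by (simp add: cab algebra_simps)
  then have ea: "e a 0 = c * a" using chord[of a] chord[of b] ge a b by simp
  \<comment> \<open>concavity and the equality at \<open>a\<close> force a linear upper bound near zero\<close>
  have up: "e x 0 \<le> c * x" if x: "0 < x" "x < a" for x
  proof -
    define l where "l = (a - x) / (a + b - x)"
    have l: "0 \<le> l" "l < 1" using x b by (auto simp: l_def)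
    have pt: "(1 - l) * x + l * (a + b) = a"
    proof -
      have "l * (a + b - x) = a - x" using x b by (simp add: l_def)
      then show ?thesis by (simp add: algebra_simps)
    qed
    have "(1 - l) * e x 0 + l * e (a + b) 0 \<le> e ((1 - l) * x + l * (a + b)) ((1 - l) * 0 + l * 0)"
      using x b l by (intro concave) auto
    then have "(1 - l) * e x 0 + l * (c * (a + b)) \<le> c * ((1 - l) * x + l * (a + b))"
      using pt ea by (simp add: cab)
    then have "(1 - l) * e x 0 \<le> (1 - l) * (c * x)" by (simp add: algebra_simps)
    then show ?thesis using l by simp
  qed
  obtain d where d: "d > 0" "\<And>a b. 0 \<le> a \<Longrightarrow> 0 \<le> b \<Longrightarrow> a + b < d \<Longrightarrow> - (- c / 2) * (a + b) \<le> e a b"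
    using small[of "- c / 2"] c by auto
  define x where "x = min (a / 2) (d / 2)"
  have x: "0 < x" "x < a" "x < d" using a d(1) by (auto simp: x_def)
  have "c / 2 * x \<le> e x 0" using d(2)[of x 0] x by simp
  then have "c / 2 * x \<le> c * x" using up[OF x(1,2)] by linarith
  moreover have "c * x < c / 2 * x" using c x(1) by (simp add: mult_neg_pos)
  ultimately show False by simp
qed

text \<open>
  A concave function with an interior minimum is constant; here it is \<open>x \<mapsto> e(x, a2) + e(a1 + b1 - x, b2)\<close>
  on the interval from \<open>0\<close> to \<open>a1 + b1\<close>, and the conclusions are its two end values.
\<close>

lemma shift_first:
  assumes a: "0 < a1" "0 < b1" and n: "0 \<le> a2" "0 \<le> b2"
    and ge: "e a1 a2 + e b1 b2 \<le> e (a1 + b1) (a2 + b2)"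
  shows "e 0 a2 + e (a1 + b1) b2 \<le> e (a1 + b1) (a2 + b2)"
    and "e (a1 + b1) a2 + e 0 b2 \<le> e (a1 + b1) (a2 + b2)"
proof -
  define s where "s = a1 + b1"
  define c where "c = e s (a2 + b2)"
  define h where "h x = e x a2 + e (s - x) b2" for x
  have h_ge: "c \<le> h x" if "0 \<le> x" "x \<le> s" for x
    using sub[of x a2 "s - x" b2] that n by (simp add: c_def h_def)
  define l where "l = a1 / s"
  have s: "0 < s" using a by (simp add: s_def)
  have l: "0 < l" "l < 1" using a by (auto simp: l_def s_def)
  have ls: "l * s = a1" using s by (simp add: l_def)
  have "(1 - l) * e 0 a2 + l * e s a2 \<le> e ((1 - l) * 0 + l * s) ((1 - l) * a2 + l * a2)"
    using l s n by (intro concave) auto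
  then have 1: "(1 - l) * e 0 a2 + l * e s a2 \<le> e a1 a2" by (simp add: ls algebra_simps)
  have bs: "(1 - (1 - l)) * 0 + (1 - l) * s = b1" using ls by (simp add: s_def algebra_simps)
  have bb: "(1 - (1 - l)) * b2 + (1 - l) * b2 = b2" by (simp add: algebra_simps)
  have "(1 - (1 - l)) * e 0 b2 + (1 - l) * e s b2 \<le> e ((1 - (1 - l)) * 0 + (1 - l) * s) ((1 - (1 - l)) * b2 + (1 - l) * b2)"
    using l s n by (intro concave) auto
  then have 2: "l * e 0 b2 + (1 - l) * e s b2 \<le> e b1 b2" unfolding bs bb by simp
  have "(1 - l) * h 0 + l * h s = ((1 - l) * e 0 a2 + l * e s a2) + (l * e 0 b2 + (1 - l) * e s b2)"
    by (simp add: h_def algebra_simps)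
  also have "\<dots> \<le> c" using 1 2 ge by (simp add: c_def s_def)
  finally have le: "(1 - l) * h 0 + l * h s \<le> c" .
  have "(1 - l) * c \<le> (1 - l) * h 0" "l * c \<le> l * h s" using h_ge[of 0] h_ge[of s] l s by auto
  moreover have "(1 - l) * c + l * c = c" by (simp add: algebra_simps)
  ultimately have "(1 - l) * h 0 \<le> (1 - l) * c" "l * h s \<le> l * c" using le by linarith+
  then have "h 0 \<le> c" "h s \<le> c" using l by simp_all
  then show "e 0 a2 + e (a1 + b1) b2 \<le> e (a1 + b1) (a2 + b2)" "e (a1 + b1) a2 + e 0 b2 \<le> e (a1 + b1) (a2 + b2)"
    by (simp_all add: h_def c_def s_def)
qed

text \<open>
  An equality is transformed by \<open>shift_first\<close>, applied to either component, until both masses of each component sit on the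
  same side. What remains contradicts \<open>strict_one\<close> or the premise \<open>mix\<close>.
\<close>

theorem strict_subadditivity:
  assumes mix: "\<And>a b. 0 < a \<Longrightarrow> 0 < b \<Longrightarrow> e a b < e a 0 + e 0 b"
    and nn: "0 \<le> a1" "0 \<le> a2" "0 \<le> b1" "0 \<le> b2" and ne: "0 < a1 + a2" "0 < b1 + b2"
  shows "e (a1 + b1) (a2 + b2) < e a1 a2 + e b1 b2"
proof (rule ccontr)
  assume "\<not> ?thesis"
  then have ge: "e a1 a2 + e b1 b2 \<le> e (a1 + b1) (a2 + b2)" by simp
  interpret sw: two_mass_energy "\<lambda>a b. e b a" by (rule swap)
  show False
  proof (cases "0 < a1 \<and> 0 < b1")
    case True
    note S = shift_first[OF _ _ nn(2,4) ge]
    have 1: "e 0 a2 + e (a1 + b1) b2 \<le> e (a1 + b1) (a2 + b2)" "e (a1 + b1) a2 + e 0 b2 \<le> e (a1 + b1) (a2 + b2)"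
      using S True by auto
    consider "a2 = 0" "b2 = 0" | "a2 = 0" "0 < b2" | "0 < a2" "b2 = 0" | "0 < a2" "0 < b2" using nn by force
    then show False
    proof cases
      case 1 then show ?thesis using strict_one[of a1 b1] ge True by simp
    next
      case 2 then show ?thesis using mix[of "a1 + b1" b2] 1(2) True by simp
    next
      case 3 then show ?thesis using mix[of "a1 + b1" a2] 1(1) True by simp
    next
      case 4
      have "e 0 (a2 + b2) + e (a1 + b1) 0 \<le> e (a1 + b1) (a2 + b2)"
        using sw.shift_first(2)[of a2 b2 0 "a1 + b1"] 4 nn 1(1) by simp
      then show ?thesis using mix[of "a1 + b1" "a2 + b2"] True 4 by simp
    qed
  next
    case f1: False
    show False
    proof (cases "0 < a2 \<and> 0 < b2")
      case True
      have 1: "e a1 0 + e b1 (a2 + b2) \<le> e (a1 + b1) (a2 + b2)" "e a1 (a2 + b2) + e b1 0 \<le> e (a1 + b1) (a2 + b2)"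
        using sw.shift_first[of a2 b2 a1 b1] True nn ge by (auto simp: add.commute)
      consider "a1 = 0" "b1 = 0" | "a1 = 0" "0 < b1" | "0 < a1" "b1 = 0" using f1 nn by force
      then show False
      proof cases
        case 1 then show ?thesis using sw.strict_one[of a2 b2] ge True by simp
      next
        case 2 then show ?thesis using mix[of b1 "a2 + b2"] 1(2) True by simp
      next
        case 3 then show ?thesis using mix[of a1 "a2 + b2"] 1(1) True by simp
      qed
    next
      case False
      then have "(a1 = 0 \<and> b2 = 0 \<and> 0 < a2 \<and> 0 < b1) \<or> (a2 = 0 \<and> b1 = 0 \<and> 0 < a1 \<and> 0 < b2)"
        using f1 nn ne by force
      then show False using mix[of b1 a2] mix[of a1 b2] ge by auto
    qed
  qed
qed

end

section \<open>Structure of the nonlinearity from its derivatives\<close>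

lemma mean_value_from_right:
  fixes f f' :: "real \<Rightarrow> real"
  assumes d: "\<And>x. 0 \<le> x \<Longrightarrow> (f has_real_derivative f' x) (at x within {0..})"
    and ab: "0 \<le> a" "a \<le> b"
  obtains \<xi> where "a \<le> \<xi>" "\<xi> \<le> b" "f b - f a = f' \<xi> * (b - a)"
proof (cases "a = b")
  case True then show ?thesis using that[of a] by simp
next
  case False
  then have lt: "a < b" using ab by simp
  have "continuous_on {a..b} f"
  proof (rule DERIV_continuous_on)
    fix x assume "x \<in> {a..b}"
    then show "(f has_real_derivative f' x) (at x within {a..b})"
      by (intro DERIV_subset[OF d]) (use ab in auto)
  qed
  moreover have "(f has_derivative (*) (f' x)) (at x)" if "a < x" "x < b" for x
  proof -
    have "at x within {0..} = at x" using that ab by (intro at_within_interior) (simp add: interior_real_atLeast)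
    then show ?thesis using d[of x] that ab by (simp add: has_field_derivative_def)
  qed
  ultimately obtain \<xi> where "a < \<xi>" "\<xi> < b" "f b - f a = f' \<xi> * (b - a)"
    using mvt[OF lt, of f "\<lambda>x. (*) (f' x)"] by metis
  then show ?thesis using that[of \<xi>] by simp
qed

text \<open>
  The structural inequalities follow from the monotonicity (G4) by the mean value theorem. Increments of
  \<open>G\<close> grow under translation by vectors of the quadrant, which gives superadditivity and (G5) for all
  positive arguments instead of small ones only; the derivative along such a vector increases, which
  gives convexity. The derivatives vanish at the origin and
  increase from there, so they are nonnegative and \<open>g1 + g2\<close> on the diagonal is a Lipschitz constant.
\<close>

lemma nonlinearity_of_derivatives:
  fixes G g1 g2 :: "real \<times> real \<Rightarrow> real" and p :: real
  assumes p: "0 < p"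
    and G1: "C1_on_quadrant G g1 g2" "G (0, 0) = 0"
    and G2: "\<And>g. g \<in> {g1, g2} \<Longrightarrow> (g \<longlongrightarrow> 0) (at (0, 0) within quadrant)"
    and G3: "\<And>g. g \<in> {g1, g2} \<Longrightarrow>
      ((\<lambda>s. g s / norm s powr p) \<longlongrightarrow> 0) (inf at_infinity (principal quadrant))"
    and G4: "\<And>g s t h k. g \<in> {g1, g2} \<Longrightarrow> s \<ge> 0 \<Longrightarrow> t \<ge> 0 \<Longrightarrow> h \<ge> 0 \<Longrightarrow> k \<ge> 0 \<Longrightarrow>
      g (s, t) \<le> g (s + h, t + k)"
    and G5: "\<exists>\<sigma>>0. \<forall>s1 s2. 0 < s1 \<longrightarrow> s1 \<le> \<sigma> \<longrightarrow> 0 < s2 \<longrightarrow> s2 \<le> \<sigma> \<longrightarrow>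
      G (s1, 0) + G (0, s2) < G (s1, s2)"
  shows "nonlinearity G (\<lambda>\<rho>. g1 (\<rho>, \<rho>) + g2 (\<rho>, \<rho>)) p"
proof -
  have d1: "((\<lambda>x. G (x, t)) has_real_derivative g1 (s, t)) (at s within {0..})" if "0 \<le> s" "0 \<le> t" for s t
    using G1(1) that by (simp add: C1_on_quadrant_def)
  have d2: "((\<lambda>y. G (s, y)) has_real_derivative g2 (s, t)) (at t within {0..})" if "0 \<le> s" "0 \<le> t" for s t
    using G1(1) that by (simp add: C1_on_quadrant_def)
  have cont: "continuous_on quadrant G" "continuous_on quadrant g1" "continuous_on quadrant g2"
    using G1(1) by (auto simp: C1_on_quadrant_def)
  have mono: "g (s, t) \<le> g (s', t')" if "g \<in> {g1, g2}" "0 \<le> s" "s \<le> s'" "0 \<le> t" "t \<le> t'" for g s t s' t'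
    using G4[OF that(1), of s t "s' - s" "t' - t"] that by simp
  have g00: "g (0, 0) = 0" if "g \<in> {g1, g2}" for g
  proof -
    have q0: "(0, 0) \<in> quadrant" by (simp add: quadrant_def)
    have "continuous_on quadrant g" using cont that by auto
    then have "(g \<longlongrightarrow> g (0, 0)) (at (0, 0) within quadrant)" using q0 by (simp add: continuous_on_def)
    moreover have "at (0, 0) within quadrant \<noteq> bot"
    proof -
      have "(0::real \<times> real) islimpt quadrant"
        unfolding islimpt_approachable
      proof (intro allI impI)
        fix e :: real assume "0 < e"
        then show "\<exists>x'\<in>quadrant. x' \<noteq> 0 \<and> dist x' (0::real \<times> real) < e"
          by (intro bexI[of _ "(e/2, 0)"]) (auto simp: quadrant_def dist_norm norm_prod_def zero_prod_def)
      qed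
      then show ?thesis by (simp add: trivial_limit_within zero_prod_def)
    qed
    ultimately show ?thesis using tendsto_unique[OF _ _ G2[OF that]] by blast
  qed
  have nn: "0 \<le> g (s, t)" if "g \<in> {g1, g2}" "0 \<le> s" "0 \<le> t" for g s t
    using mono[OF that(1), of 0 s 0 t] g00[OF that(1)] that by simp
  define \<gamma> where "\<gamma> \<rho> = g1 (\<rho>, \<rho>) + g2 (\<rho>, \<rho>)" for \<rho>
  have inc1: "\<exists>\<xi>\<ge>s. \<xi> \<le> s' \<and> G (s', t) - G (s, t) = g1 (\<xi>, t) * (s' - s)" if "0 \<le> s" "s \<le> s'" "0 \<le> t" for s s' t
    by (rule mean_value_from_right[of "\<lambda>x. G (x, t)" "\<lambda>x. g1 (x, t)" s s']) (use d1 that in auto)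
  have inc2: "\<exists>\<xi>\<ge>t. \<xi> \<le> t' \<and> G (s, t') - G (s, t) = g2 (s, \<xi>) * (t' - t)" if "0 \<le> t" "t \<le> t'" "0 \<le> s" for t t' s
    by (rule mean_value_from_right[of "\<lambda>y. G (s, y)" "\<lambda>y. g2 (s, y)" t t']) (use d2 that in auto)
  have Lip: "\<bar>G (s, t) - G (s', t')\<bar> \<le> \<gamma> \<rho> * (\<bar>s - s'\<bar> + \<bar>t - t'\<bar>)"
    if "0 \<le> s" "0 \<le> t" "0 \<le> s'" "0 \<le> t'" "s \<le> \<rho>" "t \<le> \<rho>" "s' \<le> \<rho>" "t' \<le> \<rho>" for s t s' t' \<rho>
  proof -
    have \<rho>: "0 \<le> \<rho>" using that by simp
    have g_le: "g1 (a, b) \<le> \<gamma> \<rho>" "g2 (a, b) \<le> \<gamma> \<rho>" if "0 \<le> a" "a \<le> \<rho>" "0 \<le> b" "b \<le> \<rho>" for a b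
      using mono[of g1 a \<rho> b \<rho>] mono[of g2 a \<rho> b \<rho>] nn[of g1 \<rho> \<rho>] nn[of g2 \<rho> \<rho>] that \<rho> by (auto simp: \<gamma>_def)
    have one: "\<bar>G (b, t) - G (a, t)\<bar> \<le> \<gamma> \<rho> * \<bar>b - a\<bar>" if ab: "0 \<le> a" "a \<le> b" "b \<le> \<rho>" for a b
    proof -
      obtain \<xi> where \<xi>: "a \<le> \<xi>" "\<xi> \<le> b" "G (b, t) - G (a, t) = g1 (\<xi>, t) * (b - a)" using inc1[of a b t] ab \<open>0 \<le> t\<close> by auto
      have "0 \<le> g1 (\<xi>, t)" "g1 (\<xi>, t) \<le> \<gamma> \<rho>" using nn[of g1 \<xi> t] g_le(1)[of \<xi> t] \<xi> that \<open>0 \<le> t\<close> \<open>t \<le> \<rho>\<close> by auto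
      then show ?thesis unfolding \<xi>(3) abs_mult by (intro mult_right_mono) auto
    qed
    have two: "\<bar>G (s', b) - G (s', a)\<bar> \<le> \<gamma> \<rho> * \<bar>b - a\<bar>" if ab: "0 \<le> a" "a \<le> b" "b \<le> \<rho>" for a b
    proof -
      obtain \<xi> where \<xi>: "a \<le> \<xi>" "\<xi> \<le> b" "G (s', b) - G (s', a) = g2 (s', \<xi>) * (b - a)" using inc2[of a b s'] ab \<open>0 \<le> s'\<close> by auto
      have "0 \<le> g2 (s', \<xi>)" "g2 (s', \<xi>) \<le> \<gamma> \<rho>" using nn[of g2 s' \<xi>] g_le(2)[of s' \<xi>] \<xi> that \<open>0 \<le> s'\<close> \<open>s' \<le> \<rho>\<close> by auto
      then show ?thesis unfolding \<xi>(3) abs_mult by (intro mult_right_mono) auto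
    qed
    have "\<bar>G (s, t) - G (s', t)\<bar> \<le> \<gamma> \<rho> * \<bar>s - s'\<bar>"
      using one[of s s'] one[of s' s] that by (cases "s \<le> s'") (auto simp: abs_minus_commute)
    moreover have "\<bar>G (s', t) - G (s', t')\<bar> \<le> \<gamma> \<rho> * \<bar>t - t'\<bar>"
      using two[of t t'] two[of t' t] that by (cases "t \<le> t'") (auto simp: abs_minus_commute)
    moreover have "\<bar>G (s, t) - G (s', t')\<bar> \<le> \<bar>G (s, t) - G (s', t)\<bar> + \<bar>G (s', t) - G (s', t')\<bar>" by simp
    ultimately show ?thesis unfolding distrib_left by linarith
  qed
  \<comment> \<open>increments of \<open>F2\<close> are dominated by those of a translate of \<open>F1\<close> if its derivative is\<close>
  have shift: "F2 b - F2 a \<le> F1 (c + b) - F1 (c + a)"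
    if F1: "\<And>x. 0 \<le> x \<Longrightarrow> (F1 has_real_derivative f1 x) (at x within {0..})"
      and F2: "\<And>x. 0 \<le> x \<Longrightarrow> (F2 has_real_derivative f2 x) (at x within {0..})"
      and le: "\<And>x. 0 \<le> x \<Longrightarrow> f2 x \<le> f1 (c + x)" and nn: "0 \<le> c" "0 \<le> a" "a \<le> b"
    for F1 F2 f1 f2 :: "real \<Rightarrow> real" and a b c
  proof -
    have "((\<lambda>x. F1 (c + x) - F2 x) has_real_derivative f1 (c + x) - f2 x) (at x within {0..})" if x: "0 \<le> x" for x
    proof (rule DERIV_diff[OF _ F2[OF x]])
      have "(F1 has_real_derivative f1 (c + x)) (at (c + x) within (\<lambda>x. c + x) ` {0..})"
        by (rule DERIV_subset[OF F1]) (use x nn in auto)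
      moreover have "((\<lambda>x. c + x) has_real_derivative 1) (at x within {0..})"
        by (auto intro!: derivative_eq_intros)
      ultimately have "(F1 \<circ> (\<lambda>x. c + x) has_real_derivative f1 (c + x) * 1) (at x within {0..})"
        by (rule DERIV_image_chain)
      then show "((\<lambda>x. F1 (c + x)) has_real_derivative f1 (c + x)) (at x within {0..})" by (simp add: o_def)
    qed
    then obtain \<xi> where "a \<le> \<xi>" "(F1 (c + b) - F2 b) - (F1 (c + a) - F2 a) = (f1 (c + \<xi>) - f2 \<xi>) * (b - a)"
      by (rule mean_value_from_right[where f="\<lambda>x. F1 (c + x) - F2 x", of _ a b]) (use nn in auto)
    moreover have "0 \<le> (f1 (c + \<xi>) - f2 \<xi>) * (b - a)"
      using le[of \<xi>] nn \<open>a \<le> \<xi>\<close> by (intro mult_nonneg_nonneg) auto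
    ultimately show ?thesis by simp
  qed
  have up1: "G (b, t) - G (a, t) \<le> G (c + b, t') - G (c + a, t')" if "0 \<le> a" "a \<le> b" "0 \<le> c" "0 \<le> t" "t \<le> t'" for a b c t t'
    by (rule shift[of "\<lambda>x. G (x, t')" "\<lambda>x. g1 (x, t')" "\<lambda>x. G (x, t)" "\<lambda>x. g1 (x, t)"]) (use d1 mono that in auto)
  have up2: "G (s, b) - G (s, a) \<le> G (s', c + b) - G (s', c + a)" if "0 \<le> a" "a \<le> b" "0 \<le> c" "0 \<le> s" "s \<le> s'" for a b c s s'
    by (rule shift[of "\<lambda>x. G (s', x)" "\<lambda>x. g2 (s', x)" "\<lambda>x. G (s, x)" "\<lambda>x. g2 (s, x)"]) (use d2 mono that in auto)
  have super: "G (s, t) + G (h, k) \<le> G (s + h, t + k)" if "0 \<le> s" "0 \<le> t" "0 \<le> h" "0 \<le> k" for s t h k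
    using up1[of 0 h s k "t + k"] up2[of 0 k t 0 s] that G1(2) by simp
  have nonneg: "0 \<le> G (s, t)" if st: "0 \<le> s" "0 \<le> t" for s t
  proof -
    obtain \<xi> where 1: "0 \<le> \<xi>" "G (s, t) - G (0, t) = g1 (\<xi>, t) * (s - 0)" using inc1[of 0 s t] st by auto
    obtain \<zeta> where 2: "0 \<le> \<zeta>" "G (0, t) - G (0, 0) = g2 (0, \<zeta>) * (t - 0)" using inc2[of 0 t 0] st by auto
    have "0 \<le> g1 (\<xi>, t) * (s - 0)" "0 \<le> g2 (0, \<zeta>) * (t - 0)"
      using nn[of g1 \<xi> t] nn[of g2 0 \<zeta>] 1 2 that by auto
    then show ?thesis using 1 2 G1(2) by linarith
  qed
  have upper: "G (b1, b2) - G (a1, a2) \<le> g1 (b1, b2) * (b1 - a1) + g2 (b1, b2) * (b2 - a2)"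
    if ab: "0 \<le> a1" "a1 \<le> b1" "0 \<le> a2" "a2 \<le> b2" for a1 a2 b1 b2
  proof -
    obtain \<xi> where 1: "a1 \<le> \<xi>" "\<xi> \<le> b1" "G (b1, b2) - G (a1, b2) = g1 (\<xi>, b2) * (b1 - a1)" using inc1[of a1 b1 b2] ab by auto
    obtain \<zeta> where 2: "a2 \<le> \<zeta>" "\<zeta> \<le> b2" "G (a1, b2) - G (a1, a2) = g2 (a1, \<zeta>) * (b2 - a2)" using inc2[of a2 b2 a1] ab by auto
    have "g1 (\<xi>, b2) * (b1 - a1) \<le> g1 (b1, b2) * (b1 - a1)" "g2 (a1, \<zeta>) * (b2 - a2) \<le> g2 (b1, b2) * (b2 - a2)"
      using mono[of g1 \<xi> b1 b2 b2] mono[of g2 a1 b1 \<zeta> b2] 1 2 that by (auto intro!: mult_right_mono)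
    then show ?thesis using 1 2 by linarith
  qed
  have lower: "g1 (a1, a2) * (b1 - a1) + g2 (a1, a2) * (b2 - a2) \<le> G (b1, b2) - G (a1, a2)"
    if ab: "0 \<le> a1" "a1 \<le> b1" "0 \<le> a2" "a2 \<le> b2" for a1 a2 b1 b2
  proof -
    obtain \<xi> where 1: "a1 \<le> \<xi>" "\<xi> \<le> b1" "G (b1, b2) - G (a1, b2) = g1 (\<xi>, b2) * (b1 - a1)" using inc1[of a1 b1 b2] ab by auto
    obtain \<zeta> where 2: "a2 \<le> \<zeta>" "\<zeta> \<le> b2" "G (a1, b2) - G (a1, a2) = g2 (a1, \<zeta>) * (b2 - a2)" using inc2[of a2 b2 a1] ab by auto
    have "g1 (a1, a2) * (b1 - a1) \<le> g1 (\<xi>, b2) * (b1 - a1)" "g2 (a1, a2) * (b2 - a2) \<le> g2 (a1, \<zeta>) * (b2 - a2)"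
      using mono[of g1 a1 \<xi> a2 b2] mono[of g2 a1 a1 a2 \<zeta>] 1 2 that by (auto intro!: mult_right_mono)
    then show ?thesis using 1 2 by linarith
  qed
  have convex: "G ((1 - l) * s + l * s', (1 - l) * t + l * t') \<le> (1 - l) * G (s, t) + l * G (s', t')"
    if "0 \<le> s" "s \<le> s'" "0 \<le> t" "t \<le> t'" "0 \<le> l" "l \<le> 1" for s t s' t' l
  proof -
    define x where "x = (1 - l) * s + l * s'"
    define y where "y = (1 - l) * t + l * t'"
    have x: "x - s = l * (s' - s)" "s' - x = (1 - l) * (s' - s)" and y: "y - t = l * (t' - t)" "t' - y = (1 - l) * (t' - t)"
      by (simp_all add: x_def y_def algebra_simps)
    have le: "s \<le> x" "x \<le> s'" "t \<le> y" "y \<le> t'"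
    proof -
      have "0 \<le> l * (s' - s)" "0 \<le> (1 - l) * (s' - s)" "0 \<le> l * (t' - t)" "0 \<le> (1 - l) * (t' - t)"
        using that by (auto intro!: mult_nonneg_nonneg)
      then show "s \<le> x" "x \<le> s'" "t \<le> y" "y \<le> t'" unfolding x[symmetric] y[symmetric] by simp_all
    qed
    define d where "d = g1 (x, y) * (s' - s) + g2 (x, y) * (t' - t)"
    have 1: "G (x, y) - G (s, t) \<le> l * d" using upper[of s x t y] that le by (simp add: x y d_def algebra_simps)
    have 2: "(1 - l) * d \<le> G (s', t') - G (x, y)" using lower[of x s' y t'] that le by (simp add: x y d_def algebra_simps)
    have "(1 - l) * (G (x, y) - G (s, t)) \<le> (1 - l) * (l * d)" using 1 that by (intro mult_left_mono) auto
    also have "\<dots> = l * ((1 - l) * d)" by simp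
    also have "\<dots> \<le> l * (G (s', t') - G (x, y))" using 2 that by (intro mult_left_mono) auto
    finally show ?thesis unfolding x_def[symmetric] y_def[symmetric] by (simp add: algebra_simps)
  qed
  have \<gamma>_nn: "0 \<le> \<gamma> \<rho>" if "0 \<le> \<rho>" for \<rho> using nn[of g1 \<rho> \<rho>] nn[of g2 \<rho> \<rho>] that by (simp add: \<gamma>_def)
  have \<gamma>_mono: "\<gamma> \<rho> \<le> \<gamma> \<rho>'" if "0 \<le> \<rho>" "\<rho> \<le> \<rho>'" for \<rho> \<rho>'
    using mono[of g1 \<rho> \<rho>' \<rho> \<rho>'] mono[of g2 \<rho> \<rho>' \<rho> \<rho>'] that by (simp add: \<gamma>_def)
  have far: "\<exists>R>0. \<forall>\<rho>\<ge>R. \<gamma> \<rho> \<le> \<epsilon> * \<rho> powr p" if \<epsilon>: "0 < \<epsilon>" for \<epsilon>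
  proof -
    have "\<exists>R>0. \<forall>\<rho>\<ge>R. g (\<rho>, \<rho>) \<le> \<epsilon> / 2 * \<rho> powr p" if g: "g \<in> {g1, g2}" for g
    proof -
      define \<epsilon>' where "\<epsilon>' = \<epsilon> / (2 * 2 powr p)"
      have \<epsilon>': "0 < \<epsilon>'" using \<epsilon> by (simp add: \<epsilon>'_def)
      have "eventually (\<lambda>s. g s / norm s powr p < \<epsilon>') (inf at_infinity (principal quadrant))"
        using order_tendstoD(2)[OF G3[OF g] \<epsilon>'] .
      then obtain b where b: "\<And>s. b \<le> norm s \<Longrightarrow> s \<in> quadrant \<Longrightarrow> g s / norm s powr p < \<epsilon>'"
        by (auto simp: eventually_inf_principal eventually_at_infinity)
      have "g (\<rho>, \<rho>) \<le> \<epsilon> / 2 * \<rho> powr p" if \<rho>: "max 1 b \<le> \<rho>" for \<rho>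
      proof -
        have n1: "\<rho> \<le> norm (\<rho>, \<rho>)" using \<rho> norm_fst_le[of \<rho> \<rho>] by simp
        have n2: "norm (\<rho>, \<rho>) \<le> 2 * \<rho>" using norm_Pair_le[of \<rho> \<rho>] \<rho> by simp
        have "g (\<rho>, \<rho>) / norm (\<rho>, \<rho>) powr p < \<epsilon>'" using b[of "(\<rho>, \<rho>)"] n1 \<rho> by (simp add: quadrant_def)
        moreover have "0 < norm (\<rho>, \<rho>) powr p"
        proof -
          have "0 < norm (\<rho>, \<rho>)" by (rule less_le_trans[OF _ n1]) (use \<rho> in simp)
          then show ?thesis by simp
        qed
        ultimately have "g (\<rho>, \<rho>) \<le> \<epsilon>' * norm (\<rho>, \<rho>) powr p" by (simp add: divide_less_eq less_imp_le)
        also have "\<dots> \<le> \<epsilon>' * (2 * \<rho>) powr p" using n2 p \<epsilon>' by (intro mult_left_mono powr_mono2) auto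
        also have "\<dots> = \<epsilon> / 2 * \<rho> powr p" by (simp add: \<epsilon>'_def powr_mult)
        finally show ?thesis .
      qed
      then show ?thesis by (intro exI[of _ "max 1 b"]) auto
    qed
    from this[of g1] this[of g2] obtain R1 R2 where
      R: "0 < R1" "0 < R2" "\<And>\<rho>. R1 \<le> \<rho> \<Longrightarrow> g1 (\<rho>, \<rho>) \<le> \<epsilon> / 2 * \<rho> powr p" "\<And>\<rho>. R2 \<le> \<rho> \<Longrightarrow> g2 (\<rho>, \<rho>) \<le> \<epsilon> / 2 * \<rho> powr p"
      by auto
    have "\<gamma> \<rho> \<le> \<epsilon> * \<rho> powr p" if "max R1 R2 \<le> \<rho>" for \<rho>
    proof -
      have "\<gamma> \<rho> \<le> \<epsilon> / 2 * \<rho> powr p + \<epsilon> / 2 * \<rho> powr p" using R(3)[of \<rho>] R(4)[of \<rho>] that by (simp add: \<gamma>_def)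
      then show ?thesis by (simp add: distrib_right[symmetric])
    qed
    then show ?thesis using R(1) by (intro exI[of _ "max R1 R2"]) auto
  qed
  have near: "\<exists>d>0. \<forall>\<rho>. 0 \<le> \<rho> \<longrightarrow> \<rho> < d \<longrightarrow> \<gamma> \<rho> \<le> \<epsilon>" if \<epsilon>: "0 < \<epsilon>" for \<epsilon>
  proof -
    have "\<exists>d>0. \<forall>\<rho>. 0 \<le> \<rho> \<longrightarrow> \<rho> < d \<longrightarrow> g (\<rho>, \<rho>) \<le> \<epsilon> / 2" if g: "g \<in> {g1, g2}" for g
    proof -
      have "eventually (\<lambda>s. g s < \<epsilon> / 2) (at (0, 0) within quadrant)"
        using order_tendstoD(2)[OF G2[OF g], of "\<epsilon> / 2"] \<epsilon> by simp
      then obtain d where d: "0 < d" "\<And>s. s \<in> quadrant \<Longrightarrow> s \<noteq> (0, 0) \<Longrightarrow> dist s (0, 0) < d \<Longrightarrow> g s < \<epsilon> / 2"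
        by (auto simp: eventually_at)
      have "g (\<rho>, \<rho>) \<le> \<epsilon> / 2" if \<rho>: "0 \<le> \<rho>" "\<rho> < d / 2" for \<rho>
      proof (cases "\<rho> = 0")
        case True then show ?thesis using g00[OF g] \<epsilon> by simp
      next
        case False
        have "norm (\<rho>, \<rho>) \<le> 2 * \<rho>" using norm_Pair_le[of \<rho> \<rho>] \<rho> by simp
        then have "dist (\<rho>, \<rho>) (0, 0) < d" using \<rho> by (simp add: dist_norm)
        then show ?thesis using d(2)[of "(\<rho>, \<rho>)"] False \<rho> by (simp add: quadrant_def)
      qed
      then show ?thesis using d(1) by (intro exI[of _ "d / 2"]) auto
    qed
    from this[of g1] this[of g2] obtain D1 D2 where
      D: "0 < D1" "0 < D2" "\<And>\<rho>. 0 \<le> \<rho> \<Longrightarrow> \<rho> < D1 \<Longrightarrow> g1 (\<rho>, \<rho>) \<le> \<epsilon> / 2" "\<And>\<rho>. 0 \<le> \<rho> \<Longrightarrow> \<rho> < D2 \<Longrightarrow> g2 (\<rho>, \<rho>) \<le> \<epsilon> / 2"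
      by auto
    have "\<gamma> \<rho> \<le> \<epsilon>" if "0 \<le> \<rho>" "\<rho> < min D1 D2" for \<rho>
      using D(3)[of \<rho>] D(4)[of \<rho>] that unfolding \<gamma>_def by simp
    then show ?thesis using D(1,2) by (intro exI[of _ "min D1 D2"]) auto
  qed
  have large: "\<exists>C\<ge>0. \<forall>\<rho>\<ge>0. \<gamma> \<rho> \<le> C + \<epsilon> * \<rho> powr p" if \<epsilon>: "0 < \<epsilon>" for \<epsilon>
  proof -
    obtain R where R: "0 < R" "\<And>\<rho>. R \<le> \<rho> \<Longrightarrow> \<gamma> \<rho> \<le> \<epsilon> * \<rho> powr p" using far[OF \<epsilon>] by auto
    have "\<gamma> \<rho> \<le> \<gamma> R + \<epsilon> * \<rho> powr p" if "0 \<le> \<rho>" for \<rho>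
    proof (cases "R \<le> \<rho>")
      case True then show ?thesis using R(2)[of \<rho>] \<gamma>_nn[of R] R(1) by simp
    next
      case False
      have "0 \<le> \<epsilon> * \<rho> powr p" using \<epsilon> by simp
      then show ?thesis using \<gamma>_mono[OF that, of R] False by linarith
    qed
    then show ?thesis using \<gamma>_nn[of R] R(1) by (intro exI[of _ "\<gamma> R"]) auto
  qed
  have small: "\<exists>C\<ge>0. \<forall>\<rho>\<ge>0. \<gamma> \<rho> \<le> \<epsilon> + C * \<rho> powr p" if \<epsilon>: "0 < \<epsilon>" for \<epsilon>
  proof -
    obtain d where d: "0 < d" "\<And>\<rho>. 0 \<le> \<rho> \<Longrightarrow> \<rho> < d \<Longrightarrow> \<gamma> \<rho> \<le> \<epsilon>" using near[OF \<epsilon>] by auto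
    obtain C where C: "0 \<le> C" "\<And>\<rho>. 0 \<le> \<rho> \<Longrightarrow> \<gamma> \<rho> \<le> C + 1 * \<rho> powr p" using large[of 1] by auto
    define K where "K = C / d powr p + 1"
    have K: "0 \<le> K" using C(1) by (simp add: K_def)
    have "\<gamma> \<rho> \<le> \<epsilon> + K * \<rho> powr p" if "0 \<le> \<rho>" for \<rho>
    proof (cases "\<rho> < d")
      case True
      have "0 \<le> K * \<rho> powr p" using K by simp
      then show ?thesis using d(2)[OF that True] by linarith
    next
      case False
      then have "d powr p \<le> \<rho> powr p" using d(1) p by (intro powr_mono2) auto
      then have "1 \<le> \<rho> powr p / d powr p" using d(1) by simp
      from mult_left_mono[OF this C(1)] have "C \<le> C / d powr p * \<rho> powr p" by simp
      then show ?thesis using C(2)[OF that] \<epsilon> by (simp add: K_def distrib_right)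
    qed
    then show ?thesis using K by blast
  qed
  have mix: "G (s, 0) + G (0, t) < G (s, t)" if st: "0 < s" "0 < t" for s t
  proof -
    obtain \<sigma> where \<sigma>: "0 < \<sigma>" "\<And>s1 s2. 0 < s1 \<Longrightarrow> s1 \<le> \<sigma> \<Longrightarrow> 0 < s2 \<Longrightarrow> s2 \<le> \<sigma> \<Longrightarrow> G (s1, 0) + G (0, s2) < G (s1, s2)"
      using G5 by auto
    define s1 where "s1 = min s \<sigma>"
    define t1 where "t1 = min t \<sigma>"
    have st1: "0 < s1" "s1 \<le> s" "s1 \<le> \<sigma>" "0 < t1" "t1 \<le> t" "t1 \<le> \<sigma>" using st \<sigma>(1) by (auto simp: s1_def t1_def)
    have "G (s1, 0) + G (0, t1) < G (s1, t1)" using \<sigma>(2) st1 by blast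
    moreover have "G (s, 0) - G (s1, 0) \<le> G (s, t) - G (s1, t)" using up1[of s1 s 0 0 t] st1 st by simp
    moreover have "G (0, t) - G (0, t1) \<le> G (s1, t) - G (s1, t1)" using up2[of t1 t 0 0 s1] st1 st by simp
    ultimately show ?thesis by linarith
  qed
  show ?thesis
    unfolding \<gamma>_def[abs_def, symmetric]
    by (unfold_locales; fact p G1(2) cont(1) super convex nonneg Lip \<gamma>_nn small large mix)
qed

section \<open>The energy and its infimum\<close>

text \<open>
  The type argument \<open>dim\<close> fixes the dimension. The exponent \<open>\<kappa>\<close> and the constant \<open>GN\<close> of
  \<open>Gagliardo_Nirenberg\<close> are parameters, so that they stay atomic in the estimates.
\<close>

locale energy = nonlinearity G \<gamma> \<kappa>
  for G :: "real \<times> real \<Rightarrow> real" and \<gamma> :: "real \<Rightarrow> real" and \<kappa> :: real +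
  fixes dim :: "'n::finite itself" and GN :: real
  assumes \<kappa>: "\<kappa> = 2 / real CARD('n)" and GN: "GN = 64 * 64 powr \<kappa> * CARD('n)"
begin

definition pot :: "(real^'n \<Rightarrow> complex) \<Rightarrow> (real^'n \<Rightarrow> complex) \<Rightarrow> real" where
  "pot u v = (LINT x|lborel. G ((norm (u x))\<^sup>2, (norm (v x))\<^sup>2))"

definition crit_int :: "(real^'n \<Rightarrow> complex) \<Rightarrow> real" where
  "crit_int u = (LINT x|lborel. crit u x)"

lemma GN_pos: "0 < GN"
  by (simp add: GN)

lemma crit_local:
  fixes u :: "real^'n \<Rightarrow> complex"
  assumes "u \<in> H1" "0 < m" "\<And>y. local_mass 1 u y \<le> m"
  shows "integrable lborel (crit u)" and "crit_int u \<le> GN * m powr \<kappa> * (mass u + kin u)"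
  using Gagliardo_Nirenberg[of u m] assms by (auto simp: GN \<kappa> crit_int_def mult_ac)

text \<open>
  The form of \<open>Gagliardo_Nirenberg\<close> that forgets the local masses.
\<close>

lemma crit_global:
  fixes u :: "real^'n \<Rightarrow> complex"
  assumes u: "u \<in> H1" and m: "0 < m" "mass u \<le> m"
  shows "integrable lborel (crit u)" and "crit_int u \<le> GN * m powr \<kappa> * (mass u + kin u)"
proof -
  have "local_mass 1 u y \<le> m" for y using local_mass_le_mass[OF H1_L2[OF u], of 1 y] m by linarith
  then show "integrable lborel (crit u)" "crit_int u \<le> GN * m powr \<kappa> * (mass u + kin u)"
    using crit_local[OF u m(1)] by auto
qed

lemma crit_integrable: "u \<in> H1 \<Longrightarrow> integrable lborel (crit u)" for u :: "real^'n \<Rightarrow> complex"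
  using crit_global(1)[of u "mass u + 1"] mass_nonneg[of u] by linarith

lemma G_H1_measurable:
  assumes "u \<in> L2" "v \<in> L2"
  shows "(\<lambda>x. G ((norm (u x))\<^sup>2, (norm (v x))\<^sup>2)) \<in> borel_measurable lborel"
proof -
  have [measurable]: "u \<in> borel_measurable borel" "v \<in> borel_measurable borel" using assms by auto
  show ?thesis by (rule G_measurable) auto
qed

text \<open>
  The pair enters only through its superposition, so one scalar inequality serves both components.
\<close>

lemma pot_bound:
  fixes u v :: "real^'n \<Rightarrow> complex"
  assumes u: "u \<in> H1" "v \<in> H1" and c: "0 \<le> c1" "0 \<le> c2" and \<gamma>: "\<And>\<rho>. 0 \<le> \<rho> \<Longrightarrow> \<gamma> \<rho> \<le> c1 + c2 * \<rho> powr \<kappa>"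
  shows "integrable lborel (\<lambda>x. G ((norm (u x))\<^sup>2, (norm (v x))\<^sup>2))"
    and "pot u v \<le> c1 * (mass u + mass v) + c2 * crit_int (superpose u v)"
proof -
  note w = superpose_H1[OF u] superpose_L2[OF u[THEN H1_L2]]
  have i: "integrable lborel (\<lambda>x. c1 * (norm (superpose u v x))\<^sup>2 + c2 * crit (superpose u v) x)"
    by (intro Bochner_Integration.integrable_add integrable_mult_right L2_integrable w crit_integrable)
  have le: "G ((norm (u x))\<^sup>2, (norm (v x))\<^sup>2) \<le> c1 * (norm (superpose u v x))\<^sup>2 + c2 * crit (superpose u v) x" for x
  proof -
    have "G ((norm (u x))\<^sup>2, (norm (v x))\<^sup>2) \<le> \<gamma> ((norm (superpose u v x))\<^sup>2) * (norm (superpose u v x))\<^sup>2"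
      using G_le[of "(norm (u x))\<^sup>2" "(norm (v x))\<^sup>2"] by simp
    also have "\<dots> \<le> (c1 + c2 * ((norm (superpose u v x))\<^sup>2) powr \<kappa>) * (norm (superpose u v x))\<^sup>2"
      by (intro mult_right_mono \<gamma>) auto
    finally show ?thesis by (simp add: crit_def \<kappa> algebra_simps)
  qed
  show int: "integrable lborel (\<lambda>x. G ((norm (u x))\<^sup>2, (norm (v x))\<^sup>2))"
  proof (rule Bochner_Integration.integrable_bound[OF i G_H1_measurable[OF u[THEN H1_L2]]], rule AE_I2)
    fix x
    show "norm (G ((norm (u x))\<^sup>2, (norm (v x))\<^sup>2)) \<le> norm (c1 * (norm (superpose u v x))\<^sup>2 + c2 * crit (superpose u v) x)"
      using le[of x] G_nonneg[of "(norm (u x))\<^sup>2" "(norm (v x))\<^sup>2"] by simp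
  qed
  have "pot u v \<le> (LINT x|lborel. c1 * (norm (superpose u v x))\<^sup>2 + c2 * crit (superpose u v) x)"
    unfolding pot_def by (rule integral_mono[OF int i le])
  also have "\<dots> = c1 * mass (superpose u v) + c2 * crit_int (superpose u v)"
    unfolding mass_def crit_int_def using L2_integrable[OF w(3)] crit_integrable[OF w(1)] by (simp del: superpose_norm)
  finally show "pot u v \<le> c1 * (mass u + mass v) + c2 * crit_int (superpose u v)" using w(4) by simp
qed

lemma pot_integrable:
  fixes u v :: "real^'n \<Rightarrow> complex"
  assumes "u \<in> H1" "v \<in> H1"
  shows "integrable lborel (\<lambda>x. G ((norm (u x))\<^sup>2, (norm (v x))\<^sup>2))"
proof -
  obtain C where "0 \<le> C" "\<And>\<rho>. 0 \<le> \<rho> \<Longrightarrow> \<gamma> \<rho> \<le> C + 1 * \<rho> powr \<kappa>" using \<gamma>_large[of 1] by auto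
  then show ?thesis using pot_bound(1)[OF assms, of C 1] by auto
qed

lemma J_eq:
  fixes u v :: "real^'n \<Rightarrow> complex"
  assumes "u \<in> H1" "v \<in> H1"
  shows "J G (u, v) = 1/2 * (kin u + kin v) - pot u v"
  unfolding J_def kin_def mass_def pot_def
  using L2_integrable[OF H1_weak_gradient(1)[OF assms(1)]] L2_integrable[OF H1_weak_gradient(1)[OF assms(2)]] by simp

lemma M_iff: "(u, v) \<in> M \<alpha> \<beta> \<longleftrightarrow> u \<in> H1 \<and> v \<in> H1 \<and> mass u = \<alpha> \<and> mass v = \<beta>"
  by (simp add: M_def mass_def)

lemma pot_difference:
  assumes H: "u \<in> H1" "v \<in> H1" "u' \<in> H1" "v' \<in> H1" and \<eta>: "0 \<le> \<eta>" and K: "0 \<le> K"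
    and pt: "\<And>(a::complex) (b::complex) (c::complex) (d::complex) \<rho> \<delta>.
      \<rho> = (norm a)\<^sup>2 + (norm b)\<^sup>2 + ((norm c)\<^sup>2 + (norm d)\<^sup>2) \<Longrightarrow> \<delta> = (norm (a - c))\<^sup>2 + (norm (b - d))\<^sup>2 \<Longrightarrow>
      \<bar>G ((norm a)\<^sup>2, (norm b)\<^sup>2) - G ((norm c)\<^sup>2, (norm d)\<^sup>2)\<bar> \<le> \<eta> * (\<rho> + \<rho> * \<rho> powr \<kappa>) + K * (\<delta> + \<delta> * \<delta> powr \<kappa>)"
  defines "R \<equiv> superpose (superpose u v) (superpose u' v')"
    and "D \<equiv> superpose (\<lambda>x. u x - u' x) (\<lambda>x. v x - v' x)"
  shows "\<bar>pot u v - pot u' v'\<bar> \<le> \<eta> * (mass R + crit_int R) + K * (mass D + crit_int D)"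
proof -
  have R: "R \<in> H1" unfolding R_def by (intro superpose_H1 H)
  have D: "D \<in> H1" unfolding D_def by (intro superpose_H1 H1_add_diff H)
  note i = L2_integrable[OF H1_L2[OF R]] crit_integrable[OF R] L2_integrable[OF H1_L2[OF D]] crit_integrable[OF D]
  note p = pot_integrable[OF H(1,2)] pot_integrable[OF H(3,4)]
  have "\<bar>pot u v - pot u' v'\<bar> = \<bar>LINT x|lborel. G ((norm (u x))\<^sup>2, (norm (v x))\<^sup>2) - G ((norm (u' x))\<^sup>2, (norm (v' x))\<^sup>2)\<bar>"
    unfolding pot_def using p by simp
  also have "\<dots> \<le> (LINT x|lborel. \<bar>G ((norm (u x))\<^sup>2, (norm (v x))\<^sup>2) - G ((norm (u' x))\<^sup>2, (norm (v' x))\<^sup>2)\<bar>)"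
    by (rule integral_abs_bound)
  also have "\<dots> \<le> (LINT x|lborel. \<eta> * ((norm (R x))\<^sup>2 + crit R x) + K * ((norm (D x))\<^sup>2 + crit D x))"
  proof (rule integral_mono)
    show "integrable lborel (\<lambda>x. \<bar>G ((norm (u x))\<^sup>2, (norm (v x))\<^sup>2) - G ((norm (u' x))\<^sup>2, (norm (v' x))\<^sup>2)\<bar>)"
      using p by (intro integrable_abs Bochner_Integration.integrable_diff)
    show "integrable lborel (\<lambda>x. \<eta> * ((norm (R x))\<^sup>2 + crit R x) + K * ((norm (D x))\<^sup>2 + crit D x))"
      by (intro Bochner_Integration.integrable_add integrable_mult_right i)
    show "\<bar>G ((norm (u x))\<^sup>2, (norm (v x))\<^sup>2) - G ((norm (u' x))\<^sup>2, (norm (v' x))\<^sup>2)\<bar> \<le> \<eta> * ((norm (R x))\<^sup>2 + crit R x) + K * ((norm (D x))\<^sup>2 + crit D x)" for x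
      unfolding crit_def \<kappa>[symmetric] by (rule pt) (simp_all add: R_def D_def)
  qed
  also have "\<dots> = \<eta> * (mass R + crit_int R) + K * (mass D + crit_int D)"
    unfolding mass_def crit_int_def using i by simp
  finally show ?thesis .
qed

text \<open>
  Convergence in \<open>L2\<close> suffices for sequences bounded in \<open>H1\<close>: the critical integral of the differences
  tends to zero by \<open>Gagliardo_Nirenberg\<close>, since their masses do.
\<close>

lemma pot_continuous:
  assumes H: "\<And>n. u n \<in> H1" "\<And>n. v n \<in> H1" "u' \<in> H1" "v' \<in> H1"
    and b: "\<And>n. mass (u n) \<le> A" "\<And>n. mass (v n) \<le> A" "mass u' \<le> A" "mass v' \<le> A"
    and k: "\<And>n. kin (u n) \<le> A" "\<And>n. kin (v n) \<le> A" "kin u' \<le> A" "kin v' \<le> A"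
    and lim: "(\<lambda>n. mass (\<lambda>x. u n x - u' x)) \<longlonglongrightarrow> 0" "(\<lambda>n. mass (\<lambda>x. v n x - v' x)) \<longlonglongrightarrow> 0"
  shows "(\<lambda>n. pot (u n) (v n)) \<longlonglongrightarrow> pot u' v'"
proof (rule LIMSEQ_I)
  fix e :: real assume e: "0 < e"
  have A: "0 \<le> A" using order_trans[OF mass_nonneg b(3)] .
  define Q where "Q = 4 * A + GN * (4 * A + 1) powr \<kappa> * (8 * A)"
  have Q: "0 \<le> Q" using A GN_pos by (simp add: Q_def)
  define \<eta> where "\<eta> = min 1 (e / (2 * (Q + 1)))"
  have \<eta>: "0 < \<eta>" "\<eta> \<le> 1" using e Q by (auto simp: \<eta>_def)
  have \<eta>Q: "\<eta> * Q < e / 2 + 0"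
  proof -
    have "\<eta> * Q \<le> e / (2 * (Q + 1)) * Q" using Q by (intro mult_right_mono) (auto simp: \<eta>_def)
    also have "\<dots> < e / (2 * (Q + 1)) * (Q + 1)" using e Q by (intro mult_strict_left_mono) auto
    also have "\<dots> = e / 2" using Q by (simp add: field_simps)
    finally show ?thesis by simp
  qed
  obtain K where K: "0 \<le> K" "\<And>(a::complex) (b::complex) (c::complex) (d::complex) \<rho> \<delta>.
      \<rho> = (norm a)\<^sup>2 + (norm b)\<^sup>2 + ((norm c)\<^sup>2 + (norm d)\<^sup>2) \<Longrightarrow> \<delta> = (norm (a - c))\<^sup>2 + (norm (b - d))\<^sup>2 \<Longrightarrow>
      \<bar>G ((norm a)\<^sup>2, (norm b)\<^sup>2) - G ((norm c)\<^sup>2, (norm d)\<^sup>2)\<bar> \<le> \<eta> * (\<rho> + \<rho> * \<rho> powr \<kappa>) + K * (\<delta> + \<delta> * \<delta> powr \<kappa>)"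
    by (rule G_increment[OF \<eta>]) (rule that; assumption)
  define R where "R n = superpose (superpose (u n) (v n)) (superpose u' v')" for n
  define D where "D n = superpose (\<lambda>x. u n x - u' x) (\<lambda>x. v n x - v' x)" for n
  note L = H1_L2[OF H(1)] H1_L2[OF H(2)] H1_L2[OF H(3)] H1_L2[OF H(4)]
  have RH: "R n \<in> H1" for n unfolding R_def by (intro superpose_H1 H)
  have Rm: "mass (R n) \<le> 4 * A" for n
    unfolding R_def using b(1)[of n] b(2)[of n] b(3,4)
    by (simp add: superpose_L2 superpose_L2(1)[OF L(1) L(2)] superpose_L2(1)[OF L(3) L(4)] L)
  have Rk: "kin (R n) \<le> 4 * A" for n
    using superpose_H1(2)[OF superpose_H1(1)[OF H(1)[of n] H(2)[of n]] superpose_H1(1)[OF H(3,4)]]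
      superpose_H1(2)[OF H(1)[of n] H(2)[of n]] superpose_H1(2)[OF H(3,4)] k(1)[of n] k(2)[of n] k(3,4)
    unfolding R_def by linarith
  have RQ: "mass (R n) + crit_int (R n) \<le> Q" for n
  proof -
    have "crit_int (R n) \<le> GN * (4 * A + 1) powr \<kappa> * (mass (R n) + kin (R n))"
      by (rule crit_global(2)[OF RH]) (use A Rm[of n] in auto)
    also have "\<dots> \<le> GN * (4 * A + 1) powr \<kappa> * (8 * A)"
      using Rm[of n] Rk[of n] GN_pos by (intro mult_left_mono) auto
    finally show ?thesis using Rm[of n] by (simp add: Q_def)
  qed
  have DH: "D n \<in> H1" for n unfolding D_def by (intro superpose_H1 H1_add_diff H)
  have Dm: "mass (D n) = mass (\<lambda>x. u n x - u' x) + mass (\<lambda>x. v n x - v' x)" for n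
    unfolding D_def by (intro superpose_L2 L2_diff L)
  have Dlim: "(\<lambda>n. mass (D n)) \<longlonglongrightarrow> 0" using tendsto_add[OF lim] by (simp add: Dm)
  have kd: "kin (\<lambda>x. f x - g x) \<le> 2 * kin f + 2 * kin g" if "f \<in> H1" "g \<in> H1" for f g
    using H1_add_diff(3)[OF that] kin_nonneg[of "\<lambda>x. f x + g x"] by linarith
  have Dk: "kin (D n) \<le> 8 * A" for n
    using superpose_H1(2)[OF H1_add_diff(2)[OF H(1)[of n] H(3)] H1_add_diff(2)[OF H(2)[of n] H(4)]]
      kd[OF H(1)[of n] H(3)] kd[OF H(2)[of n] H(4)] k(1)[of n] k(2)[of n] k(3,4)
    unfolding D_def by linarith
  \<comment> \<open>the inequality asks for a positive bound of the mass\<close>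
  define m where "m n = mass (D n) + 1 / real (Suc n)" for n
  have m: "0 < m n" "mass (D n) \<le> m n" for n by (auto simp: m_def add_nonneg_pos)
  have mlim: "m \<longlonglongrightarrow> 0"
    using tendsto_add[OF Dlim LIMSEQ_Suc[OF lim_1_over_n]] by (simp add: m_def[abs_def])
  have mp: "(\<lambda>n. m n powr \<kappa>) \<longlonglongrightarrow> 0"
    by (rule tendsto_zero_powrI[OF mlim tendsto_const]) (use m(1) p in \<open>auto intro!: always_eventually less_imp_le\<close>)
  have Dc: "crit_int (D n) \<le> GN * m n powr \<kappa> * (mass (D n) + 8 * A)" for n
  proof -
    have "crit_int (D n) \<le> GN * m n powr \<kappa> * (mass (D n) + kin (D n))" by (rule crit_global(2)[OF DH m])
    also have "\<dots> \<le> GN * m n powr \<kappa> * (mass (D n) + 8 * A)" using Dk[of n] GN_pos by (intro mult_left_mono) auto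
    finally show ?thesis .
  qed
  have "(\<lambda>n. K * (mass (D n) + GN * m n powr \<kappa> * (mass (D n) + 8 * A))) \<longlonglongrightarrow> K * (0 + GN * 0 * (0 + 8 * A))"
    by (intro tendsto_intros Dlim mp)
  then have "eventually (\<lambda>n. K * (mass (D n) + GN * m n powr \<kappa> * (mass (D n) + 8 * A)) < e / 2) sequentially"
    by (rule order_tendstoD(2)) (use e in simp)
  then obtain N where N: "\<And>n. n \<ge> N \<Longrightarrow> K * (mass (D n) + GN * m n powr \<kappa> * (mass (D n) + 8 * A)) < e / 2"
    by (auto simp: eventually_sequentially)
  have "norm (pot (u n) (v n) - pot u' v') < e" if "n \<ge> N" for n
  proof -
    have "\<bar>pot (u n) (v n) - pot u' v'\<bar> \<le> \<eta> * (mass (R n) + crit_int (R n)) + K * (mass (D n) + crit_int (D n))"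
      unfolding R_def D_def by (rule pot_difference[OF H(1) H(2) H(3,4) _ K]) (use \<eta> in simp)
    moreover have "\<eta> * (mass (R n) + crit_int (R n)) \<le> \<eta> * Q" using RQ[of n] \<eta> by (intro mult_left_mono) auto
    moreover have "K * (mass (D n) + crit_int (D n)) \<le> K * (mass (D n) + GN * m n powr \<kappa> * (mass (D n) + 8 * A))"
      using Dc[of n] K(1) by (intro mult_left_mono) auto
    ultimately show ?thesis using N[OF that] \<eta>Q by simp
  qed
  then show "\<exists>no. \<forall>n\<ge>no. norm (pot (u n) (v n) - pot u' v') < e" by blast
qed

text \<open>
  By \<open>\<gamma>_large\<close> the critical part of the potential can be given a coefficient so small that it consumes
  only half of the kinetic energy.
\<close>

lemma J_coercive:
  assumes A: "0 \<le> A"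
  shows "\<exists>C\<ge>0. \<forall>(u :: real^'n \<Rightarrow> complex)\<in>H1. \<forall>(v :: real^'n \<Rightarrow> complex)\<in>H1.
    mass u + mass v \<le> A \<longrightarrow> 1/4 * (kin u + kin v) - C \<le> J G (u, v)"
proof -
  define B where "B = GN * (A + 1) powr \<kappa>"
  have B: "0 < B" using GN_pos A by (simp add: B_def)
  obtain c where c: "0 \<le> c" "\<And>\<rho>. 0 \<le> \<rho> \<Longrightarrow> \<gamma> \<rho> \<le> c + 1 / (4 * B) * \<rho> powr \<kappa>"
    using \<gamma>_large[of "1 / (4 * B)"] B by auto
  show ?thesis
  proof (intro exI[of _ "c * A + A"] conjI ballI impI)
    show "0 \<le> c * A + A" using c A by simp
    fix u v :: "real^'n \<Rightarrow> complex" assume H: "u \<in> H1" "v \<in> H1" and m: "mass u + mass v \<le> A"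
    note w = superpose_H1[OF H] superpose_L2[OF H[THEN H1_L2]]
    have "crit_int (superpose u v) \<le> B * (mass (superpose u v) + kin (superpose u v))"
      unfolding B_def by (rule crit_global(2)[OF w(1)]) (use A m w(4) in auto)
    also have "\<dots> \<le> B * (A + (kin u + kin v))" using w m B by (intro mult_left_mono) auto
    finally have cr: "crit_int (superpose u v) \<le> B * (A + (kin u + kin v))" .
    have "pot u v \<le> c * (mass u + mass v) + 1 / (4 * B) * crit_int (superpose u v)"
      by (rule pot_bound(2)[OF H c(1) _ c(2)]) (use B in auto)
    also have "\<dots> \<le> c * A + 1 / (4 * B) * (B * (A + (kin u + kin v)))"
      using m c(1) cr B by (intro add_mono mult_left_mono) auto
    also have "\<dots> = c * A + A / 4 + (kin u + kin v) / 4" using B by (simp add: field_simps)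
    finally show "1/4 * (kin u + kin v) - (c * A + A) \<le> J G (u, v)"
      unfolding J_eq[OF H] using A by argo
  qed
qed

abbreviation "Einf \<equiv> E dim G"

lemma M_nonempty: "0 \<le> \<alpha> \<Longrightarrow> 0 \<le> \<beta> \<Longrightarrow> \<exists>p. p \<in> (M \<alpha> \<beta> :: ((real^'n \<Rightarrow> complex) \<times> (real^'n \<Rightarrow> complex)) set)"
  using H1_mass_exists[of \<alpha>] H1_mass_exists[of \<beta>] M_iff by metis

lemma J_bdd_below: "bdd_below (J G ` (M \<alpha> \<beta> :: ((real^'n \<Rightarrow> complex) \<times> (real^'n \<Rightarrow> complex)) set))"
proof -
  obtain C where C: "\<forall>(u :: real^'n \<Rightarrow> complex)\<in>H1. \<forall>(v :: real^'n \<Rightarrow> complex)\<in>H1.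
      mass u + mass v \<le> \<bar>\<alpha>\<bar> + \<bar>\<beta>\<bar> \<longrightarrow> 1/4 * (kin u + kin v) - C \<le> J G (u, v)"
    using J_coercive[of "\<bar>\<alpha>\<bar> + \<bar>\<beta>\<bar>"] by auto
  have "- C \<le> J G p" if p: "p \<in> M \<alpha> \<beta>" for p :: "(real^'n \<Rightarrow> complex) \<times> (real^'n \<Rightarrow> complex)"
  proof -
    obtain u v where uv: "p = (u, v)" "u \<in> H1" "v \<in> H1" "mass u = \<alpha>" "mass v = \<beta>" using p M_iff by (cases p) auto
    have "1/4 * (kin u + kin v) - C \<le> J G (u, v)" using C uv by auto
    then show ?thesis using kin_nonneg[of u] kin_nonneg[of v] unfolding uv(1) by argo
  qed
  then show ?thesis by (intro bdd_belowI2)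
qed

lemma E_le:
  fixes u v :: "real^'n \<Rightarrow> complex"
  assumes "u \<in> H1" "v \<in> H1" "mass u = \<alpha>" "mass v = \<beta>" shows "Einf \<alpha> \<beta> \<le> J G (u, v)"
  unfolding E_def by (rule cINF_lower[OF J_bdd_below]) (use assms M_iff in auto)

lemma E_approx:
  assumes "0 \<le> \<alpha>" "0 \<le> \<beta>" "0 < e"
  obtains u v :: "real^'n \<Rightarrow> complex" where "u \<in> H1" "v \<in> H1" "mass u = \<alpha>" "mass v = \<beta>" "J G (u, v) < Einf \<alpha> \<beta> + e"
proof -
  have ne: "J G ` (M \<alpha> \<beta> :: ((real^'n \<Rightarrow> complex) \<times> (real^'n \<Rightarrow> complex)) set) \<noteq> {}" using M_nonempty[OF assms(1,2)] by auto
  have "Inf (J G ` (M \<alpha> \<beta> :: ((real^'n \<Rightarrow> complex) \<times> (real^'n \<Rightarrow> complex)) set)) < Einf \<alpha> \<beta> + e"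
    unfolding E_def using assms by simp
  from cInf_lessD[OF ne this] obtain p :: "(real^'n \<Rightarrow> complex) \<times> (real^'n \<Rightarrow> complex)" where "p \<in> M \<alpha> \<beta>" "J G p < Einf \<alpha> \<beta> + e"
    by auto
  then show thesis using that by (cases p) (auto simp: M_iff)
qed

lemma E_ge:
  assumes "0 \<le> \<alpha>" "0 \<le> \<beta>"
    and le: "\<And>u v :: real^'n \<Rightarrow> complex. u \<in> H1 \<Longrightarrow> v \<in> H1 \<Longrightarrow> mass u = \<alpha> \<Longrightarrow> mass v = \<beta> \<Longrightarrow> c \<le> J G (u, v)"
  shows "c \<le> Einf \<alpha> \<beta>"
proof (rule field_le_epsilon)
  fix e :: real assume "0 < e"
  then obtain u v :: "real^'n \<Rightarrow> complex" where "u \<in> H1" "v \<in> H1" "mass u = \<alpha>" "mass v = \<beta>" "J G (u, v) < Einf \<alpha> \<beta> + e"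
    by (rule E_approx[OF assms(1,2)])
  then show "c \<le> Einf \<alpha> \<beta> + e" using le[of u v] by linarith
qed

lemma pot_null:
  assumes "u \<in> H1" "v \<in> H1" "mass u = 0" "mass v = 0" shows "pot u v = 0"
proof -
  have "AE x in lborel. u x = 0" "AE x in lborel. v x = 0"
    using mass_eq_0_iff[OF H1_L2[OF assms(1)]] mass_eq_0_iff[OF H1_L2[OF assms(2)]] assms by auto
  then have "AE x in lborel. G ((norm (u x))\<^sup>2, (norm (v x))\<^sup>2) = 0"
    by eventually_elim (simp add: G_zero)
  then show ?thesis unfolding pot_def by (rule integral_eq_zero_AE)
qed

lemma J_superpose:
  fixes u1 v1 :: "real^'n \<Rightarrow> complex"
  assumes H: "u1 \<in> H1" "v1 \<in> H1" "u2 \<in> H1" "v2 \<in> H1"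
  shows "J G (superpose u1 u2, superpose v1 v2) \<le> J G (u1, v1) + J G (u2, v2)"
proof -
  have "pot u1 v1 + pot u2 v2 \<le> pot (superpose u1 u2) (superpose v1 v2)"
  proof -
    have "pot u1 v1 + pot u2 v2 = (LINT x|lborel. G ((norm (u1 x))\<^sup>2, (norm (v1 x))\<^sup>2) + G ((norm (u2 x))\<^sup>2, (norm (v2 x))\<^sup>2))"
      unfolding pot_def using pot_integrable[OF H(1,2)] pot_integrable[OF H(3,4)] by simp
    also have "\<dots> \<le> pot (superpose u1 u2) (superpose v1 v2)"
      unfolding pot_def
    proof (rule integral_mono)
      show "integrable lborel (\<lambda>x. G ((norm (superpose u1 u2 x))\<^sup>2, (norm (superpose v1 v2 x))\<^sup>2))"
        by (intro pot_integrable superpose_H1 H)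
      show "G ((norm (u1 x))\<^sup>2, (norm (v1 x))\<^sup>2) + G ((norm (u2 x))\<^sup>2, (norm (v2 x))\<^sup>2)
          \<le> G ((norm (superpose u1 u2 x))\<^sup>2, (norm (superpose v1 v2 x))\<^sup>2)" for x
        using G_superadd by simp
    qed (use pot_integrable[OF H(1,2)] pot_integrable[OF H(3,4)] in simp)
    finally show ?thesis .
  qed
  then show ?thesis
    using superpose_H1(2)[OF H(1,3)] superpose_H1(2)[OF H(2,4)]
    unfolding J_eq[OF H(1,2)] J_eq[OF H(3,4)] J_eq[OF superpose_H1(1)[OF H(1,3)] superpose_H1(1)[OF H(2,4)]] by argo
qed

text \<open>
  The infima of the two sides are approximated and the approximants superposed.
\<close>

lemma E_subadditive:
  assumes "0 \<le> a" "0 \<le> b" "0 \<le> c" "0 \<le> d"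
  shows "Einf (a + c) (b + d) \<le> Einf a b + Einf c d"
proof (rule field_le_epsilon)
  fix e :: real assume "0 < e"
  then have e2: "0 < e / 2" by simp
  obtain u1 v1 :: "real^'n \<Rightarrow> complex" where 1: "u1 \<in> H1" "v1 \<in> H1" "mass u1 = a" "mass v1 = b" "J G (u1, v1) < Einf a b + e/2"
    by (rule E_approx[OF assms(1,2) e2])
  obtain u2 v2 :: "real^'n \<Rightarrow> complex" where 2: "u2 \<in> H1" "v2 \<in> H1" "mass u2 = c" "mass v2 = d" "J G (u2, v2) < Einf c d + e/2"
    by (rule E_approx[OF assms(3,4) e2])
  have "Einf (a + c) (b + d) \<le> J G (superpose u1 u2, superpose v1 v2)"
    by (rule E_le) (use 1 2 in \<open>auto simp: superpose_H1 superpose_L2 H1_L2\<close>)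
  then show "Einf (a + c) (b + d) \<le> Einf a b + Einf c d + e"
    using J_superpose[OF 1(1,2) 2(1,2)] 1(5) 2(5) by argo
qed

text \<open>
  The pair \<open>(u, v)\<close> is, in terms of squared moduli, a convex combination of the two rescaled pairs.
\<close>

lemma pot_scale_convex:
  assumes H: "u \<in> H1" "v \<in> H1" and l: "0 \<le> l" "l \<le> 1"
    and t: "0 \<le> t1" "t1 \<le> s1" "0 \<le> t2" "t2 \<le> s2" "(1 - l) * t1 + l * s1 = 1" "(1 - l) * t2 + l * s2 = 1"
  shows "pot u v \<le> (1 - l) * pot (\<lambda>x. sqrt t1 *\<^sub>R u x) (\<lambda>x. sqrt t2 *\<^sub>R v x) + l * pot (\<lambda>x. sqrt s1 *\<^sub>R u x) (\<lambda>x. sqrt s2 *\<^sub>R v x)"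
proof -
  have i: "integrable lborel (\<lambda>x. G ((norm (sqrt a *\<^sub>R u x))\<^sup>2, (norm (sqrt b *\<^sub>R v x))\<^sup>2))" for a b
    by (intro pot_integrable H1_scaleR H)
  have n: "(norm (sqrt a *\<^sub>R z))\<^sup>2 = a * (norm z)\<^sup>2" if "0 \<le> a" for a and z :: complex
    using that by (simp add: power_mult_distrib)
  have "pot u v \<le> (LINT x|lborel. (1 - l) * G ((norm (sqrt t1 *\<^sub>R u x))\<^sup>2, (norm (sqrt t2 *\<^sub>R v x))\<^sup>2)
      + l * G ((norm (sqrt s1 *\<^sub>R u x))\<^sup>2, (norm (sqrt s2 *\<^sub>R v x))\<^sup>2))"
    unfolding pot_def
  proof (rule integral_mono)
    show "integrable lborel (\<lambda>x. (1 - l) * G ((norm (sqrt t1 *\<^sub>R u x))\<^sup>2, (norm (sqrt t2 *\<^sub>R v x))\<^sup>2)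
      + l * G ((norm (sqrt s1 *\<^sub>R u x))\<^sup>2, (norm (sqrt s2 *\<^sub>R v x))\<^sup>2))"
      by (intro Bochner_Integration.integrable_add integrable_mult_right i)
    fix x
    define a where "a = (norm (u x))\<^sup>2"
    define b where "b = (norm (v x))\<^sup>2"
    have ab: "0 \<le> a" "0 \<le> b" by (auto simp: a_def b_def)
    have e: "(1 - l) * (t1 * a) + l * (s1 * a) = a" "(1 - l) * (t2 * b) + l * (s2 * b) = b"
      using t(5,6) by (simp_all add: mult.assoc[symmetric] distrib_right[symmetric])
    have "G (a, b) \<le> (1 - l) * G (t1 * a, t2 * b) + l * G (s1 * a, s2 * b)"
      using G_convex[of "t1 * a" "s1 * a" "t2 * b" "s2 * b" l] t ab l unfolding e by (simp add: mult_right_mono)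
    moreover have "0 \<le> s1" "0 \<le> s2" using t by auto
    ultimately show "G ((norm (u x))\<^sup>2, (norm (v x))\<^sup>2) \<le> (1 - l) * G ((norm (sqrt t1 *\<^sub>R u x))\<^sup>2, (norm (sqrt t2 *\<^sub>R v x))\<^sup>2)
      + l * G ((norm (sqrt s1 *\<^sub>R u x))\<^sup>2, (norm (sqrt s2 *\<^sub>R v x))\<^sup>2)"
      unfolding n[OF t(1)] n[OF t(3)] n[OF \<open>0 \<le> s1\<close>] n[OF \<open>0 \<le> s2\<close>] a_def b_def by simp
  qed (rule pot_integrable[OF H])
  also have "\<dots> = (1 - l) * pot (\<lambda>x. sqrt t1 *\<^sub>R u x) (\<lambda>x. sqrt t2 *\<^sub>R v x) + l * pot (\<lambda>x. sqrt s1 *\<^sub>R u x) (\<lambda>x. sqrt s2 *\<^sub>R v x)"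
    unfolding pot_def using i by (simp only: Bochner_Integration.integral_add integrable_mult_right integral_mult_right_zero)
  finally show ?thesis .
qed

text \<open>
  A pair with the intermediate masses is rescaled in amplitude to the masses \<open>(a, b)\<close> and \<open>(a', b')\<close>. The
  kinetic energy is linear in the squared amplitudes and the potential energy convex, so the energy is
  concave; competitors for the two outer problems are obtained from one for the middle problem.
\<close>

lemma E_concave:
  assumes "0 \<le> a" "a \<le> a'" "0 \<le> b" "b \<le> b'" "0 \<le> l" "l \<le> 1"
  shows "(1 - l) * Einf a b + l * Einf a' b' \<le> Einf ((1 - l) * a + l * a') ((1 - l) * b + l * b')"
proof (cases "l = 0 \<or> l = 1")
  case True then show ?thesis by auto
next
  case False
  then have l: "0 < l" "l < 1" using assms by auto
  define \<mu> where "\<mu> = (1 - l) * a + l * a'"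
  define \<nu> where "\<nu> = (1 - l) * b + l * b'"
  have \<mu>\<nu>: "0 \<le> \<mu>" "0 \<le> \<nu>" using assms by (auto simp: \<mu>_def \<nu>_def)
  \<comment> \<open>the factors \<open>t\<close> and \<open>s\<close> rescale the mass \<open>m\<close> to \<open>x\<close> and to \<open>y\<close>\<close>
  have fac: "\<exists>t s. 0 \<le> t \<and> t \<le> s \<and> (1 - l) * t + l * s = 1 \<and> t * m = x \<and> s * m = y"
    if "0 \<le> x" "x \<le> y" "m = (1 - l) * x + l * y" for x y m
  proof (cases "y = 0")
    case False
    then have "0 < l * y" "0 \<le> (1 - l) * x" using that l by auto
    then have m: "0 < m" using that(3) by linarith
    have "(1 - l) * (x / m) + l * (y / m) = 1"
      using m that(3) by (simp add: add_divide_distrib[symmetric])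
    then show ?thesis using that m by (intro exI[of _ "x / m"] exI[of _ "y / m"]) (auto simp: divide_right_mono)
  next
    case True
    then show ?thesis using that by (intro exI[of _ 1] exI[of _ 1]) auto
  qed
  obtain t1 s1 where 1: "0 \<le> t1" "t1 \<le> s1" "(1 - l) * t1 + l * s1 = 1" "t1 * \<mu> = a" "s1 * \<mu> = a'"
    using fac[of a a' \<mu>] assms by (auto simp: \<mu>_def)
  obtain t2 s2 where 2: "0 \<le> t2" "t2 \<le> s2" "(1 - l) * t2 + l * s2 = 1" "t2 * \<nu> = b" "s2 * \<nu> = b'"
    using fac[of b b' \<nu>] assms by (auto simp: \<nu>_def)
  show ?thesis
    unfolding \<mu>_def[symmetric] \<nu>_def[symmetric]
  proof (rule E_ge[OF \<mu>\<nu>])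
    fix u v :: "real^'n \<Rightarrow> complex" assume H: "u \<in> H1" "v \<in> H1" and m: "mass u = \<mu>" "mass v = \<nu>"
    have s0: "0 \<le> s1" "0 \<le> s2" using 1 2 by auto
    have A: "Einf a b \<le> J G (\<lambda>x. sqrt t1 *\<^sub>R u x, \<lambda>x. sqrt t2 *\<^sub>R v x)"
      by (rule E_le) (use H m 1 2 in \<open>auto simp: H1_scaleR L2_scaleR H1_L2\<close>)
    have B: "Einf a' b' \<le> J G (\<lambda>x. sqrt s1 *\<^sub>R u x, \<lambda>x. sqrt s2 *\<^sub>R v x)"
      by (rule E_le) (use H m 1 2 s0 in \<open>auto simp: H1_scaleR L2_scaleR H1_L2\<close>)
    let ?pt = "pot (\<lambda>x. sqrt t1 *\<^sub>R u x) (\<lambda>x. sqrt t2 *\<^sub>R v x)" and ?ps = "pot (\<lambda>x. sqrt s1 *\<^sub>R u x) (\<lambda>x. sqrt s2 *\<^sub>R v x)"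
    have JA: "J G (\<lambda>x. sqrt t1 *\<^sub>R u x, \<lambda>x. sqrt t2 *\<^sub>R v x) = 1/2 * (t1 * kin u + t2 * kin v) - ?pt"
      using 1(1) 2(1) by (simp add: J_eq H1_scaleR H)
    have JB: "J G (\<lambda>x. sqrt s1 *\<^sub>R u x, \<lambda>x. sqrt s2 *\<^sub>R v x) = 1/2 * (s1 * kin u + s2 * kin v) - ?ps"
      using s0 by (simp add: J_eq H1_scaleR H)
    have "(1 - l) * (1/2 * (t1 * kin u + t2 * kin v)) + l * (1/2 * (s1 * kin u + s2 * kin v))
        = 1/2 * (((1 - l) * t1 + l * s1) * kin u + ((1 - l) * t2 + l * s2) * kin v)"
      by (simp add: field_simps)
    also have "\<dots> = 1/2 * (kin u + kin v)" by (simp add: 1(3) 2(3))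
    finally have k: "(1 - l) * (1/2 * (t1 * kin u + t2 * kin v)) + l * (1/2 * (s1 * kin u + s2 * kin v)) = 1/2 * (kin u + kin v)" .
    have p: "pot u v \<le> (1 - l) * ?pt + l * ?ps"
      by (rule pot_scale_convex[OF H _ _ 1(1,2) 2(1,2) 1(3) 2(3)]) (use l in auto)
    have "(1 - l) * Einf a b + l * Einf a' b'
      \<le> (1 - l) * (1/2 * (t1 * kin u + t2 * kin v) - ?pt) + l * (1/2 * (s1 * kin u + s2 * kin v) - ?ps)"
      using A B l unfolding JA JB by (intro add_mono mult_left_mono) auto
    also have "\<dots> = ((1 - l) * (1/2 * (t1 * kin u + t2 * kin v)) + l * (1/2 * (s1 * kin u + s2 * kin v))) - ((1 - l) * ?pt + l * ?ps)"
      by (simp only: right_diff_distrib)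
    also have "\<dots> \<le> J G (u, v)" unfolding k J_eq[OF H] using p by simp
    finally show "(1 - l) * Einf a b + l * Einf a' b' \<le> J G (u, v)" .
  qed
qed

lemma E_zero: "Einf 0 0 = 0"
proof (rule antisym)
  have "J G (\<lambda>x::real^'n. 0, \<lambda>x. 0) = 0"
    by (subst J_eq) (auto simp: null_H1 pot_null)
  then show "Einf 0 0 \<le> 0" using E_le[of "\<lambda>x. 0" "\<lambda>x. 0" 0 0] by (simp add: null_H1)
  show "0 \<le> Einf 0 0"
  proof (rule E_ge)
    fix u v :: "real^'n \<Rightarrow> complex" assume "u \<in> H1" "v \<in> H1" "mass u = 0" "mass v = 0"
    then show "0 \<le> J G (u, v)" by (simp add: J_eq pot_null)
  qed auto
qed

text \<open>
  For small masses the critical part is absorbed by the kinetic energy, and by \<open>\<gamma>_small\<close>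
  what remains is at most \<open>\<epsilon>\<close> times the mass.
\<close>

lemma E_small:
  assumes \<epsilon>: "0 < \<epsilon>"
  shows "\<exists>d>0. \<forall>a b. 0 \<le> a \<longrightarrow> 0 \<le> b \<longrightarrow> a + b < d \<longrightarrow> - \<epsilon> * (a + b) \<le> Einf a b"
proof -
  obtain C where C: "0 \<le> C" "\<And>\<rho>. 0 \<le> \<rho> \<Longrightarrow> \<gamma> \<rho> \<le> \<epsilon>/2 + C * \<rho> powr \<kappa>"
    using \<gamma>_small[of "\<epsilon>/2"] \<epsilon> by auto
  have "((\<lambda>x. C * GN * x powr \<kappa>) \<longlongrightarrow> C * GN * 0) (at_right 0)"
    by (intro tendsto_mult tendsto_const tendsto_zero_powrI[where b="\<kappa>"] tendsto_ident_at)
       (auto simp: eventually_at_filter p intro!: always_eventually)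
  then have "eventually (\<lambda>x. C * GN * x powr \<kappa> < min (1/2) (\<epsilon>/2)) (at_right 0)"
    by (rule order_tendstoD(2)) (use \<epsilon> in auto)
  then obtain d where d: "0 < d" "\<And>x. 0 < x \<Longrightarrow> x < d \<Longrightarrow> C * GN * x powr \<kappa> < min (1/2) (\<epsilon>/2)"
    by (auto simp: eventually_at_right_field)
  have "- \<epsilon> * (a + b) \<le> Einf a b" if ab: "0 \<le> a" "0 \<le> b" "a + b < d" for a b
  proof (cases "a + b = 0")
    case True
    then have "a = 0" "b = 0" using ab by linarith+
    then show ?thesis using E_zero by simp
  next
    case False
    then have m: "0 < a + b" using ab by simp
    show ?thesis
    proof (rule E_ge[OF ab(1,2)])
      fix u v :: "real^'n \<Rightarrow> complex" assume H: "u \<in> H1" "v \<in> H1" and mm: "mass u = a" "mass v = b"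
      note w = superpose_H1[OF H] superpose_L2[OF H[THEN H1_L2]]
      define x where "x = C * GN * (a + b) powr \<kappa>"
      have x: "0 \<le> x" "x \<le> 1/2" "x \<le> \<epsilon>/2" using d(2)[OF m ab(3)] C(1) GN_pos by (auto simp: x_def)
      have "crit_int (superpose u v) \<le> GN * (a + b) powr \<kappa> * (mass (superpose u v) + kin (superpose u v))"
        by (rule crit_global(2)[OF w(1) m]) (use w mm in auto)
      then have "C * crit_int (superpose u v) \<le> x * (mass (superpose u v) + kin (superpose u v))"
        using mult_left_mono[OF _ C(1)] unfolding x_def by (fastforce simp: mult.assoc)
      also have "\<dots> \<le> x * ((a + b) + (kin u + kin v))" using w mm x by (intro mult_left_mono) auto
      also have "\<dots> \<le> \<epsilon>/2 * (a + b) + 1/2 * (kin u + kin v)"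
      proof -
        have "x * (a + b) \<le> \<epsilon>/2 * (a + b)" using x m by (intro mult_right_mono) auto
        moreover have "x * (kin u + kin v) \<le> 1/2 * (kin u + kin v)" using x by (intro mult_right_mono) auto
        ultimately show ?thesis unfolding distrib_left[of x "a + b"] by linarith
      qed
      finally have "C * crit_int (superpose u v) \<le> \<epsilon>/2 * (a + b) + 1/2 * (kin u + kin v)" .
      moreover have "pot u v \<le> \<epsilon>/2 * (mass u + mass v) + C * crit_int (superpose u v)"
        by (rule pot_bound(2)[OF H _ C]) (use \<epsilon> in auto)
      ultimately show "- \<epsilon> * (a + b) \<le> J G (u, v)" unfolding J_eq[OF H] mm by argo
    qed
  qed
  then show ?thesis using d(1) by blast
qed

lemma two_mass_energy_E:
  assumes "\<And>a. 0 < a \<Longrightarrow> Einf a 0 < 0" "\<And>b. 0 < b \<Longrightarrow> Einf 0 b < 0"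
  shows "two_mass_energy Einf"
  by unfold_locales (fact E_zero E_subadditive E_concave assms E_small)+

lemma J_lsc:
  fixes u v :: "nat \<Rightarrow> real^'n \<Rightarrow> complex"
  assumes H: "\<And>n. u n \<in> H1" "\<And>n. v n \<in> H1" "u' \<in> H1" "v' \<in> H1"
    and b: "\<And>n. mass (u n) \<le> A" "\<And>n. mass (v n) \<le> A" "mass u' \<le> A" "mass v' \<le> A"
    and k: "\<And>n. kin (u n) \<le> A" "\<And>n. kin (v n) \<le> A" "kin u' \<le> A" "kin v' \<le> A"
    and lim: "(\<lambda>n. mass (\<lambda>x. u n x - u' x)) \<longlonglongrightarrow> 0" "(\<lambda>n. mass (\<lambda>x. v n x - v' x)) \<longlonglongrightarrow> 0"
    and AE: "AE x in lborel. (\<lambda>n. u n x) \<longlonglongrightarrow> u' x" "AE x in lborel. (\<lambda>n. v n x) \<longlonglongrightarrow> v' x" and e: "0 < e"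
  shows "eventually (\<lambda>n. J G (u', v') - e < J G (u n, v n)) sequentially"
proof -
  have e2: "0 < e / 2" using e by simp
  have "(\<lambda>n. pot (u n) (v n)) \<longlonglongrightarrow> pot u' v'" by (rule pot_continuous[OF H b k lim])
  then have "eventually (\<lambda>n. pot (u n) (v n) < pot u' v' + e/2) sequentially"
    by (rule order_tendstoD(2)) (use e in simp)
  with kin_lsc[OF H(1,3) AE(1) e2] kin_lsc[OF H(2,4) AE(2) e2] show ?thesis
  proof eventually_elim
    case (elim n)
    then show ?case unfolding J_eq[OF H(1)[of n] H(2)[of n]] J_eq[OF H(3,4)] by argo
  qed
qed

end

section \<open>Splitting the energy at a large radius\<close>

text \<open>
  The angle rises from \<open>0\<close> inside the ball of radius \<open>R\<close> to \<open>pi / 2\<close> outside the ball of radius \<open>2 R\<close>;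
  its cosine and sine cut a function into two parts whose squared moduli add up to that of the function.
  The shell part agrees with the function on the annulus between the two radii and measures what is lost there.
\<close>

definition cut_angle :: "real \<Rightarrow> real^'n::finite \<Rightarrow> real" where
  "cut_angle R x = max 0 (min 1 ((norm x - R) / R)) * (pi / 2)"

definition inner_part :: "real \<Rightarrow> (real^'n::finite \<Rightarrow> complex) \<Rightarrow> real^'n \<Rightarrow> complex" where
  "inner_part R f x = cos (cut_angle R x) *\<^sub>R f x"

definition outer_part :: "real \<Rightarrow> (real^'n::finite \<Rightarrow> complex) \<Rightarrow> real^'n \<Rightarrow> complex" where
  "outer_part R f x = sin (cut_angle R x) *\<^sub>R f x"

definition shell_part :: "real \<Rightarrow> (real^'n::finite \<Rightarrow> complex) \<Rightarrow> real^'n \<Rightarrow> complex" where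
  "shell_part R f = outer_part (R / 2) (inner_part (2 * R) f)"

lemma cut_angle_Lipschitz:
  assumes "0 < R" shows "\<bar>cut_angle R x - cut_angle R y\<bar> \<le> (pi / (2 * R)) * norm (x - y)"
proof -
  have "\<bar>cut_angle R x - cut_angle R y\<bar> = \<bar>max 0 (min 1 ((norm x - R) / R)) - max 0 (min 1 ((norm y - R) / R))\<bar> * (pi / 2)"
  proof -
    have "cut_angle R x - cut_angle R y = (max 0 (min 1 ((norm x - R) / R)) - max 0 (min 1 ((norm y - R) / R))) * (pi / 2)"
      unfolding cut_angle_def by (rule left_diff_distrib[symmetric])
    then show ?thesis by (simp only: abs_mult) simp
  qed
  also have "\<dots> \<le> \<bar>(norm x - R) / R - (norm y - R) / R\<bar> * (pi / 2)"
    by (intro mult_right_mono) (auto simp: max_def min_def)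
  also have "(norm x - R) / R - (norm y - R) / R = (norm x - norm y) / R"
    by (simp add: diff_divide_distrib)
  also have "\<bar>(norm x - norm y) / R\<bar> * (pi / 2) = \<bar>norm x - norm y\<bar> * (pi / (2 * R))"
    using assms by (simp add: abs_divide)
  also have "\<dots> \<le> norm (x - y) * (pi / (2 * R))"
    using assms by (intro mult_right_mono norm_triangle_ineq3) auto
  finally show ?thesis by (simp add: mult.commute)
qed

lemma cut_angle_measurable [measurable]: "cut_angle R \<in> borel_measurable borel"
  unfolding cut_angle_def[abs_def] by measurable

lemma cut_angle_inside: "0 < R \<Longrightarrow> norm x \<le> R \<Longrightarrow> cut_angle R x = 0"
  by (simp add: cut_angle_def divide_le_0_iff)

lemma cut_angle_outside: "0 < R \<Longrightarrow> 2 * R \<le> norm x \<Longrightarrow> cut_angle R x = pi / 2"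
  by (simp add: cut_angle_def min_def max_def field_simps)

lemma cut_trig_outside:
  assumes "0 < R" "2 * R \<le> norm x"
  shows "cos (cut_angle R x) = 0" and "sin (cut_angle R x) = 1"
  unfolding cut_angle_outside[OF assms] by (rule cos_pi_half sin_pi_half)+

lemma part_norm:
  "norm (inner_part R f x) \<le> norm (f x)" "norm (outer_part R f x) \<le> norm (f x)" "norm (shell_part R f x) \<le> norm (f x)"
proof -
  have i: "norm (inner_part R f x) \<le> norm (f x)" for R and f :: "real^'n::finite \<Rightarrow> complex" and x
    using mult_right_mono[OF abs_cos_le_one[of "cut_angle R x"] norm_ge_zero[of "f x"]] by (simp add: inner_part_def)
  have o: "norm (outer_part R f x) \<le> norm (f x)" for R and f :: "real^'n::finite \<Rightarrow> complex" and x
    using mult_right_mono[OF abs_sin_le_one[of "cut_angle R x"] norm_ge_zero[of "f x"]] by (simp add: outer_part_def)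
  show "norm (inner_part R f x) \<le> norm (f x)" "norm (outer_part R f x) \<le> norm (f x)" "norm (shell_part R f x) \<le> norm (f x)"
    using i o order_trans[OF o i] by (auto simp: shell_part_def)
qed

lemma inner_outer_H1:
  fixes f :: "real^'n::finite \<Rightarrow> complex"
  assumes f: "f \<in> H1" and R: "0 < R"
  shows "inner_part R f \<in> H1" and "outer_part R f \<in> H1"
    and "mass (inner_part R f) + mass (outer_part R f) = mass f"
    and "kin (inner_part R f) + kin (outer_part R f) \<le> kin f + CARD('n) * (pi / (2 * R))\<^sup>2 * mass f"
  using cutoff_H1[OF f cut_angle_Lipschitz[OF R] cut_angle_measurable] cutoff_L2(3)[OF H1_L2[OF f] cut_angle_measurable, of R]
  by (auto simp: inner_part_def[abs_def] outer_part_def[abs_def])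

lemma part_kin_bound:
  fixes f :: "real^'n::finite \<Rightarrow> complex"
  assumes f: "f \<in> H1" and R: "1 \<le> R"
  shows "kin (inner_part R f) \<le> kin f + CARD('n) * 4 * mass f" "kin (outer_part R f) \<le> kin f + CARD('n) * 4 * mass f"
proof -
  have "pi / (2 * R) \<le> 2"
    using pi_less_4 R by (simp add: field_simps)
  then have "(pi / (2 * R))\<^sup>2 \<le> 2\<^sup>2" using R by (intro power_mono) auto
  then have "CARD('n) * (pi / (2 * R))\<^sup>2 * mass f \<le> CARD('n) * 4 * mass f"
    by (intro mult_right_mono mult_left_mono) auto
  then show "kin (inner_part R f) \<le> kin f + CARD('n) * 4 * mass f" "kin (outer_part R f) \<le> kin f + CARD('n) * 4 * mass f"
    using inner_outer_H1(4)[OF f, of R] R kin_nonneg[of "inner_part R f"] kin_nonneg[of "outer_part R f"] by linarith+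
qed

lemma shell_H1:
  fixes f :: "real^'n::finite \<Rightarrow> complex"
  assumes f: "f \<in> H1" and R: "2 \<le> R"
  shows "shell_part R f \<in> H1" and "kin (shell_part R f) \<le> kin f + CARD('n) * 8 * mass f"
proof -
  have i: "inner_part (2 * R) f \<in> H1" using inner_outer_H1(1)[OF f, of "2 * R"] R by simp
  show "shell_part R f \<in> H1" unfolding shell_part_def using inner_outer_H1(2)[OF i, of "R/2"] R by simp
  have m: "mass (inner_part (2 * R) f) \<le> mass f"
    using inner_outer_H1(3)[OF f, of "2 * R"] R mass_nonneg[of "outer_part (2 * R) f"] by linarith
  have "kin (shell_part R f) \<le> kin (inner_part (2 * R) f) + CARD('n) * 4 * mass (inner_part (2 * R) f)"
    unfolding shell_part_def by (rule part_kin_bound(2)[OF i]) (use R in simp)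
  also have "\<dots> \<le> (kin f + CARD('n) * 4 * mass f) + CARD('n) * 4 * mass f"
    using part_kin_bound(1)[OF f, of "2 * R"] R m by (intro add_mono mult_left_mono) auto
  finally show "kin (shell_part R f) \<le> kin f + CARD('n) * 8 * mass f" by (simp add: algebra_simps)
qed

lemma part_limit:
  fixes f :: "nat \<Rightarrow> real^'n::finite \<Rightarrow> complex"
  assumes f: "\<And>n. f n \<in> H1" "g \<in> H1"
    and loc: "\<And>R. (\<lambda>n. mass (\<lambda>x. indicator (ball 0 R) x *\<^sub>R (f n x - g x))) \<longlonglongrightarrow> 0" and R: "0 < R"
  shows "(\<lambda>n. mass (\<lambda>x. inner_part R (f n) x - inner_part R g x)) \<longlonglongrightarrow> 0"
    and "(\<lambda>n. mass (\<lambda>x. shell_part R (f n) x - shell_part R g x)) \<longlonglongrightarrow> 0"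
proof -
  have meas [measurable]: "f n \<in> borel_measurable borel" "g \<in> borel_measurable borel" for n using f by (auto intro!: L2_measurable H1_L2)
  have *: "(\<lambda>n. mass (\<lambda>x. c x *\<^sub>R (f n x - g x))) \<longlonglongrightarrow> 0"
    if c: "c \<in> borel_measurable borel" "\<And>x. \<bar>c x\<bar> \<le> indicator (ball 0 S) x" for c :: "real^'n \<Rightarrow> real" and S
  proof (rule Lim_null_comparison[OF _ loc[of S]], rule always_eventually, rule allI)
    fix n
    have L: "(\<lambda>x. f n x - g x) \<in> L2" by (intro L2_diff H1_L2 f)
    have iL: "(\<lambda>x. indicator (ball 0 S) x *\<^sub>R (f n x - g x)) \<in> L2"
    proof (rule L2_mono(1)[OF _ L])
      show "(\<lambda>x. indicator (ball 0 S) x *\<^sub>R (f n x - g x)) \<in> borel_measurable borel"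
        by (intro borel_measurable_scaleR borel_measurable_indicator L2_measurable[OF L]) simp
    qed (auto simp: indicator_def)
    have "mass (\<lambda>x. c x *\<^sub>R (f n x - g x)) \<le> mass (\<lambda>x. indicator (ball 0 S) x *\<^sub>R (f n x - g x))"
    proof (rule L2_mono(2)[OF _ iL])
      show "(\<lambda>x. c x *\<^sub>R (f n x - g x)) \<in> borel_measurable borel"
        by (intro borel_measurable_scaleR c L2_measurable[OF L])
      show "norm (c x *\<^sub>R (f n x - g x)) \<le> norm (indicator (ball 0 S) x *\<^sub>R (f n x - g x))" for x
        using mult_right_mono[OF c(2)[of x] norm_ge_zero[of "f n x - g x"]] by simp
    qed
    then show "norm (mass (\<lambda>x. c x *\<^sub>R (f n x - g x))) \<le> mass (\<lambda>x. indicator (ball 0 S) x *\<^sub>R (f n x - g x))" by simp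
  qed
  have c1: "\<bar>cos (cut_angle S x)\<bar> \<le> indicator (ball 0 (2 * S)) x" if "0 < S" for S and x :: "real^'n"
    using cut_trig_outside(1)[OF that, of x] abs_cos_le_one[of "cut_angle S x"] by (auto simp: indicator_def)
  have "(\<lambda>x. inner_part R (f n) x - inner_part R g x) = (\<lambda>x. cos (cut_angle R x) *\<^sub>R (f n x - g x))" for n
    by (simp add: inner_part_def scaleR_diff_right)
  then show "(\<lambda>n. mass (\<lambda>x. inner_part R (f n) x - inner_part R g x)) \<longlonglongrightarrow> 0"
    using *[of "\<lambda>x. cos (cut_angle R x)" "2 * R"] c1[OF R] by simp
  have c2: "\<bar>sin (cut_angle (R/2) x) * cos (cut_angle (2*R) x)\<bar> \<le> indicator (ball 0 (2 * (2 * R))) x" for x :: "real^'n"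
  proof -
    have "\<bar>sin (cut_angle (R/2) x)\<bar> * \<bar>cos (cut_angle (2*R) x)\<bar> \<le> 1 * indicator (ball 0 (2 * (2 * R))) x"
      using c1[of "2*R" x] R by (intro mult_mono) auto
    then show ?thesis by (simp add: abs_mult)
  qed
  have "(\<lambda>x. shell_part R (f n) x - shell_part R g x) = (\<lambda>x. (sin (cut_angle (R/2) x) * cos (cut_angle (2*R) x)) *\<^sub>R (f n x - g x))" for n
    by (simp add: shell_part_def inner_part_def outer_part_def scaleR_diff_right)
  then show "(\<lambda>n. mass (\<lambda>x. shell_part R (f n) x - shell_part R g x)) \<longlonglongrightarrow> 0"
    using *[of "\<lambda>x. sin (cut_angle (R/2) x) * cos (cut_angle (2*R) x)" "2 * (2 * R)"] c2 by simp
qed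

lemma mass_dominated:
  fixes f :: "nat \<Rightarrow> real^'n::finite \<Rightarrow> complex"
  assumes f: "\<And>n. f n \<in> borel_measurable borel" and g: "g \<in> L2" and le: "\<And>n x. norm (f n x) \<le> norm (g x)"
    and lim: "\<And>x. (\<lambda>n. f n x) \<longlonglongrightarrow> 0"
  shows "(\<lambda>n. mass (f n)) \<longlonglongrightarrow> 0"
proof -
  have "(\<lambda>n. LINT x|lborel. (norm (f n x))\<^sup>2) \<longlonglongrightarrow> (LINT x::real^'n|lborel. 0)"
  proof (rule integral_dominated_convergence[OF _ _ L2_integrable[OF g]])
    show "(\<lambda>x. (norm (f n x))\<^sup>2) \<in> borel_measurable lborel" for n using f[of n] by measurable
    show "AE x in lborel. (\<lambda>n. (norm (f n x))\<^sup>2) \<longlonglongrightarrow> 0"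
      using tendsto_power[OF tendsto_norm[OF lim], of _ 2] by simp
    show "AE x in lborel. norm ((norm (f n x))\<^sup>2) \<le> (norm (g x))\<^sup>2" for n
      using le by (simp add: power_mono)
  qed simp
  then show ?thesis by (simp add: mass_def)
qed

lemma inner_part_exhausts:
  fixes g :: "real^'n::finite \<Rightarrow> complex"
  assumes g: "g \<in> H1"
  shows "(\<lambda>n. inner_part (real n + 2) g x) \<longlonglongrightarrow> g x"
    and "(\<lambda>n. mass (\<lambda>x. inner_part (real n + 2) g x - g x)) \<longlonglongrightarrow> 0"
    and "(\<lambda>n. mass (\<lambda>x. shell_part (real n + 2) g x - 0)) \<longlonglongrightarrow> 0"
proof -
  have [measurable]: "g \<in> borel_measurable borel" using H1_L2[OF g] by auto
  have ev: "eventually (\<lambda>n. inner_part (real n + 2) g x = g x \<and> shell_part (real n + 2) g x = 0) sequentially" for x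
    using eventually_ge_at_top[of "nat \<lceil>2 * norm x\<rceil>"]
  proof eventually_elim
    case (elim n)
    then have n: "2 * norm x \<le> real n + 2" using real_nat_ceiling_ge[of "2 * norm x"] by linarith
    then have "norm x \<le> real n + 2" using norm_ge_zero[of x] by linarith
    then have "cut_angle (real n + 2) x = 0" by (intro cut_angle_inside) auto
    moreover have "cut_angle ((real n + 2) / 2) x = 0" using n by (intro cut_angle_inside) auto
    ultimately show ?case by (simp add: inner_part_def shell_part_def outer_part_def)
  qed
  show lim: "(\<lambda>n. inner_part (real n + 2) g x) \<longlonglongrightarrow> g x" for x
    by (rule tendsto_eventually) (use ev[of x] in \<open>auto elim: eventually_mono\<close>)
  have m: "inner_part R g \<in> borel_measurable borel" "shell_part R g \<in> borel_measurable borel" for R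
    unfolding inner_part_def[abs_def] shell_part_def outer_part_def[abs_def] by measurable
  show "(\<lambda>n. mass (\<lambda>x. inner_part (real n + 2) g x - g x)) \<longlonglongrightarrow> 0"
  proof (rule mass_dominated[OF _ L2_scaleR(1)[OF H1_L2[OF g], of 2]])
    show "(\<lambda>x. inner_part (real n + 2) g x - g x) \<in> borel_measurable borel" for n using m(1) by measurable
    show "norm (inner_part (real n + 2) g x - g x) \<le> norm (2 *\<^sub>R g x)" for n x
      using norm_triangle_ineq4[of "inner_part (real n + 2) g x" "g x"] part_norm(1)[of "real n + 2" g x] by simp
    show "(\<lambda>n. inner_part (real n + 2) g x - g x) \<longlonglongrightarrow> 0" for x
      using lim[of x] by (simp add: LIM_zero)
  qed
  show "(\<lambda>n. mass (\<lambda>x. shell_part (real n + 2) g x - 0)) \<longlonglongrightarrow> 0"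
  proof (rule mass_dominated[OF _ H1_L2[OF g]])
    show "(\<lambda>x. shell_part (real n + 2) g x - 0) \<in> borel_measurable borel" for n using m(2) by simp
    show "norm (shell_part (real n + 2) g x - 0) \<le> norm (g x)" for n x using part_norm(3)[of "real n + 2" g x] by simp
    show "(\<lambda>n. shell_part (real n + 2) g x - 0) \<longlonglongrightarrow> 0" for x
      by (rule tendsto_eventually) (use ev[of x] in \<open>auto elim: eventually_mono\<close>)
  qed
qed

context energy
begin

text \<open>
  The kinetic error comes from \<open>rotation_increment\<close>. The potential energy is split exactly outside the
  annulus; on the annulus the shell part is the whole function, and its potential energy covers the deficit.
\<close>

lemma J_split:
  fixes u v :: "real^'n \<Rightarrow> complex"
  assumes H: "u \<in> H1" "v \<in> H1" and R: "2 \<le> R"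
  shows "J G (inner_part R u, inner_part R v) + J G (outer_part R u, outer_part R v)
    \<le> J G (u, v) + CARD('n) * (pi / (2 * R))\<^sup>2 * (mass u + mass v) / 2 + pot (shell_part R u) (shell_part R v)"
proof -
  have R0: "0 < R" using R by simp
  note P = inner_outer_H1[OF H(1) R0] inner_outer_H1[OF H(2) R0]
  note S = shell_H1(1)[OF H(1) R] shell_H1(1)[OF H(2) R]
  have i1: "integrable lborel (\<lambda>x. G ((norm (inner_part R u x))\<^sup>2, (norm (inner_part R v x))\<^sup>2))" by (rule pot_integrable[OF P(1,5)])
  have i2: "integrable lborel (\<lambda>x. G ((norm (outer_part R u x))\<^sup>2, (norm (outer_part R v x))\<^sup>2))" by (rule pot_integrable[OF P(2,6)])
  have i3: "integrable lborel (\<lambda>x. G ((norm (shell_part R u x))\<^sup>2, (norm (shell_part R v x))\<^sup>2))" by (rule pot_integrable[OF S])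
  have "pot u v \<le> (LINT x|lborel. (G ((norm (inner_part R u x))\<^sup>2, (norm (inner_part R v x))\<^sup>2)
      + G ((norm (outer_part R u x))\<^sup>2, (norm (outer_part R v x))\<^sup>2)) + G ((norm (shell_part R u x))\<^sup>2, (norm (shell_part R v x))\<^sup>2))"
    unfolding pot_def
  proof (rule integral_mono[OF pot_integrable[OF H]])
    show "integrable lborel (\<lambda>x. (G ((norm (inner_part R u x))\<^sup>2, (norm (inner_part R v x))\<^sup>2)
      + G ((norm (outer_part R u x))\<^sup>2, (norm (outer_part R v x))\<^sup>2)) + G ((norm (shell_part R u x))\<^sup>2, (norm (shell_part R v x))\<^sup>2))"
      by (intro Bochner_Integration.integrable_add i1 i2 i3)
    fix x
    have nn: "0 \<le> G ((norm (f x))\<^sup>2, (norm (g x))\<^sup>2)" for f g :: "real^'n \<Rightarrow> complex" by (simp add: G_nonneg)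
    consider "norm x \<le> R" | "R \<le> norm x" "norm x \<le> 2 * R" | "2 * R \<le> norm x" by linarith
    then show "G ((norm (u x))\<^sup>2, (norm (v x))\<^sup>2) \<le> (G ((norm (inner_part R u x))\<^sup>2, (norm (inner_part R v x))\<^sup>2)
      + G ((norm (outer_part R u x))\<^sup>2, (norm (outer_part R v x))\<^sup>2)) + G ((norm (shell_part R u x))\<^sup>2, (norm (shell_part R v x))\<^sup>2)"
    proof cases
      case 1
      then have "inner_part R u x = u x" "inner_part R v x = v x"
        using cut_angle_inside[OF R0, of x] by (auto simp: inner_part_def)
      then show ?thesis using nn[of "outer_part R u" "outer_part R v"] nn[of "shell_part R u" "shell_part R v"] by simp
    next
      case 2
      then have "sin (cut_angle (R/2) x) = 1" "cut_angle (2*R) x = 0"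
        using cut_trig_outside(2)[of "R/2" x] cut_angle_inside[of "2*R" x] R0 by auto
      then have "shell_part R u x = u x" "shell_part R v x = v x"
        by (auto simp: shell_part_def inner_part_def outer_part_def)
      then show ?thesis using nn[of "outer_part R u" "outer_part R v"] nn[of "inner_part R u" "inner_part R v"] by simp
    next
      case 3
      then have "outer_part R u x = u x" "outer_part R v x = v x"
        using cut_trig_outside[OF R0, of x] by (auto simp: outer_part_def)
      then show ?thesis using nn[of "inner_part R u" "inner_part R v"] nn[of "shell_part R u" "shell_part R v"] by simp
    qed
  qed
  also have "\<dots> = pot (inner_part R u) (inner_part R v) + pot (outer_part R u) (outer_part R v) + pot (shell_part R u) (shell_part R v)"
    unfolding pot_def using i1 i2 i3 by simp
  finally have pot: "pot u v \<le> pot (inner_part R u) (inner_part R v) + pot (outer_part R u) (outer_part R v) + pot (shell_part R u) (shell_part R v)" .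
  define K where "K = CARD('n) * (pi / (2 * R))\<^sup>2"
  have "K * (mass u + mass v) / 2 = (K * mass u + K * mass v) / 2" by (simp add: distrib_left)
  then show ?thesis
    using pot P(4,8) unfolding J_eq[OF H] J_eq[OF P(1,5)] J_eq[OF P(2,6)] K_def[symmetric] by argo
qed

lemma J_translate:
  fixes u v :: "real^'n \<Rightarrow> complex"
  assumes H: "u \<in> H1" "v \<in> H1"
  shows "J G (\<lambda>x. u (x + y), \<lambda>x. v (x + y)) = J G (u, v)"
proof -
  have "pot (\<lambda>x. u (x + y)) (\<lambda>x. v (x + y)) = pot u v"
    unfolding pot_def
    by (rule integral_translate[where f="\<lambda>x. G ((norm (u x))\<^sup>2, (norm (v x))\<^sup>2)"])
       (use G_H1_measurable[OF H[THEN H1_L2]] in simp)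
  then show ?thesis by (simp add: J_eq H1_translate H)
qed

lemma local_mass_superpose:
  fixes u v :: "real^'n \<Rightarrow> complex"
  assumes "u \<in> L2" "v \<in> L2"
  shows "local_mass t (superpose u v) y = local_mass t u y + local_mass t v y"
  unfolding local_mass_def superpose_norm distrib_left
  by (rule Bochner_Integration.integral_add) (intro local_mass_integrable assms)+

text \<open>
  If all local masses were small, \<open>crit_local\<close> would make the potential energy at most \<open>- c / 4\<close>, and then
  the energy could not be close to \<open>c\<close>.
\<close>

lemma nonvanishing:
  fixes u v :: "nat \<Rightarrow> real^'n \<Rightarrow> complex"
  assumes H: "\<And>n. u n \<in> H1" "\<And>n. v n \<in> H1"
    and b: "\<And>n. mass (u n) + mass (v n) \<le> A" "\<And>n. kin (u n) + kin (v n) \<le> A"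
    and lim: "(\<lambda>n. J G (u n, v n)) \<longlonglongrightarrow> c" and c: "c < 0"
  shows "\<exists>\<delta>>0. eventually (\<lambda>n. \<exists>y. \<delta> \<le> local_mass 1 (u n) y + local_mass 1 (v n) y) sequentially"
proof -
  have A: "0 \<le> A" using order_trans[OF add_nonneg_nonneg[OF mass_nonneg mass_nonneg] b(1)] .
  define \<epsilon> where "\<epsilon> = - c / (8 * (A + 1))"
  have \<epsilon>: "0 < \<epsilon>" unfolding \<epsilon>_def using c A by (intro divide_pos_pos) auto
  have \<epsilon>A: "\<epsilon> * A \<le> - c / 8"
  proof -
    have "\<epsilon> * A \<le> \<epsilon> * (A + 1)" using \<epsilon> by simp
    also have "\<dots> = - c / 8" using A by (simp add: \<epsilon>_def field_simps)
    finally show ?thesis .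
  qed
  obtain C where C: "0 \<le> C" "\<And>\<rho>. 0 \<le> \<rho> \<Longrightarrow> \<gamma> \<rho> \<le> \<epsilon> + C * \<rho> powr \<kappa>"
    using \<gamma>_small[OF \<epsilon>] by auto
  have "((\<lambda>x. C * (GN * x powr \<kappa> * (2 * A))) \<longlongrightarrow> C * (GN * 0 * (2 * A))) (at_right 0)"
    by (intro tendsto_mult tendsto_const tendsto_zero_powrI[where b="\<kappa>"] tendsto_ident_at)
       (auto simp: eventually_at_filter p intro!: always_eventually)
  then have "eventually (\<lambda>x. C * (GN * x powr \<kappa> * (2 * A)) < - c / 8) (at_right 0)"
    by (rule order_tendstoD(2)) (use c in auto)
  then obtain d where d: "0 < d" "\<And>x. 0 < x \<Longrightarrow> x < d \<Longrightarrow> C * (GN * x powr \<kappa> * (2 * A)) < - c / 8"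
    by (auto simp: eventually_at_right_field)
  define \<delta> where "\<delta> = d / 2"
  have \<delta>: "0 < \<delta>" "C * (GN * \<delta> powr \<kappa> * (2 * A)) < - c / 8" using d by (auto simp: \<delta>_def)
  have "eventually (\<lambda>n. J G (u n, v n) < c / 2) sequentially"
    using order_tendstoD(2)[OF lim, of "c/2"] c by simp
  then have "eventually (\<lambda>n. \<exists>y. \<delta> \<le> local_mass 1 (u n) y + local_mass 1 (v n) y) sequentially"
  proof eventually_elim
    case (elim n)
    show ?case
    proof (rule ccontr)
      assume "\<not> ?thesis"
      then have small: "local_mass 1 (u n) y + local_mass 1 (v n) y \<le> \<delta>" for y by (metis less_imp_le not_le)
      note w = superpose_H1[OF H(1)[of n] H(2)[of n]] superpose_L2[OF H1_L2[OF H(1)[of n]] H1_L2[OF H(2)[of n]]]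
      have "crit_int (superpose (u n) (v n)) \<le> GN * \<delta> powr \<kappa> * (mass (superpose (u n) (v n)) + kin (superpose (u n) (v n)))"
        by (rule crit_local(2)[OF w(1) \<delta>(1)]) (simp add: local_mass_superpose H1_L2 H small)
      also have "\<dots> \<le> GN * \<delta> powr \<kappa> * (2 * A)"
        using w b(1)[of n] b(2)[of n] GN_pos by (intro mult_left_mono) auto
      finally have "C * crit_int (superpose (u n) (v n)) \<le> C * (GN * \<delta> powr \<kappa> * (2 * A))"
        using C(1) by (rule mult_left_mono)
      moreover have "pot (u n) (v n) \<le> \<epsilon> * (mass (u n) + mass (v n)) + C * crit_int (superpose (u n) (v n))"
        by (rule pot_bound(2)[OF H(1) H(2) _ C]) (use \<epsilon> in simp)
      moreover have "\<epsilon> * (mass (u n) + mass (v n)) \<le> \<epsilon> * A" using b(1)[of n] \<epsilon> by (intro mult_left_mono) auto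
      ultimately have "pot (u n) (v n) \<le> - c / 4" using \<delta>(2) \<epsilon>A by argo
      then show False using elim c kin_nonneg[of "u n"] kin_nonneg[of "v n"] unfolding J_eq[OF H(1)[of n] H(2)[of n]] by argo
    qed
  qed
  then show ?thesis using \<delta>(1) by blast
qed

end

section \<open>Compactness of minimizing sequences\<close>

lemma local_mass_translate: "local_mass t (\<lambda>x. f (x + y)) 0 = local_mass t f y"
  by (simp add: local_mass_def add.commute)

text \<open>
  A unit cube at the origin lies in a ball, where the convergence provided by \<open>Rellich\<close> is available.
\<close>

lemma local_mass_le_ball:
  fixes f :: "real^'n::finite \<Rightarrow> complex"
  assumes f: "f \<in> L2"
  shows "local_mass 1 f 0 \<le> mass (\<lambda>x. indicator (ball 0 (real CARD('n) + 1)) x *\<^sub>R f x)"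
  unfolding local_mass_def mass_def
proof (rule integral_mono)
  have L: "(\<lambda>x. indicator (ball 0 (real CARD('n) + 1)) x *\<^sub>R f x) \<in> L2"
  proof (rule L2_mono(1)[OF _ f])
    show "(\<lambda>x. indicator (ball 0 (real CARD('n) + 1)) x *\<^sub>R f x) \<in> borel_measurable borel"
      by (intro borel_measurable_scaleR borel_measurable_indicator L2_measurable[OF f]) simp
  qed (auto simp: indicator_def)
  show "integrable lborel (\<lambda>x. (norm (indicator (ball 0 (real CARD('n) + 1)) x *\<^sub>R f x))\<^sup>2)" by (rule L2_integrable[OF L])
  show "integrable lborel (\<lambda>z. indicator (cube 1) z * (norm (f (0 + z)))\<^sup>2)" by (rule local_mass_integrable[OF f])
  fix z :: "real^'n"
  have "norm z < real CARD('n) + 1" if "z \<in> cube 1"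
  proof -
    have "(norm z)\<^sup>2 \<le> real CARD('n) * 1\<^sup>2" by (rule cube_norm[OF that])
    also have "\<dots> < (real CARD('n) + 1)\<^sup>2" by (simp add: power2_eq_square algebra_simps add_pos_nonneg)
    finally show ?thesis by (rule power2_less_imp_less) simp
  qed
  then show "indicator (cube 1) z * (norm (f (0 + z)))\<^sup>2 \<le> (norm (indicator (ball 0 (real CARD('n) + 1)) z *\<^sub>R f z))\<^sup>2"
    by (auto simp: indicator_def)
qed

text \<open>
  By the parallelogram identity, the mass of \<open>f n - g\<close> is \<open>4 mass g\<close> minus the mass of \<open>f n + g\<close>, and
  the latter is lower semicontinuous with limit function \<open>2 g\<close>.
\<close>

lemma mass_convergence:
  fixes f :: "nat \<Rightarrow> real^'n::finite \<Rightarrow> complex"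
  assumes f: "\<And>n. f n \<in> L2" "g \<in> L2" and m: "\<And>n. mass (f n) = mass g"
    and AE: "AE x in lborel. (\<lambda>n. f n x) \<longlonglongrightarrow> g x"
  shows "(\<lambda>n. mass (\<lambda>x. f n x - g x)) \<longlonglongrightarrow> 0"
proof (rule LIMSEQ_I)
  fix e :: real assume e: "0 < e"
  have g2: "(\<lambda>x. g x + g x) \<in> L2" "mass (\<lambda>x. g x + g x) = 4 * mass g"
    using L2_scaleR[OF f(2), of 2] by (simp_all add: scaleR_2)
  have "AE x in lborel. (\<lambda>n. f n x + g x) \<longlonglongrightarrow> g x + g x"
    using AE by eventually_elim (intro tendsto_intros)
  then have "eventually (\<lambda>n. mass (\<lambda>x. g x + g x) - e < mass (\<lambda>x. f n x + g x)) sequentially"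
    by (rule mass_lsc[OF L2_add(1)[OF f] g2(1) _ e])
  then obtain N where N: "\<And>n. n \<ge> N \<Longrightarrow> 4 * mass g - e < mass (\<lambda>x. f n x + g x)"
    unfolding g2(2) by (auto simp: eventually_sequentially)
  have "norm (mass (\<lambda>x. f n x - g x) - 0) < e" if "n \<ge> N" for n
    using N[OF that] mass_parallelogram[OF f(1)[of n] f(2)] m[of n] by simp
  then show "\<exists>no. \<forall>n\<ge>no. norm (mass (\<lambda>x. f n x - g x) - 0) < e" by blast
qed

lemma kin_convergence:
  fixes f :: "nat \<Rightarrow> real^'n::finite \<Rightarrow> complex"
  assumes f: "\<And>n. f n \<in> H1" "g \<in> H1" and AE: "AE x in lborel. (\<lambda>n. f n x) \<longlonglongrightarrow> g x"
    and up: "\<And>e. 0 < e \<Longrightarrow> eventually (\<lambda>n. kin (f n) < kin g + e) sequentially"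
  shows "(\<lambda>n. kin (\<lambda>x. f n x - g x)) \<longlonglongrightarrow> 0"
proof (rule LIMSEQ_I)
  fix e :: real assume e: "0 < e"
  have e4: "0 < e / 4" using e by simp
  have g2: "(\<lambda>x. g x + g x) \<in> H1" "kin (\<lambda>x. g x + g x) = 4 * kin g"
    using H1_scaleR[OF f(2), of 2] by (simp_all add: scaleR_2)
  have "AE x in lborel. (\<lambda>n. f n x + g x) \<longlonglongrightarrow> g x + g x"
    using AE by eventually_elim (intro tendsto_intros)
  then have "eventually (\<lambda>n. kin (\<lambda>x. g x + g x) - e/4 < kin (\<lambda>x. f n x + g x)) sequentially"
    by (rule kin_lsc[OF H1_add_diff(1)[OF f] g2(1) _ e4])
  then have "eventually (\<lambda>n. norm (kin (\<lambda>x. f n x - g x) - 0) < e) sequentially"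
    using up[OF e4]
  proof eventually_elim
    case (elim n)
    then have "kin (\<lambda>x. f n x - g x) < e"
      using H1_add_diff(3)[OF f(1)[of n] f(2)] e unfolding g2(2) by argo
    then show ?case by simp
  qed
  then show "\<exists>no. \<forall>n\<ge>no. norm (kin (\<lambda>x. f n x - g x) - 0) < e" by (simp add: eventually_sequentially)
qed

locale negative_energy = energy G \<gamma> \<kappa> dim GN
  for G :: "real \<times> real \<Rightarrow> real" and \<gamma> :: "real \<Rightarrow> real" and \<kappa> :: real and dim :: "'n::finite itself" and GN :: real +
  assumes neg1: "\<And>a. 0 < a \<Longrightarrow> E dim G a 0 < 0" and neg2: "\<And>b. 0 < b \<Longrightarrow> E dim G 0 b < 0"
begin

sublocale tm: two_mass_energy "E dim G"
  by (rule two_mass_energy_E) (fact neg1 neg2)+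

text \<open>
  Cut the limit at a large radius \<open>R\<close>, then the sequence at the same radius. The inner part converges to
  that of the limit, and its energy is lower semicontinuous. The outer part is a competitor for the remaining masses up to
  a small excess, which \<open>tm.lsc\<close> tolerates. The shell costs little, since the limit has little there.
\<close>

lemma energy_of_limit:
  fixes U V :: "nat \<Rightarrow> real^'n \<Rightarrow> complex"
  assumes H: "\<And>n. U n \<in> H1" "\<And>n. V n \<in> H1" "u \<in> H1" "v \<in> H1"
    and m: "\<And>n. mass (U n) = \<alpha>" "\<And>n. mass (V n) = \<beta>" and k: "\<And>n. kin (U n) \<le> K" "\<And>n. kin (V n) \<le> K"
    and lim: "(\<lambda>n. J G (U n, V n)) \<longlonglongrightarrow> E dim G \<alpha> \<beta>"
    and AE: "AE x in lborel. (\<lambda>n. U n x) \<longlonglongrightarrow> u x" "AE x in lborel. (\<lambda>n. V n x) \<longlonglongrightarrow> v x"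
    and loc: "\<And>R. (\<lambda>n. mass (\<lambda>x. indicator (ball 0 R) x *\<^sub>R (U n x - u x))) \<longlonglongrightarrow> 0"
      "\<And>R. (\<lambda>n. mass (\<lambda>x. indicator (ball 0 R) x *\<^sub>R (V n x - v x))) \<longlonglongrightarrow> 0"
  shows "mass u \<le> \<alpha>" and "mass v \<le> \<beta>" and "J G (u, v) + E dim G (\<alpha> - mass u) (\<beta> - mass v) \<le> E dim G \<alpha> \<beta>"
proof -
  have meas: "u \<in> borel_measurable borel" "v \<in> borel_measurable borel" using H(3,4) by (auto intro!: L2_measurable H1_L2)
  have FU: "mass u \<le> \<alpha>" "kin u \<le> K" using H1_Fatou(2,3)[OF H(1) meas(1) AE(1), of \<alpha> K] m k by auto
  have FV: "mass v \<le> \<beta>" "kin v \<le> K" using H1_Fatou(2,3)[OF H(2) meas(2) AE(2), of \<beta> K] m k by auto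
  show "mass u \<le> \<alpha>" "mass v \<le> \<beta>" by fact+
  have \<alpha>: "0 \<le> \<alpha>" and \<beta>: "0 \<le> \<beta>" using mass_nonneg[of "U 0"] mass_nonneg[of "V 0"] m by auto
  have K0: "0 \<le> K" using order_trans[OF kin_nonneg k(1)] .
  \<comment> \<open>one bound for all masses and kinetic energies that occur, those of the cut-off functions included\<close>
  define A where "A = K + CARD('n) * 8 * (\<alpha> + \<beta>) + \<alpha> + \<beta>"
  have mA: "mass f \<le> A" if "mass f \<le> \<alpha> + \<beta>" for f :: "real^'n \<Rightarrow> complex"
    using that K0 \<alpha> \<beta> mult_nonneg_nonneg[of "CARD('n) * 8" "\<alpha> + \<beta>"] unfolding A_def by linarith
  have kA: "c1 + CARD('n) * c * c2 \<le> A" if "c1 \<le> K" "0 \<le> c2" "c2 \<le> \<alpha> + \<beta>" "c \<le> 8" "0 \<le> c" for c1 c2 c :: real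
  proof -
    have "CARD('n) * c * c2 \<le> CARD('n) * 8 * (\<alpha> + \<beta>)" using that by (intro mult_mono) auto
    then show ?thesis using that \<alpha> \<beta> unfolding A_def by linarith
  qed
  have KA: "K \<le> A" using kA[of K 0 0] \<alpha> \<beta> by simp
  have parts: "inner_part R f \<in> H1" "shell_part R f \<in> H1" "mass (inner_part R f) \<le> A" "mass (shell_part R f) \<le> A"
      "kin (inner_part R f) \<le> A" "kin (shell_part R f) \<le> A"
    if f: "f \<in> H1" "mass f \<le> \<alpha> + \<beta>" "kin f \<le> K" and R: "2 \<le> R" for R and f :: "real^'n \<Rightarrow> complex"
  proof -
    show i: "inner_part R f \<in> H1" using inner_outer_H1(1)[OF f(1), of R] R by simp
    show s: "shell_part R f \<in> H1" by (rule shell_H1(1)[OF f(1) R])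
    show "mass (inner_part R f) \<le> A"
      by (rule mA[OF order_trans[OF L2_mono(2)[OF L2_measurable[OF H1_L2[OF i]] H1_L2[OF f(1)] part_norm(1)] f(2)]])
    show "mass (shell_part R f) \<le> A"
      by (rule mA[OF order_trans[OF L2_mono(2)[OF L2_measurable[OF H1_L2[OF s]] H1_L2[OF f(1)] part_norm(3)] f(2)]])
    show "kin (inner_part R f) \<le> A"
      using part_kin_bound(1)[OF f(1), of R] kA[of "kin f" "mass f" 4] f R by simp
    show "kin (shell_part R f) \<le> A"
      using shell_H1(2)[OF f(1) R] kA[of "kin f" "mass f" 8] f R by simp
  qed
  have uv: "mass u \<le> \<alpha> + \<beta>" "mass v \<le> \<alpha> + \<beta>" "mass (U n) \<le> \<alpha> + \<beta>" "mass (V n) \<le> \<alpha> + \<beta>" for n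
    using FU FV \<alpha> \<beta> m by auto
  show "J G (u, v) + E dim G (\<alpha> - mass u) (\<beta> - mass v) \<le> E dim G \<alpha> \<beta>"
  proof (rule field_le_epsilon)
    fix e :: real assume e: "0 < e"
    define \<epsilon> where "\<epsilon> = e / 8"
    have \<epsilon>: "0 < \<epsilon>" using e by (simp add: \<epsilon>_def)
    obtain d where d: "0 < d" "\<And>a' b'. 0 \<le> a' \<Longrightarrow> 0 \<le> b' \<Longrightarrow> a' < \<alpha> - mass u + d \<Longrightarrow> b' < \<beta> - mass v + d \<Longrightarrow>
        E dim G (\<alpha> - mass u) (\<beta> - mass v) - \<epsilon> < E dim G a' b'"
      using tm.lsc[of "\<alpha> - mass u" "\<beta> - mass v" \<epsilon>] FU(1) FV(1) \<epsilon> by auto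
    have d2: "0 < d / 2" using d(1) by simp
    \<comment> \<open>for \<open>n \<rightarrow> \<infinity>\<close> the inner part exhausts the limit, and shell and kinetic error vanish: this fixes the radius\<close>
    define rad where "rad n = real n + 2" for n :: nat
    have rad: "2 \<le> rad n" for n by (simp add: rad_def)
    note xu = inner_part_exhausts[OF H(3), folded rad_def] and xv = inner_part_exhausts[OF H(4), folded rad_def]
    note Pu = parts[OF H(3) uv(1) FU(2) rad] and Pv = parts[OF H(4) uv(2) FV(2) rad]
    have ev1: "eventually (\<lambda>n. J G (u, v) - \<epsilon> < J G (inner_part (rad n) u, inner_part (rad n) v)) sequentially"
      by (rule J_lsc[where A=A, OF Pu(1) Pv(1) H(3,4) Pu(3) Pv(3) mA[OF uv(1)] mA[OF uv(2)] Pu(5) Pv(5)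
          order_trans[OF FU(2) KA] order_trans[OF FV(2) KA] xu(2) xv(2) _ _ \<epsilon>])
        (auto intro: AE_I2 xu(1) xv(1))
    have ev2: "eventually (\<lambda>n. mass u - d/2 < mass (inner_part (rad n) u)) sequentially"
      by (rule mass_lsc[OF H1_L2[OF Pu(1)] H1_L2[OF H(3)] _ d2]) (auto intro: AE_I2 xu(1))
    have ev3: "eventually (\<lambda>n. mass v - d/2 < mass (inner_part (rad n) v)) sequentially"
      by (rule mass_lsc[OF H1_L2[OF Pv(1)] H1_L2[OF H(4)] _ d2]) (auto intro: AE_I2 xv(1))
    have zero: "(\<lambda>x. 0) \<in> H1" "kin (\<lambda>x::real^'n. 0) = 0" "pot (\<lambda>x. 0) (\<lambda>x. 0) = 0" by (auto simp: null_H1 pot_null)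
    have A0: "0 \<le> A" using order_trans[OF K0 KA] .
    have "(\<lambda>n. pot (shell_part (rad n) u) (shell_part (rad n) v)) \<longlonglongrightarrow> pot (\<lambda>x. 0) (\<lambda>x. 0)"
      by (rule pot_continuous[where A=A, OF Pu(2) Pv(2) zero(1) zero(1) Pu(4) Pv(4) _ _ Pu(6) Pv(6) _ _ xu(3) xv(3)])
         (simp_all add: zero A0)
    then have ev4: "eventually (\<lambda>n. pot (shell_part (rad n) u) (shell_part (rad n) v) < \<epsilon>) sequentially"
      by (rule order_tendstoD(2)) (use zero \<epsilon> in simp)
    have ev5: "eventually (\<lambda>n. CARD('n) * (pi / (2 * rad n))\<^sup>2 * (\<alpha> + \<beta>) / 2 < \<epsilon>) sequentially"
    proof -
      have "filterlim (\<lambda>n. 2 * rad n) at_top sequentially"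
        by (rule filterlim_at_top_mono[OF filterlim_real_sequentially]) (simp add: rad_def)
      then have "(\<lambda>n. pi / (2 * rad n)) \<longlonglongrightarrow> 0"
        by (intro tendsto_divide_0[OF tendsto_const] filterlim_at_top_imp_at_infinity)
      then have "(\<lambda>n. CARD('n) * (pi / (2 * rad n))\<^sup>2 * (\<alpha> + \<beta>) / 2) \<longlonglongrightarrow> CARD('n) * 0\<^sup>2 * (\<alpha> + \<beta>) / 2"
        by (intro tendsto_intros) auto
      then show ?thesis by (rule order_tendstoD(2)) (use \<epsilon> in simp)
    qed
    have "eventually (\<lambda>n. J G (u, v) - \<epsilon> < J G (inner_part (rad n) u, inner_part (rad n) v)
        \<and> mass u - d/2 < mass (inner_part (rad n) u) \<and> mass v - d/2 < mass (inner_part (rad n) v)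
        \<and> pot (shell_part (rad n) u) (shell_part (rad n) v) < \<epsilon> \<and> CARD('n) * (pi / (2 * rad n))\<^sup>2 * (\<alpha> + \<beta>) / 2 < \<epsilon>) sequentially"
      using ev1 ev2 ev3 ev4 ev5 by eventually_elim auto
    then obtain n0 where n0: "J G (u, v) - \<epsilon> < J G (inner_part (rad n0) u, inner_part (rad n0) v)"
        "mass u - d/2 < mass (inner_part (rad n0) u)" "mass v - d/2 < mass (inner_part (rad n0) v)"
        "pot (shell_part (rad n0) u) (shell_part (rad n0) v) < \<epsilon>" "CARD('n) * (pi / (2 * rad n0))\<^sup>2 * (\<alpha> + \<beta>) / 2 < \<epsilon>"
      by (auto simp: eventually_sequentially)
    define R where "R = rad n0"
    have R: "2 \<le> R" "0 < R" using rad[of n0] by (auto simp: R_def)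
    note n0 = n0[folded R_def]
    \<comment> \<open>with the radius fixed, \<open>n\<close> is now the index of the sequence\<close>
    note QU = parts[OF H(1) uv(3) k(1) R(1)] and QV = parts[OF H(2) uv(4) k(2) R(1)]
    note Ru = parts[OF H(3) uv(1) FU(2) R(1)] and Rv = parts[OF H(4) uv(2) FV(2) R(1)]
    note LU = part_limit[OF H(1) H(3) loc(1) R(2)] and LV = part_limit[OF H(2) H(4) loc(2) R(2)]
    have AEi: "AE x in lborel. (\<lambda>n. inner_part R (U n) x) \<longlonglongrightarrow> inner_part R u x"
      using AE(1) by eventually_elim (auto simp: inner_part_def intro!: tendsto_intros)
    have AEj: "AE x in lborel. (\<lambda>n. inner_part R (V n) x) \<longlonglongrightarrow> inner_part R v x"
      using AE(2) by eventually_elim (auto simp: inner_part_def intro!: tendsto_intros)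
    have f1: "eventually (\<lambda>n. J G (inner_part R u, inner_part R v) - \<epsilon> < J G (inner_part R (U n), inner_part R (V n))) sequentially"
      by (rule J_lsc[where A=A, OF QU(1) QV(1) Ru(1) Rv(1) QU(3) QV(3) Ru(3) Rv(3) QU(5) QV(5) Ru(5) Rv(5) LU(1) LV(1) AEi AEj \<epsilon>])
    have f2: "eventually (\<lambda>n. mass (inner_part R u) - d/2 < mass (inner_part R (U n))) sequentially"
      by (rule mass_lsc[OF H1_L2[OF QU(1)] H1_L2[OF Ru(1)] AEi d2])
    have f3: "eventually (\<lambda>n. mass (inner_part R v) - d/2 < mass (inner_part R (V n))) sequentially"
      by (rule mass_lsc[OF H1_L2[OF QV(1)] H1_L2[OF Rv(1)] AEj d2])
    have "(\<lambda>n. pot (shell_part R (U n)) (shell_part R (V n))) \<longlonglongrightarrow> pot (shell_part R u) (shell_part R v)"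
      by (rule pot_continuous[where A=A, OF QU(2) QV(2) Ru(2) Rv(2) QU(4) QV(4) Ru(4) Rv(4) QU(6) QV(6) Ru(6) Rv(6) LU(2) LV(2)])
    then have f4: "eventually (\<lambda>n. pot (shell_part R (U n)) (shell_part R (V n)) < \<epsilon>) sequentially"
      by (rule order_tendstoD(2)) (use n0 in simp)
    have f5: "eventually (\<lambda>n. J G (U n, V n) < E dim G \<alpha> \<beta> + \<epsilon>) sequentially"
      by (rule order_tendstoD(2)[OF lim]) (use \<epsilon> in simp)
    define T where "T = CARD('n) * (pi / (2 * R))\<^sup>2 * (\<alpha> + \<beta>) / 2"
    have "eventually (\<lambda>n. J G (u, v) + E dim G (\<alpha> - mass u) (\<beta> - mass v) < E dim G \<alpha> \<beta> + e) sequentially"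
      using f1 f2 f3 f4 f5
    proof eventually_elim
      case (elim n)
      note O = inner_outer_H1[OF H(1)[of n] R(2)] inner_outer_H1[OF H(2)[of n] R(2)]
      have "E dim G (mass (outer_part R (U n))) (mass (outer_part R (V n))) \<le> J G (outer_part R (U n), outer_part R (V n))"
        by (rule E_le[OF O(2,6)]) auto
      moreover have "E dim G (\<alpha> - mass u) (\<beta> - mass v) - \<epsilon> < E dim G (mass (outer_part R (U n))) (mass (outer_part R (V n)))"
      proof (rule d(2))
        show "mass (outer_part R (U n)) < \<alpha> - mass u + d" using O(3) m(1)[of n] elim(2) n0(2) by argo
        show "mass (outer_part R (V n)) < \<beta> - mass v + d" using O(7) m(2)[of n] elim(3) n0(3) by argo
      qed auto
      moreover note J_split[OF H(1)[of n] H(2)[of n] R(1), unfolded m, folded T_def]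
      ultimately show ?case using elim(1,4,5) n0(1) n0(5)[folded T_def] e unfolding \<epsilon>_def by argo
    qed
    then have "J G (u, v) + E dim G (\<alpha> - mass u) (\<beta> - mass v) < E dim G \<alpha> \<beta> + e" by (simp add: eventually_const)
    then show "J G (u, v) + E dim G (\<alpha> - mass u) (\<beta> - mass v) \<le> E dim G \<alpha> \<beta> + e" by simp
  qed
qed

lemma kin_bounded:
  fixes u v :: "nat \<Rightarrow> real^'n \<Rightarrow> complex"
  assumes H: "\<And>n. u n \<in> H1" "\<And>n. v n \<in> H1" and m: "\<And>n. mass (u n) = \<alpha>" "\<And>n. mass (v n) = \<beta>"
    and lim: "(\<lambda>n. J G (u n, v n)) \<longlonglongrightarrow> c"
  shows "\<exists>K. \<forall>n. kin (u n) + kin (v n) \<le> K"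
proof -
  have ab: "0 \<le> \<alpha>" "0 \<le> \<beta>" using mass_nonneg[of "u 0"] mass_nonneg[of "v 0"] m by auto
  obtain C where C: "\<forall>(u :: real^'n \<Rightarrow> complex)\<in>H1. \<forall>(v :: real^'n \<Rightarrow> complex)\<in>H1.
      mass u + mass v \<le> \<alpha> + \<beta> \<longrightarrow> 1/4 * (kin u + kin v) - C \<le> J G (u, v)"
    using J_coercive[of "\<alpha> + \<beta>"] ab by auto
  have "Bseq (\<lambda>n. J G (u n, v n))" using lim by (rule convergent_imp_Bseq[OF convergentI])
  then obtain B where B: "\<And>n. norm (J G (u n, v n)) \<le> B" by (auto simp: Bseq_def)
  have "kin (u n) + kin (v n) \<le> 4 * (B + C)" for n
  proof -
    have "1/4 * (kin (u n) + kin (v n)) - C \<le> J G (u n, v n)" using C H m by auto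
    moreover have "J G (u n, v n) \<le> B" using B[of n] by simp
    ultimately show ?thesis by argo
  qed
  then show ?thesis by blast
qed

text \<open>
  The translations bring the cubes of \<open>nonvanishing\<close> to the origin, so the local limit keeps a positive mass.
\<close>

lemma profile:
  fixes u v :: "nat \<Rightarrow> real^'n \<Rightarrow> complex"
  assumes H: "\<And>n. u n \<in> H1" "\<And>n. v n \<in> H1" and m: "\<And>n. mass (u n) = \<alpha>" "\<And>n. mass (v n) = \<beta>"
    and lim: "(\<lambda>n. J G (u n, v n)) \<longlonglongrightarrow> E dim G \<alpha> \<beta>" and pos: "0 < \<alpha> + \<beta>"
  shows "\<exists>(r :: nat \<Rightarrow> nat) y u' v'. strict_mono r \<and> u' \<in> H1 \<and> v' \<in> H1
    \<and> (AE x in lborel. (\<lambda>n. u (r n) (x + y n)) \<longlonglongrightarrow> u' x) \<and> (AE x in lborel. (\<lambda>n. v (r n) (x + y n)) \<longlonglongrightarrow> v' x)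
    \<and> 0 < mass u' + mass v' \<and> mass u' \<le> \<alpha> \<and> mass v' \<le> \<beta>
    \<and> J G (u', v') + E dim G (\<alpha> - mass u') (\<beta> - mass v') \<le> E dim G \<alpha> \<beta>"
proof -
  have ab: "0 \<le> \<alpha>" "0 \<le> \<beta>" using mass_nonneg[of "u 0"] mass_nonneg[of "v 0"] m by auto
  obtain K where K: "\<And>n. kin (u n) + kin (v n) \<le> K" using kin_bounded[OF H m lim] by auto
  have ku: "kin (u n) \<le> K" "kin (v n) \<le> K" for n
    using K[of n] kin_nonneg[of "u n"] kin_nonneg[of "v n"] by linarith+
  define A where "A = max K (\<alpha> + \<beta>)"
  have "\<exists>\<delta>>0. eventually (\<lambda>n. \<exists>y. \<delta> \<le> local_mass 1 (u n) y + local_mass 1 (v n) y) sequentially"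
    by (rule nonvanishing[OF H, where A=A and c="E dim G \<alpha> \<beta>"]) (use m K lim tm.neg[OF ab pos] in \<open>auto simp: A_def le_max_iff_disj\<close>)
  then obtain \<delta> N where \<delta>: "0 < \<delta>" "\<And>n. n \<ge> N \<Longrightarrow> \<exists>y. \<delta> \<le> local_mass 1 (u n) y + local_mass 1 (v n) y"
    by (auto simp: eventually_sequentially)
  then have "\<exists>y. \<forall>n. \<delta> \<le> local_mass 1 (u (n + N)) (y n) + local_mass 1 (v (n + N)) (y n)"
    by (intro choice allI \<delta>(2)) simp
  then obtain y where y: "\<And>n. \<delta> \<le> local_mass 1 (u (n + N)) (y n) + local_mass 1 (v (n + N)) (y n)" by blast
  define U where "U n x = u (n + N) (x + y n)" for n x
  define V where "V n x = v (n + N) (x + y n)" for n x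
  have UH: "U n \<in> H1" "mass (U n) = \<alpha>" "kin (U n) \<le> K" for n
    unfolding U_def[abs_def] using H m ku by (auto simp: H1_translate L2_translate H1_L2)
  have VH: "V n \<in> H1" "mass (V n) = \<beta>" "kin (V n) \<le> K" for n
    unfolding V_def[abs_def] using H m ku by (auto simp: H1_translate L2_translate H1_L2)
  have JUV: "J G (U n, V n) = J G (u (n + N), v (n + N))" for n
    unfolding U_def[abs_def] V_def[abs_def] by (rule J_translate[OF H])
  obtain r1 u' where r1: "strict_mono (r1 :: nat \<Rightarrow> nat)" "u' \<in> H1" "AE x in lborel. (\<lambda>n. U (r1 n) x) \<longlonglongrightarrow> u' x"
    "\<And>R. (\<lambda>n. mass (\<lambda>x. indicator (ball 0 R) x *\<^sub>R (U (r1 n) x - u' x))) \<longlonglongrightarrow> 0"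
    by (rule Rellich[of U \<alpha> K]) (use UH in auto)
  obtain r2 v' where r2: "strict_mono (r2 :: nat \<Rightarrow> nat)" "v' \<in> H1" "AE x in lborel. (\<lambda>n. V (r1 (r2 n)) x) \<longlonglongrightarrow> v' x"
    "\<And>R. (\<lambda>n. mass (\<lambda>x. indicator (ball 0 R) x *\<^sub>R (V (r1 (r2 n)) x - v' x))) \<longlonglongrightarrow> 0"
    by (rule Rellich[of "\<lambda>n. V (r1 n)" \<beta> K]) (use VH in auto)
  define q where "q n = r1 (r2 n)" for n
  have q: "strict_mono q" using strict_mono_o[OF r1(1) r2(1)] unfolding q_def[abs_def] o_def .
  have AEu: "AE x in lborel. (\<lambda>n. U (q n) x) \<longlonglongrightarrow> u' x"
    using r1(3) by eventually_elim (use LIMSEQ_subseq_LIMSEQ[OF _ r2(1)] in \<open>auto simp: q_def o_def\<close>)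
  have AEv: "AE x in lborel. (\<lambda>n. V (q n) x) \<longlonglongrightarrow> v' x" using r2(3) by (simp add: q_def)
  have lu: "(\<lambda>n. mass (\<lambda>x. indicator (ball 0 R) x *\<^sub>R (U (q n) x - u' x))) \<longlonglongrightarrow> 0" for R
    using LIMSEQ_subseq_LIMSEQ[OF r1(4)[of R] r2(1)] by (simp add: q_def o_def)
  have lv: "(\<lambda>n. mass (\<lambda>x. indicator (ball 0 R) x *\<^sub>R (V (q n) x - v' x))) \<longlonglongrightarrow> 0" for R
    using r2(4)[of R] by (simp add: q_def)
  have "strict_mono (\<lambda>n. q n + N)" using q by (simp add: strict_mono_def)
  have Jlim: "(\<lambda>n. J G (U (q n), V (q n))) \<longlonglongrightarrow> E dim G \<alpha> \<beta>"
    unfolding JUV using LIMSEQ_subseq_LIMSEQ[OF lim \<open>strict_mono (\<lambda>n. q n + N)\<close>] by (simp add: o_def)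
  note EL = energy_of_limit[OF UH(1) VH(1) r1(2) r2(2) UH(2) VH(2) UH(3) VH(3) Jlim AEu AEv lu lv]
  have "0 < mass u' + mass v'"
  proof (rule ccontr)
    assume "\<not> 0 < mass u' + mass v'"
    then have z: "mass u' = 0" "mass v' = 0" using mass_nonneg[of u'] mass_nonneg[of v'] by linarith+
    have ball: "local_mass 1 f 0 \<le> 2 * mass (\<lambda>x. indicator (ball 0 (real CARD('n) + 1)) x *\<^sub>R (f x - g x)) + 2 * mass g"
      if f: "f \<in> L2" and g: "g \<in> L2" for f g :: "real^'n \<Rightarrow> complex"
    proof -
      let ?i = "\<lambda>h x. indicator (ball 0 (real CARD('n) + 1)) x *\<^sub>R (h x :: complex)"
      have iL: "?i h \<in> L2" if "h \<in> L2" for h :: "real^'n \<Rightarrow> complex"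
      proof (rule L2_mono(1)[OF _ that])
        show "?i h \<in> borel_measurable borel"
          by (intro borel_measurable_scaleR borel_measurable_indicator L2_measurable[OF that]) simp
      qed (auto simp: indicator_def)
      have "local_mass 1 f 0 \<le> mass (?i f)" by (rule local_mass_le_ball[OF f])
      also have "?i f = (\<lambda>x. ?i (\<lambda>x. f x - g x) x + ?i g x)" by (simp add: fun_eq_iff algebra_simps)
      also have "mass \<dots> \<le> 2 * mass (?i (\<lambda>x. f x - g x)) + 2 * mass (?i g)"
        by (intro L2_add iL L2_diff f g)
      also have "mass (?i g) \<le> mass g"
        by (rule L2_mono(2)[OF L2_measurable[OF iL[OF g]] g]) (auto simp: indicator_def)
      finally show ?thesis by simp
    qed
    let ?R = "real CARD('n) + 1"
    have "\<delta> \<le> 2 * mass (\<lambda>x. indicator (ball 0 ?R) x *\<^sub>R (U (q n) x - u' x)) + 2 * mass (\<lambda>x. indicator (ball 0 ?R) x *\<^sub>R (V (q n) x - v' x))" for n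
      using y[of "q n"] ball[OF H1_L2[OF UH(1)[of "q n"]] H1_L2[OF r1(2)]] ball[OF H1_L2[OF VH(1)[of "q n"]] H1_L2[OF r2(2)]] z
      unfolding U_def[abs_def] V_def[abs_def] local_mass_translate by linarith
    moreover have "(\<lambda>n. 2 * mass (\<lambda>x. indicator (ball 0 ?R) x *\<^sub>R (U (q n) x - u' x)) + 2 * mass (\<lambda>x. indicator (ball 0 ?R) x *\<^sub>R (V (q n) x - v' x))) \<longlonglongrightarrow> 2 * 0 + 2 * 0"
      by (intro tendsto_intros lu lv)
    ultimately have "\<delta> \<le> 2 * 0 + 2 * 0" by (intro LIMSEQ_le_const) auto
    then show False using \<delta>(1) by simp
  qed
  then show ?thesis
    using EL r1(2) r2(2) AEu AEv \<open>strict_mono (\<lambda>n. q n + N)\<close>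
    by (intro exI[of _ "\<lambda>n. q n + N"] exI[of _ "\<lambda>n. y (q n)"] exI[of _ u'] exI[of _ v']) (simp add: U_def V_def)
qed


lemma pot_null_component:
  assumes H: "u \<in> H1" "v \<in> H1"
  shows "mass v = 0 \<Longrightarrow> pot u v = pot u (\<lambda>x. 0)" and "mass u = 0 \<Longrightarrow> pot u v = pot (\<lambda>x. 0) v"
proof -
  note L = H[THEN H1_L2]
  have z: "(\<lambda>x::real^'n. 0::complex) \<in> L2" by simp
  show "pot u v = pot u (\<lambda>x. 0)" if "mass v = 0"
    unfolding pot_def
  proof (rule integral_cong_AE[OF G_H1_measurable[OF L] G_H1_measurable[OF L(1) z]])
    have "AE x in lborel. v x = 0" using that mass_eq_0_iff[OF L(2)] by simp
    then show "AE x in lborel. G ((norm (u x))\<^sup>2, (norm (v x))\<^sup>2) = G ((norm (u x))\<^sup>2, (norm (0::complex))\<^sup>2)"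
      by eventually_elim simp
  qed
  show "pot u v = pot (\<lambda>x. 0) v" if "mass u = 0"
    unfolding pot_def
  proof (rule integral_cong_AE[OF G_H1_measurable[OF L] G_H1_measurable[OF z L(2)]])
    have "AE x in lborel. u x = 0" using that mass_eq_0_iff[OF L(1)] by simp
    then show "AE x in lborel. G ((norm (u x))\<^sup>2, (norm (v x))\<^sup>2) = G ((norm (0::complex))\<^sup>2, (norm (v x))\<^sup>2)"
      by eventually_elim simp
  qed
qed

text \<open>
  If no translate of \<open>v\<close> met \<open>u\<close> on a set of positive measure, Fubini's theorem would force \<open>u\<close> or
  \<open>v\<close> to vanish almost everywhere. On an overlap, \<open>G_mix\<close> gives a strict gain.
\<close>

lemma overlapping_translate:
  assumes H: "u \<in> H1" "v \<in> H1" and m: "0 < mass u" "0 < mass v"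
  shows "\<exists>y. pot u (\<lambda>x. 0) + pot (\<lambda>x. 0) v < pot u (\<lambda>x. v (x + y))"
proof (rule ccontr)
  assume "\<not> ?thesis"
  then have le: "pot u (\<lambda>x. v (x + y)) \<le> pot u (\<lambda>x. 0) + pot (\<lambda>x. 0) v" for y by (auto simp: not_less)
  have z: "(\<lambda>x::real^'n. 0::complex) \<in> H1" by (simp add: null_H1)
  have [measurable]: "u \<in> borel_measurable borel" "v \<in> borel_measurable borel" using H by (auto intro!: L2_measurable H1_L2)
  have "AE x in lborel. u x = 0 \<or> v (x + y) = 0" for y
  proof -
    define w where "w x = v (x + y)" for x
    have w: "w \<in> H1" unfolding w_def[abs_def] by (rule H1_translate(1)[OF H(2)])
    let ?D = "\<lambda>x. G ((norm (u x))\<^sup>2, (norm (w x))\<^sup>2) - (G ((norm (u x))\<^sup>2, (norm (0::complex))\<^sup>2) + G ((norm (0::complex))\<^sup>2, (norm (w x))\<^sup>2))"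
    note i = pot_integrable[OF H(1) w] pot_integrable[OF H(1) z] pot_integrable[OF z w]
    have Di: "integrable lborel ?D" by (intro Bochner_Integration.integrable_diff Bochner_Integration.integrable_add i)
    have D0: "0 \<le> ?D x" for x using G_superadd[of "(norm (u x))\<^sup>2" 0 0 "(norm (w x))\<^sup>2"] by simp
    have "pot (\<lambda>x. 0) w = pot (\<lambda>x. 0) v"
      using J_translate[OF z H(2), of y] H1_translate[OF H(2), of y]
      unfolding w_def[abs_def] J_eq[OF z H(2)] J_eq[OF z H1_translate(1)[OF H(2)]] by simp
    moreover have "(LINT x|lborel. ?D x) = pot u w - (pot u (\<lambda>x. 0) + pot (\<lambda>x. 0) w)"
      unfolding pot_def using i by (simp only: Bochner_Integration.integral_diff Bochner_Integration.integral_add Bochner_Integration.integrable_add)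
    ultimately have "(LINT x|lborel. ?D x) \<le> 0" using le[of y] by (simp add: w_def[abs_def])
    moreover have "0 \<le> (LINT x|lborel. ?D x)" using D0 by (intro integral_nonneg_AE) (auto intro!: AE_I2)
    ultimately have "(LINT x|lborel. ?D x) = 0" by simp
    then have "AE x in lborel. ?D x = 0"
      by (subst (asm) integral_nonneg_eq_0_iff_AE[OF Di]) (use D0 in \<open>auto intro!: AE_I2\<close>)
    then show ?thesis
    proof eventually_elim
      case (elim x)
      show ?case
      proof (rule ccontr)
        assume "\<not> (u x = 0 \<or> v (x + y) = 0)"
        then have "0 < (norm (u x))\<^sup>2" "0 < (norm (w x))\<^sup>2" by (auto simp: w_def)
        from G_mix[OF this] elim show False by simp
      qed
    qed
  qed
  then have "AE y in lborel. AE x in lborel. u x = 0 \<or> v (x + y) = 0" by simp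
  then have "AE x in lborel. AE y in lborel. u x = 0 \<or> v (x + y) = 0"
  proof (subst lborel_pair.AE_commute)
    have "Measurable.pred (borel \<Otimes>\<^sub>M borel) (\<lambda>p. u (fst p) = 0 \<or> v (fst p + snd p) = 0)" by measurable
    then show "{p \<in> space (lborel \<Otimes>\<^sub>M lborel). u (fst p) = 0 \<or> v (fst p + snd p) = 0} \<in> sets (lborel \<Otimes>\<^sub>M lborel)"
      by (simp add: pred_def space_pair_measure)
  qed
  moreover have "\<not> (AE y in lborel. v (x + y) = 0)" for x
    using mass_eq_0_iff[OF L2_translate(1)[OF H1_L2[OF H(2)], of x]] L2_translate(2)[OF H1_L2[OF H(2)], of x] m(2)
    by (simp add: add.commute)
  ultimately have "AE x in lborel. u x = 0" by (auto elim!: eventually_mono)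
  then show False using mass_eq_0_iff[OF H1_L2[OF H(1)]] m(1) by simp
qed

text \<open>
  Strict subadditivity is only assumed at the given masses, so that the statement also serves the problems
  with one component, from which the general case is derived.
\<close>

lemma full_profile:
  fixes u v :: "nat \<Rightarrow> real^'n \<Rightarrow> complex"
  assumes H: "\<And>n. u n \<in> H1" "\<And>n. v n \<in> H1" and m: "\<And>n. mass (u n) = \<alpha>" "\<And>n. mass (v n) = \<beta>"
    and lim: "(\<lambda>n. J G (u n, v n)) \<longlonglongrightarrow> E dim G \<alpha> \<beta>" and pos: "0 < \<alpha> + \<beta>"
    and strict: "\<And>a b c d. 0 \<le> a \<Longrightarrow> 0 \<le> b \<Longrightarrow> 0 \<le> c \<Longrightarrow> 0 \<le> d \<Longrightarrow> 0 < a + b \<Longrightarrow> 0 < c + d \<Longrightarrow>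
      a + c = \<alpha> \<Longrightarrow> b + d = \<beta> \<Longrightarrow> E dim G \<alpha> \<beta> < E dim G a b + E dim G c d"
  shows "\<exists>(r :: nat \<Rightarrow> nat) y u' v'. strict_mono r \<and> u' \<in> H1 \<and> v' \<in> H1
    \<and> (AE x in lborel. (\<lambda>n. u (r n) (x + y n)) \<longlonglongrightarrow> u' x) \<and> (AE x in lborel. (\<lambda>n. v (r n) (x + y n)) \<longlonglongrightarrow> v' x)
    \<and> mass u' = \<alpha> \<and> mass v' = \<beta> \<and> J G (u', v') \<le> E dim G \<alpha> \<beta>"
proof -
  obtain r :: "nat \<Rightarrow> nat" and y u' v' where P: "strict_mono r" "u' \<in> H1" "v' \<in> H1"
    "AE x in lborel. (\<lambda>n. u (r n) (x + y n)) \<longlonglongrightarrow> u' x" "AE x in lborel. (\<lambda>n. v (r n) (x + y n)) \<longlonglongrightarrow> v' x"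
    "0 < mass u' + mass v'" "mass u' \<le> \<alpha>" "mass v' \<le> \<beta>"
    "J G (u', v') + E dim G (\<alpha> - mass u') (\<beta> - mass v') \<le> E dim G \<alpha> \<beta>"
    using profile[OF H m lim pos] by - (elim exE conjE, (rule that; assumption))
  have "\<not> 0 < (\<alpha> - mass u') + (\<beta> - mass v')"
  proof
    assume "0 < (\<alpha> - mass u') + (\<beta> - mass v')"
    then have "E dim G \<alpha> \<beta> < E dim G (mass u') (mass v') + E dim G (\<alpha> - mass u') (\<beta> - mass v')"
      using P(6,7,8) by (intro strict) auto
    then show False using E_le[OF P(2,3) refl refl] P(9) by linarith
  qed
  then have e: "mass u' = \<alpha>" "mass v' = \<beta>" using P(7,8) by linarith+
  then have "J G (u', v') \<le> E dim G \<alpha> \<beta>" using P(9) E_zero by simp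
  then show ?thesis using P(1-5) e by blast
qed

lemma minimizer:
  assumes nn: "0 \<le> \<alpha>" "0 \<le> \<beta>" and pos: "0 < \<alpha> + \<beta>"
    and strict: "\<And>a b c d. 0 \<le> a \<Longrightarrow> 0 \<le> b \<Longrightarrow> 0 \<le> c \<Longrightarrow> 0 \<le> d \<Longrightarrow> 0 < a + b \<Longrightarrow> 0 < c + d \<Longrightarrow>
      a + c = \<alpha> \<Longrightarrow> b + d = \<beta> \<Longrightarrow> E dim G \<alpha> \<beta> < E dim G a b + E dim G c d"
  shows "\<exists>u v. u \<in> H1 \<and> v \<in> H1 \<and> mass u = \<alpha> \<and> mass v = \<beta> \<and> J G (u, v :: real^'n \<Rightarrow> complex) \<le> E dim G \<alpha> \<beta>"
proof -
  define Q where "Q n p \<longleftrightarrow> fst p \<in> H1 \<and> snd p \<in> H1 \<and> mass (fst p) = \<alpha> \<and> mass (snd p) = \<beta>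
      \<and> J G p < E dim G \<alpha> \<beta> + 1 / real (Suc n)" for n and p :: "(real^'n \<Rightarrow> complex) \<times> (real^'n \<Rightarrow> complex)"
  have "\<exists>p. Q n p" for n
  proof -
    obtain u v :: "real^'n \<Rightarrow> complex" where "u \<in> H1" "v \<in> H1" "mass u = \<alpha>" "mass v = \<beta>" "J G (u, v) < E dim G \<alpha> \<beta> + 1 / real (Suc n)"
      by (rule E_approx[OF nn, of "1 / real (Suc n)"]) auto
    then have "Q n (u, v)" by (simp add: Q_def)
    then show ?thesis by blast
  qed
  then obtain p where p: "\<And>n. Q n (p n)" by metis
  define U where "U n = fst (p n)" for n
  define V where "V n = snd (p n)" for n
  have UV: "U n \<in> H1" "V n \<in> H1" "mass (U n) = \<alpha>" "mass (V n) = \<beta>" "J G (U n, V n) < E dim G \<alpha> \<beta> + 1 / real (Suc n)" for n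
    using p[of n] by (auto simp: Q_def U_def V_def)
  have "(\<lambda>n. J G (U n, V n)) \<longlonglongrightarrow> E dim G \<alpha> \<beta>"
  proof (rule tendsto_sandwich[of "\<lambda>n. E dim G \<alpha> \<beta>" _ _ "\<lambda>n. E dim G \<alpha> \<beta> + 1 / real (Suc n)"])
    show "eventually (\<lambda>n. E dim G \<alpha> \<beta> \<le> J G (U n, V n)) sequentially"
      using E_le[OF UV(1,2,3,4)] by (intro always_eventually) auto
    show "eventually (\<lambda>n. J G (U n, V n) \<le> E dim G \<alpha> \<beta> + 1 / real (Suc n)) sequentially"
      using UV(5) by (intro always_eventually allI less_imp_le)
    show "(\<lambda>n. E dim G \<alpha> \<beta> + 1 / real (Suc n)) \<longlonglongrightarrow> E dim G \<alpha> \<beta>"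
      using tendsto_add[OF tendsto_const LIMSEQ_Suc[OF lim_1_over_n]] by simp
  qed simp
  from full_profile[OF UV(1,2,3,4) this pos strict] show ?thesis by blast
qed

text \<open>
  The competitor pairs a minimizer for \<open>(a, 0)\<close> with a translate of one for \<open>(0, b)\<close>.
\<close>

lemma mixing_lowers_energy:
  assumes ab: "0 < a" "0 < b" shows "E dim G a b < E dim G a 0 + E dim G 0 b"
proof -
  have z: "(\<lambda>x::real^'n. 0::complex) \<in> H1" by (simp add: null_H1)
  have "\<exists>u v. u \<in> H1 \<and> v \<in> H1 \<and> mass u = a \<and> mass v = 0 \<and> J G (u, v :: real^'n \<Rightarrow> complex) \<le> E dim G a 0"
  proof (rule minimizer)
    fix a' b' c' d' :: real
    assume "0 \<le> a'" "0 \<le> b'" "0 \<le> c'" "0 \<le> d'" "0 < a' + b'" "0 < c' + d'" "a' + c' = a" "b' + d' = 0"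
    then have "b' = 0" "d' = 0" "0 < a'" "0 < c'" "a = a' + c'" by linarith+
    then show "E dim G a 0 < E dim G a' b' + E dim G c' d'" using tm.strict_one[of a' c'] by simp
  qed (use ab in auto)
  then obtain u v0 where u: "u \<in> H1" "v0 \<in> H1" "mass u = a" "mass v0 = 0" "J G (u, v0 :: real^'n \<Rightarrow> complex) \<le> E dim G a 0" by blast
  have "\<exists>u v. u \<in> H1 \<and> v \<in> H1 \<and> mass u = 0 \<and> mass v = b \<and> J G (u, v :: real^'n \<Rightarrow> complex) \<le> E dim G 0 b"
  proof (rule minimizer)
    fix a' b' c' d' :: real
    assume "0 \<le> a'" "0 \<le> b'" "0 \<le> c'" "0 \<le> d'" "0 < a' + b'" "0 < c' + d'" "a' + c' = 0" "b' + d' = b"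
    then have "a' = 0" "c' = 0" "0 < b'" "0 < d'" "b = b' + d'" by linarith+
    then show "E dim G 0 b < E dim G a' b' + E dim G c' d'"
      using two_mass_energy.strict_one[OF tm.swap, of b' d'] by simp
  qed (use ab in auto)
  then obtain u0 v where v: "u0 \<in> H1" "v \<in> H1" "mass u0 = 0" "mass v = b" "J G (u0, v :: real^'n \<Rightarrow> complex) \<le> E dim G 0 b" by blast
  obtain y where y: "pot u (\<lambda>x. 0) + pot (\<lambda>x. 0) v < pot u (\<lambda>x. v (x + y))"
    using overlapping_translate[OF u(1) v(2)] u(3) v(4) ab by auto
  have "E dim G a b \<le> J G (u, \<lambda>x. v (x + y))"
    by (rule E_le) (use u v in \<open>auto simp: H1_translate L2_translate H1_L2\<close>)
  also have "J G (u, \<lambda>x. v (x + y)) = 1/2 * (kin u + kin v) - pot u (\<lambda>x. v (x + y))"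
    by (simp add: J_eq u v H1_translate)
  also have "\<dots> < J G (u, v0) + J G (u0, v)"
    using y null_H1(2)[OF H1_L2[OF u(2)] u(4)] null_H1(2)[OF H1_L2[OF v(1)] v(3)]
      pot_null_component(1)[OF u(1,2,4)] pot_null_component(2)[OF v(1,2,3)]
    unfolding J_eq[OF u(1,2)] J_eq[OF v(1,2)] by argo
  finally show ?thesis using u(5) v(5) by linarith
qed

lemma H1_norm_eq: "H1_norm f = sqrt (mass f + kin f)"
  by (simp add: H1_norm_def kin_def mass_def)

text \<open>
  With all mass retained, the limit is a minimizer, and masses and potential energies converge; hence so does the sum of the
  kinetic energies, and by lower semicontinuity each of them.
\<close>

lemma minimizing_sequence_compact:
  fixes u v :: "nat \<Rightarrow> real^'n \<Rightarrow> complex"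
  assumes H: "\<And>n. u n \<in> H1" "\<And>n. v n \<in> H1" and m: "\<And>n. mass (u n) = \<alpha>" "\<And>n. mass (v n) = \<beta>"
    and lim: "(\<lambda>n. J G (u n, v n)) \<longlonglongrightarrow> E dim G \<alpha> \<beta>"
  shows "\<exists>(r :: nat \<Rightarrow> nat) u' v' y. strict_mono r \<and> u' \<in> H1 \<and> v' \<in> H1 \<and> mass u' = \<alpha> \<and> mass v' = \<beta>
    \<and> (\<lambda>n. H1_norm (\<lambda>x. u (r n) (x + y n) - u' x)) \<longlonglongrightarrow> 0 \<and> (\<lambda>n. H1_norm (\<lambda>x. v (r n) (x + y n) - v' x)) \<longlonglongrightarrow> 0"
proof (cases "\<alpha> + \<beta> = 0")
  case True
  then have 0: "\<alpha> = 0" "\<beta> = 0" using mass_nonneg[of "u 0"] mass_nonneg[of "v 0"] m(1)[of 0] m(2)[of 0] by linarith+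
  have z: "(\<lambda>x::real^'n. 0::complex) \<in> H1" by (simp add: null_H1)
  have n: "H1_norm (u n) = 0" "H1_norm (v n) = 0" for n
    using null_H1(2)[OF H1_L2[OF H(1)[of n]]] null_H1(2)[OF H1_L2[OF H(2)[of n]]] m[of n] 0 by (simp_all add: H1_norm_eq)
  show ?thesis
    by (rule exI[of _ id], rule exI[of _ "\<lambda>x. 0"], rule exI[of _ "\<lambda>x. 0"], rule exI[of _ "\<lambda>n. 0"])
      (use z 0 n in \<open>auto simp: strict_mono_def\<close>)
next
  case False
  then have pos: "0 < \<alpha> + \<beta>" using mass_nonneg[of "u 0"] mass_nonneg[of "v 0"] m(1)[of 0] m(2)[of 0] by linarith
  have strict: "E dim G \<alpha> \<beta> < E dim G a b + E dim G c d"
    if "0 \<le> a" "0 \<le> b" "0 \<le> c" "0 \<le> d" "0 < a + b" "0 < c + d" "a + c = \<alpha>" "b + d = \<beta>" for a b c d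
    using tm.strict_subadditivity[OF mixing_lowers_energy, of a b c d] that by simp
  have "\<exists>(r :: nat \<Rightarrow> nat) y u' v'. strict_mono r \<and> u' \<in> H1 \<and> v' \<in> H1
    \<and> (AE x in lborel. (\<lambda>n. u (r n) (x + y n)) \<longlonglongrightarrow> u' x) \<and> (AE x in lborel. (\<lambda>n. v (r n) (x + y n)) \<longlonglongrightarrow> v' x)
    \<and> mass u' = \<alpha> \<and> mass v' = \<beta> \<and> J G (u', v') \<le> E dim G \<alpha> \<beta>"
    by (rule full_profile[OF H m lim pos]) (rule strict)
  then obtain r :: "nat \<Rightarrow> nat" and y u' v' where P: "strict_mono r" "u' \<in> H1" "v' \<in> H1"
    "AE x in lborel. (\<lambda>n. u (r n) (x + y n)) \<longlonglongrightarrow> u' x" "AE x in lborel. (\<lambda>n. v (r n) (x + y n)) \<longlonglongrightarrow> v' x"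
    "mass u' = \<alpha>" "mass v' = \<beta>" "J G (u', v') \<le> E dim G \<alpha> \<beta>"
    by - (elim exE conjE, (rule that; assumption))
  obtain K where K: "\<And>n. kin (u n) + kin (v n) \<le> K" using kin_bounded[OF H m lim] by auto
  define f where "f n x = u (r n) (x + y n)" for n x
  define g where "g n x = v (r n) (x + y n)" for n x
  have f: "f n \<in> H1" "mass (f n) = mass u'" "kin (f n) = kin (u (r n))" for n
    unfolding f_def[abs_def] by (simp_all add: H1_translate L2_translate H1_L2 H m P)
  have g: "g n \<in> H1" "mass (g n) = mass v'" "kin (g n) = kin (v (r n))" for n
    unfolding g_def[abs_def] by (simp_all add: H1_translate L2_translate H1_L2 H m P)
  have AE: "AE x in lborel. (\<lambda>n. f n x) \<longlonglongrightarrow> u' x" "AE x in lborel. (\<lambda>n. g n x) \<longlonglongrightarrow> v' x"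
    using P(4,5) by (simp_all add: f_def g_def)
  note mf = mass_convergence[OF H1_L2[OF f(1)] H1_L2[OF P(2)] f(2) AE(1)]
  note mg = mass_convergence[OF H1_L2[OF g(1)] H1_L2[OF P(3)] g(2) AE(2)]
  define A where "A = Max {K, \<alpha>, \<beta>, kin u', kin v'}"
  have A: "K \<le> A" "\<alpha> \<le> A" "\<beta> \<le> A" "kin u' \<le> A" "kin v' \<le> A" by (simp_all add: A_def)
  have kA: "kin (f n) \<le> A" "kin (g n) \<le> A" for n
    using K[of "r n"] kin_nonneg[of "u (r n)"] kin_nonneg[of "v (r n)"] A(1) f(3)[of n] g(3)[of n] by linarith+
  have pl: "(\<lambda>n. pot (f n) (g n)) \<longlonglongrightarrow> pot u' v'"
    by (rule pot_continuous[where A=A, OF f(1) g(1) P(2,3) _ _ _ _ kA A(4,5) mf mg])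
      (use f(2) g(2) P(6,7) A in simp_all)
  have "J G (f n, g n) = J G (u (r n), v (r n))" for n
    unfolding f_def[abs_def] g_def[abs_def] by (rule J_translate[OF H])
  then have "(\<lambda>n. J G (f n, g n)) \<longlonglongrightarrow> E dim G \<alpha> \<beta>"
    using LIMSEQ_subseq_LIMSEQ[OF lim P(1)] by (simp add: o_def)
  moreover have "E dim G \<alpha> \<beta> = J G (u', v')" using E_le[OF P(2,3,6,7)] P(8) by simp
  ultimately have "(\<lambda>n. 2 * (J G (f n, g n) + pot (f n) (g n))) \<longlonglongrightarrow> 2 * (J G (u', v') + pot u' v')"
    using pl by (intro tendsto_intros) auto
  then have kl: "(\<lambda>n. kin (f n) + kin (g n)) \<longlonglongrightarrow> kin u' + kin v'"
    unfolding J_eq[OF P(2,3)] J_eq[OF f(1) g(1)] by (simp add: add_divide_distrib)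
  have up: "eventually (\<lambda>n. kin (f n) < kin u' + e) sequentially" "eventually (\<lambda>n. kin (g n) < kin v' + e) sequentially"
    if e: "0 < e" for e
  proof -
    have e2: "0 < e / 2" using e by simp
    have s: "eventually (\<lambda>n. kin (f n) + kin (g n) < kin u' + kin v' + e/2) sequentially"
      by (rule order_tendstoD(2)[OF kl]) (use e in simp)
    show "eventually (\<lambda>n. kin (f n) < kin u' + e) sequentially"
      using s kin_lsc[OF g(1) P(3) AE(2) e2] by eventually_elim argo
    show "eventually (\<lambda>n. kin (g n) < kin v' + e) sequentially"
      using s kin_lsc[OF f(1) P(2) AE(1) e2] by eventually_elim argo
  qed
  have "(\<lambda>n. H1_norm (\<lambda>x. f n x - u' x)) \<longlonglongrightarrow> sqrt (0 + 0)"
    unfolding H1_norm_eq by (intro tendsto_intros mf kin_convergence[OF f(1) P(2) AE(1) up(1)])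
  moreover have "(\<lambda>n. H1_norm (\<lambda>x. g n x - v' x)) \<longlonglongrightarrow> sqrt (0 + 0)"
    unfolding H1_norm_eq by (intro tendsto_intros mg kin_convergence[OF g(1) P(3) AE(2) up(2)])
  ultimately show ?thesis
    using P(1,2,3,6,7) unfolding f_def g_def by (intro exI[of _ r] exI[of _ u'] exI[of _ v'] exI[of _ y]) simp
qed

end

theorem theorem4p1:
  fixes G g1 g2 :: "real \<times> real \<Rightarrow> real"
  assumes G1: "C1_on_quadrant G g1 g2" "G (0, 0) = 0"
    and G2: "\<And>g. g \<in> {g1, g2} \<Longrightarrow> (g \<longlongrightarrow> 0) (at (0, 0) within quadrant)"
    and G3: "\<And>g. g \<in> {g1, g2} \<Longrightarrow>
      ((\<lambda>s. g s / norm s powr (2 / real CARD('n::finite))) \<longlongrightarrow> 0) (inf at_infinity (principal quadrant))"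
    and G4: "\<And>g s t h k. g \<in> {g1, g2} \<Longrightarrow> s \<ge> 0 \<Longrightarrow> t \<ge> 0 \<Longrightarrow> h \<ge> 0 \<Longrightarrow> k \<ge> 0 \<Longrightarrow>
      g (s, t) \<le> g (s + h, t + k)"
    and G5: "\<exists>\<sigma>>0. \<forall>s1 s2. 0 < s1 \<longrightarrow> s1 \<le> \<sigma> \<longrightarrow> 0 < s2 \<longrightarrow> s2 \<le> \<sigma> \<longrightarrow>
      G (s1, 0) + G (0, s2) < G (s1, s2)"
    and E2: "\<And>\<alpha>. \<alpha> > 0 \<Longrightarrow> E TYPE('n) G \<alpha> 0 < 0" "\<And>\<beta>. \<beta> > 0 \<Longrightarrow> E TYPE('n) G 0 \<beta> < 0"
  shows "\<forall>\<alpha>\<ge>0. \<forall>\<beta>\<ge>0. \<forall>(u :: nat \<Rightarrow> real^'n \<Rightarrow> complex) (v :: nat \<Rightarrow> real^'n \<Rightarrow> complex).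
    minimizing_sequence G \<alpha> \<beta> u v \<longrightarrow>
    (\<exists>(r :: nat \<Rightarrow> nat) u' v' (y :: nat \<Rightarrow> real^'n).
       strict_mono r \<and> (u', v') \<in> M \<alpha> \<beta> \<and>
       (\<lambda>n. H1_norm (\<lambda>x. u (r n) (x - y n) - u' x)) \<longlonglongrightarrow> 0 \<and>
       (\<lambda>n. H1_norm (\<lambda>x. v (r n) (x - y n) - v' x)) \<longlonglongrightarrow> 0)"
proof (intro allI impI)
  fix \<alpha> \<beta> :: real and u v :: "nat \<Rightarrow> real^'n \<Rightarrow> complex"
  assume ms: "minimizing_sequence G \<alpha> \<beta> u v"
  interpret nonlinearity G "\<lambda>\<rho>. g1 (\<rho>, \<rho>) + g2 (\<rho>, \<rho>)" "2 / real CARD('n)"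
    by (rule nonlinearity_of_derivatives[OF _ G1 G2 G3 G4 G5]) auto
  interpret negative_energy G "\<lambda>\<rho>. g1 (\<rho>, \<rho>) + g2 (\<rho>, \<rho>)" "2 / real CARD('n)" "TYPE('n)"
    "64 * 64 powr (2 / real CARD('n)) * CARD('n)"
    by unfold_locales (use E2 in auto)
  have s: "u n \<in> H1" "v n \<in> H1" "mass (u n) = \<alpha>" "mass (v n) = \<beta>" for n
    using ms by (auto simp: minimizing_sequence_def M_iff)
  have lim: "(\<lambda>n. J G (u n, v n)) \<longlonglongrightarrow> E TYPE('n) G \<alpha> \<beta>" using ms by (simp add: minimizing_sequence_def)
  obtain r :: "nat \<Rightarrow> nat" and u' v' y where
    "strict_mono r" "u' \<in> H1" "v' \<in> H1" "mass u' = \<alpha>" "mass v' = \<beta>"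
    "(\<lambda>n. H1_norm (\<lambda>x. u (r n) (x + y n) - u' x)) \<longlonglongrightarrow> 0" "(\<lambda>n. H1_norm (\<lambda>x. v (r n) (x + y n) - v' x)) \<longlonglongrightarrow> 0"
    using minimizing_sequence_compact[OF s lim] by - (elim exE conjE, (rule that; assumption))
  then show "\<exists>(r :: nat \<Rightarrow> nat) u' v' (y :: nat \<Rightarrow> real^'n). strict_mono r \<and> (u', v') \<in> M \<alpha> \<beta> \<and>
       (\<lambda>n. H1_norm (\<lambda>x. u (r n) (x - y n) - u' x)) \<longlonglongrightarrow> 0 \<and>
       (\<lambda>n. H1_norm (\<lambda>x. v (r n) (x - y n) - v' x)) \<longlonglongrightarrow> 0"
    by (intro exI[of _ r] exI[of _ u'] exI[of _ v'] exI[of _ "\<lambda>n. - y n"]) (simp add: M_iff)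
qed

end
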